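(* Let $G=(V,E)$ be a connected graph with $|E|\geq 1$. Then the following statements are equivalent: (a) $I_G$ has a $d$-linear resolution for some $d\geq 2$; (b) $G=P_3$ or $G=K_2\sharp_{K_1}K_3$ or $G=K_4$ (up to isomorphism).
   Context: $\mathbb{K}$ is a field. All graphs are finite and simple with non-empty vertex set. $K_n$ is the complete graph on $n$ vertices, $P_3$ is the path on $3$ vertices, and $K_2\sharp_{K_1}K_3$ is the graph obtained by gluing $K_2$ and $K_3$ along one common vertex (a triangle with one pendant edge). For a graph $G=(V,E)$ let $S_G=\mathbb{K}[q_{A|B}]$ be the polynomial ring with one variable for each unordered partition $A|B$ of $V$ (i.e. $A\cup B=V$, $A\cap B=\emptyset$, empty parts allowed), standard graded, and $R_G=\mathbb{K}[s_{ij},t_{ij}:\{i,j\}\in E]$. Let $\mathrm{Cut}(A|B)\subseteq E$ be the set of edges with one endpoint in $A$ and the other in $B$. Let $\phi_G\colon S_G\to R_G$ be the $\mathbb{K}$-algebra homomorphism $q_{A|B}\mapsto \prod_{\{i,j\}\in \mathrm{Cut}(A|B)}s_{ij}\prod_{\{i,j\}\in E\setminus \mathrm{Cut}(A|B)}t_{ij}$. The cut ideal is the graded ideal $I_G=\ker\phi_G$. A nonzero graded ideal $I\subseteq S_G$ has a $d$-linear resolution if its graded Betti numbers $\beta_{i,i+j}^{S_G}(I)=\dim_{\mathbb{K}}\mathrm{Tor}_i^{S_G}(\mathbb{K},I)_{i+j}$ vanish for all $i$ and all $j\neq d$. *)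

theory Defs
  imports Complex_Main "HOL-Library.Poly_Mapping"
begin

section \<open>Graphs\<close>

type_synonym 'v graph = "'v set \<times> 'v set set"

definition simple_graph :: "'v graph \<Rightarrow> bool" where
  "simple_graph G \<longleftrightarrow> finite (fst G) \<and> fst G \<noteq> {} \<and> snd G \<subseteq> {e. e \<subseteq> fst G \<and> card e = 2}"

definition connected_graph :: "'v graph \<Rightarrow> bool" where
  "connected_graph G \<longleftrightarrow> (\<forall>u\<in>fst G. \<forall>v\<in>fst G. (u, v) \<in> {(x, y). {x, y} \<in> snd G}\<^sup>*)"

definition isomorphic_graphs :: "'v graph \<Rightarrow> 'w graph \<Rightarrow> bool" where
  "isomorphic_graphs G H \<longleftrightarrow>
     (\<exists>f. bij_betw f (fst G) (fst H) \<and> (\<lambda>e. f ` e) ` snd G = snd H)"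

definition complete_graph :: "nat \<Rightarrow> nat graph" where
  "complete_graph n = ({..<n}, {e. e \<subseteq> {..<n} \<and> card e = 2})"

definition path_graph :: "nat \<Rightarrow> nat graph" where
  "path_graph n = ({..<n}, {{i, Suc i} | i. Suc i < n})"

text \<open>The triangle on \<open>0, 1, 2\<close> and the edge on \<open>2, 3\<close>, glued along the vertex \<open>2\<close>.\<close>

definition K2_glued_K3 :: "nat graph" where
  "K2_glued_K3 = ({0, 1, 2, 3}, {{0, 1}, {0, 2}, {1, 2}} \<union> {{2, 3}})"


section \<open>Polynomial rings\<close>

text \<open>The polynomials over \<open>'k\<close> with indeterminates in \<open>'x\<close>. Since the set \<open>X\<close> of
  indeterminates of a polynomial ring need not be a whole type, the ring is the subset
  \<open>poly_ring X\<close> of this type.\<close>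

type_synonym ('x, 'k) pol = "('x \<Rightarrow>\<^sub>0 nat) \<Rightarrow>\<^sub>0 'k"

definition poly_ring :: "'x set \<Rightarrow> ('x, 'k::field) pol set" where
  "poly_ring X = {p. \<forall>m\<in>Poly_Mapping.keys p. Poly_Mapping.keys m \<subseteq> X}"

definition const :: "'k \<Rightarrow> ('x, 'k::field) pol" where
  "const c = Poly_Mapping.single 0 c"

definition indet :: "'x \<Rightarrow> ('x, 'k::field) pol" where
  "indet x = Poly_Mapping.single (Poly_Mapping.single x 1) 1"

definition total_deg :: "('x \<Rightarrow>\<^sub>0 nat) \<Rightarrow> nat" where
  "total_deg m = (\<Sum>x\<in>Poly_Mapping.keys m. Poly_Mapping.lookup m x)"

text \<open>The algebra homomorphism sending each indeterminate \<open>x\<close> to \<open>f x\<close>.\<close>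

definition subst_hom :: "('x \<Rightarrow> ('y, 'k) pol) \<Rightarrow> ('x, 'k::field) pol \<Rightarrow> ('y, 'k) pol" where
  "subst_hom f p =
     (\<Sum>m\<in>Poly_Mapping.keys p. const (Poly_Mapping.lookup p m) *
        (\<Prod>x\<in>Poly_Mapping.keys m. f x ^ Poly_Mapping.lookup m x))"


section \<open>Cut ideals\<close>

text \<open>An unordered partition \<open>A|B\<close> is the two-element set \<open>{A, B}\<close>.\<close>

definition partitions :: "'v graph \<Rightarrow> 'v set set set" where
  "partitions G = {{A, B} | A B. A \<union> B = fst G \<and> A \<inter> B = {}}"

definition cut :: "'v graph \<Rightarrow> 'v set set \<Rightarrow> 'v set set" where
  "cut G P = {e \<in> snd G. \<exists>A B. P = {A, B} \<and> (\<exists>a\<in>A. \<exists>b\<in>B. e = {a, b})}"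

datatype 'e st_var = S_var 'e | T_var 'e

definition cut_map :: "'v graph \<Rightarrow> ('v set set, 'k::field) pol \<Rightarrow> ('v set st_var, 'k) pol" where
  "cut_map G = subst_hom (\<lambda>P.
     (\<Prod>e\<in>cut G P. indet (S_var e)) * (\<Prod>e\<in>snd G - cut G P. indet (T_var e)))"

definition cut_ideal :: "'v graph \<Rightarrow> ('v set set, 'k::field) pol set" where
  "cut_ideal G = {p \<in> poly_ring (partitions G). cut_map G p = 0}"


section \<open>Graded free resolutions\<close>

text \<open>Elements of a free module with basis \<open>e\<^sub>0, e\<^sub>1, \<dots>\<close> are the finitely supported
  functions from \<open>nat\<close> to polynomials.\<close>

definition vsmult :: "('x, 'k::field) pol \<Rightarrow> (nat \<Rightarrow>\<^sub>0 ('x, 'k) pol) \<Rightarrow> (nat \<Rightarrow>\<^sub>0 ('x, 'k) pol)" where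
  "vsmult p v = Poly_Mapping.map (\<lambda>q. p * q) v"

definition kscale :: "'k \<Rightarrow> (nat \<Rightarrow>\<^sub>0 ('x, 'k::field) pol) \<Rightarrow> (nat \<Rightarrow>\<^sub>0 ('x, 'k) pol)" where
  "kscale c v = vsmult (const c) v"

lemma lookup_vsmult: "Poly_Mapping.lookup (vsmult p v) k = p * Poly_Mapping.lookup v k"
  by (auto simp: vsmult_def map.rep_eq when_def)

lemma const_simps: "const (a + b) = const a + const b" "const (a * b) = const a * const b" "const 1 = 1"
  by (simp_all add: const_def single_add mult_single)

lemma lookup_kscale: "Poly_Mapping.lookup (kscale c v) k = const c * Poly_Mapping.lookup v k"
  by (simp add: kscale_def lookup_vsmult)

interpretation kvec: vector_space kscale
  by unfold_locales
    (rule poly_mapping_eqI, simp add: lookup_kscale lookup_add const_simps algebra_simps)+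

definition linear_ext ::
    "(nat \<Rightarrow> (nat \<Rightarrow>\<^sub>0 ('x, 'k) pol)) \<Rightarrow> (nat \<Rightarrow>\<^sub>0 ('x, 'k::field) pol) \<Rightarrow> (nat \<Rightarrow>\<^sub>0 ('x, 'k) pol)" where
  "linear_ext c v = (\<Sum>k\<in>Poly_Mapping.keys v. vsmult (Poly_Mapping.lookup v k) (c k))"

text \<open>Data of an augmented complex \<open>\<dots> \<rightarrow> F\<^sub>1 \<rightarrow> F\<^sub>0 \<rightarrow> \<K>\<close> of finitely generated graded
  free modules: \<open>F\<^sub>i\<close> has the basis \<open>e\<^sub>k\<close> (\<open>k < rnk i\<close>), where \<open>e\<^sub>k\<close> has degree
  \<open>bdeg i k\<close>; \<open>bdry i k\<close> in \<open>F\<^sub>i\<close> is the image of the \<open>k\<close>-th basis element of \<open>F\<^bsub>i+1\<^esub>\<close>;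
  and \<open>aug k\<close> is the image in \<open>\<K>\<close> of the \<open>k\<close>-th basis element of \<open>F\<^sub>0\<close>.\<close>

record (overloaded) ('x, 'k) free_complex =
  rnk :: "nat \<Rightarrow> nat"
  bdeg :: "nat \<Rightarrow> nat \<Rightarrow> int"
  bdry :: "nat \<Rightarrow> nat \<Rightarrow> (nat \<Rightarrow>\<^sub>0 ('x \<Rightarrow>\<^sub>0 nat) \<Rightarrow>\<^sub>0 'k)"
  aug :: "nat \<Rightarrow> 'k"

text \<open>For an ideal \<open>I\<close>, the submodule \<open>I F\<^sub>i\<close>, which is \<open>F\<^sub>i \<otimes> I\<close> because \<open>F\<^sub>i\<close> is free; it is
  \<open>F\<^sub>i\<close> itself if \<open>I\<close> is the whole ring.\<close>

definition chains ::
    "('x, 'k) free_complex \<Rightarrow> ('x, 'k::field) pol set \<Rightarrow> nat \<Rightarrow> (nat \<Rightarrow>\<^sub>0 ('x, 'k) pol) set" where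
  "chains F I i = {v. Poly_Mapping.keys v \<subseteq> {..<rnk F i} \<and>
                      (\<forall>k<rnk F i. Poly_Mapping.lookup v k \<in> I)}"

definition degree_part ::
    "('x, 'k) free_complex \<Rightarrow> nat \<Rightarrow> int \<Rightarrow> (nat \<Rightarrow>\<^sub>0 ('x, 'k::field) pol) set" where
  "degree_part F i j = {v. \<forall>k\<in>Poly_Mapping.keys v.
     \<forall>m\<in>Poly_Mapping.keys (Poly_Mapping.lookup v k). int (total_deg m) + bdeg F i k = j}"

text \<open>The \<open>S\<close>-linear map \<open>F\<^sub>0 \<rightarrow> \<K>\<close>; the indeterminates act on \<open>\<K>\<close> as zero, so a polynomial
  acts by its constant coefficient.\<close>

definition augmentation ::
    "('x, 'k) free_complex \<Rightarrow> (nat \<Rightarrow>\<^sub>0 ('x, 'k::field) pol) \<Rightarrow> 'k" where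
  "augmentation F v =
     (\<Sum>k\<in>Poly_Mapping.keys v. Poly_Mapping.lookup (Poly_Mapping.lookup v k) 0 * aug F k)"

text \<open>The complex is a graded free resolution of the residue field \<open>\<K>\<close> (concentrated in
  degree 0) over the polynomial ring in the indeterminates \<open>X\<close>.\<close>

definition resolves_residue_field :: "'x set \<Rightarrow> ('x, 'k::field) free_complex \<Rightarrow> bool" where
  "resolves_residue_field X F \<longleftrightarrow>
     (\<forall>i. \<forall>k<rnk F (Suc i).
        bdry F i k \<in> chains F (poly_ring X) i \<inter> degree_part F i (bdeg F (Suc i) k)) \<and>
     (\<forall>k<rnk F 0. aug F k \<noteq> 0 \<longrightarrow> bdeg F 0 k = 0) \<and>
     augmentation F ` chains F (poly_ring X) 0 = UNIV \<and>
     {v \<in> chains F (poly_ring X) 0. augmentation F v = 0} =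
       linear_ext (bdry F 0) ` chains F (poly_ring X) 1 \<and>
     (\<forall>i. {v \<in> chains F (poly_ring X) (Suc i). linear_ext (bdry F i) v = 0} =
       linear_ext (bdry F (Suc i)) ` chains F (poly_ring X) (Suc (Suc i)))"


section \<open>Graded Betti numbers\<close>

text \<open>The degree \<open>j\<close> strands of the cycles and boundaries of the complex \<open>F \<otimes> I\<close>.\<close>

definition tor_cycles ::
    "('x, 'k) free_complex \<Rightarrow> ('x, 'k::field) pol set \<Rightarrow> nat \<Rightarrow> int \<Rightarrow> (nat \<Rightarrow>\<^sub>0 ('x, 'k) pol) set" where
  "tor_cycles F I i j = {v \<in> chains F I i \<inter> degree_part F i j.
     case i of 0 \<Rightarrow> True | Suc l \<Rightarrow> linear_ext (bdry F l) v = 0}"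

definition tor_boundaries ::
    "('x, 'k) free_complex \<Rightarrow> ('x, 'k::field) pol set \<Rightarrow> nat \<Rightarrow> int \<Rightarrow> (nat \<Rightarrow>\<^sub>0 ('x, 'k) pol) set" where
  "tor_boundaries F I i j =
     linear_ext (bdry F i) ` (chains F I (Suc i) \<inter> degree_part F (Suc i) j)"

text \<open>The dimension of \<open>Tor\<^sub>i(\<K>, I)\<^sub>j\<close>, computed as the homology of \<open>F \<otimes> I\<close> for a graded free
  resolution \<open>F\<close> of \<open>\<K>\<close>; it does not depend on the choice of \<open>F\<close>. For finite \<open>X\<close> all strands are
  finite-dimensional, so the dimension of the quotient is the difference of the dimensions.\<close>

definition graded_betti :: "'x set \<Rightarrow> ('x, 'k::field) pol set \<Rightarrow> nat \<Rightarrow> int \<Rightarrow> nat" where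
  "graded_betti X I i j =
     (let F = SOME F. resolves_residue_field X F
      in kvec.dim (tor_cycles F I i j) - kvec.dim (tor_boundaries F I i j))"

definition has_linear_resolution :: "'x set \<Rightarrow> ('x, 'k::field) pol set \<Rightarrow> nat \<Rightarrow> bool" where
  "has_linear_resolution X I d \<longleftrightarrow>
     I \<noteq> {0} \<and> (\<forall>i j. j \<noteq> int d \<longrightarrow> graded_betti X I i (int i + j) = 0)"

end

theory Submission
  imports Defs "HOL-Library.FuncSet"
begin

text \<open>The modules \<open>Tor\<^sub>i(\<K>, I)\<close> are computed with the Koszul complex. The cut ideals of \<open>P\<^sub>3\<close> and of the
  triangle with a pendant edge are the ideals of the \<open>2 \<times> 2\<close> minors of a generic matrix with two rows,
  and the cut ideal of \<open>K\<^sub>4\<close> is generated by the difference of two coprime square-free monomials of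
  degree 4. In each case a bound for the regularity of the quotient gives the linear resolution.

  Conversely, let the vertex set be partitioned into connected pieces. If a monomial only involves
  partitions that do not separate vertices of the same piece, then so does every monomial with the
  same image under the cut map. Hence the Betti numbers of the cut ideal of the contracted graph are
  among those of \<open>G\<close>. If \<open>G\<close> can be contracted to \<open>C\<^sub>4\<close>, the diamond, \<open>P\<^sub>4\<close>, \<open>K\<^bsub>1,3\<^esub>\<close>, two triangles with a
  common vertex, or \<open>K\<^sub>5\<close>, then two different strands are non-zero; this is witnessed by explicit
  cycles and cocycles. A connected graph without such contractions is complete with at most four
  vertices, or has a cut vertex that leaves only the two graphs above: separate two non-adjacent
  vertices by a minimal separator and split connected sets into connected halves.\<close>

text \<open>The Betti numbers are defined by a resolution chosen with \<open>SOME\<close>. The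
  Koszul complex can replace it only after a comparison theorem for graded resolutions; since only
  the vanishing of Betti numbers matters, it is enough to transfer the vanishing of homology. The
  regularity bounds come from adjoining a variable and from dividing by one. Both lead out of the
  toric ideals. Hence ideals are given by labels on monomials in an option type: \<open>None\<close>
  marks the monomials in the ideal, and equal labels mark congruent monomials. Toric ideals,
  monomial ideals and the intermediate ones all have this form, and both operations act on labels.
  The field is arbitrary, so the witnesses for non-vanishing are integral: a cycle and a cocycle
  with pairing 1 survive over every field. A witness of homological degree \<open>i + 1\<close> and
  coefficient degree \<open>c\<close> forces \<open>d = c + 1\<close>, and a contraction is
  impossible if two of its witnesses disagree. The path with three vertices and
  \<open>K\<^sub>4\<close> each force one value, 2 and 4, so a graph with a linear resolution cannot
  be contracted to both.\<close>

abbreviation "lookup \<equiv> Poly_Mapping.lookup"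
abbreviation "keys \<equiv> Poly_Mapping.keys"
abbreviation "single \<equiv> Poly_Mapping.single"

section \<open>Linear extension over finitely supported functions\<close>

lemma pol_expand: "p = (\<Sum>m\<in>keys p. single m (lookup p m))"
proof (rule poly_mapping_eqI)
  fix k
  have "(\<Sum>m\<in>keys p. lookup (single m (lookup p m)) k) = (\<Sum>m\<in>keys p. if m = k then lookup p m else 0)"
    by (intro sum.cong) (auto simp: lookup_single)
  also have "\<dots> = lookup p k" by (simp add: in_keys_iff)
  finally show "lookup p k = lookup (\<Sum>m\<in>keys p. single m (lookup p m)) k"
    by (simp add: lookup_sum)
qed

lemma pol_induct [case_names zero single add]:
  fixes p :: "'a \<Rightarrow>\<^sub>0 'b::comm_monoid_add"
  assumes "P 0" "\<And>m c. m \<in> keys p \<Longrightarrow> P (single m c)" "\<And>q r. P q \<Longrightarrow> P r \<Longrightarrow> P (q + r)"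
  shows "P p"
proof -
  have "P (\<Sum>m\<in>A. single m (lookup p m))" if "finite A" "A \<subseteq> keys p" for A
    using that by (induction A rule: finite_induct) (auto intro: assms)
  from this[of "keys p"] show ?thesis using pol_expand[of p] by simp
qed

text \<open>Substitutions on monomials, fibre sums, exponent vectors, counts, module maps and
  augmentations are all of this shape. Additivity, compatibility with sums and evaluation over a
  larger finite index set are proved here once.\<close>

definition lin :: "('m \<Rightarrow> 'c::zero \<Rightarrow> 'b::comm_monoid_add) \<Rightarrow> ('m \<Rightarrow>\<^sub>0 'c) \<Rightarrow> 'b" where
  "lin g p = (\<Sum>m\<in>keys p. g m (lookup p m))"

definition additive_coeffs :: "('m \<Rightarrow> 'c::monoid_add \<Rightarrow> 'b::monoid_add) \<Rightarrow> bool" where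
  "additive_coeffs g \<longleftrightarrow> (\<forall>m. g m 0 = 0) \<and> (\<forall>m a b. g m (a + b) = g m a + g m b)"

lemma lin_superset:
  assumes "finite A" "keys p \<subseteq> A" "\<And>m. g m 0 = 0"
  shows "lin g p = (\<Sum>m\<in>A. g m (lookup p m))"
  unfolding lin_def using assms
  by (intro sum.mono_neutral_left) (auto simp: in_keys_iff)

lemma lin_add:
  assumes "additive_coeffs g"
  shows "lin g (p + q) = lin g p + lin g (q :: _ \<Rightarrow>\<^sub>0 _ :: comm_monoid_add)"
proof -
  let ?A = "keys p \<union> keys q"
  have "lin g (p + q) = (\<Sum>m\<in>?A. g m (lookup (p + q) m))"
    using keys_add[of p q] by (intro lin_superset) (use assms in \<open>auto simp: additive_coeffs_def\<close>)
  also have "\<dots> = (\<Sum>m\<in>?A. g m (lookup p m)) + (\<Sum>m\<in>?A. g m (lookup q m))"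
    using assms by (simp add: lookup_add additive_coeffs_def sum.distrib)
  also have "\<dots> = lin g p + lin g q"
    using lin_superset[of ?A p g] lin_superset[of ?A q g] assms by (simp add: additive_coeffs_def)
  finally show ?thesis .
qed

lemma lin_zero [simp]: "lin g 0 = 0" by (simp add: lin_def)

lemma lin_single: "g m 0 = 0 \<Longrightarrow> lin g (single m c) = g m c"
  by (cases "c = 0") (auto simp: lin_def)

lemma lin_sum:
  assumes "additive_coeffs g"
  shows "lin g (\<Sum>i\<in>I. f i) = (\<Sum>i\<in>I. lin g (f i :: _ \<Rightarrow>\<^sub>0 _ :: comm_monoid_add))"
  by (induction I rule: infinite_finite_induct) (simp_all add: lin_add[OF assms])

lemma lin_diff:
  assumes "additive_coeffs g"
  shows "lin g (p - q) = lin g p - (lin g (q :: _ \<Rightarrow>\<^sub>0 _ :: ab_group_add) :: _ :: ab_group_add)"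
  using lin_add[OF assms, of "p - q" q] by (simp add: algebra_simps)

section \<open>Monomials\<close>

definition mons :: "'x set \<Rightarrow> ('x \<Rightarrow>\<^sub>0 nat) set" where
  "mons X = {m. keys m \<subseteq> X}"

lemma keys_add_nat: "keys (m + n) = keys m \<union> keys (n :: 'x \<Rightarrow>\<^sub>0 nat)"
  by (auto simp: in_keys_iff lookup_add)

lemma mons_add [simp]: "m + n \<in> mons X \<longleftrightarrow> m \<in> mons X \<and> n \<in> mons X"
  by (auto simp: mons_def keys_add_nat)

lemma mons_zero [simp]: "0 \<in> mons X" by (simp add: mons_def)

lemma mons_single [simp]: "single x (Suc 0) \<in> mons X \<longleftrightarrow> x \<in> X" by (simp add: mons_def)

lemma total_deg_superset:
  "finite A \<Longrightarrow> keys m \<subseteq> A \<Longrightarrow> total_deg m = (\<Sum>x\<in>A. lookup m x)"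
  unfolding total_deg_def by (intro sum.mono_neutral_left) (auto simp: in_keys_iff)

lemma total_deg_add [simp]: "total_deg (m + n) = total_deg m + total_deg n"
proof -
  let ?A = "keys m \<union> keys n"
  have "total_deg (m + n) = (\<Sum>x\<in>?A. lookup m x) + (\<Sum>x\<in>?A. lookup n x)"
    by (subst total_deg_superset[of ?A]) (auto simp: keys_add_nat lookup_add sum.distrib)
  thus ?thesis by (simp add: total_deg_superset[of ?A, symmetric])
qed

lemma total_deg_single [simp]: "total_deg (single x k) = k"
  by (cases "k = 0") (auto simp: total_deg_def)

lemma total_deg_zero [simp]: "total_deg 0 = 0" by (simp add: total_deg_def)

lemma total_deg_eq_0_iff: "total_deg m = 0 \<longleftrightarrow> m = 0"
  by (auto simp: total_deg_def in_keys_iff poly_mapping_eq_iff fun_eq_iff)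

lemma mon_minus_single:
  "x \<in> keys m \<Longrightarrow> (m - single x (Suc 0)) + single x (Suc 0) = (m :: 'x \<Rightarrow>\<^sub>0 nat)"
  by (rule poly_mapping_eqI) (auto simp: lookup_add lookup_minus lookup_single when_def in_keys_iff)

lemma finite_mons_deg:
  assumes "finite X" shows "finite {m \<in> mons X. total_deg m = n}"
proof -
  let ?M = "{m \<in> mons X. total_deg m = n}"
  have "inj_on (\<lambda>m. restrict (lookup m) X) ?M"
  proof (rule inj_onI)
    fix m m' :: "'a \<Rightarrow>\<^sub>0 nat"
    assume a: "m \<in> ?M" "m' \<in> ?M" "restrict (lookup m) X = restrict (lookup m') X"
    have "lookup m x = lookup m' x" if "x \<in> X" for x
      using fun_cong[OF a(3), of x] that unfolding restrict_def by simp
    moreover have "lookup m x = lookup m' x" if "x \<notin> X" for x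
      using a(1,2) that by (metis (mono_tags, lifting) in_keys_iff mem_Collect_eq mons_def subset_iff)
    ultimately show "m = m'" by (intro poly_mapping_eqI) blast
  qed
  moreover have "(\<lambda>m. restrict (lookup m) X) ` ?M \<subseteq> X \<rightarrow>\<^sub>E {..n}"
  proof clarsimp
    fix m :: "'a \<Rightarrow>\<^sub>0 nat" and x assume "m \<in> mons X" "x \<in> X" "n = total_deg m"
    thus "lookup m x \<le> total_deg m" using assms
      by (subst total_deg_superset[of X]) (auto simp: mons_def intro: member_le_sum)
  qed
  moreover have "finite (X \<rightarrow>\<^sub>E {..n})" using assms by (intro finite_PiE) auto
  ultimately show ?thesis by (meson finite_imageD finite_subset)
qed

section \<open>Polynomials\<close>

lemma poly_ring_mons: "poly_ring X = {p. keys p \<subseteq> mons X}"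
  by (auto simp: poly_ring_def mons_def)

lemma poly_ring_add: "p \<in> poly_ring X \<Longrightarrow> q \<in> poly_ring X \<Longrightarrow> p + q \<in> poly_ring X"
  using keys_add[of p q] by (auto simp: poly_ring_mons)

lemma poly_ring_zero [simp]: "0 \<in> poly_ring X" by (simp add: poly_ring_mons)

lemma poly_ring_one [simp]: "1 \<in> poly_ring X" by (simp add: poly_ring_mons)

lemma poly_ring_uminus: "p \<in> poly_ring X \<Longrightarrow> - p \<in> poly_ring X"
  by (auto simp: poly_ring_mons in_keys_iff)

lemma poly_ring_minus: "p \<in> poly_ring X \<Longrightarrow> q \<in> poly_ring X \<Longrightarrow> p - q \<in> poly_ring X"
  using poly_ring_add[of p X "- q"] poly_ring_uminus[of q X] by simp

lemma poly_ring_mult: "p \<in> poly_ring X \<Longrightarrow> q \<in> poly_ring X \<Longrightarrow> p * q \<in> poly_ring X"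
  using keys_mult[of p q] by (fastforce simp: poly_ring_mons)

lemma poly_ring_sum: "(\<And>i. i \<in> I \<Longrightarrow> f i \<in> poly_ring X) \<Longrightarrow> (\<Sum>i\<in>I. f i) \<in> poly_ring X"
  by (induction I rule: infinite_finite_induct) (auto intro: poly_ring_add)

lemma poly_ring_power: "p \<in> poly_ring X \<Longrightarrow> p ^ n \<in> poly_ring X"
  by (induction n) (auto intro: poly_ring_mult)

lemma poly_ring_single: "m \<in> mons X \<Longrightarrow> single m c \<in> poly_ring X"
  by (auto simp: poly_ring_mons)

lemma poly_ring_indet: "x \<in> X \<Longrightarrow> indet x \<in> poly_ring X"
  by (auto simp: indet_def intro!: poly_ring_single)

definition homog :: "int \<Rightarrow> ('x, 'k::field) pol \<Rightarrow> bool" where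
  "homog c p \<longleftrightarrow> (\<forall>m\<in>keys p. int (total_deg m) = c)"

lemma homog_zero [simp]: "homog c 0" by (simp add: homog_def)

lemma homog_add: "homog c p \<Longrightarrow> homog c q \<Longrightarrow> homog c (p + q)"
  using keys_add[of p q] by (auto simp: homog_def)

lemma homog_uminus: "homog c p \<Longrightarrow> homog c (- p)"
  by (auto simp: homog_def in_keys_iff)

lemma homog_minus: "homog c p \<Longrightarrow> homog c q \<Longrightarrow> homog c (p - q)"
  using homog_add[of c p "- q"] homog_uminus[of c q] by simp

lemma homog_mult: "homog c p \<Longrightarrow> homog d q \<Longrightarrow> homog (c + d) (p * q)"
  using keys_mult[of p q] by (fastforce simp: homog_def)

lemma homog_sum: "(\<And>i. i \<in> I \<Longrightarrow> homog c (f i)) \<Longrightarrow> homog c (\<Sum>i\<in>I. f i)"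
  by (induction I rule: infinite_finite_induct) (auto intro: homog_add)

lemma homog_indet: "homog 1 (indet x)"
  by (auto simp: homog_def indet_def)

text \<open>The linear extension of a partial map on monomials, \<open>None\<close> meaning that the
  monomial is dropped. It serves for division by a variable, for homogeneous components and for
  dividing by a variable modulo an ideal.\<close>

definition mmap :: "(('x \<Rightarrow>\<^sub>0 nat) \<Rightarrow> ('x \<Rightarrow>\<^sub>0 nat) option) \<Rightarrow> ('x, 'k::field) pol \<Rightarrow> ('x, 'k) pol" where
  "mmap g = lin (\<lambda>m c. case g m of None \<Rightarrow> 0 | Some m' \<Rightarrow> single m' c)"

lemma mmap_add: "mmap g (p + q) = mmap g p + mmap g q"
  unfolding mmap_def by (rule lin_add) (auto simp: additive_coeffs_def single_add split: option.split)

lemma mmap_zero [simp]: "mmap g 0 = 0" by (simp add: mmap_def)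

lemma mmap_single: "mmap g (single m c) = (case g m of None \<Rightarrow> 0 | Some m' \<Rightarrow> single m' c)"
  unfolding mmap_def by (rule lin_single) (auto split: option.split)

lemma mmap_sum: "mmap g (\<Sum>i\<in>I. f i) = (\<Sum>i\<in>I. mmap g (f i))"
  unfolding mmap_def by (rule lin_sum) (auto simp: additive_coeffs_def single_add split: option.split)

lemma mmap_uminus: "mmap g (- p) = - mmap g p"
  using mmap_add[of g p "- p"] by (simp add: eq_neg_iff_add_eq_0 add.commute)

lemma keys_mmap: "keys (mmap g p) \<subseteq> {m'. \<exists>m\<in>keys p. g m = Some m'}"
proof -
  have "keys (mmap g p) \<subseteq> (\<Union>m\<in>keys p. keys (case g m of None \<Rightarrow> 0 | Some m' \<Rightarrow> single m' (lookup p m)))"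
    unfolding mmap_def lin_def by (rule keys_sum)
  thus ?thesis by (fastforce split: option.splits if_splits)
qed

lemma mmap_sgn: "mmap g ((-1) ^ n * p) = (-1) ^ n * mmap g p"
  by (induction n) (auto simp: mmap_uminus)

section \<open>Fibre ideals\<close>

text \<open>The coefficient at \<open>b\<close> of the image of a polynomial under the linear map
  that sends a monomial to its label and the monomials labelled \<open>None\<close> to zero.\<close>

definition fsum :: "(('x \<Rightarrow>\<^sub>0 nat) \<Rightarrow> 'b option) \<Rightarrow> 'b \<Rightarrow> ('x, 'k::field) pol \<Rightarrow> 'k" where
  "fsum \<mu> b = lin (\<lambda>m c. if \<mu> m = Some b then c else 0)"

lemma fsum_add: "fsum \<mu> b (p + q) = fsum \<mu> b p + fsum \<mu> b q"
  unfolding fsum_def by (rule lin_add) (auto simp: additive_coeffs_def)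

lemma fsum_diff: "fsum \<mu> b (p - q) = fsum \<mu> b p - fsum \<mu> b q"
  unfolding fsum_def by (rule lin_diff) (auto simp: additive_coeffs_def)

lemma fsum_zero [simp]: "fsum \<mu> b 0 = 0" by (simp add: fsum_def)

lemma fsum_uminus: "fsum \<mu> b (- p) = - fsum \<mu> b p"
  using fsum_diff[of \<mu> b 0 p] by simp

lemma fsum_single: "fsum \<mu> b (single m c) = (if \<mu> m = Some b then c else 0)"
  unfolding fsum_def by (rule lin_single) auto

lemma fsum_sum: "fsum \<mu> b (\<Sum>i\<in>I. f i) = (\<Sum>i\<in>I. fsum \<mu> b (f i))"
  unfolding fsum_def by (rule lin_sum) (auto simp: additive_coeffs_def)

lemma fsum_sgn: "fsum \<mu> b ((-1) ^ n * p) = (-1) ^ n * fsum \<mu> b p"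
  by (induction n) (auto simp: fsum_uminus)

lemma fsum_single_mult: "fsum \<mu> b (single n c * p) = c * fsum (\<lambda>m. \<mu> (m + n)) b p"
proof (induction p rule: pol_induct)
  case (single m d) thus ?case by (simp add: mult_single fsum_single add.commute)
qed (auto simp: distrib_left fsum_add)

lemma fsum_indet: "fsum \<mu> b (indet x * p) = fsum (\<lambda>m. \<mu> (m + single x (Suc 0))) b p"
  by (simp add: indet_def fsum_single_mult)

lemma fsum_eq_0I: "(\<And>m. m \<in> keys p \<Longrightarrow> \<mu> m \<noteq> Some b) \<Longrightarrow> fsum \<mu> b p = 0"
  unfolding fsum_def lin_def by (intro sum.neutral) auto

text \<open>Among the monomials of \<open>p\<close>, the fibre of \<open>\<nu>\<close> over
  \<open>b\<close> is a union of fibres of \<open>\<mu>\<close> over proper labels, so its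
  coefficient sum is a sum of zeros. Inclusions between fibre ideals and their closure under
  multiplication rest on this.\<close>

lemma fsum_coarsen:
  assumes "\<And>m. m \<in> keys p \<Longrightarrow> \<mu> m = None \<Longrightarrow> \<nu> m \<noteq> Some b"
    and "\<And>m m'. m \<in> keys p \<Longrightarrow> m' \<in> keys p \<Longrightarrow> \<mu> m = \<mu> m' \<Longrightarrow> \<nu> m = \<nu> m'"
    and "\<And>c. fsum \<mu> c p = 0"
  shows "fsum \<nu> b p = 0"
proof -
  let ?K = "{m \<in> keys p. \<nu> m = Some b}"
  have "fsum \<nu> b p = (\<Sum>m\<in>?K. lookup p m)"
    unfolding fsum_def lin_def by (rule sum.inter_filter[symmetric]) simp
  also have "\<dots> = (\<Sum>c\<in>\<mu> ` ?K. \<Sum>m | m \<in> ?K \<and> \<mu> m = c. lookup p m)"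
    by (rule sum.image_gen) simp
  also have "\<dots> = 0"
  proof (rule sum.neutral, clarify)
    fix m0 assume m0: "m0 \<in> keys p" "\<nu> m0 = Some b"
    hence "\<mu> m0 \<noteq> None" using assms(1)[of m0] by metis
    then obtain c where c: "\<mu> m0 = Some c" by blast
    have "{m \<in> ?K. \<mu> m = \<mu> m0} = {m \<in> keys p. \<mu> m = Some c}"
    proof (intro Collect_cong iffI conjI)
      fix m assume "m \<in> keys p \<and> \<mu> m = Some c"
      hence m: "m \<in> keys p" "\<mu> m = \<mu> m0" using c by simp_all
      show "m \<in> ?K" using assms(2)[OF m(1) m0(1) m(2)] m(1) m0(2) by simp
    qed (use c in auto)
    hence "(\<Sum>m | m \<in> ?K \<and> \<mu> m = \<mu> m0. lookup p m) = (\<Sum>m\<in>{m \<in> keys p. \<mu> m = Some c}. lookup p m)"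
      by simp
    also have "\<dots> = fsum \<mu> c p"
      unfolding fsum_def lin_def by (rule sum.inter_filter) simp
    finally show "(\<Sum>m | m \<in> ?K \<and> \<mu> m = \<mu> m0. lookup p m) = 0" using assms(3) by simp
  qed
  finally show ?thesis .
qed

text \<open>The kernel of the linear map given by the labels: a toric ideal if \<open>None\<close>
  does not occur, a monomial ideal if every monomial outside the ideal is its own label.\<close>

definition fibre_ideal :: "'x set \<Rightarrow> (('x \<Rightarrow>\<^sub>0 nat) \<Rightarrow> 'b option) \<Rightarrow> ('x, 'k::field) pol set" where
  "fibre_ideal X \<mu> = {p \<in> poly_ring X. \<forall>b. fsum \<mu> b p = 0}"

text \<open>The first two conditions make the labels compatible with multiplication by monomials, so
  that the kernel is an ideal. The third makes the surviving fibres homogeneous, so that exchanging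
  a monomial within its fibre preserves degrees.\<close>

definition graded_fibres :: "'x set \<Rightarrow> (('x \<Rightarrow>\<^sub>0 nat) \<Rightarrow> 'b option) \<Rightarrow> bool" where
  "graded_fibres X \<mu> \<longleftrightarrow>
     (\<forall>m\<in>mons X. \<forall>n\<in>mons X. \<mu> m = None \<longrightarrow> \<mu> (m + n) = None) \<and>
     (\<forall>m\<in>mons X. \<forall>m'\<in>mons X. \<forall>n\<in>mons X. \<mu> m = \<mu> m' \<longrightarrow> \<mu> (m + n) = \<mu> (m' + n)) \<and>
     (\<forall>m\<in>mons X. \<forall>m'\<in>mons X. \<mu> m = \<mu> m' \<longrightarrow> \<mu> m \<noteq> None \<longrightarrow> total_deg m = total_deg m')"

lemma fibre_ideal_add: "p \<in> fibre_ideal X \<mu> \<Longrightarrow> q \<in> fibre_ideal X \<mu> \<Longrightarrow> p + q \<in> fibre_ideal X \<mu>"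
  by (auto simp: fibre_ideal_def fsum_add poly_ring_add)

lemma fibre_ideal_zero [simp]: "0 \<in> fibre_ideal X \<mu>" by (simp add: fibre_ideal_def)

lemma fibre_ideal_mono:
  assumes "\<And>m. m \<in> mons X \<Longrightarrow> \<mu> m = None \<Longrightarrow> \<nu> m = None"
    "\<And>m m'. m \<in> mons X \<Longrightarrow> m' \<in> mons X \<Longrightarrow> \<mu> m = \<mu> m' \<Longrightarrow> \<nu> m = \<nu> m'"
  shows "fibre_ideal X \<mu> \<subseteq> fibre_ideal X \<nu>"
proof
  fix p assume "p \<in> fibre_ideal X \<mu>"
  hence p: "p \<in> poly_ring X" "\<And>b. fsum \<mu> b p = 0" and m: "\<And>m. m \<in> keys p \<Longrightarrow> m \<in> mons X"
    by (auto simp: fibre_ideal_def poly_ring_mons)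
  have "fsum \<nu> b p = 0" for b
  proof (rule fsum_coarsen[of p \<mu>])
    show "\<nu> m \<noteq> Some b" if "m \<in> keys p" "\<mu> m = None" for m
      using assms(1)[OF m[OF that(1)] that(2)] by simp
    show "\<nu> m = \<nu> m'" if "m \<in> keys p" "m' \<in> keys p" "\<mu> m = \<mu> m'" for m m'
      using assms(2)[OF m[OF that(1)] m[OF that(2)] that(3)] .
  qed (rule p)
  thus "p \<in> fibre_ideal X \<nu>" using p by (simp add: fibre_ideal_def)
qed

text \<open>Only the partition into fibres and the set labelled \<open>None\<close> matter. The
  label types may differ, which lets a toric ideal turn into a monomial ideal once a variable has
  been adjoined.\<close>

lemma fibre_ideal_eqI:
  assumes "\<And>m. m \<in> mons X \<Longrightarrow> \<mu> m = None \<longleftrightarrow> \<nu> m = None"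
    "\<And>m m'. m \<in> mons X \<Longrightarrow> m' \<in> mons X \<Longrightarrow> \<mu> m = \<mu> m' \<longleftrightarrow> \<nu> m = \<nu> m'"
  shows "fibre_ideal X \<mu> = fibre_ideal X \<nu>"
  using assms by (intro equalityI fibre_ideal_mono) blast+

lemma fibre_ideal_mult:
  assumes "graded_fibres X \<mu>" "q \<in> poly_ring X" "p \<in> fibre_ideal X \<mu>"
  shows "q * p \<in> fibre_ideal X \<mu>"
proof (rule pol_induct[where p = q and P = "\<lambda>q. q * p \<in> fibre_ideal X \<mu>"])
  fix n c assume "n \<in> keys q"
  hence n: "n \<in> mons X" using assms(2) by (auto simp: poly_ring_mons)
  have k: "keys p \<subseteq> mons X" using assms(3) by (auto simp: fibre_ideal_def poly_ring_mons)
  have "fsum (\<lambda>m. \<mu> (m + n)) b p = 0" for b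
  proof (rule fsum_coarsen[of p \<mu>])
    show "\<mu> (m + n) \<noteq> Some b" if "m \<in> keys p" "\<mu> m = None" for m
      using assms(1) n k that unfolding graded_fibres_def by (metis option.distinct(1) subsetD)
    show "\<mu> (m + n) = \<mu> (m' + n)" if "m \<in> keys p" "m' \<in> keys p" "\<mu> m = \<mu> m'" for m m'
      using assms(1) n k that unfolding graded_fibres_def by (meson subsetD)
  qed (use assms(3) in \<open>simp add: fibre_ideal_def\<close>)
  thus "single n c * p \<in> fibre_ideal X \<mu>" using assms(3) n
    by (auto simp: fibre_ideal_def fsum_single_mult poly_ring_mult poly_ring_single)
qed (auto simp: distrib_right intro!: fibre_ideal_add)

definition ring_ideal :: "'x set \<Rightarrow> ('x, 'k::field) pol set \<Rightarrow> bool" where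
  "ring_ideal X J \<longleftrightarrow> 0 \<in> J \<and> (\<forall>p\<in>J. \<forall>q\<in>J. p + q \<in> J) \<and> (\<forall>q\<in>poly_ring X. \<forall>p\<in>J. q * p \<in> J) \<and> J \<subseteq> poly_ring X"

lemma ring_ideal_fibre:
  assumes "graded_fibres X \<mu>" shows "ring_ideal X (fibre_ideal X \<mu>)"
  unfolding ring_ideal_def
  by (intro conjI ballI fibre_ideal_add fibre_ideal_mult[OF assms] fibre_ideal_zero)
    (auto simp: fibre_ideal_def)

lemma ring_ideal_ring: "ring_ideal X (poly_ring X)"
  by (auto simp: ring_ideal_def poly_ring_add poly_ring_mult)

lemma ring_ideal_mult: "ring_ideal X J \<Longrightarrow> q \<in> poly_ring X \<Longrightarrow> p \<in> J \<Longrightarrow> q * p \<in> J"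
  unfolding ring_ideal_def by blast

lemma ring_ideal_add: "ring_ideal X J \<Longrightarrow> q \<in> J \<Longrightarrow> p \<in> J \<Longrightarrow> q + p \<in> J"
  unfolding ring_ideal_def by blast

lemma ring_ideal_zero: "ring_ideal X J \<Longrightarrow> 0 \<in> J"
  unfolding ring_ideal_def by blast

lemma ring_ideal_sum: "ring_ideal X J \<Longrightarrow> (\<And>i. i \<in> I \<Longrightarrow> f i \<in> J) \<Longrightarrow> (\<Sum>i\<in>I. f i) \<in> J"
  by (induction I rule: infinite_finite_induct) (simp_all add: ring_ideal_zero ring_ideal_add)

lemma ring_ideal_uminus: "ring_ideal X J \<Longrightarrow> p \<in> J \<Longrightarrow> - p \<in> J"
  using ring_ideal_mult[of X J "- 1" p] poly_ring_uminus[OF poly_ring_one, of X] by simp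

lemma ring_ideal_minus: "ring_ideal X J \<Longrightarrow> p \<in> J \<Longrightarrow> q \<in> J \<Longrightarrow> p - q \<in> J"
  using ring_ideal_uminus[of X J q] ring_ideal_add[of X J p "- q"] by simp

section \<open>The Koszul complex\<close>

text \<open>Terms cancel in pairs; nothing is derived from \<open>2 a = 0\<close>, so the argument
  is valid in characteristic 2. It yields \<open>kbd_kbd\<close>.\<close>

lemma sum_off_diagonal_antisym:
  fixes a :: "'a \<Rightarrow> 'a \<Rightarrow> 'b::ab_group_add"
  assumes "finite A" "\<forall>x\<in>A. \<forall>y\<in>A. x \<noteq> y \<longrightarrow> a x y + a y x = 0"
  shows "(\<Sum>x\<in>A. \<Sum>y\<in>A - {x}. a x y) = 0"
  using assms
proof (induction A rule: finite_induct)
  case (insert z A)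
  have 1: "(\<Sum>y\<in>insert z A - {x}. a x y) = a x z + (\<Sum>y\<in>A - {x}. a x y)" if "x \<in> A" for x
  proof -
    have "insert z A - {x} = insert z (A - {x})" using insert(2) that by blast
    moreover have "finite (A - {x})" "z \<notin> A - {x}" using insert(1,2) by simp_all
    ultimately show ?thesis by simp
  qed
  have IH: "(\<Sum>x\<in>A. \<Sum>y\<in>A - {x}. a x y) = 0" using insert(3,4) by blast
  have "insert z A - {z} = A" using insert(2) by simp
  hence "(\<Sum>x\<in>insert z A. \<Sum>y\<in>insert z A - {x}. a x y)
      = (\<Sum>y\<in>A. a z y) + (\<Sum>x\<in>A. \<Sum>y\<in>insert z A - {x}. a x y)"
    by (simp only: sum.insert[OF insert(1,2)])
  also have "(\<Sum>x\<in>A. \<Sum>y\<in>insert z A - {x}. a x y) = (\<Sum>x\<in>A. a x z + (\<Sum>y\<in>A - {x}. a x y))"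
    by (intro sum.cong refl 1)
  also have "(\<Sum>y\<in>A. a z y) + \<dots> = (\<Sum>y\<in>A. a z y + a y z)"
    by (simp only: sum.distrib IH add_0_right)
  also have "\<dots> = 0"
    using insert(2,4) by (intro sum.neutral) auto
  finally show ?case .
qed simp

text \<open>The numbering \<open>rk\<close> orders the variables; signs and the first variable of a
  monomial refer to it. It is a parameter because a certificate needs an order in which its own
  partitions come first.\<close>

locale koszul =
  fixes X :: "'x set" and rk :: "'x \<Rightarrow> nat"
  assumes finX: "finite X" and rk_inj: "inj_on rk X"
begin

definition ksign :: "'x \<Rightarrow> 'x set \<Rightarrow> ('x, 'k::field) pol" where
  "ksign x U = (-1) ^ card {u \<in> U. rk u < rk x}"

definition kchain :: "nat \<Rightarrow> ('x set \<Rightarrow> ('x, 'k::field) pol) set" where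
  "kchain i = {v. \<forall>W. v W \<in> poly_ring X \<and> (v W \<noteq> 0 \<longrightarrow> W \<subseteq> X \<and> card W = i)}"

definition kbd :: "('x set \<Rightarrow> ('x, 'k::field) pol) \<Rightarrow> 'x set \<Rightarrow> ('x, 'k) pol" where
  "kbd v U = (\<Sum>x\<in>X - U. ksign x U * (indet x * v (insert x U)))"

text \<open>The degree \<open>c\<close> is that of the coefficients, so a chain in homological
  degree \<open>i\<close> has internal degree \<open>i + c\<close>. The boundary raises
  \<open>c\<close> by one and preserves the internal degree.\<close>

definition khom :: "int \<Rightarrow> ('x set \<Rightarrow> ('x, 'k::field) pol) \<Rightarrow> bool" where
  "khom c v \<longleftrightarrow> (\<forall>W. homog c (v W))"

lemma kchainD: "v \<in> kchain i \<Longrightarrow> v W \<in> poly_ring X" "v \<in> kchain i \<Longrightarrow> v W \<noteq> 0 \<Longrightarrow> W \<subseteq> X \<and> card W = i"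
  by (auto simp: kchain_def)

lemma kchain_0: "v \<in> kchain i \<Longrightarrow> \<not> (W \<subseteq> X \<and> card W = i) \<Longrightarrow> v W = 0"
  by (auto simp: kchain_def)

lemma ksign_ring: "ksign x U \<in> poly_ring X"
  unfolding ksign_def by (intro poly_ring_power poly_ring_uminus) simp

lemma ksign_sq: "ksign x U * ksign x U = 1"
  by (simp add: ksign_def flip: power_mult_distrib)

lemma homog_ksign: "homog c p \<Longrightarrow> homog c (ksign x U * p)"
proof -
  have "homog c ((-1) ^ n * p)" if "homog c p" for n using that
    by (induction n) (auto intro: homog_uminus)
  thus "homog c p \<Longrightarrow> homog c (ksign x U * p)" by (simp add: ksign_def)
qed

lemma ksign_insert:
  assumes "finite U" "y \<notin> U"
  shows "ksign x (insert y U) = (if rk y < rk x then - ksign x U else ksign x U)"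
proof -
  have "{u \<in> insert y U. rk u < rk x} = (if rk y < rk x then insert y {u \<in> U. rk u < rk x} else {u \<in> U. rk u < rk x})"
    by auto
  thus ?thesis using assms by (simp add: ksign_def)
qed

lemma ksign_swap:
  assumes "x \<in> X" "y \<in> X" "x \<noteq> y" "finite U" "x \<notin> U" "y \<notin> U"
  shows "ksign x U * ksign y (insert x U) = - (ksign y U * ksign x (insert y U))"
proof -
  have "rk x \<noteq> rk y" using assms rk_inj by (auto dest: inj_onD)
  thus ?thesis using assms by (cases "rk x < rk y") (auto simp: ksign_insert algebra_simps)
qed

lemma finite_sub: "W \<subseteq> X \<Longrightarrow> finite W" using finX finite_subset by blast

lemma kbd_in:
  assumes "v \<in> kchain (Suc i)" shows "kbd v \<in> kchain i"
proof -
  have "kbd v U \<in> poly_ring X" for U unfolding kbd_def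
    by (intro poly_ring_sum poly_ring_mult ksign_ring poly_ring_indet kchainD[OF assms]) auto
  moreover have "U \<subseteq> X \<and> card U = i" if "kbd v U \<noteq> 0" for U
  proof -
    obtain x where x: "x \<in> X - U" "ksign x U * (indet x * v (insert x U)) \<noteq> 0"
      using \<open>kbd v U \<noteq> 0\<close> unfolding kbd_def by (meson sum.not_neutral_contains_not_neutral)
    hence "v (insert x U) \<noteq> 0" by auto
    from kchainD(2)[OF assms this] x show ?thesis using finite_sub[of "insert x U"]
      by (auto simp: card_insert_if)
  qed
  ultimately show ?thesis by (auto simp: kchain_def)
qed

lemma kbd_0: "v \<in> kchain 0 \<Longrightarrow> kbd v = (\<lambda>_. 0)"
proof
  fix U assume v: "v \<in> kchain 0"
  have "v (insert x U) = 0" for x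
  proof (rule kchain_0[OF v])
    show "\<not> (insert x U \<subseteq> X \<and> card (insert x U) = 0)"
      using finite_sub[of "insert x U"] by (auto simp: card_gt_0_iff)
  qed
  thus "kbd v U = 0" by (simp add: kbd_def)
qed

text \<open>For \<open>i = 0\<close> the boundary is the zero chain, which belongs to every
  \<open>kchain\<close>, so the truncated \<open>i - 1\<close> does no harm.\<close>

lemma kbd_pred_in: "v \<in> kchain i \<Longrightarrow> kbd v \<in> kchain (i - 1)"
  using kbd_in[of v "i - 1"] kbd_0[of v] by (cases i) (auto simp: kchain_def)

lemma kbd_zero [simp]: "kbd (\<lambda>_. 0) = (\<lambda>_. 0)" by (simp add: kbd_def fun_eq_iff)

lemma kbd_add: "kbd (\<lambda>W. v W + w W) U = kbd v U + kbd w U"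
  by (simp add: kbd_def algebra_simps sum.distrib)

lemma kbd_diff: "kbd (\<lambda>W. v W - w W) U = kbd v U - kbd w U"
  by (simp add: kbd_def algebra_simps sum_subtractf)

lemma kbd_mult: "kbd (\<lambda>W. p * v W) U = p * kbd v U"
  by (simp add: kbd_def sum_distrib_left algebra_simps)

lemma kchainI:
  assumes "\<And>W. v W \<in> poly_ring X" "\<And>W. \<not> (W \<subseteq> X \<and> card W = i) \<Longrightarrow> v W = 0"
  shows "v \<in> kchain i"
  using assms unfolding kchain_def by blast

lemma kchain_add: "v \<in> kchain i \<Longrightarrow> w \<in> kchain i \<Longrightarrow> (\<lambda>W. v W + w W) \<in> kchain i"
  by (rule kchainI) (simp_all add: poly_ring_add kchainD(1) kchain_0)

lemma kchain_diff: "v \<in> kchain i \<Longrightarrow> w \<in> kchain i \<Longrightarrow> (\<lambda>W. v W - w W) \<in> kchain i"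
  by (rule kchainI) (simp_all add: poly_ring_minus kchainD(1) kchain_0)

lemma kchain_mult: "v \<in> kchain i \<Longrightarrow> p \<in> poly_ring X \<Longrightarrow> (\<lambda>W. p * v W) \<in> kchain i"
  by (rule kchainI) (simp_all add: poly_ring_mult kchainD(1) kchain_0)

lemma khom_add: "khom c v \<Longrightarrow> khom c w \<Longrightarrow> khom c (\<lambda>W. v W + w W)"
  by (simp add: khom_def homog_add)

lemma khom_diff: "khom c v \<Longrightarrow> khom c w \<Longrightarrow> khom c (\<lambda>W. v W - w W)"
  by (simp add: khom_def homog_minus)

lemma khom_kbd:
  assumes "khom c v" shows "khom (c + 1) (kbd v)"
proof -
  have "homog (c + 1) (indet x * v W)" for x W
    using homog_mult[OF homog_indet, of c "v W" x] assms by (simp add: khom_def add.commute)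
  thus ?thesis by (simp add: khom_def kbd_def homog_sum homog_ksign)
qed

lemma kbd_ideal:
  assumes "ring_ideal X J" "\<And>W. v W \<in> J" shows "kbd v U \<in> J"
  unfolding kbd_def
  by (intro ring_ideal_sum[OF assms(1)] ring_ideal_mult[OF assms(1)] ksign_ring poly_ring_indet assms(2)) auto

lemma kbd_kbd:
  fixes v :: "'x set \<Rightarrow> ('x, 'k::field) pol"
  assumes "v \<in> kchain i" shows "kbd (kbd v) U = 0"
proof (cases "U \<subseteq> X")
  case False
  hence "v (insert y (insert x U)) = 0" for x y by (intro kchain_0[OF assms]) auto
  thus ?thesis by (simp add: kbd_def)
next
  case True
  let ?a = "\<lambda>x y. (ksign x U * ksign y (insert x U)) * (indet x * indet y * v (insert y (insert x U)))"
  have "kbd (kbd v) U = (\<Sum>x\<in>X - U. \<Sum>y\<in>X - insert x U. ?a x y)"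
    unfolding kbd_def by (simp add: sum_distrib_left algebra_simps)
  also have "\<dots> = (\<Sum>x\<in>X - U. \<Sum>y\<in>(X - U) - {x}. ?a x y)"
  proof (rule sum.cong[OF refl])
    fix x
    have "X - insert x U = X - U - {x}" by auto
    thus "(\<Sum>y\<in>X - insert x U. ?a x y) = (\<Sum>y\<in>X - U - {x}. ?a x y)" by simp
  qed
  also have "\<dots> = 0"
  proof (intro sum_off_diagonal_antisym ballI impI)
    fix x y assume xy: "x \<in> X - U" "y \<in> X - U" "x \<noteq> y"
    have 1: "ksign x U * ksign y (insert x U) = - (ksign y U * ksign x (insert y U) :: ('x, 'k) pol)"
      using xy finite_sub[OF True] by (intro ksign_swap) auto
    have 2: "indet x * indet y * v (insert y (insert x U)) = indet y * indet x * v (insert x (insert y U))"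
      by (simp add: insert_commute mult.commute)
    show "?a x y + ?a y x = 0" unfolding 1 2 by (simp only: minus_mult_left[symmetric] left_minus)
  qed (use finX in auto)
  finally show ?thesis .
qed

section \<open>Multiplication by a variable is null-homotopic\<close>

definition kwedge :: "'x \<Rightarrow> ('x set \<Rightarrow> ('x, 'k::field) pol) \<Rightarrow> 'x set \<Rightarrow> ('x, 'k) pol" where
  "kwedge x v U = (if x \<in> U then ksign x (U - {x}) * v (U - {x}) else 0)"

lemma kwedge_in:
  assumes "v \<in> kchain i" "x \<in> X" shows "kwedge x v \<in> kchain (Suc i)"
proof -
  have "U \<subseteq> X \<and> card U = Suc i" if "x \<in> U" "ksign x (U - {x}) * v (U - {x}) \<noteq> 0" for U
  proof -
    have "v (U - {x}) \<noteq> 0" using that by auto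
    hence u: "U - {x} \<subseteq> X" "card (U - {x}) = i" using kchainD(2)[OF assms(1)] by auto
    have "U = insert x (U - {x})" using that by auto
    thus ?thesis using u assms(2) finite_sub[OF u(1)] by (metis card_insert_disjoint Diff_iff insertI1 insert_subset)
  qed
  thus ?thesis using kchainD(1)[OF assms(1)]
    by (auto simp: kchain_def kwedge_def intro!: poly_ring_mult ksign_ring)
qed

lemma khom_kwedge: "khom c v \<Longrightarrow> khom c (kwedge x v)"
  by (auto simp: khom_def kwedge_def intro: homog_ksign)

lemma kwedge_ideal:
  assumes "ring_ideal X J" "\<And>W. v W \<in> J" shows "kwedge x v U \<in> J"
  using assms by (auto simp: kwedge_def intro!: ring_ideal_mult ksign_ring ring_ideal_zero)

text \<open>Exterior multiplication by the basis vector of \<open>x\<close> is a homotopy from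
  multiplication by \<open>x\<close> to zero. Consequently \<open>x\<close> times a cycle modulo an
  ideal is a boundary modulo that ideal, as used in \<open>quot_reg_regular\<close>.\<close>

lemma kwedge_homotopy:
  fixes v :: "'x set \<Rightarrow> ('x, 'k::field) pol"
  assumes v: "v \<in> kchain i" and x: "x \<in> X"
  shows "kbd (kwedge x v) U + kwedge x (kbd v) U = indet x * v U"
proof (cases "U \<subseteq> X")
  case False
  have 0: "v W = 0" if "\<not> W \<subseteq> X" for W using that by (intro kchain_0[OF v]) auto
  have "v U = 0" "v (insert y U - {x}) = 0" "v (insert y (U - {x})) = 0" for y
    by (rule 0; use False x in blast)+
  hence "kwedge x v (insert y U) = 0" "kbd v (U - {x}) = 0" for y by (simp_all add: kbd_def kwedge_def)
  thus ?thesis using \<open>v U = 0\<close> by (simp add: kbd_def[of "kwedge x v"] kwedge_def[of x "kbd v"])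
next
  case True
  note fin = finite_sub[OF True]
  show ?thesis
  proof (cases "x \<in> U")
    case False
    have "kbd (kwedge x v) U = (\<Sum>y\<in>X - U. if y = x then indet x * v U else 0)"
      unfolding kbd_def
    proof (rule sum.cong[OF refl])
      fix y assume y: "y \<in> X - U"
      show "ksign y U * (indet y * kwedge x v (insert y U)) = (if y = x then indet x * v U else 0)"
      proof (cases "y = x")
        case True
        have "insert x U - {x} = U" using \<open>x \<notin> U\<close> by simp
        hence "ksign x U * (indet x * kwedge x v (insert x U)) = (ksign x U * ksign x U) * (indet x * v U)"
          by (simp add: kwedge_def algebra_simps)
        thus ?thesis using True by (simp add: ksign_sq)
      qed (use \<open>x \<notin> U\<close> in \<open>simp add: kwedge_def\<close>)
    qed
    thus ?thesis using False x finX by (simp add: kwedge_def)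
  next
    case xU: True
    define V where "V = U - {x}"
    have V: "U = insert x V" "x \<notin> V" "finite V" using xU fin by (auto simp: V_def)
    have XV: "X - V = insert x (X - U)" using V x by auto
    have "kwedge x (kbd v) U = ksign x V * (\<Sum>y\<in>X - V. ksign y V * (indet y * v (insert y V)))"
      using xU by (simp add: kwedge_def kbd_def V_def)
    also have "\<dots> = ksign x V * ksign x V * (indet x * v U) +
        (\<Sum>y\<in>X - U. ksign x V * ksign y V * (indet y * v (insert y V)))"
      using V finX xU unfolding XV by (simp add: algebra_simps sum_distrib_left)
    also have "(\<Sum>y\<in>X - U. ksign x V * ksign y V * (indet y * v (insert y V))) = - kbd (kwedge x v) U"
      unfolding kbd_def sum_negf[symmetric]
    proof (rule sum.cong[OF refl])
      fix y assume y: "y \<in> X - U"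
      have "insert y U - {x} = insert y V" using V y by auto
      hence "kwedge x v (insert y U) = ksign x (insert y V) * v (insert y V)" using xU by (simp add: kwedge_def)
      moreover have "ksign x V * ksign y V = - (ksign y U * ksign x (insert y V) :: ('x, 'k) pol)"
      proof -
        have "rk x \<noteq> rk y" using rk_inj x y V by (auto dest: inj_onD)
        thus ?thesis using y V by (cases "rk x < rk y") (auto simp: ksign_insert)
      qed
      ultimately show "ksign x V * ksign y V * (indet y * v (insert y V)) =
         - (ksign y U * (indet y * kwedge x v (insert y U)))"
        by (simp add: algebra_simps)
    qed
    finally show ?thesis by (simp add: ksign_sq)
  qed
qed

text \<open>Division by \<open>y\<close> of the monomials whose first variable is \<open>y\<close>. Moving that variable into
  the exterior part contracts the Koszul complex.\<close>

definition divmin :: "'x \<Rightarrow> ('x, 'k::field) pol \<Rightarrow> ('x, 'k) pol" where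
  "divmin y = mmap (\<lambda>m. if y \<in> keys m \<and> (\<forall>x\<in>keys m. rk y \<le> rk x) then Some (m - single y (Suc 0)) else None)"

lemma divmin_indet_less:
  assumes "rk x < rk y" shows "divmin y (indet x * p) = 0"
proof (induction p rule: pol_induct)
  case (single m c)
  have "x \<in> keys (single x (Suc 0) + m)" by (simp add: keys_add_nat)
  thus ?case using assms
    by (auto simp: divmin_def indet_def mult_single mmap_single not_le)
qed (auto simp: divmin_def mmap_add distrib_left)

lemma divmin_indet_greater:
  assumes "rk y < rk x" shows "divmin y (indet x * p) = indet x * divmin y p"
proof (induction p rule: pol_induct)
  case (single m c)
  have xy: "x \<noteq> y" using assms by auto
  have "(single x (Suc 0) + m) - single y (Suc 0) = single x (Suc 0) + (m - single y (Suc 0))" if "y \<in> keys m"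
    using that xy by (intro poly_mapping_eqI) (auto simp: lookup_add lookup_minus lookup_single when_def in_keys_iff)
  thus ?case using assms xy
    by (auto simp: divmin_def indet_def mult_single mmap_single keys_add_nat)
qed (auto simp: divmin_def mmap_add distrib_left)

lemma divmin_ring: "p \<in> poly_ring X \<Longrightarrow> divmin y p \<in> poly_ring X"
proof -
  assume p: "p \<in> poly_ring X"
  have "m - single y (Suc 0) \<in> mons X" if "m \<in> keys p" for m
  proof -
    have "m \<in> mons X" using p that by (auto simp: poly_ring_mons)
    thus ?thesis by (auto simp: mons_def in_keys_iff lookup_minus subset_iff)
  qed
  thus ?thesis
    using keys_mmap[of "\<lambda>m. if y \<in> keys m \<and> (\<forall>x\<in>keys m. rk y \<le> rk x) then Some (m - single y (Suc 0)) else None" p]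
    by (force simp: poly_ring_mons divmin_def split: if_splits)
qed

lemma divmin_homog: "homog c p \<Longrightarrow> homog (c - 1) (divmin y p)"
proof -
  assume p: "homog c p"
  have *: "int (total_deg (m - single y (Suc 0))) = int (total_deg m) - 1" if "y \<in> keys m" for m
    using arg_cong[OF mon_minus_single[OF that], of total_deg] by (simp only: total_deg_add total_deg_single)
  show ?thesis unfolding homog_def
  proof
    fix m' assume "m' \<in> keys (divmin y p)"
    then obtain m where "m \<in> keys p" "y \<in> keys m" "m' = m - single y (Suc 0)"
      using keys_mmap[of "\<lambda>m. if y \<in> keys m \<and> (\<forall>x\<in>keys m. rk y \<le> rk x) then Some (m - single y (Suc 0)) else None" p]
      by (force simp: divmin_def split: if_splits)
    thus "int (total_deg m') = c - 1" using p * by (auto simp: homog_def)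
  qed
qed

lemma min_var:
  assumes "K \<noteq> {}" "K \<subseteq> X"
  obtains x0 where "x0 \<in> K" "\<And>x. x \<in> X \<Longrightarrow> (x \<in> K \<and> (\<forall>z\<in>K. rk x \<le> rk z)) \<longleftrightarrow> x = x0"
proof -
  have fK: "finite K" using assms finite_sub by blast
  let ?x = "arg_min_on rk K"
  have x: "?x \<in> K" "\<And>z. z \<in> K \<Longrightarrow> rk ?x \<le> rk z"
    using arg_min_if_finite[OF fK assms(1), of rk] by (auto simp: not_less)
  show ?thesis
  proof (rule that[OF x(1)])
    fix x assume "x \<in> X"
    show "(x \<in> K \<and> (\<forall>z\<in>K. rk x \<le> rk z)) \<longleftrightarrow> x = ?x"
    proof
      assume a: "x \<in> K \<and> (\<forall>z\<in>K. rk x \<le> rk z)"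
      have "rk x = rk ?x" using a x by (intro antisym) auto
      thus "x = ?x" using rk_inj a x(1) assms(2) by (meson inj_onD subsetD)
    qed (use x in blast)
  qed
qed

text \<open>A non-constant monomial has exactly one first variable, so at most one summand is
  non-zero, and that summand gives the monomial back.\<close>

lemma indet_divmin_single:
  assumes m: "m \<in> mons X" and A: "A \<subseteq> X"
  shows "(\<Sum>x\<in>A. indet x * divmin x (single m c)) =
     (if \<exists>x\<in>A. x \<in> keys m \<and> (\<forall>z\<in>keys m. rk x \<le> rk z) then single m c else 0)"
proof (cases "keys m = {}")
  case True thus ?thesis by (simp add: divmin_def mmap_single)
next
  case False
  obtain x0 where x0: "x0 \<in> keys m" "\<And>x. x \<in> X \<Longrightarrow> (x \<in> keys m \<and> (\<forall>z\<in>keys m. rk x \<le> rk z)) \<longleftrightarrow> x = x0"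
    using min_var[OF False] m by (auto simp: mons_def)
  have "(\<Sum>x\<in>A. indet x * divmin x (single m c)) = (\<Sum>x\<in>A. if x = x0 then single m c else 0)"
  proof (rule sum.cong[OF refl])
    fix x assume "x \<in> A"
    hence "x \<in> X" using A by auto
    thus "indet x * divmin x (single m c) = (if x = x0 then single m c else 0)"
      using x0(2)[of x] mon_minus_single[OF x0(1)]
      by (simp add: divmin_def mmap_single indet_def mult_single add.commute)
  qed
  moreover have "(\<exists>x\<in>A. x \<in> keys m \<and> (\<forall>z\<in>keys m. rk x \<le> rk z)) \<longleftrightarrow> x0 \<in> A"
    using x0(2) A by (metis subsetD)
  ultimately show ?thesis using finite_sub[OF A] by simp
qed

lemma divmin_total:
  assumes "p \<in> poly_ring X"
  shows "(\<Sum>x\<in>X. indet x * divmin x p) = p - single 0 (lookup p 0)"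
proof (rule pol_induct[where p = p and P = "\<lambda>p. (\<Sum>x\<in>X. indet x * divmin x p) = p - single 0 (lookup p 0)"])
  fix m c assume "m \<in> keys p"
  hence m: "m \<in> mons X" using assms by (auto simp: poly_ring_mons)
  show "(\<Sum>x\<in>X. indet x * divmin x (single m c)) = single m c - single 0 (lookup (single m c) 0)"
  proof (cases "m = 0")
    case True thus ?thesis by (simp add: divmin_def mmap_single)
  next
    case False
    hence "keys m \<noteq> {}" by (auto simp: poly_mapping_eq_iff fun_eq_iff in_keys_iff)
    then obtain x0 where "x0 \<in> keys m" "\<And>x. x \<in> X \<Longrightarrow> (x \<in> keys m \<and> (\<forall>z\<in>keys m. rk x \<le> rk z)) \<longleftrightarrow> x = x0"
      using min_var[of "keys m"] m by (auto simp: mons_def)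
    moreover have "x0 \<in> X" using calculation(1) m by (auto simp: mons_def)
    ultimately have "\<exists>x\<in>X. x \<in> keys m \<and> (\<forall>z\<in>keys m. rk x \<le> rk z)" by blast
    thus ?thesis using indet_divmin_single[OF m order_refl, of c] False
      by (simp add: lookup_single)
  qed
qed (simp_all add: divmin_def mmap_add distrib_left sum.distrib lookup_add single_add)

text \<open>A monomial that begins before \<open>y\<close> is recovered by the sum. For any other
  monomial \<open>y\<close> is the first variable of its product with \<open>y\<close>, and the last
  term recovers it. Exactly one of the two cases occurs.\<close>

lemma divmin_split:
  assumes "p \<in> poly_ring X" "y \<in> X"
  shows "(\<Sum>x\<in>{x \<in> X. rk x < rk y}. indet x * divmin x p) + divmin y (indet y * p) = p"
proof (rule pol_induct[where p = p and P = "\<lambda>p. (\<Sum>x\<in>{x \<in> X. rk x < rk y}. indet x * divmin x p) + divmin y (indet y * p) = p"])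
  fix m c assume "m \<in> keys p"
  hence m: "m \<in> mons X" using assms by (auto simp: poly_ring_mons)
  have dy: "divmin y (indet y * single m c) = (if \<forall>x\<in>keys m. rk y \<le> rk x then single m c else 0)"
    by (simp add: divmin_def indet_def mult_single mmap_single keys_add_nat)
  show "(\<Sum>x\<in>{x \<in> X. rk x < rk y}. indet x * divmin x (single m c)) + divmin y (indet y * single m c) = single m c"
  proof (cases "\<forall>x\<in>keys m. rk y \<le> rk x")
    case True
    hence "\<not> (\<exists>x\<in>{x \<in> X. rk x < rk y}. x \<in> keys m \<and> (\<forall>z\<in>keys m. rk x \<le> rk z))" by auto
    thus ?thesis using True dy indet_divmin_single[OF m, of "{x \<in> X. rk x < rk y}" c] by auto
  next
    case False
    then obtain z where z: "z \<in> keys m" "rk z < rk y" by (auto simp: not_le)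
    hence ne: "keys m \<noteq> {}" by blast
    have "keys m \<subseteq> X" using m by (simp add: mons_def)
    then obtain x0 where x0: "x0 \<in> keys m" "\<And>x. x \<in> X \<Longrightarrow> (x \<in> keys m \<and> (\<forall>z\<in>keys m. rk x \<le> rk z)) \<longleftrightarrow> x = x0"
      using min_var[OF ne] by blast
    have "x0 \<in> X" using x0(1) m by (auto simp: mons_def)
    hence "\<forall>z\<in>keys m. rk x0 \<le> rk z" using x0(2) by blast
    hence "\<exists>x\<in>{x \<in> X. rk x < rk y}. x \<in> keys m \<and> (\<forall>z\<in>keys m. rk x \<le> rk z)"
      using x0(1) \<open>x0 \<in> X\<close> z by (metis (mono_tags, lifting) le_less_trans mem_Collect_eq)
    thus ?thesis using False dy indet_divmin_single[OF m, of "{x \<in> X. rk x < rk y}" c] by auto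
  qed
qed (simp_all add: divmin_def mmap_add distrib_left sum.distrib lookup_add single_add algebra_simps)

text \<open>On a single term, the first variable \<open>y\<close> of the monomial moves into the
  index set if it precedes all elements of that set; otherwise the term is sent to zero. As
  \<open>y\<close> becomes the first element, no sign appears.\<close>

definition kcontract :: "('x set \<Rightarrow> ('x, 'k::field) pol) \<Rightarrow> 'x set \<Rightarrow> ('x, 'k) pol" where
  "kcontract v U = (if U \<noteq> {} \<and> U \<subseteq> X then divmin (arg_min_on rk U) (v (U - {arg_min_on rk U})) else 0)"

lemma arg_min_on_eq:
  assumes "y \<in> U" "U \<subseteq> X" "\<And>u. u \<in> U \<Longrightarrow> rk y \<le> rk u" shows "arg_min_on rk U = y"
proof -
  have "finite U" "U \<noteq> {}" using assms finite_sub by auto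
  from arg_min_if_finite[OF this, of rk] have "arg_min_on rk U \<in> U" "rk (arg_min_on rk U) \<le> rk y"
    using assms(1) by (auto simp: not_less)
  thus ?thesis using assms rk_inj by (meson antisym inj_onD subsetD)
qed

lemma kcontract_in:
  assumes "v \<in> kchain i" shows "kcontract v \<in> kchain (Suc i)"
proof -
  have "card U = Suc i" if "U \<noteq> {}" "U \<subseteq> X" "divmin (arg_min_on rk U) (v (U - {arg_min_on rk U})) \<noteq> 0" for U
  proof -
    have "v (U - {arg_min_on rk U}) \<noteq> 0" using that by (auto simp: divmin_def)
    hence "card (U - {arg_min_on rk U}) = i" using kchainD(2)[OF assms] by auto
    moreover have "arg_min_on rk U \<in> U" using arg_min_if_finite(1)[OF finite_sub] that by auto
    ultimately show ?thesis using finite_sub[OF that(2)] by (metis card.remove)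
  qed
  thus ?thesis using kchainD(1)[OF assms] by (auto simp: kchain_def kcontract_def intro: divmin_ring)
qed

lemma khom_kcontract: "khom c v \<Longrightarrow> khom (c - 1) (kcontract v)"
  by (auto simp: khom_def kcontract_def intro: divmin_homog)

lemma divmin_ksign: "divmin y (ksign x U * p) = ksign x U * divmin y p"
  by (simp add: divmin_def ksign_def mmap_sgn)

text \<open>Let \<open>y\<close> be the first element of \<open>U\<close> and
  \<open>V = U - {y}\<close>. Variables before \<open>y\<close> contribute the monomials of
  \<open>v U\<close> that begin before \<open>y\<close>. Variables after \<open>y\<close>
  contribute, up to sign, the part beginning with \<open>y\<close> of the coefficient of
  \<open>kbd v\<close> at \<open>V\<close>, except for the summand of \<open>y\<close> itself. That
  coefficient is zero, and \<open>divmin_split\<close> adds up what remains.\<close>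

lemma kcontract_homotopy_nonempty:
  fixes v :: "'x set \<Rightarrow> ('x, 'k::field) pol"
  assumes v: "v \<in> kchain i" and cyc: "\<And>U. kbd v U = 0" and U: "U \<noteq> {}" "U \<subseteq> X"
  shows "kbd (kcontract v) U = v U"
proof -
  define y where "y = arg_min_on rk U"
  have finU: "finite U" using U finite_sub by blast
  have y: "y \<in> U" "\<And>u. u \<in> U \<Longrightarrow> rk y \<le> rk u"
    using arg_min_if_finite[OF finU U(1), of rk] by (auto simp: not_less y_def)
  have yX: "y \<in> X" using y U by auto
  define V where "V = U - {y}"
  have UV: "U = insert y V" "y \<notin> V" using y by (auto simp: V_def)
  have finV: "finite V" using finU by (simp add: V_def)
  define L where "L = {x \<in> X. rk x < rk y}"
  define G where "G = {x \<in> X - U. rk y < rk x}"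
  have XU: "X - U = L \<union> G" unfolding L_def G_def
  proof (intro equalityI subsetI)
    fix x assume x: "x \<in> X - U"
    hence "rk x \<noteq> rk y" using rk_inj yX y(1) by (metis Diff_iff inj_onD)
    thus "x \<in> {x \<in> X. rk x < rk y} \<union> {x \<in> X - U. rk y < rk x}" using x by (cases "rk x < rk y") auto
  next
    fix x assume x: "x \<in> {x \<in> X. rk x < rk y} \<union> {x \<in> X - U. rk y < rk x}"
    thus "x \<in> X - U" using y(2)[of x] by (cases "x \<in> U") auto
  qed
  have dis: "L \<inter> G = {}" by (auto simp: L_def G_def)
  have fin: "finite L" "finite G" using finX by (auto simp: L_def G_def)
  have on_L: "ksign x U * (indet x * kcontract v (insert x U)) = indet x * divmin x (v U)" if xL: "x \<in> L" for x
  proof -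
    have that: "x \<in> X" "rk x < rk y" using xL by (auto simp: L_def)
    have "x \<notin> U" using that y(2) by (meson leD)
    have 1: "arg_min_on rk (insert x U) = x"
    proof (rule arg_min_on_eq)
      show "rk x \<le> rk u" if "u \<in> insert x U" for u using that \<open>rk x < rk y\<close> y(2)[of u] by auto
    qed (use that U in auto)
    have "{u \<in> U. rk u < rk x} = {}" using y(2) that by fastforce
    hence "(ksign x U :: ('x, 'k) pol) = 1" unfolding ksign_def by (simp only: card.empty power_0)
    thus ?thesis using 1 that U \<open>x \<notin> U\<close> by (simp add: kcontract_def)
  qed
  have on_G: "ksign x U * (indet x * kcontract v (insert x U)) = - divmin y (ksign x V * (indet x * v (insert x V)))"
    if xG: "x \<in> G" for x
  proof -
    have that: "x \<in> X - U" "rk y < rk x" using xG by (auto simp: G_def)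
    have 1: "arg_min_on rk (insert x U) = y"
    proof (rule arg_min_on_eq)
      show "rk y \<le> rk u" if "u \<in> insert x U" for u using that \<open>rk y < rk x\<close> y(2)[of u] by auto
    qed (use that U y in auto)
    have "insert x U - {y} = insert x V" using that UV by auto
    moreover have "ksign x U = - (ksign x V :: ('x, 'k) pol)" using that finV UV by (simp add: ksign_insert)
    ultimately show ?thesis using 1 that U divmin_indet_greater[of y x "v (insert x V)"]
      by (simp add: kcontract_def divmin_ksign)
  qed
  have "0 = divmin y (kbd v V)" using cyc by (simp add: divmin_def)
  also have "\<dots> = (\<Sum>x\<in>X - V. divmin y (ksign x V * (indet x * v (insert x V))))"
    by (simp add: kbd_def divmin_def mmap_sum)
  also have "X - V = insert y (X - U)" using UV yX by auto
  also have "(\<Sum>x\<in>insert y (X - U). divmin y (ksign x V * (indet x * v (insert x V)))) =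
      divmin y (ksign y V * (indet y * v U)) + (\<Sum>x\<in>X - U. divmin y (ksign x V * (indet x * v (insert x V))))"
  proof -
    have "finite (X - U)" "y \<notin> X - U" using finX y(1) by simp_all
    thus ?thesis by (simp add: UV(1)[symmetric])
  qed
  also have "(\<Sum>x\<in>X - U. divmin y (ksign x V * (indet x * v (insert x V)))) =
      (\<Sum>x\<in>L. divmin y (ksign x V * (indet x * v (insert x V)))) +
      (\<Sum>x\<in>G. divmin y (ksign x V * (indet x * v (insert x V))))"
    by (subst XU, rule sum.union_disjoint) (fact fin dis)+
  also have "(\<Sum>x\<in>L. divmin y (ksign x V * (indet x * v (insert x V)))) = 0"
    by (rule sum.neutral) (simp add: L_def divmin_ksign divmin_indet_less)
  finally have z: "(\<Sum>x\<in>G. divmin y (ksign x V * (indet x * v (insert x V)))) = - divmin y (ksign y V * (indet y * v U))"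
    by (simp add: eq_neg_iff_add_eq_0 add.commute)
  have "{u \<in> V. rk u < rk y} = {}" using y(2) UV by fastforce
  hence s1: "(ksign y V :: ('x, 'k) pol) = 1" unfolding ksign_def by (simp only: card.empty power_0)
  have "kbd (kcontract v) U = (\<Sum>x\<in>L. ksign x U * (indet x * kcontract v (insert x U))) +
      (\<Sum>x\<in>G. ksign x U * (indet x * kcontract v (insert x U)))"
    unfolding kbd_def by (subst XU, rule sum.union_disjoint) (fact fin dis)+
  also have "\<dots> = (\<Sum>x\<in>L. indet x * divmin x (v U)) + (\<Sum>x\<in>G. - divmin y (ksign x V * (indet x * v (insert x V))))"
    using on_L on_G by simp
  also have "\<dots> = (\<Sum>x\<in>L. indet x * divmin x (v U)) + divmin y (indet y * v U)"
    using z by (simp add: sum_negf s1)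
  also have "\<dots> = v U" using divmin_split[OF kchainD(1)[OF v] yX] by (simp only: L_def)
  finally show ?thesis .
qed

lemma kcontract_homotopy_empty:
  assumes v: "v \<in> kchain i"
  shows "kbd (kcontract v) {} = v {} - single 0 (lookup (v {}) 0)"
proof -
  have "ksign x {} * (indet x * kcontract v (insert x {})) = indet x * divmin x (v {})" if "x \<in> X" for x
  proof -
    have "arg_min_on rk {x} = x" by (rule arg_min_on_eq) (use that in auto)
    thus ?thesis using that by (simp add: kcontract_def ksign_def)
  qed
  thus ?thesis using divmin_total[OF kchainD(1)[OF v]] by (simp add: kbd_def)
qed

text \<open>Exactness with an explicit preimage, whose degrees are known from
  \<open>kcontract_in\<close> and \<open>khom_kcontract\<close>. In homological degree 0 the
  constant term is the obstruction, hence the condition there.\<close>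

lemma kbd_exact:
  assumes v: "v \<in> kchain i" and cyc: "\<And>U. kbd v U = 0" and aug: "i = 0 \<Longrightarrow> lookup (v {}) 0 = 0"
  shows "kbd (kcontract v) = v"
proof
  fix U
  consider "U \<noteq> {}" "U \<subseteq> X" | "U = {}" | "\<not> U \<subseteq> X" by blast
  thus "kbd (kcontract v) U = v U"
  proof cases
    case 1 thus ?thesis using kcontract_homotopy_nonempty[OF v cyc] by blast
  next
    case 2
    have "lookup (v {}) 0 = 0" using aug kchain_0[OF v, of "{}"] by (cases "i = 0") auto
    thus ?thesis using 2 kcontract_homotopy_empty[OF v] by simp
  next
    case 3
    have "kbd (kcontract v) \<in> kchain i" by (intro kbd_in kcontract_in v)
    from kchain_0[OF this, of U] kchain_0[OF v, of U] 3 show ?thesis by simp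
  qed
qed

end

section \<open>Vanishing of graded Tor modules of quotients\<close>

context koszul
begin

text \<open>\<open>tor_vanish i c J\<close> says that \<open>Tor\<^sub>i(\<K>, S/J)\<close> is zero in degree \<open>i + c\<close>, and
  \<open>quot_reg r J\<close> that the regularity of \<open>S/J\<close> is at most \<open>r\<close>.\<close>

definition tor_vanish :: "nat \<Rightarrow> int \<Rightarrow> ('x, 'k::field) pol set \<Rightarrow> bool" where
  "tor_vanish i c J \<longleftrightarrow> (\<forall>v\<in>kchain i. khom c v \<longrightarrow> (\<forall>W. kbd v W \<in> J) \<longrightarrow>
     (\<exists>u\<in>kchain (Suc i). khom (c - 1) u \<and> (\<forall>W. v W - kbd u W \<in> J)))"

definition quot_reg :: "nat \<Rightarrow> ('x, 'k::field) pol set \<Rightarrow> bool" where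
  "quot_reg r J \<longleftrightarrow> (\<forall>i c. int r < c \<longrightarrow> tor_vanish i c J)"

lemma quot_reg_mono: "quot_reg r J \<Longrightarrow> r \<le> s \<Longrightarrow> quot_reg s J"
  by (auto simp: quot_reg_def)

text \<open>Labels for the sum of the ideal and \<open>(x)\<close>: a fibre that contains a multiple
  of \<open>x\<close> becomes zero.\<close>

definition kill :: "'x \<Rightarrow> (('x \<Rightarrow>\<^sub>0 nat) \<Rightarrow> 'b option) \<Rightarrow> ('x \<Rightarrow>\<^sub>0 nat) \<Rightarrow> 'b option" where
  "kill x \<mu> m = (if \<exists>n\<in>mons X. \<mu> (n + single x (Suc 0)) = \<mu> m then None else \<mu> m)"

text \<open>Labels for the colon ideal by \<open>x\<close>.\<close>

definition shift :: "'x \<Rightarrow> (('x \<Rightarrow>\<^sub>0 nat) \<Rightarrow> 'b option) \<Rightarrow> ('x \<Rightarrow>\<^sub>0 nat) \<Rightarrow> 'b option" where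
  "shift x \<mu> m = \<mu> (m + single x (Suc 0))"

text \<open>A chosen division by \<open>x\<close> modulo the ideal, available on the non-zero fibres
  that contain a multiple of \<open>x\<close>.\<close>

definition quot_mon :: "'x \<Rightarrow> (('x \<Rightarrow>\<^sub>0 nat) \<Rightarrow> 'b option) \<Rightarrow> ('x \<Rightarrow>\<^sub>0 nat) \<Rightarrow> ('x \<Rightarrow>\<^sub>0 nat) option" where
  "quot_mon x \<mu> m = (if \<mu> m \<noteq> None \<and> (\<exists>n\<in>mons X. \<mu> (n + single x (Suc 0)) = \<mu> m)
     then Some (SOME n. n \<in> mons X \<and> \<mu> (n + single x (Suc 0)) = \<mu> m) else None)"

lemma quot_mon_SomeD:
  assumes "quot_mon x \<mu> m = Some n"
  shows "n \<in> mons X" "\<mu> (n + single x (Suc 0)) = \<mu> m" "\<mu> m \<noteq> None"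
proof -
  let ?P = "\<lambda>n. n \<in> mons X \<and> \<mu> (n + single x (Suc 0)) = \<mu> m"
  have "Ex ?P" and n: "n = (SOME n. ?P n)" and "\<mu> m \<noteq> None"
    using assms by (auto simp: quot_mon_def split: if_splits)
  from someI_ex[OF this(1)] n show "n \<in> mons X" "\<mu> (n + single x (Suc 0)) = \<mu> m" by simp_all
  show "\<mu> m \<noteq> None" by fact
qed

text \<open>Subtracting \<open>x\<close> times the chosen quotients empties exactly the fibres that
  \<open>kill\<close> deletes and leaves the other fibre sums alone. Hence an element of the ideal
  for \<open>kill\<close> is divisible by \<open>x\<close> modulo the ideal for
  \<open>\<mu>\<close>.\<close>

lemma fsum_kill:
  "fsum \<mu> b (p - indet x * mmap (quot_mon x \<mu>) p) = fsum (kill x \<mu>) b p"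
proof (induction p rule: pol_induct)
  case (single m c)
  show ?case
  proof (cases "quot_mon x \<mu> m")
    case None
    hence "\<mu> m = None \<or> \<not> (\<exists>n\<in>mons X. \<mu> (n + single x (Suc 0)) = \<mu> m)"
      by (auto simp: quot_mon_def split: if_splits)
    hence "(kill x \<mu> m = Some b) = (\<mu> m = Some b)" by (auto simp: kill_def)
    thus ?thesis using None by (simp add: mmap_single fsum_single)
  next
    case (Some n)
    note n = quot_mon_SomeD[OF Some]
    have "kill x \<mu> m = None" using n unfolding kill_def by auto
    thus ?thesis using Some n(2)
      by (simp add: mmap_single fsum_single fsum_diff fsum_indet)
  qed
next
  case (add p q)
  have "p + q - indet x * mmap (quot_mon x \<mu>) (p + q) =
      (p - indet x * mmap (quot_mon x \<mu>) p) + (q - indet x * mmap (quot_mon x \<mu>) q)"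
    by (simp add: mmap_add algebra_simps)
  thus ?case using add by (simp only: fsum_add)
qed simp

lemma quot_mon_ring: "mmap (quot_mon x \<mu>) p \<in> poly_ring X"
  using keys_mmap[of "quot_mon x \<mu>" p] quot_mon_SomeD(1)[of x \<mu>]
  by (fastforce simp: poly_ring_mons)

lemma quot_mon_homog:
  assumes \<mu>: "graded_fibres X \<mu>" and x: "x \<in> X" and p: "p \<in> poly_ring X" "homog c p"
  shows "homog (c - 1) (mmap (quot_mon x \<mu>) p)"
  unfolding homog_def
proof
  fix n assume "n \<in> keys (mmap (quot_mon x \<mu>) p)"
  then obtain m where m: "m \<in> keys p" "quot_mon x \<mu> m = Some n"
    using keys_mmap[of "quot_mon x \<mu>" p] by blast
  note n = quot_mon_SomeD[OF m(2)]
  have "m \<in> mons X" using p m by (auto simp: poly_ring_mons)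
  moreover have "n + single x (Suc 0) \<in> mons X" using n x by simp
  ultimately have "total_deg (n + single x (Suc 0)) = total_deg m"
    using \<mu> n unfolding graded_fibres_def by metis
  moreover have "int (total_deg m) = c" using p m by (auto simp: homog_def)
  ultimately show "int (total_deg n) = c - 1" by simp
qed

lemma fibre_ideal_kill: "fibre_ideal X \<mu> \<subseteq> fibre_ideal X (kill x \<mu>)"
  by (rule fibre_ideal_mono) (auto simp: kill_def)

text \<open>A cycle modulo the ideal is also one modulo the sum with \<open>(x)\<close>, where it
  bounds by hypothesis; \<open>fsum_kill\<close> writes the rest as \<open>x\<close> times a chain
  \<open>w\<close>. Comparing boundaries puts \<open>x\<close> times the boundary of
  \<open>w\<close> into the ideal. Both regularity lemmas below start from here.\<close>

lemma kill_decompose: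
  fixes v :: "'x set \<Rightarrow> ('x, 'k::field) pol"
  assumes \<mu>: "graded_fibres X \<mu>" and x: "x \<in> X"
    and reg: "tor_vanish i c (fibre_ideal X (kill x \<mu>) :: ('x, 'k) pol set)"
    and v: "v \<in> kchain i" "khom c v" "\<And>W. kbd v W \<in> fibre_ideal X \<mu>"
  obtains u w where "u \<in> kchain (Suc i)" "khom (c - 1) u" "w \<in> kchain i" "khom (c - 1) w"
    "\<And>W. v W - kbd u W - indet x * w W \<in> fibre_ideal X \<mu>"
    "\<And>W. indet x * kbd w W \<in> fibre_ideal X \<mu>"
proof -
  let ?J = "fibre_ideal X \<mu> :: ('x, 'k) pol set"
  have J: "ring_ideal X ?J" using \<mu> by (rule ring_ideal_fibre)
  have "\<forall>W. kbd v W \<in> fibre_ideal X (kill x \<mu>)" using v(3) fibre_ideal_kill[of \<mu> x] by blast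
  then obtain u where u: "u \<in> kchain (Suc i)" "khom (c - 1) u"
      "\<And>W. v W - kbd u W \<in> fibre_ideal X (kill x \<mu>)"
    using reg v unfolding tor_vanish_def by blast
  define a where "a = (\<lambda>W. v W - kbd u W)"
  have a: "a \<in> kchain i" "khom c a"
    unfolding a_def using khom_diff[OF v(2), of "kbd u"] khom_kbd[OF u(2)] kchain_diff[OF v(1) kbd_in[OF u(1)]]
    by simp_all
  define w where "w = (\<lambda>W. mmap (quot_mon x \<mu>) (a W))"
  have w: "w \<in> kchain i"
    unfolding w_def by (rule kchainI) (auto simp: quot_mon_ring kchain_0[OF a(1)])
  have w': "khom (c - 1) w"
    using quot_mon_homog[OF \<mu> x kchainD(1)[OF a(1)]] a(2) by (auto simp: khom_def w_def)
  have b: "a W - indet x * w W \<in> ?J" for W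
  proof -
    have "fsum \<mu> b (a W - indet x * w W) = 0" for b
      using u(3)[of W] unfolding w_def fsum_kill by (simp add: fibre_ideal_def a_def)
    moreover have "a W - indet x * w W \<in> poly_ring X"
      by (intro poly_ring_minus poly_ring_mult poly_ring_indet x kchainD(1)[OF a(1)] kchainD(1)[OF w])
    ultimately show ?thesis by (simp add: fibre_ideal_def)
  qed
  have "indet x * kbd w W = kbd v W - kbd (\<lambda>W. a W - indet x * w W) W" for W
    by (simp add: kbd_diff kbd_mult a_def kbd_kbd[OF u(1)])
  hence "indet x * kbd w W \<in> ?J" for W
    using ring_ideal_minus[OF J v(3) kbd_ideal[OF J b]] by simp
  thus ?thesis using that[OF u(1,2) w w'] b by (simp add: a_def)
qed

text \<open>The exact sequence of \<open>S/(J : x)\<close>, shifted by one, \<open>S/J\<close> and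
  \<open>S/(J + (x))\<close>, chased by hand: \<open>w\<close> is a cycle modulo
  \<open>J : x\<close> of coefficient degree \<open>c - 1\<close>, so it bounds there, and
  \<open>x\<close> times its preimage corrects \<open>u\<close>.\<close>

lemma quot_reg_colon:
  assumes \<mu>: "graded_fibres X \<mu>" and x: "x \<in> X"
    and kill: "quot_reg (Suc r) (fibre_ideal X (kill x \<mu>) :: ('x, 'k::field) pol set)"
    and shift: "quot_reg r (fibre_ideal X (shift x \<mu>) :: ('x, 'k) pol set)"
  shows "quot_reg (Suc r) (fibre_ideal X \<mu> :: ('x, 'k) pol set)"
  unfolding quot_reg_def
proof (intro allI impI)
  fix i and c :: int assume c: "int (Suc r) < c"
  let ?J = "fibre_ideal X \<mu> :: ('x, 'k) pol set" and ?Q = "fibre_ideal X (shift x \<mu>) :: ('x, 'k) pol set"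
  have J: "ring_ideal X ?J" using \<mu> by (rule ring_ideal_fibre)
  have QJ: "indet x * p \<in> ?J \<longleftrightarrow> p \<in> ?Q" if "p \<in> poly_ring X" for p
    using that poly_ring_mult[OF poly_ring_indet[OF x] that]
    by (simp add: fibre_ideal_def fsum_indet shift_def[abs_def])
  show "tor_vanish i c ?J" unfolding tor_vanish_def
  proof (intro ballI impI)
    fix v :: "'x set \<Rightarrow> ('x, 'k) pol"
    assume v: "v \<in> kchain i" "khom c v" "\<forall>W. kbd v W \<in> ?J"
    have "tor_vanish i c (fibre_ideal X (kill x \<mu>) :: ('x, 'k) pol set)"
      using kill c by (simp add: quot_reg_def)
    then obtain u w where u: "u \<in> kchain (Suc i)" "khom (c - 1) u"
      and w: "w \<in> kchain i" "khom (c - 1) w"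
        "\<And>W. v W - kbd u W - indet x * w W \<in> ?J" "\<And>W. indet x * kbd w W \<in> ?J"
      using kill_decompose[OF \<mu> x _ v(1,2)] v(3) by blast
    have "\<forall>W. kbd w W \<in> ?Q" using w(4) QJ kchainD(1)[OF kbd_pred_in[OF w(1)]] by blast
    moreover have "tor_vanish i (c - 1) ?Q" using shift c by (simp add: quot_reg_def)
    ultimately obtain u' where u': "u' \<in> kchain (Suc i)" "khom (c - 1 - 1) u'" "\<And>W. w W - kbd u' W \<in> ?Q"
      using w(1,2) unfolding tor_vanish_def by blast
    let ?u = "\<lambda>W. u W + indet x * u' W"
    have "?u \<in> kchain (Suc i)"
      by (intro kchain_add kchain_mult u u' poly_ring_indet x)
    moreover have "khom (c - 1) ?u"
    proof (rule khom_add[OF u(2)])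
      show "khom (c - 1) (\<lambda>W. indet x * u' W)"
        using homog_mult[OF homog_indet, of "c - 1 - 1" "u' W" x for W] u'(2) by (simp add: khom_def)
    qed
    moreover have "v W - kbd ?u W \<in> ?J" for W
    proof -
      have "w W - kbd u' W \<in> poly_ring X" using u'(3) by (auto simp: fibre_ideal_def)
      hence "indet x * (w W - kbd u' W) \<in> ?J" using QJ u'(3) by blast
      from ring_ideal_add[OF J w(3)[of W] this] show ?thesis
        by (simp add: kbd_add kbd_mult algebra_simps)
    qed
    ultimately show "\<exists>u\<in>kchain (Suc i). khom (c - 1) u \<and> (\<forall>W. v W - kbd u W \<in> ?J)" by blast
  qed
qed

text \<open>The last hypothesis says that \<open>x\<close> is a non-zero-divisor modulo the ideal.
  Then \<open>w\<close> is itself a cycle modulo the ideal, and \<open>x w\<close> bounds by the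
  wedge homotopy, so the regularity does not grow.\<close>

lemma quot_reg_regular:
  assumes \<mu>: "graded_fibres X \<mu>" and x: "x \<in> X"
    and kill: "quot_reg r (fibre_ideal X (kill x \<mu>) :: ('x, 'k::field) pol set)"
    and reg: "fibre_ideal X (shift x \<mu>) \<subseteq> (fibre_ideal X \<mu> :: ('x, 'k) pol set)"
  shows "quot_reg r (fibre_ideal X \<mu> :: ('x, 'k) pol set)"
  unfolding quot_reg_def
proof (intro allI impI)
  fix i and c :: int assume c: "int r < c"
  let ?J = "fibre_ideal X \<mu> :: ('x, 'k) pol set"
  have J: "ring_ideal X ?J" using \<mu> by (rule ring_ideal_fibre)
  show "tor_vanish i c ?J" unfolding tor_vanish_def
  proof (intro ballI impI)
    fix v :: "'x set \<Rightarrow> ('x, 'k) pol"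
    assume v: "v \<in> kchain i" "khom c v" "\<forall>W. kbd v W \<in> ?J"
    have "tor_vanish i c (fibre_ideal X (kill x \<mu>) :: ('x, 'k) pol set)"
      using kill c by (simp add: quot_reg_def)
    then obtain u w where u: "u \<in> kchain (Suc i)" "khom (c - 1) u"
      and w: "w \<in> kchain i" "khom (c - 1) w"
        "\<And>W. v W - kbd u W - indet x * w W \<in> ?J" "\<And>W. indet x * kbd w W \<in> ?J"
      using kill_decompose[OF \<mu> x _ v(1,2)] v(3) by blast
    have dw: "kbd w W \<in> ?J" for W
    proof -
      have "kbd w W \<in> poly_ring X" using kchainD(1)[OF kbd_pred_in[OF w(1)]] .
      hence "kbd w W \<in> fibre_ideal X (shift x \<mu>)" using w(4)[of W]
        by (simp add: fibre_ideal_def fsum_indet shift_def[abs_def])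
      thus ?thesis using reg by blast
    qed
    let ?u = "\<lambda>W. u W + kwedge x w W"
    have "?u \<in> kchain (Suc i)" by (intro kchain_add u kwedge_in w x)
    moreover have "khom (c - 1) ?u" by (intro khom_add u khom_kwedge w)
    moreover have "v W - kbd ?u W \<in> ?J" for W
    proof -
      have "v W - kbd ?u W = (v W - kbd u W - indet x * w W) + kwedge x (kbd w) W"
        using kwedge_homotopy[OF w(1) x, of W] by (simp add: kbd_add algebra_simps)
      moreover have "kwedge x (kbd w) W \<in> ?J" by (rule kwedge_ideal[OF J]) (rule dw)
      ultimately show ?thesis using ring_ideal_add[OF J w(3)] by metis
    qed
    ultimately show "\<exists>u\<in>kchain (Suc i). khom (c - 1) u \<and> (\<forall>W. v W - kbd u W \<in> ?J)" by blast
  qed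
qed

text \<open>All coefficients of degree above \<open>r\<close> lie in the ideal, so the zero chain
  serves as preimage.\<close>

lemma quot_reg_artinian:
  assumes "\<And>m. m \<in> mons X \<Longrightarrow> r < total_deg m \<Longrightarrow> \<mu> m = None"
  shows "quot_reg r (fibre_ideal X \<mu> :: ('x, 'k::field) pol set)"
proof -
  have "\<exists>u\<in>kchain (Suc i). khom (c - 1) u \<and> (\<forall>W. v W - kbd u W \<in> fibre_ideal X \<mu>)"
    if "int r < c" "v \<in> kchain i" "khom c v" for i c and v :: "'x set \<Rightarrow> ('x, 'k) pol"
  proof -
    have "fsum \<mu> b (v W) = 0" for b W
    proof (rule fsum_eq_0I)
      fix m assume m: "m \<in> keys (v W)"
      hence "m \<in> mons X" using kchainD(1)[OF that(2)] by (auto simp: poly_ring_mons)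
      moreover have "int (total_deg m) = c" using that(3) m unfolding khom_def homog_def by blast
      hence "r < total_deg m" using that(1) by simp
      ultimately show "\<mu> m \<noteq> Some b" using assms by simp
    qed
    hence "\<forall>W. v W - kbd (\<lambda>_. 0) W \<in> fibre_ideal X \<mu>"
      using kchainD(1)[OF that(2)] by (simp add: fibre_ideal_def)
    moreover have "(\<lambda>_. 0) \<in> kchain (Suc i)" "khom (c - 1) (\<lambda>_. 0)" by (auto simp: kchain_def khom_def)
    ultimately show ?thesis by blast
  qed
  thus ?thesis unfolding quot_reg_def tor_vanish_def by blast
qed

subsection \<open>Monomial ideals\<close>

text \<open>The ideal generated by the variables in \<open>A\<close> and by the product of the
  variables in \<open>B\<close>. A non-empty \<open>B\<close> inside \<open>A\<close> gives the
  ideals generated by variables alone.\<close>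

definition mon_ideal :: "'x set \<Rightarrow> 'x set \<Rightarrow> ('x \<Rightarrow>\<^sub>0 nat) \<Rightarrow> ('x \<Rightarrow>\<^sub>0 nat) option" where
  "mon_ideal A B m = (if keys m \<inter> A \<noteq> {} \<or> B \<subseteq> keys m then None else Some m)"

lemma mon_ideal_None: "mon_ideal A B m = None \<longleftrightarrow> keys m \<inter> A \<noteq> {} \<or> B \<subseteq> keys m"
  by (auto simp: mon_ideal_def)

lemma mon_ideal_eq: "mon_ideal A B m = mon_ideal A B m' \<longleftrightarrow>
   (mon_ideal A B m = None \<and> mon_ideal A B m' = None) \<or> (mon_ideal A B m \<noteq> None \<and> m = m')"
  by (auto simp: mon_ideal_def)

lemma mon_ideal_add: "mon_ideal A B m = None \<Longrightarrow> mon_ideal A B (m + n) = None"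
  by (auto simp: mon_ideal_None keys_add_nat)

lemma graded_mon_ideal: "graded_fibres X (mon_ideal A B)"
proof -
  have "mon_ideal A B (m + n) = mon_ideal A B (m' + n)" if "mon_ideal A B m = mon_ideal A B m'" for m m' n
    using that mon_ideal_add[of A B m n] mon_ideal_add[of A B m' n] unfolding mon_ideal_eq[of A B m m'] by auto
  thus ?thesis unfolding graded_fibres_def by (auto simp: mon_ideal_add mon_ideal_eq)
qed

lemma kill_mon_ideal:
  assumes "m \<in> mons X"
  shows "kill x (mon_ideal A B) m = (if x \<in> keys m then None else mon_ideal A B m)"
proof (cases "mon_ideal A B m = None")
  case True
  hence "mon_ideal A B (m + single x (Suc 0)) = mon_ideal A B m" by (simp add: mon_ideal_add)
  thus ?thesis using True assms unfolding kill_def by auto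
next
  case False
  have "(\<exists>n\<in>mons X. mon_ideal A B (n + single x (Suc 0)) = mon_ideal A B m) \<longleftrightarrow> x \<in> keys m"
  proof
    assume "x \<in> keys m"
    have "m - single x (Suc 0) \<in> mons X"
      using assms mon_minus_single[OF \<open>x \<in> keys m\<close>] mons_add by metis
    thus "\<exists>n\<in>mons X. mon_ideal A B (n + single x (Suc 0)) = mon_ideal A B m"
      using mon_minus_single[OF \<open>x \<in> keys m\<close>] by metis
  next
    assume "\<exists>n\<in>mons X. mon_ideal A B (n + single x (Suc 0)) = mon_ideal A B m"
    then obtain n where "mon_ideal A B (n + single x (Suc 0)) = mon_ideal A B m" by blast
    hence "n + single x (Suc 0) = m" using False by (metis mon_ideal_eq)
    thus "x \<in> keys m" by (auto simp: keys_add_nat)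
  qed
  thus ?thesis unfolding kill_def by auto
qed

lemma fibre_ideal_cong:
  "(\<And>m. m \<in> mons X \<Longrightarrow> \<mu> m = \<nu> m) \<Longrightarrow> fibre_ideal X \<mu> = fibre_ideal X \<nu>"
  by (rule fibre_ideal_eqI) simp_all

text \<open>Every variable outside \<open>A\<close> is regular modulo the ideal. Adjoining them one
  after the other ends at the maximal ideal, whose quotient lives in degree 0.\<close>

lemma quot_reg_variables:
  assumes "B \<subseteq> A" "B \<noteq> {}" "A \<subseteq> X"
  shows "quot_reg 0 (fibre_ideal X (mon_ideal A B) :: ('x, 'k::field) pol set)"
  using assms(1,3)
proof (induction "card (X - A)" arbitrary: A)
  case 0
  hence "A = X" using finX by auto
  show ?case
  proof (rule quot_reg_artinian)
    fix m :: "'x \<Rightarrow>\<^sub>0 nat" assume m: "m \<in> mons X" "0 < total_deg m"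
    hence "m \<noteq> 0" by auto
    hence "keys m \<noteq> {}" by (auto simp: poly_mapping_eq_iff fun_eq_iff in_keys_iff)
    hence "keys m \<inter> A \<noteq> {}" using m(1) \<open>A = X\<close> unfolding mons_def by blast
    thus "mon_ideal A B m = None" by (simp add: mon_ideal_None)
  qed
next
  case (Suc k)
  have "X - A \<noteq> {}" using Suc(2) by (metis card.empty nat.simps(3))
  then obtain x where x: "x \<in> X - A" by blast
  have k: "k = card (X - insert x A)"
  proof -
    have eq: "X - A = insert x (X - insert x A)" using x by blast
    have "card (X - A) = Suc (card (X - insert x A))"
      by (subst eq, rule card_insert_disjoint) (use finX in auto)
    thus ?thesis using Suc(2) by simp
  qed
  have BA: "mon_ideal A B m = None \<longleftrightarrow> keys m \<inter> A \<noteq> {}" for m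
    using assms(2) Suc.prems by (auto simp: mon_ideal_None)
  have K: "fibre_ideal X (kill x (mon_ideal A B)) = (fibre_ideal X (mon_ideal (insert x A) B) :: ('x, 'k) pol set)"
    by (rule fibre_ideal_cong) (simp add: kill_mon_ideal mon_ideal_def Int_insert_right)
  have Q: "quot_reg 0 (fibre_ideal X (mon_ideal (insert x A) B) :: ('x, 'k) pol set)"
    using k Suc(1)[OF k] Suc.prems x by auto
  have S: "fibre_ideal X (shift x (mon_ideal A B)) \<subseteq> (fibre_ideal X (mon_ideal A B) :: ('x, 'k) pol set)"
  proof (rule fibre_ideal_mono)
    have N: "mon_ideal A B (m + single x (Suc 0)) = None \<longleftrightarrow> mon_ideal A B m = None" for m
      using x unfolding BA by (auto simp: keys_add_nat)
    show "mon_ideal A B m = None" if "shift x (mon_ideal A B) m = None" for m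
      using that N by (simp add: shift_def)
    show "mon_ideal A B m = mon_ideal A B m'" if "shift x (mon_ideal A B) m = shift x (mon_ideal A B) m'" for m m'
      using that N unfolding shift_def mon_ideal_eq[of A B m m']
        mon_ideal_eq[of A B "m + single x (Suc 0)" "m' + single x (Suc 0)"] by simp
  qed
  have "x \<in> X" using x by blast
  show ?case
    by (rule quot_reg_regular[OF graded_mon_ideal \<open>x \<in> X\<close> _ S]) (simp only: K Q)
qed

text \<open>For \<open>y\<close> in \<open>B\<close>, adjoining \<open>y\<close> leaves an ideal of
  variables, of regularity 0, and the colon by \<open>y\<close> removes \<open>y\<close> from the
  product. Each step of the induction raises the bound by one.\<close>

lemma quot_reg_mon_ideal:
  assumes "finite B" "B \<noteq> {}" "B \<subseteq> X" "A \<subseteq> X" "A \<inter> B = {}"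
  shows "quot_reg (card B - 1) (fibre_ideal X (mon_ideal A B) :: ('x, 'k::field) pol set)"
  using assms
proof (induction B rule: finite_ne_induct)
  case (singleton y)
  have "mon_ideal A {y} = mon_ideal (insert y A) {y}" by (auto simp: mon_ideal_def fun_eq_iff)
  thus ?case using quot_reg_variables[of "{y}" "insert y A"] singleton by simp
next
  case (insert y B)
  have kill: "fibre_ideal X (kill y (mon_ideal A (insert y B))) = (fibre_ideal X (mon_ideal (insert y A) {y}) :: ('x, 'k) pol set)"
    by (rule fibre_ideal_cong) (simp add: kill_mon_ideal mon_ideal_def Int_insert_right)
  have "quot_reg 0 (fibre_ideal X (mon_ideal (insert y A) {y}) :: ('x, 'k) pol set)"
    using insert.prems by (intro quot_reg_variables) auto
  hence 1: "quot_reg (Suc (card B - 1)) (fibre_ideal X (kill y (mon_ideal A (insert y B))) :: ('x, 'k) pol set)"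
    unfolding kill by (rule quot_reg_mono) simp
  have shift: "fibre_ideal X (shift y (mon_ideal A (insert y B))) = (fibre_ideal X (mon_ideal A B) :: ('x, 'k) pol set)"
  proof (rule fibre_ideal_eqI)
    have N: "mon_ideal A (insert y B) (m + single y (Suc 0)) = None \<longleftrightarrow> mon_ideal A B m = None" for m
      using insert.prems insert.hyps by (auto simp: mon_ideal_None keys_add_nat)
    show "shift y (mon_ideal A (insert y B)) m = None \<longleftrightarrow> mon_ideal A B m = None" for m
      using N by (simp add: shift_def)
    show "(shift y (mon_ideal A (insert y B)) m = shift y (mon_ideal A (insert y B)) m') = (mon_ideal A B m = mon_ideal A B m')" for m m'
      using N unfolding shift_def mon_ideal_eq[of A B m m']
        mon_ideal_eq[of A "insert y B" "m + single y (Suc 0)" "m' + single y (Suc 0)"] by simp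
  qed
  have "quot_reg (card B - 1) (fibre_ideal X (mon_ideal A B) :: ('x, 'k) pol set)"
    using insert.IH insert.prems by blast
  hence 2: "quot_reg (card B - 1) (fibre_ideal X (shift y (mon_ideal A (insert y B))) :: ('x, 'k) pol set)"
    unfolding shift .
  have "y \<in> X" using insert.prems by blast
  from quot_reg_colon[OF graded_mon_ideal this 1 2]
  have "quot_reg (Suc (card B - 1)) (fibre_ideal X (mon_ideal A (insert y B)) :: ('x, 'k) pol set)" .
  moreover have "card (insert y B) - 1 = Suc (card B - 1)" using insert.hyps card_gt_0_iff[of B] by simp
  ultimately show ?case by (simp only:)
qed

end

section \<open>Regularity of the two kinds of toric ideals that occur\<close>

context koszul
begin

lemma mons_diff: "m \<in> mons X \<Longrightarrow> (m - n :: 'x \<Rightarrow>\<^sub>0 nat) \<in> mons X"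
  by (auto simp: mons_def in_keys_iff lookup_minus subset_iff)

text \<open>The toric ideal of a lattice spanned by the difference of two coprime square-free monomials.\<close>

lemma quot_reg_binomial:
  fixes \<mu> :: "('x \<Rightarrow>\<^sub>0 nat) \<Rightarrow> 'b option"
  assumes X: "X = E \<union> F" "E \<inter> F = {}" "E \<noteq> {}" "card E = card F"
    and not_None: "\<And>m. m \<in> mons X \<Longrightarrow> \<mu> m \<noteq> None"
    and fibre: "\<And>m m'. m \<in> mons X \<Longrightarrow> m' \<in> mons X \<Longrightarrow> \<mu> m = \<mu> m' \<longleftrightarrow>
      (\<exists>k::int. (\<forall>e\<in>E. int (lookup m' e) = int (lookup m e) + k) \<and> (\<forall>f\<in>F. int (lookup m' f) = int (lookup m f) - k))"
  shows "quot_reg (card F - 1) (fibre_ideal X \<mu> :: ('x, 'k::field) pol set)"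
proof -
  have fin: "finite E" "finite F" using finX X by auto
  have "F \<noteq> {}" using X fin by auto
  obtain x where x: "x \<in> E" using X by blast
  have xX: "x \<in> X" using x X by blast
  have deg: "int (total_deg m) = (\<Sum>e\<in>E. int (lookup m e)) + (\<Sum>f\<in>F. int (lookup m f))" if "m \<in> mons X" for m
  proof -
    have "total_deg m = (\<Sum>x\<in>E \<union> F. lookup m x)"
      using that X fin by (intro total_deg_superset) (auto simp: mons_def)
    thus ?thesis using X(2) fin by (simp add: sum.union_disjoint)
  qed
  have graded: "graded_fibres X \<mu>"
    unfolding graded_fibres_def
  proof (intro conjI ballI impI)
    fix m m' n assume mm: "m \<in> mons X" "m' \<in> mons X" "n \<in> mons X" and "\<mu> m = \<mu> m'"
    then obtain k :: int where "\<forall>e\<in>E. int (lookup m' e) = int (lookup m e) + k" "\<forall>f\<in>F. int (lookup m' f) = int (lookup m f) - k"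
      using fibre by blast
    hence "\<exists>k::int. (\<forall>e\<in>E. int (lookup (m' + n) e) = int (lookup (m + n) e) + k) \<and> (\<forall>f\<in>F. int (lookup (m' + n) f) = int (lookup (m + n) f) - k)"
      by (intro exI[of _ k]) (simp add: lookup_add)
    thus "\<mu> (m + n) = \<mu> (m' + n)" using fibre[of "m + n" "m' + n"] mm by simp
  next
    fix m m' assume mm: "m \<in> mons X" "m' \<in> mons X" and "\<mu> m = \<mu> m'"
    then obtain k :: int where "\<forall>e\<in>E. int (lookup m' e) = int (lookup m e) + k" "\<forall>f\<in>F. int (lookup m' f) = int (lookup m f) - k"
      using fibre by blast
    hence "int (total_deg m') = int (total_deg m)"
      using X(4) by (simp add: deg mm sum.distrib sum_subtractf)
    thus "total_deg m = total_deg m'" by simp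
  qed (use not_None in blast)
  \<comment> \<open>A monomial is congruent to a multiple of \<open>x\<close> exactly if it contains
    \<open>x\<close> or the whole product over \<open>F\<close>, which can be exchanged for the
    product over \<open>E\<close>.\<close>
  have cond: "(\<exists>n\<in>mons X. \<mu> (n + single x (Suc 0)) = \<mu> m) \<longleftrightarrow> x \<in> keys m \<or> F \<subseteq> keys m" if m: "m \<in> mons X" for m
  proof
    assume "\<exists>n\<in>mons X. \<mu> (n + single x (Suc 0)) = \<mu> m"
    then obtain n where n: "n \<in> mons X" "\<mu> (n + single x (Suc 0)) = \<mu> m" by blast
    hence "n + single x (Suc 0) \<in> mons X" using xX by simp
    then obtain k :: int where k: "\<forall>e\<in>E. int (lookup m e) = int (lookup (n + single x (Suc 0)) e) + k"
        "\<forall>f\<in>F. int (lookup m f) = int (lookup (n + single x (Suc 0)) f) - k"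
      using n fibre m by blast
    show "x \<in> keys m \<or> F \<subseteq> keys m"
    proof (cases "k \<ge> 0")
      case True
      have "int (lookup m x) > 0" using k(1) x True by (simp add: lookup_add)
      thus ?thesis by (simp add: in_keys_iff)
    next
      case False
      have "lookup m f \<noteq> 0" if "f \<in> F" for f
      proof -
        have "int (lookup m f) > 0" using k(2) that False by simp
        thus ?thesis by simp
      qed
      thus ?thesis by (auto simp: in_keys_iff)
    qed
  next
    assume "x \<in> keys m \<or> F \<subseteq> keys m"
    thus "\<exists>n\<in>mons X. \<mu> (n + single x (Suc 0)) = \<mu> m"
    proof
      assume "x \<in> keys m"
      thus ?thesis using mon_minus_single[of x m] mons_diff[OF m, of "single x (Suc 0)"] by metis
    next
      assume F: "F \<subseteq> keys m"
      let ?s = "\<lambda>A. \<Sum>a\<in>A. single a (Suc 0)"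
      have ls: "lookup (?s A) y = (if y \<in> A then 1 else 0)" if "finite A" for A :: "'x set" and y
        using that by (simp add: lookup_sum lookup_single when_def)
      \<comment> \<open>The product over \<open>F\<close> is replaced by the one over
        \<open>E\<close>, from which \<open>x\<close> is split off; the shift is then
        \<open>k = - 1\<close>.\<close>
      define n where "n = (m - ?s F) + ?s (E - {x})"
      have "?s (E - {x}) \<in> mons X"
      proof -
        have "keys (?s (E - {x})) \<subseteq> E" using ls[of "E - {x}"] fin by (auto simp: in_keys_iff split: if_splits)
        thus ?thesis using X by (auto simp: mons_def)
      qed
      hence n: "n \<in> mons X" using mons_diff[OF m] by (simp add: n_def)
      have l: "int (lookup (n + single x (Suc 0)) y) = int (lookup m y) + (if y \<in> E then 1 else if y \<in> F then - 1 else 0)" for y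
      proof -
        have "y \<in> F \<Longrightarrow> lookup m y \<ge> 1" using F by (auto simp: in_keys_iff Suc_le_eq subset_iff)
        thus ?thesis using X(2) x fin
          by (auto simp: n_def lookup_add lookup_minus ls lookup_single when_def of_nat_diff)
      qed
      have "\<exists>k::int. (\<forall>e\<in>E. int (lookup m e) = int (lookup (n + single x (Suc 0)) e) + k) \<and> (\<forall>f\<in>F. int (lookup m f) = int (lookup (n + single x (Suc 0)) f) - k)"
        using X(2) by (intro exI[of _ "- 1"]) (auto simp: l)
      moreover have "n + single x (Suc 0) \<in> mons X" using n xX by simp
      ultimately have "\<mu> (n + single x (Suc 0)) = \<mu> m" using fibre m by blast
      thus ?thesis using n by blast
    qed
  qed
  have "fibre_ideal X (kill x \<mu>) = (fibre_ideal X (mon_ideal {x} F) :: ('x, 'k) pol set)"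
  proof (rule fibre_ideal_eqI)
    have N: "kill x \<mu> m = None \<longleftrightarrow> mon_ideal {x} F m = None" if "m \<in> mons X" for m
      using cond[OF that] not_None[OF that] by (auto simp: kill_def mon_ideal_None)
    show "kill x \<mu> m = None \<longleftrightarrow> mon_ideal {x} F m = None" if "m \<in> mons X" for m using N that .
    show "kill x \<mu> m = kill x \<mu> m' \<longleftrightarrow> mon_ideal {x} F m = mon_ideal {x} F m'"
      if m: "m \<in> mons X" "m' \<in> mons X" for m m'
    proof (cases "mon_ideal {x} F m = None \<or> mon_ideal {x} F m' = None")
      case True
      thus ?thesis using N[OF m(1)] N[OF m(2)] by (metis mon_ideal_eq)
    next
      case False
      hence x0: "x \<notin> keys m" "x \<notin> keys m'" by (auto simp: mon_ideal_None)
      have "kill x \<mu> m = \<mu> m" "kill x \<mu> m' = \<mu> m'"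
        using False N[OF m(1)] N[OF m(2)] by (auto simp: kill_def split: if_splits)
      moreover have "m = m'" if eq: "\<mu> m = \<mu> m'"
      proof -
        obtain k :: int where k: "\<forall>e\<in>E. int (lookup m' e) = int (lookup m e) + k" "\<forall>f\<in>F. int (lookup m' f) = int (lookup m f) - k"
          using eq fibre m by blast
        \<comment> \<open>Neither monomial contains \<open>x\<close>, so the shift, read off at
          \<open>x\<close>, vanishes.\<close>
        have "k = 0" using k(1) x x0 by (auto simp: in_keys_iff)
        show "m = m'"
        proof (rule poly_mapping_eqI)
          fix y show "lookup m y = lookup m' y"
          proof (cases "y \<in> X")
            case True thus ?thesis using k \<open>k = 0\<close> X by auto
          next
            case False
            hence "y \<notin> keys m" "y \<notin> keys m'" using m by (auto simp: mons_def)
            thus ?thesis by (simp add: in_keys_iff)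
          qed
        qed
      qed
      ultimately show ?thesis using False mon_ideal_eq[of "{x}" F m m'] by auto
    qed
  qed
  moreover have "quot_reg (card F - 1) (fibre_ideal X (mon_ideal {x} F) :: ('x, 'k) pol set)"
    using X x fin \<open>F \<noteq> {}\<close> by (intro quot_reg_mon_ideal) auto
  ultimately have K: "quot_reg (card F - 1) (fibre_ideal X (kill x \<mu>) :: ('x, 'k) pol set)" by simp
  show ?thesis
  \<comment> \<open>Multiplying both monomials by \<open>x\<close> leaves the differences of
    exponents unchanged, so \<open>x\<close> is regular.\<close>
  proof (rule quot_reg_regular[OF graded xX K], rule fibre_ideal_mono)
    fix m assume "m \<in> mons X" "shift x \<mu> m = None"
    thus "\<mu> m = None" using not_None[of "m + single x (Suc 0)"] xX by (simp add: shift_def)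
  next
    fix m m' assume m: "m \<in> mons X" "m' \<in> mons X" "shift x \<mu> m = shift x \<mu> m'"
    thus "\<mu> m = \<mu> m'" using fibre[of m m'] fibre[of "m + single x (Suc 0)" "m' + single x (Suc 0)"] xX
      by (simp add: shift_def lookup_add)
  qed
qed

text \<open>The \<open>2 \<times> 2\<close> minors of the \<open>2 \<times> n\<close> matrix with the rows \<open>xv\<close> and \<open>yv\<close>.\<close>

lemma quot_reg_segre:
  fixes \<mu> :: "('x \<Rightarrow>\<^sub>0 nat) \<Rightarrow> 'b option" and xv yv :: "nat \<Rightarrow> 'x" and n :: nat
  assumes X: "X = xv ` {..<n} \<union> yv ` {..<n}"
    and inj: "inj_on xv {..<n}" "inj_on yv {..<n}" "xv ` {..<n} \<inter> yv ` {..<n} = {}"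
    and not_None: "\<And>m. m \<in> mons X \<Longrightarrow> \<mu> m \<noteq> None"
    and fibre: "\<And>m m'. m \<in> mons X \<Longrightarrow> m' \<in> mons X \<Longrightarrow> \<mu> m = \<mu> m' \<longleftrightarrow>
      (\<forall>j<n. lookup m (xv j) + lookup m (yv j) = lookup m' (xv j) + lookup m' (yv j)) \<and>
      (\<Sum>j<n. lookup m (xv j)) = (\<Sum>j<n. lookup m' (xv j))"
  shows "quot_reg 1 (fibre_ideal X \<mu> :: ('x, 'k::field) pol set)"
proof -
  define col :: "('x \<Rightarrow>\<^sub>0 nat) \<Rightarrow> nat \<Rightarrow> nat" where "col = (\<lambda>m j. if j < n then lookup m (xv j) + lookup m (yv j) else (0::nat))"
  define top :: "('x \<Rightarrow>\<^sub>0 nat) \<Rightarrow> nat" where "top = (\<lambda>m. \<Sum>j<n. lookup m (xv j))"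
  \<comment> \<open>Fibres of the matrix ideal are given by the column degrees and the degree in the
    first row. The labels \<open>seg k\<close> describe its sum with all variables of the first
    \<open>k\<close> columns, which leads from the ideal itself at \<open>k = 0\<close> to the
    maximal ideal at \<open>k = n\<close>.\<close>
  define seg where "seg = (\<lambda>k m. if \<exists>j<k. col m j > 0 then None else Some (col m, top m))"
  have col_add: "col (m + m') = (\<lambda>j. col m j + col m' j)" for m m' :: "'x \<Rightarrow>\<^sub>0 nat"
    by (auto simp: col_def lookup_add fun_eq_iff)
  have top_add: "top (m + m') = top m + top m'" for m m' :: "'x \<Rightarrow>\<^sub>0 nat"
    by (simp add: top_def lookup_add sum.distrib)
  have ne: "xv i \<noteq> yv j" "yv j \<noteq> xv i" if "i < n" "j < n" for i j using inj(3) that by blast+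
  have injx: "xv i = xv j \<longleftrightarrow> i = j" "yv i = yv j \<longleftrightarrow> i = j" if "i < n" "j < n" for i j
    using inj(1,2) that by (auto dest: inj_onD)
  have col_x: "col (single (xv k) (Suc 0)) j = (if j = k then 1 else 0)"
    and col_y: "col (single (yv k) (Suc 0)) j = (if j = k then 1 else 0)" if "k < n" for k j
    using that ne injx by (auto simp: col_def lookup_single when_def)
  have top_x: "top (single (xv k) (Suc 0)) = 1" if "k < n" for k
  proof -
    have "top (single (xv k) (Suc 0)) = (\<Sum>j<n. if j = k then 1 else 0)"
      unfolding top_def using injx that by (intro sum.cong) (auto simp: lookup_single when_def)
    thus ?thesis using that by simp
  qed
  have top_y: "top (single (yv k) (Suc 0)) = 0" if "k < n" for k
    unfolding top_def using ne that by (intro sum.neutral) (auto simp: lookup_single when_def)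
  have xX: "xv k \<in> X" and yX: "yv k \<in> X" if "k < n" for k using that X by auto
  have seg_None: "seg k m = None \<longleftrightarrow> (\<exists>j<k. col m j > 0)" for k m by (simp add: seg_def)
  have seg_eq: "seg k m = seg k m' \<longleftrightarrow> (seg k m = None \<and> seg k m' = None) \<or>
      (seg k m \<noteq> None \<and> col m = col m' \<and> top m = top m')" for k m m'
    by (auto simp: seg_def)
  have col_not_n: "col m j = 0" if "\<not> j < n" for m j using that by (simp add: col_def)
  have deg: "total_deg m = (\<Sum>j<n. col m j)" if "m \<in> mons X" for m
  proof -
    have "total_deg m = (\<Sum>x\<in>X. lookup m x)"
      using that finX by (intro total_deg_superset) (auto simp: mons_def)
    also have "\<dots> = (\<Sum>x\<in>xv ` {..<n}. lookup m x) + (\<Sum>x\<in>yv ` {..<n}. lookup m x)"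
      unfolding X using inj(3) by (intro sum.union_disjoint) auto
    also have "\<dots> = (\<Sum>j<n. lookup m (xv j)) + (\<Sum>j<n. lookup m (yv j))"
      using inj by (simp add: sum.reindex)
    finally show ?thesis by (simp add: col_def sum.distrib)
  qed
  have graded_if: "graded_fibres X (\<lambda>m. if P m then None else Some (col m, top m))"
    if P: "\<And>m m'. P m \<Longrightarrow> P (m + m')" "\<And>m m'. col m = col m' \<Longrightarrow> top m = top m' \<Longrightarrow> P m = P m'" for P
  proof -
    have *: "P (m + m'') = P (m' + m'')" if "col m = col m'" "top m = top m'" for m m' m''
      using that by (intro P(2)) (simp_all add: col_add top_add)
    have eq: "(if P m then None else Some (col m, top m)) = (if P m' then None else Some (col m', top m')) \<longleftrightarrow>
        (P m \<and> P m') \<or> (\<not> P m \<and> \<not> P m' \<and> col m = col m' \<and> top m = top m')" for m m'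
      by auto
    have 2: "(P (m + m'') \<and> P (m' + m'')) \<or> (\<not> P (m + m'') \<and> \<not> P (m' + m'') \<and> col (m + m'') = col (m' + m'') \<and> top (m + m'') = top (m' + m''))"
      if "(P m \<and> P m') \<or> (\<not> P m \<and> \<not> P m' \<and> col m = col m' \<and> top m = top m')" for m m' m''
      using that P(1)[of m m''] P(1)[of m' m''] *[of m m' m''] by (auto simp only: col_add top_add)
    show ?thesis unfolding graded_fibres_def eq
    proof (intro conjI ballI impI)
      fix m n assume "(if P m then None else Some (col m, top m)) = None"
      hence "P m" by (simp split: if_splits)
      thus "(if P (m + n) then None else Some (col (m + n), top (m + n))) = None" using P(1) by simp
    next
      fix m m' assume "m \<in> mons X" "m' \<in> mons X" "(P m \<and> P m') \<or> (\<not> P m \<and> \<not> P m' \<and> col m = col m' \<and> top m = top m')"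
        "(if P m then None else Some (col m, top m)) \<noteq> None"
      thus "total_deg m = total_deg m'" by (auto simp: deg split: if_splits)
    qed (rule 2)
  qed
  have graded_seg: "graded_fibres X (seg k)" for k
    unfolding seg_def by (rule graded_if) (auto simp: col_add)
  have main: "quot_reg 1 (fibre_ideal X (seg k) :: ('x, 'k) pol set)" if "k \<le> n" for k
    using that
  \<comment> \<open>Downwards from \<open>k = n\<close>. Between \<open>seg k\<close> and
    \<open>seg (Suc k)\<close> first \<open>xv k\<close> is adjoined, as a regular element, and then
    \<open>yv k\<close>, with a colon ideal generated by variables.\<close>
  proof (induction rule: inc_induct)
    case base
    show ?case
    proof (rule quot_reg_mono[of 0], rule quot_reg_artinian)
      fix m assume "m \<in> mons X" "0 < total_deg m"
      hence "\<exists>j<n. col m j > 0" using deg[of m] by (metis gr0I less_irrefl sum.neutral lessThan_iff)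
      thus "seg n m = None" by (simp add: seg_def)
    qed simp
  next
    case (step k)
    hence k: "k < n" by simp
    let ?x = "xv k" and ?y = "yv k"
    \<comment> \<open>Once \<open>xv k\<close> has been adjoined, a monomial vanishes also if it
      involves column \<open>k\<close> and any variable of the first row, because a minor moves the
      first row into column \<open>k\<close>.\<close>
    define P where "P = (\<lambda>m. (\<exists>j<k. col m j > 0) \<or> (col m k > 0 \<and> top m > 0))"
    define \<mu>1 where "\<mu>1 = (\<lambda>m. if P m then None else Some (col m, top m))"
    have \<mu>1_eq: "\<mu>1 m = \<mu>1 m' \<longleftrightarrow> (P m \<and> P m') \<or> (\<not> P m \<and> \<not> P m' \<and> col m = col m' \<and> top m = top m')" for m m'
      by (auto simp: \<mu>1_def)
    have graded1: "graded_fibres X \<mu>1"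
      unfolding \<mu>1_def by (rule graded_if) (auto simp: P_def col_add top_add)
    have kill_x: "kill ?x (seg k) m = \<mu>1 m" if m: "m \<in> mons X" for m
    proof -
      have "(\<exists>n\<in>mons X. seg k (n + single ?x (Suc 0)) = seg k m) \<longleftrightarrow> P m"
      proof
        assume "\<exists>n\<in>mons X. seg k (n + single ?x (Suc 0)) = seg k m"
        then obtain n' where "seg k (n' + single ?x (Suc 0)) = seg k m" by blast
        hence "seg k m = None \<or> (col m = col (n' + single ?x (Suc 0)) \<and> top m = top (n' + single ?x (Suc 0)))"
          using seg_eq by metis
        thus "P m" using k by (auto simp: P_def seg_None col_add top_add col_x top_x)
      next
        assume "P m"
        show "\<exists>n\<in>mons X. seg k (n + single ?x (Suc 0)) = seg k m"
        proof (cases "\<exists>j<k. col m j > 0")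
          case True
          hence "seg k (m + single ?x (Suc 0)) = seg k m" by (auto simp: seg_def col_add)
          thus ?thesis using m by blast
        next
          case False
          hence pos: "col m k > 0" "top m > 0" using \<open>P m\<close> by (auto simp: P_def)
          show ?thesis
          proof (cases "?x \<in> keys m")
            case True
            thus ?thesis using mon_minus_single[OF True] mons_diff[OF m, of "single ?x (Suc 0)"] by metis
          next
            case xk: False
            hence yk: "?y \<in> keys m" using pos(1) k by (simp add: col_def in_keys_iff)
            obtain j where j: "j < n" "xv j \<in> keys m"
              using pos(2) unfolding top_def by (metis (no_types, lifting) gr0I in_keys_iff lessThan_iff not_gr_zero sum.neutral)
            define m1 where "m1 = m - single (yv k) (Suc 0)"
            have m1: "m1 + single (yv k) (Suc 0) = m" unfolding m1_def by (rule mon_minus_single[OF yk])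
            have "xv j \<in> keys m1"
              using j m1 ne[OF j(1) k] by (auto simp: in_keys_iff lookup_add lookup_single when_def m1_def lookup_minus)
            define m2 where "m2 = m1 - single (xv j) (Suc 0)"
            have m2: "m2 + single (xv j) (Suc 0) = m1" unfolding m2_def by (rule mon_minus_single) fact
            have m2X: "m2 \<in> mons X" unfolding m2_def m1_def by (intro mons_diff m)
            have cm: "col m = (\<lambda>i. col m2 i + (if i = j then 1 else 0) + (if i = k then 1 else 0))"
              unfolding m1[symmetric] m2[symmetric] col_add using j k by (simp add: col_x col_y)
            have tm: "top m = top m2 + 1"
              unfolding m1[symmetric] m2[symmetric] top_add using j k by (simp add: top_x top_y)
            \<comment> \<open>The exchange along the minor of the columns \<open>j\<close> and
              \<open>k\<close>: \<open>xv j * yv k\<close> becomes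
              \<open>yv j * xv k\<close>.\<close>
            let ?n = "m2 + single (yv j) (Suc 0)"
            have "col (?n + single ?x (Suc 0)) = col m" unfolding cm col_add using j k by (simp add: col_x col_y)
            moreover have "top (?n + single ?x (Suc 0)) = top m" unfolding tm top_add using j k by (simp add: top_x top_y)
            ultimately have "seg k (?n + single ?x (Suc 0)) = seg k m" by (simp add: seg_def)
            moreover have "?n \<in> mons X" using m2X yX[OF j(1)] by simp
            ultimately show ?thesis by blast
          qed
        qed
      qed
      thus ?thesis by (auto simp: kill_def \<mu>1_def seg_def P_def)
    qed
    have kill_y: "kill ?y \<mu>1 m = seg (Suc k) m" if m: "m \<in> mons X" for m
    proof -
      have "(\<exists>n\<in>mons X. \<mu>1 (n + single ?y (Suc 0)) = \<mu>1 m) \<longleftrightarrow> P m \<or> col m k > 0"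
      proof
        assume "\<exists>n\<in>mons X. \<mu>1 (n + single ?y (Suc 0)) = \<mu>1 m"
        then obtain n' where "\<mu>1 (n' + single ?y (Suc 0)) = \<mu>1 m" by blast
        hence "P m \<or> col m = col (n' + single ?y (Suc 0))" unfolding \<mu>1_eq by auto
        thus "P m \<or> col m k > 0" using k by (auto simp: col_add col_y)
      next
        assume "P m \<or> col m k > 0"
        show "\<exists>n\<in>mons X. \<mu>1 (n + single ?y (Suc 0)) = \<mu>1 m"
        proof (cases "P m")
          case True
          hence "P (m + single ?y (Suc 0))" by (auto simp: P_def col_add top_add)
          hence "\<mu>1 (m + single ?y (Suc 0)) = \<mu>1 m" using True by (simp add: \<mu>1_def)
          thus ?thesis using m by blast
        next
          case False
          hence c: "col m k > 0" "top m = 0" using \<open>P m \<or> col m k > 0\<close> by (auto simp: P_def)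
          have "lookup m ?x = 0" using c(2) k by (simp add: top_def)
          hence "?y \<in> keys m" using c(1) k by (simp add: col_def in_keys_iff)
          thus ?thesis using mon_minus_single mons_diff[OF m, of "single ?y (Suc 0)"] by metis
        qed
      qed
      thus ?thesis by (auto simp: kill_def \<mu>1_def seg_def P_def less_Suc_eq)
    qed
    \<comment> \<open>After multiplication by \<open>yv k\<close> column \<open>k\<close> is always
      occupied, so every first-row variable is sent to zero, as are the earlier columns. The colon
      ideal is therefore generated by the variables in \<open>A\<close>.\<close>
    define A where "A = xv ` {..<n} \<union> yv ` {..<k}"
    have AX: "A \<subseteq> X" using k X by (auto simp: A_def)
    have shift_y: "fibre_ideal X (shift ?y \<mu>1) = (fibre_ideal X (mon_ideal A A) :: ('x, 'k) pol set)"
    proof (rule fibre_ideal_eqI)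
      have A0: "?x \<in> A" using k by (auto simp: A_def)
      have MN: "mon_ideal A A m = None \<longleftrightarrow> keys m \<inter> A \<noteq> {}" for m
        using A0 by (auto simp: mon_ideal_None)
      have PA: "P (m + single ?y (Suc 0)) \<longleftrightarrow> keys m \<inter> A \<noteq> {}" for m
      proof -
        have c: "col (m + single ?y (Suc 0)) j = col m j + (if j = k then 1 else 0)" for j
          using k by (simp add: col_add col_y)
        have "top (m + single ?y (Suc 0)) = top m" using k by (simp add: top_add top_y)
        hence "P (m + single ?y (Suc 0)) \<longleftrightarrow> (\<exists>j<k. col m j > 0) \<or> top m > 0"
          unfolding P_def c by (simp cong: conj_cong)
        also have "top m > 0 \<longleftrightarrow> (\<exists>j<n. lookup m (xv j) \<noteq> 0)"
          using sum_eq_0_iff[of "{..<n}" "\<lambda>j. lookup m (xv j)"] unfolding top_def neq0_conv[symmetric] by auto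
        also have "(\<exists>j<k. col m j > 0) \<or> (\<exists>j<n. lookup m (xv j) \<noteq> 0) \<longleftrightarrow>
            (\<exists>j<k. lookup m (yv j) \<noteq> 0) \<or> (\<exists>j<n. lookup m (xv j) \<noteq> 0)"
        proof -
          have "col m j = lookup m (xv j) + lookup m (yv j)" if "j < k" for j
            using that k by (simp add: col_def)
          thus ?thesis using k by (metis add_gr_0 neq0_conv order.strict_trans)
        qed
        finally show ?thesis by (auto simp: A_def in_keys_iff)
      qed
      show "shift ?y \<mu>1 m = None \<longleftrightarrow> mon_ideal A A m = None" for m
        unfolding MN PA[symmetric] by (simp add: shift_def \<mu>1_def)
      show "(shift ?y \<mu>1 m = shift ?y \<mu>1 m') = (mon_ideal A A m = mon_ideal A A m')" if m: "m \<in> mons X" "m' \<in> mons X" for m m'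
      proof -
        have "m = m'" if z: "\<not> P (m + single ?y (Suc 0))" "\<not> P (m' + single ?y (Suc 0))" and c: "col (m + single ?y (Suc 0)) = col (m' + single ?y (Suc 0))"
        proof (rule poly_mapping_eqI)
          fix z
          have col_eq: "col m j = col m' j" for j using fun_cong[OF c, of j] by (simp add: col_add)
          have x0: "lookup m (xv j) = 0" "lookup m' (xv j) = 0" if "j < n" for j
            using z[unfolded PA] that by (auto simp: A_def in_keys_iff)
          show "lookup m z = lookup m' z"
          proof (cases "z \<in> X")
            case True
            then obtain j where "j < n" "z = xv j \<or> z = yv j" using X by auto
            thus ?thesis using x0[of j] col_eq[of j] by (auto simp: col_def)
          next
            case False
            hence "z \<notin> keys m" "z \<notin> keys m'" using m by (auto simp: mons_def)
            thus ?thesis by (simp add: in_keys_iff)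
          qed
        qed
        thus ?thesis unfolding shift_def \<mu>1_eq mon_ideal_eq[of A A m m'] MN PA[symmetric] by auto
      qed
    qed
    have IH: "quot_reg 1 (fibre_ideal X (seg (Suc k)) :: ('x, 'k) pol set)" by (rule step.IH)
    have K1: "quot_reg (Suc 0) (fibre_ideal X (kill ?y \<mu>1) :: ('x, 'k) pol set)"
    proof -
      have "fibre_ideal X (kill ?y \<mu>1) = (fibre_ideal X (seg (Suc k)) :: ('x, 'k) pol set)"
        by (rule fibre_ideal_cong) (rule kill_y)
      thus ?thesis using IH by simp
    qed
    have "A \<noteq> {}" using k by (auto simp: A_def)
    hence "quot_reg 0 (fibre_ideal X (shift ?y \<mu>1) :: ('x, 'k) pol set)"
      unfolding shift_y using AX by (intro quot_reg_variables) auto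
    from quot_reg_colon[OF graded1 yX[OF k] K1 this]
    have Q1: "quot_reg 1 (fibre_ideal X \<mu>1 :: ('x, 'k) pol set)" by simp
    have K2: "quot_reg 1 (fibre_ideal X (kill ?x (seg k)) :: ('x, 'k) pol set)"
    proof -
      have "fibre_ideal X (kill ?x (seg k)) = (fibre_ideal X \<mu>1 :: ('x, 'k) pol set)"
        by (rule fibre_ideal_cong) (rule kill_x)
      thus ?thesis using Q1 by simp
    qed
    show ?case
    \<comment> \<open>The variable \<open>xv k\<close> adds the same degrees to both monomials and
      touches no earlier column, so it is regular modulo \<open>seg k\<close>.\<close>
    proof (rule quot_reg_regular[OF graded_seg xX[OF k] K2], rule fibre_ideal_mono)
      fix m assume "shift ?x (seg k) m = None"
      thus "seg k m = None" using k by (auto simp: shift_def seg_None col_add col_x split: if_splits)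
    next
      fix m m' assume "shift ?x (seg k) m = shift ?x (seg k) m'"
      moreover have "seg k (m + single ?x (Suc 0)) = None \<longleftrightarrow> seg k m = None" for m
        using k by (auto simp: seg_None col_add col_x)
      ultimately show "seg k m = seg k m'" unfolding shift_def
          seg_eq[of k m m'] seg_eq[of k "m + single ?x (Suc 0)" "m' + single ?x (Suc 0)"]
        by (auto simp: col_add top_add fun_eq_iff)
    qed
  qed
  have "fibre_ideal X \<mu> = (fibre_ideal X (seg 0) :: ('x, 'k) pol set)"
  proof (rule fibre_ideal_eqI)
    show "\<mu> m = None \<longleftrightarrow> seg 0 m = None" if "m \<in> mons X" for m using not_None[OF that] by (simp add: seg_def)
    show "\<mu> m = \<mu> m' \<longleftrightarrow> seg 0 m = seg 0 m'" if "m \<in> mons X" "m' \<in> mons X" for m m'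
      using fibre[OF that] by (auto simp: seg_def col_def top_def fun_eq_iff)
  qed
  thus ?thesis using main[of 0] by simp
qed

end

section \<open>Comparison of graded free resolutions\<close>

lemma vsmult_add_left: "vsmult (a + b) v = vsmult a v + vsmult b v"
  by (rule poly_mapping_eqI) (simp add: lookup_vsmult lookup_add distrib_right)

lemma vsmult_zero_left [simp]: "vsmult 0 v = 0"
  by (rule poly_mapping_eqI) (simp add: lookup_vsmult)

lemma vsmult_zero_right [simp]: "vsmult p 0 = 0"
  by (rule poly_mapping_eqI) (simp add: lookup_vsmult)

lemma vsmult_one [simp]: "vsmult 1 v = v"
  by (rule poly_mapping_eqI) (simp add: lookup_vsmult)

lemma vsmult_add_right: "vsmult p (v + w) = vsmult p v + vsmult p w"
  by (rule poly_mapping_eqI) (simp add: lookup_vsmult lookup_add distrib_left)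

lemma vsmult_diff_right: "vsmult p (v - w) = vsmult p v - vsmult p w"
  by (rule poly_mapping_eqI) (simp add: lookup_vsmult lookup_minus right_diff_distrib)

lemma vsmult_sum_right: "vsmult p (\<Sum>i\<in>I. f i) = (\<Sum>i\<in>I. vsmult p (f i))"
  by (induction I rule: infinite_finite_induct) (simp_all add: vsmult_add_right)

lemma vsmult_vsmult: "vsmult p (vsmult q v) = vsmult (p * q) v"
  by (rule poly_mapping_eqI) (simp add: lookup_vsmult mult.assoc)

lemma linear_ext_lin: "linear_ext c = lin (\<lambda>k p. vsmult p (c k))"
  by (simp add: fun_eq_iff linear_ext_def lin_def)

lemma additive_vsmult: "additive_coeffs (\<lambda>k p. vsmult p (c k))"
  by (simp add: additive_coeffs_def vsmult_add_left)

lemma linear_ext_zero [simp]: "linear_ext c 0 = 0"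
  by (simp add: linear_ext_lin)

lemma linear_ext_add: "linear_ext c (v + w) = linear_ext c v + linear_ext c w"
  unfolding linear_ext_lin by (rule lin_add[OF additive_vsmult])

lemma linear_ext_diff: "linear_ext c (v - w) = linear_ext c v - linear_ext c w"
  unfolding linear_ext_lin by (rule lin_diff[OF additive_vsmult])

lemma linear_ext_sum: "linear_ext c (\<Sum>i\<in>I. f i) = (\<Sum>i\<in>I. linear_ext c (f i))"
  unfolding linear_ext_lin by (rule lin_sum[OF additive_vsmult])

lemma linear_ext_single: "linear_ext c (single k p) = vsmult p (c k)"
  unfolding linear_ext_lin by (rule lin_single) simp

lemma linear_ext_superset:
  "finite A \<Longrightarrow> keys v \<subseteq> A \<Longrightarrow> linear_ext c v = (\<Sum>k\<in>A. vsmult (lookup v k) (c k))"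
  unfolding linear_ext_lin by (rule lin_superset) simp_all

lemma linear_ext_vsmult: "linear_ext c (vsmult p v) = vsmult p (linear_ext c v)"
proof -
  have "keys (vsmult p v) \<subseteq> keys v" by (auto simp: in_keys_iff lookup_vsmult)
  hence "linear_ext c (vsmult p v) = (\<Sum>k\<in>keys v. vsmult (lookup (vsmult p v) k) (c k))"
    by (intro linear_ext_superset) simp_all
  thus ?thesis by (simp add: linear_ext_def vsmult_sum_right vsmult_vsmult lookup_vsmult)
qed

lemma linear_ext_linear_ext: "linear_ext c (linear_ext d v) = linear_ext (\<lambda>k. linear_ext c (d k)) v"
  by (simp add: linear_ext_def[of d] linear_ext_def[of "\<lambda>k. linear_ext c (d k)"] linear_ext_sum linear_ext_vsmult)

lemma linear_ext_cong: "(\<And>k. k \<in> keys v \<Longrightarrow> c k = d k) \<Longrightarrow> linear_ext c v = linear_ext d v"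
  by (simp add: linear_ext_def)

lemma linear_ext_fun_diff: "linear_ext (\<lambda>k. c k - d k) v = linear_ext c v - linear_ext d v"
  by (simp add: linear_ext_def vsmult_diff_right sum_subtractf)

lemma linear_ext_id: "linear_ext (\<lambda>k. single k 1) v = v"
proof -
  have "vsmult p (single k 1) = single k p" for p :: "('a, 'b) pol" and k
    by (rule poly_mapping_eqI) (simp add: lookup_vsmult lookup_single when_def)
  thus ?thesis using pol_expand[of v] by (simp add: linear_ext_def)
qed

lemma lookup_linear_ext: "lookup (linear_ext c v) j = (\<Sum>k\<in>keys v. lookup v k * lookup (c k) j)"
  by (simp add: linear_ext_def lookup_sum lookup_vsmult)

lemma degree_part_homog:
  "degree_part F i j = {v. \<forall>k. homog (j - bdeg F i k) (lookup v k)}"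
proof -
  have *: "homog (j - bdeg F i k) (lookup v k) = (\<forall>m\<in>keys (lookup v k). int (total_deg m) + bdeg F i k = j)" for v k
    unfolding homog_def by (intro ball_cong refl) auto
  have "(\<forall>k\<in>keys v. homog (j - bdeg F i k) (lookup v k)) = (\<forall>k. homog (j - bdeg F i k) (lookup v k))" for v
    by (metis homog_zero in_keys_iff)
  thus ?thesis unfolding degree_part_def *[symmetric] by (intro Collect_cong)
qed

lemma degree_part_add: "v \<in> degree_part F i j \<Longrightarrow> w \<in> degree_part F i j \<Longrightarrow> v + w \<in> degree_part F i j"
  by (simp add: degree_part_homog lookup_add homog_add)

lemma degree_part_diff: "v \<in> degree_part F i j \<Longrightarrow> w \<in> degree_part F i j \<Longrightarrow> v - w \<in> degree_part F i j"
  by (simp add: degree_part_homog lookup_minus homog_minus)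

lemma chains_zero: "ring_ideal X I \<Longrightarrow> 0 \<in> chains F I i"
  by (simp add: chains_def ring_ideal_zero)

lemma chains_add:
  "ring_ideal X I \<Longrightarrow> v \<in> chains F I i \<Longrightarrow> w \<in> chains F I i \<Longrightarrow> v + w \<in> chains F I i"
  using keys_add[of v w] by (auto simp: chains_def lookup_add ring_ideal_add)

lemma chains_diff:
  assumes "ring_ideal X I" "v \<in> chains F I i" "w \<in> chains F I i" shows "v - w \<in> chains F I i"
proof -
  have "keys (v - w) \<subseteq> keys v \<union> keys w" by (auto simp: in_keys_iff lookup_minus)
  thus ?thesis using assms(2,3) by (auto simp: chains_def lookup_minus ring_ideal_minus[OF assms(1)])
qed

lemma chains_mono: "I \<subseteq> J \<Longrightarrow> chains F I i \<subseteq> chains F J i"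
  by (auto simp: chains_def)

lemma chains_out: "v \<in> chains F I i \<Longrightarrow> \<not> k < rnk F i \<Longrightarrow> lookup v k = 0"
  by (auto simp: chains_def in_keys_iff)

lemma chains_lookup: "ring_ideal X I \<Longrightarrow> v \<in> chains F I i \<Longrightarrow> lookup v k \<in> I"
  using chains_out[of v F I i k] ring_ideal_zero[of X I]
  by (cases "k < rnk F i") (auto simp: chains_def)

lemma chainsI:
  assumes "\<And>k. \<not> k < rnk F i \<Longrightarrow> lookup v k = 0" "\<And>k. lookup v k \<in> I"
  shows "v \<in> chains F I i"
  using assms by (auto simp: chains_def in_keys_iff)

lemma linear_ext_chains:
  assumes I: "ring_ideal X I" and v: "v \<in> chains F' I i'"
    and c: "\<And>k. k < rnk F' i' \<Longrightarrow> c k \<in> chains F (poly_ring X) i"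
  shows "linear_ext c v \<in> chains F I i"
proof (rule chainsI)
  have k: "k < rnk F' i'" if "k \<in> keys v" for k using v that by (auto simp: chains_def)
  show "lookup (linear_ext c v) j = 0" if "\<not> j < rnk F i" for j
    unfolding lookup_linear_ext by (rule sum.neutral) (simp add: chains_out[OF c[OF k] that])
  show "lookup (linear_ext c v) j \<in> I" for j unfolding lookup_linear_ext
  proof (rule ring_ideal_sum[OF I])
    fix l assume "l \<in> keys v"
    hence "lookup (c l) j * lookup v l \<in> I"
      by (intro ring_ideal_mult[OF I] chains_lookup[OF ring_ideal_ring c[OF k]] chains_lookup[OF I v])
    thus "lookup v l * lookup (c l) j \<in> I" by (simp add: mult.commute)
  qed
qed

lemma linear_ext_degree:
  assumes "v \<in> degree_part F' i' j" "\<And>k. k \<in> keys v \<Longrightarrow> c k \<in> degree_part F i (bdeg F' i' k)"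
  shows "linear_ext c v \<in> degree_part F i j"
  unfolding degree_part_homog
proof (intro CollectI allI)
  fix l
  have "homog (j - bdeg F i l) (lookup v k * lookup (c k) l)" if "k \<in> keys v" for k
    using homog_mult[of "j - bdeg F' i' k" "lookup v k" "bdeg F' i' k - bdeg F i l" "lookup (c k) l"] assms that
    by (simp add: degree_part_homog)
  thus "homog (j - bdeg F i l) (lookup (linear_ext c v) l)"
    unfolding lookup_linear_ext by (rule homog_sum)
qed

section \<open>Homogeneous components\<close>

definition hcomp :: "int \<Rightarrow> ('x, 'k::field) pol \<Rightarrow> ('x, 'k) pol" where
  "hcomp c = mmap (\<lambda>m. if int (total_deg m) = c then Some m else None)"

lemma hcomp_zero [simp]: "hcomp c 0 = 0" by (simp add: hcomp_def)

lemma hcomp_homog: "homog c (hcomp c p)"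
  using keys_mmap[of "\<lambda>m. if int (total_deg m) = c then Some m else None" p]
  by (auto simp: homog_def hcomp_def split: if_splits)

lemma hcomp_ring: "p \<in> poly_ring X \<Longrightarrow> hcomp c p \<in> poly_ring X"
  using keys_mmap[of "\<lambda>m. if int (total_deg m) = c then Some m else None" p]
  by (auto simp: poly_ring_mons hcomp_def split: if_splits)

lemma hcomp_single: "hcomp c (single m a) = (if int (total_deg m) = c then single m a else 0)"
  by (simp add: hcomp_def mmap_single)

lemma hcomp_add: "hcomp c (p + q) = hcomp c p + hcomp c q"
  by (simp add: hcomp_def mmap_add)

lemma hcomp_sum: "hcomp c (\<Sum>i\<in>I. f i) = (\<Sum>i\<in>I. hcomp c (f i))"
  by (simp add: hcomp_def mmap_sum)

lemma hcomp_id: assumes "homog c p" shows "hcomp c p = p"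
proof -
  have "hcomp c p = (\<Sum>m\<in>keys p. hcomp c (single m (lookup p m)))"
    by (subst (1) pol_expand[of p]) (rule hcomp_sum)
  also have "\<dots> = (\<Sum>m\<in>keys p. single m (lookup p m))"
    using assms by (intro sum.cong) (auto simp: hcomp_single homog_def)
  finally show ?thesis using pol_expand[of p] by simp
qed

lemma hcomp_mult_homog:
  assumes "homog e q" shows "hcomp (c + e) (p * q) = hcomp c p * q"
proof (induction p rule: pol_induct)
  case (single m a)
  have "hcomp (c + e) (single m a * r) = hcomp c (single m a) * r" if "homog e r" for r
  proof -
    have "single m a * r = (\<Sum>n\<in>keys r. single (m + n) (a * lookup r n))"
      by (subst (1) pol_expand[of r]) (simp add: sum_distrib_left mult_single)
    moreover have "int (total_deg (m + n)) = c + e \<longleftrightarrow> int (total_deg m) = c" if "n \<in> keys r" for n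
      using \<open>homog e r\<close> that by (auto simp: homog_def)
    ultimately show ?thesis by (simp add: hcomp_sum hcomp_single)
  qed
  thus ?case using assms by blast
qed (simp_all add: hcomp_add distrib_right)

lemma lookup_hcomp_0: "lookup (hcomp 0 p) 0 = lookup p 0"
  by (induction p rule: pol_induct) (auto simp: hcomp_single hcomp_add lookup_add lookup_single total_deg_eq_0_iff)

definition chain_hcomp :: "('x, 'k::field) free_complex \<Rightarrow> nat \<Rightarrow> int \<Rightarrow> (nat \<Rightarrow>\<^sub>0 ('x, 'k) pol) \<Rightarrow> (nat \<Rightarrow>\<^sub>0 ('x, 'k) pol)" where
  "chain_hcomp F i j v = (\<Sum>k\<in>keys v. single k (hcomp (j - bdeg F i k) (lookup v k)))"

lemma lookup_chain_hcomp: "lookup (chain_hcomp F i j v) k = hcomp (j - bdeg F i k) (lookup v k)"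
proof -
  have "lookup (chain_hcomp F i j v) k = (\<Sum>l\<in>keys v. if l = k then hcomp (j - bdeg F i k) (lookup v k) else 0)"
    unfolding chain_hcomp_def lookup_sum by (intro sum.cong) (auto simp: lookup_single)
  thus ?thesis by (simp add: in_keys_iff)
qed

lemma chain_hcomp_degree: "chain_hcomp F i j v \<in> degree_part F i j"
  by (simp add: degree_part_homog lookup_chain_hcomp hcomp_homog)

lemma chain_hcomp_chains: "v \<in> chains F (poly_ring X) i \<Longrightarrow> chain_hcomp F i j v \<in> chains F (poly_ring X) i"
  by (rule chainsI) (simp_all add: lookup_chain_hcomp chains_out hcomp_ring chains_lookup[OF ring_ideal_ring])

text \<open>Degree-preserving maps commute with taking components. Thus a preimage of a homogeneous
  chain may be replaced by its component of the right degree.\<close>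

lemma linear_ext_chain_hcomp:
  assumes "\<And>k. k \<in> keys v \<Longrightarrow> c k \<in> degree_part F i (bdeg F' i' k)"
    and "linear_ext c v \<in> degree_part F i j"
  shows "linear_ext c (chain_hcomp F' i' j v) = linear_ext c v"
proof (rule poly_mapping_eqI)
  fix l
  have sub: "keys (chain_hcomp F' i' j v) \<subseteq> keys v"
    by (auto simp: in_keys_iff lookup_chain_hcomp)
  have "lookup (linear_ext c (chain_hcomp F' i' j v)) l
      = (\<Sum>k\<in>keys v. hcomp (j - bdeg F' i' k) (lookup v k) * lookup (c k) l)"
    by (subst linear_ext_superset[OF _ sub]) (simp_all add: lookup_sum lookup_vsmult lookup_chain_hcomp)
  also have "\<dots> = (\<Sum>k\<in>keys v. hcomp (j - bdeg F i l) (lookup v k * lookup (c k) l))"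
  proof (rule sum.cong[OF refl])
    fix k assume "k \<in> keys v"
    hence "homog (bdeg F' i' k - bdeg F i l) (lookup (c k) l)" using assms(1) by (simp add: degree_part_homog)
    from hcomp_mult_homog[OF this, of "j - bdeg F' i' k" "lookup v k"]
    show "hcomp (j - bdeg F' i' k) (lookup v k) * lookup (c k) l = hcomp (j - bdeg F i l) (lookup v k * lookup (c k) l)"
      by simp
  qed
  also have "\<dots> = hcomp (j - bdeg F i l) (lookup (linear_ext c v) l)"
    by (simp add: lookup_linear_ext hcomp_sum)
  also have "\<dots> = lookup (linear_ext c v) l"
    using assms(2) by (intro hcomp_id) (simp add: degree_part_homog)
  finally show "lookup (linear_ext c (chain_hcomp F' i' j v)) l = lookup (linear_ext c v) l" .
qed

text \<open>Unlike in \<open>tor_cycles\<close>, the condition in homological degree 0 is that the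
  augmentation vanishes, so that exactness reads the same in all degrees.\<close>

definition is_cycle :: "('x, 'k::field) free_complex \<Rightarrow> nat \<Rightarrow> (nat \<Rightarrow>\<^sub>0 ('x, 'k) pol) \<Rightarrow> bool" where
  "is_cycle F i v = (case i of 0 \<Rightarrow> augmentation F v = 0 | Suc l \<Rightarrow> linear_ext (bdry F l) v = 0)"

lemma augmentation_lin: "augmentation F = lin (\<lambda>k p. lookup p 0 * aug F k)"
  by (simp add: fun_eq_iff augmentation_def lin_def)

lemma additive_aug:
  fixes F :: "('x, 'k::field) free_complex"
  shows "additive_coeffs (\<lambda>k p. lookup p 0 * aug F k)"
  by (simp add: additive_coeffs_def lookup_add distrib_right)

lemma augmentation_zero [simp]: "augmentation F 0 = 0" by (simp add: augmentation_lin)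

lemma augmentation_diff: "augmentation F (v - w) = augmentation F v - augmentation F w"
  unfolding augmentation_lin by (rule lin_diff[OF additive_aug])

lemma augmentation_sum: "augmentation F (\<Sum>i\<in>I. f i) = (\<Sum>i\<in>I. augmentation F (f i))"
  unfolding augmentation_lin by (rule lin_sum[OF additive_aug])

lemma augmentation_single: "augmentation F (single k p) = lookup p 0 * aug F k"
  unfolding augmentation_lin by (rule lin_single) simp

lemma lookup_mult_0: "lookup (p * q) 0 = lookup p 0 * lookup (q :: ('x, 'k::field) pol) 0"
proof (induction p rule: pol_induct)
  case (single m a)
  show ?case
  proof (induction q rule: pol_induct)
    case (single n b)
    have "m + n = 0 \<longleftrightarrow> m = 0 \<and> n = 0"
      using total_deg_eq_0_iff[of "m + n"] total_deg_eq_0_iff[of m] total_deg_eq_0_iff[of n] by simp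
    thus ?case by (auto simp: mult_single lookup_single when_def)
  qed (simp_all add: distrib_left lookup_add)
qed (simp_all add: distrib_right lookup_add)

lemma augmentation_vsmult: "augmentation F (vsmult p v) = lookup p 0 * augmentation F v"
proof -
  have "augmentation F (vsmult p v) = (\<Sum>k\<in>keys v. lookup (lookup (vsmult p v) k) 0 * aug F k)"
    unfolding augmentation_lin by (rule lin_superset) (auto simp: in_keys_iff lookup_vsmult)
  thus ?thesis by (simp add: augmentation_def lookup_vsmult lookup_mult_0 sum_distrib_left mult.assoc)
qed

lemma augmentation_linear_ext:
  "augmentation F (linear_ext c v) = (\<Sum>k\<in>keys v. lookup (lookup v k) 0 * augmentation F (c k))"
  by (simp add: linear_ext_def augmentation_sum augmentation_vsmult)

section \<open>Chain maps and homotopies between graded resolutions\<close>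

locale residue_resolution =
  fixes X :: "'x set" and F :: "('x, 'k::field) free_complex"
  assumes res: "resolves_residue_field X F"
begin

abbreviation "S \<equiv> poly_ring X :: ('x, 'k) pol set"

abbreviation "bd i \<equiv> linear_ext (bdry F i)"

lemma bdry_chains: "k < rnk F (Suc i) \<Longrightarrow> bdry F i k \<in> chains F S i"
  and bdry_degree: "k < rnk F (Suc i) \<Longrightarrow> bdry F i k \<in> degree_part F i (bdeg F (Suc i) k)"
  using res by (auto simp: resolves_residue_field_def)

lemma aug_deg: "k < rnk F 0 \<Longrightarrow> aug F k \<noteq> 0 \<Longrightarrow> bdeg F 0 k = 0"
  using res by (auto simp: resolves_residue_field_def)

lemma chains_keys: "v \<in> chains F I i \<Longrightarrow> k \<in> keys v \<Longrightarrow> k < rnk F i"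
  by (auto simp: chains_def)

lemma exact: "{v \<in> chains F S i. is_cycle F i v} = bd i ` chains F S (Suc i)"
  using res by (cases i) (simp_all add: resolves_residue_field_def is_cycle_def)

lemma bd_cycle: "v \<in> chains F S (Suc i) \<Longrightarrow> is_cycle F i (bd i v)"
  using exact[of i] by blast

lemma exact_graded:
  assumes "v \<in> chains F S i" "v \<in> degree_part F i j" "is_cycle F i v"
  obtains u where "u \<in> chains F S (Suc i)" "u \<in> degree_part F (Suc i) j" "bd i u = v"
proof -
  obtain u where u: "u \<in> chains F S (Suc i)" "v = bd i u" using exact[of i] assms by blast
  have "bd i (chain_hcomp F (Suc i) j u) = bd i u"
    using u assms(2) bdry_degree chains_keys[OF u(1)] by (intro linear_ext_chain_hcomp) auto
  thus ?thesis using that[of "chain_hcomp F (Suc i) j u"] u chain_hcomp_chains chain_hcomp_degree by blast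
qed

lemma bd_chains:
  "ring_ideal X I \<Longrightarrow> v \<in> chains F I (Suc i) \<Longrightarrow> bd i v \<in> chains F I i"
  by (rule linear_ext_chains) (use bdry_chains in auto)

lemma bd_degree:
  "v \<in> chains F I (Suc i) \<Longrightarrow> v \<in> degree_part F (Suc i) j \<Longrightarrow> bd i v \<in> degree_part F i j"
  by (rule linear_ext_degree) (use bdry_degree chains_keys in auto)

lemma basis_chains: "k < rnk F i \<Longrightarrow> single k 1 \<in> chains F S i"
  by (auto simp: chains_def lookup_single when_def)

lemma bdry_cycle: "k < rnk F (Suc i) \<Longrightarrow> is_cycle F i (bdry F i k)"
  using bd_cycle[OF basis_chains] by (simp add: linear_ext_single)

end

text \<open>\<open>\<phi> i k\<close> is the image of the \<open>k\<close>-th basis element in homological degree \<open>i\<close>.\<close>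

definition graded_map :: "'x set \<Rightarrow> ('x, 'k::field) free_complex \<Rightarrow> ('x, 'k) free_complex \<Rightarrow> nat \<Rightarrow> nat \<Rightarrow>
    (nat \<Rightarrow> (nat \<Rightarrow>\<^sub>0 ('x, 'k) pol)) \<Rightarrow> bool" where
  "graded_map X F F' i i' f \<longleftrightarrow>
     (\<forall>k<rnk F i. f k \<in> chains F' (poly_ring X) i' \<and> f k \<in> degree_part F' i' (bdeg F i k))"

lemma graded_mapD:
  assumes "graded_map X F F' i i' f" "v \<in> chains F I i" "ring_ideal X I"
  shows "linear_ext f v \<in> chains F' I i'"
    "v \<in> degree_part F i j \<Longrightarrow> linear_ext f v \<in> degree_part F' i' j"
proof -
  show "linear_ext f v \<in> chains F' I i'"
    using assms by (intro linear_ext_chains[OF assms(3,2)]) (simp add: graded_map_def)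
  show "linear_ext f v \<in> degree_part F' i' j" if "v \<in> degree_part F i j"
    using assms(1,2) by (intro linear_ext_degree[OF that]) (auto simp: graded_map_def chains_def)
qed

text \<open>Images of basis elements are lifted along exactness, one homological degree at a time
  and always in the right degree. \<open>Q\<close> carries the fact that boundaries are already
  mapped to cycles, which is what the next lift needs; \<open>R\<close> is the commutation between
  neighbouring degrees.\<close>

lemma chain_map_exists:
  assumes F: "resolves_residue_field X F" and F': "resolves_residue_field X (F' :: ('x, 'k::field) free_complex)"
  obtains \<phi> where "\<And>i. graded_map X F F' i i (\<phi> i)" "\<And>k. k < rnk F 0 \<Longrightarrow> augmentation F' (\<phi> 0 k) = aug F k"
    "\<And>i k. k < rnk F (Suc i) \<Longrightarrow> linear_ext (bdry F' i) (\<phi> (Suc i) k) = linear_ext (\<phi> i) (bdry F i k)"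
proof -
  interpret F: residue_resolution X F by unfold_locales (rule F)
  interpret F': residue_resolution X F' by unfold_locales (rule F')
  define Q where "Q = (\<lambda>i f. graded_map X F F' i i f \<and>
     (\<forall>k<rnk F (Suc i). is_cycle F' i (linear_ext f (bdry F i k))) \<and>
     (i = 0 \<longrightarrow> (\<forall>k<rnk F 0. augmentation F' (f k) = aug F k)))"
  define R where "R = (\<lambda>i f g. \<forall>k<rnk F (Suc i). linear_ext (bdry F' i) (g k) = linear_ext f (bdry F i k))"
  have "\<exists>f. Q 0 f"
  proof -
    have "\<exists>w. w \<in> chains F' (poly_ring X) 0 \<and> w \<in> degree_part F' 0 (bdeg F 0 k) \<and> augmentation F' w = aug F k"
      if k: "k < rnk F 0" for k
    proof (cases "aug F k = 0")
      case True
      thus ?thesis by (intro exI[of _ 0]) (simp add: chains_zero[OF ring_ideal_ring] degree_part_homog)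
    next
      case False
      hence b: "bdeg F 0 k = 0" using F.aug_deg[OF k] by simp
      obtain w where w: "w \<in> chains F' (poly_ring X) 0" "augmentation F' w = aug F k"
        using F' unfolding resolves_residue_field_def by (metis (no_types, lifting) UNIV_I imageE)
      \<comment> \<open>A generator with non-zero augmentation has degree 0, so its constant
        coefficient survives in the component of degree 0; the other generators do not
        contribute.\<close>
      have "augmentation F' (chain_hcomp F' 0 0 w) = augmentation F' w"
      proof -
        have "keys (chain_hcomp F' 0 0 w) \<subseteq> keys w" by (auto simp: in_keys_iff lookup_chain_hcomp)
        hence "augmentation F' (chain_hcomp F' 0 0 w) = (\<Sum>l\<in>keys w. lookup (lookup (chain_hcomp F' 0 0 w) l) 0 * aug F' l)"
          unfolding augmentation_lin by (intro lin_superset) simp_all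
        also have "\<dots> = (\<Sum>l\<in>keys w. lookup (lookup w l) 0 * aug F' l)"
        proof (rule sum.cong[OF refl])
          fix l assume "l \<in> keys w"
          hence l: "l < rnk F' 0" using w(1) F'.chains_keys by blast
          show "lookup (lookup (chain_hcomp F' 0 0 w) l) 0 * aug F' l = lookup (lookup w l) 0 * aug F' l"
            using F'.aug_deg[OF l] by (cases "aug F' l = 0") (simp_all add: lookup_chain_hcomp lookup_hcomp_0)
        qed
        finally show ?thesis by (simp add: augmentation_def)
      qed
      thus ?thesis using w b chain_hcomp_chains[OF w(1)] chain_hcomp_degree[of F' 0 0 w]
        by (intro exI[of _ "chain_hcomp F' 0 0 w"]) simp
    qed
    then obtain f where f: "\<And>k. k < rnk F 0 \<Longrightarrow> f k \<in> chains F' (poly_ring X) 0 \<and> f k \<in> degree_part F' 0 (bdeg F 0 k) \<and> augmentation F' (f k) = aug F k"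
      by metis
    have "is_cycle F' 0 (linear_ext f (bdry F 0 k))" if k: "k < rnk F (Suc 0)" for k
    proof -
      have "augmentation F' (linear_ext f (bdry F 0 k)) = augmentation F (bdry F 0 k)"
        unfolding augmentation_linear_ext augmentation_def[of F]
        using f F.chains_keys[OF F.bdry_chains[OF k]] by (intro sum.cong) auto
      thus ?thesis using F.bdry_cycle[OF k] by (simp add: is_cycle_def)
    qed
    thus ?thesis using f by (intro exI[of _ f]) (simp add: Q_def graded_map_def)
  qed
  moreover have "\<exists>g. Q (Suc i) g \<and> R i f g" if Q: "Q i f" for i f
  proof -
    have "\<exists>w. w \<in> chains F' (poly_ring X) (Suc i) \<and> w \<in> degree_part F' (Suc i) (bdeg F (Suc i) k) \<and>
        linear_ext (bdry F' i) w = linear_ext f (bdry F i k)" if k: "k < rnk F (Suc i)" for k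
    proof -
      have g: "graded_map X F F' i i f" using Q by (simp add: Q_def)
      have "is_cycle F' i (linear_ext f (bdry F i k))" using Q k by (simp add: Q_def)
      from F'.exact_graded[OF graded_mapD(1)[OF g F.bdry_chains[OF k] ring_ideal_ring]
        graded_mapD(2)[OF g F.bdry_chains[OF k] ring_ideal_ring F.bdry_degree[OF k]] this]
      show ?thesis by blast
    qed
    then obtain g where g: "\<And>k. k < rnk F (Suc i) \<Longrightarrow> g k \<in> chains F' (poly_ring X) (Suc i) \<and>
        g k \<in> degree_part F' (Suc i) (bdeg F (Suc i) k) \<and> linear_ext (bdry F' i) (g k) = linear_ext f (bdry F i k)"
      by metis
    have "is_cycle F' (Suc i) (linear_ext g (bdry F (Suc i) k))" if k: "k < rnk F (Suc (Suc i))" for k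
    proof -
      have "linear_ext (bdry F' i) (linear_ext g (bdry F (Suc i) k))
          = linear_ext (\<lambda>l. linear_ext f (bdry F i l)) (bdry F (Suc i) k)"
        unfolding linear_ext_linear_ext
        using g F.chains_keys[OF F.bdry_chains[OF k]] by (intro linear_ext_cong) auto
      also have "\<dots> = linear_ext f (linear_ext (bdry F i) (bdry F (Suc i) k))"
        by (simp only: linear_ext_linear_ext)
      also have "linear_ext (bdry F i) (bdry F (Suc i) k) = 0"
        using F.bdry_cycle[OF k] by (simp add: is_cycle_def)
      finally show ?thesis by (simp add: is_cycle_def)
    qed
    thus ?thesis using g by (intro exI[of _ g]) (simp add: Q_def R_def graded_map_def)
  qed
  ultimately obtain \<phi> where "\<And>i. Q i (\<phi> i)" "\<And>i. R i (\<phi> i) (\<phi> (Suc i))"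
    using dependent_nat_choice[of Q R] by metis
  thus ?thesis using that[of \<phi>] by (simp add: Q_def R_def)
qed

text \<open>The uniqueness half of the comparison theorem, for use with the difference of the
  identity and a round trip between two resolutions. The lifting scheme is that of
  \<open>chain_map_exists\<close>.\<close>

lemma null_homotopy_exists:
  assumes F: "resolves_residue_field X (F :: ('x, 'k::field) free_complex)"
    and \<alpha>: "\<And>i. graded_map X F F i i (\<alpha> i)" "\<And>k. k < rnk F 0 \<Longrightarrow> augmentation F (\<alpha> 0 k) = 0"
    "\<And>i k. k < rnk F (Suc i) \<Longrightarrow> linear_ext (bdry F i) (\<alpha> (Suc i) k) = linear_ext (\<alpha> i) (bdry F i k)"
  obtains h where "\<And>i. graded_map X F F i (Suc i) (h i)"
    "\<And>k. k < rnk F 0 \<Longrightarrow> linear_ext (bdry F 0) (h 0 k) = \<alpha> 0 k"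
    "\<And>i k. k < rnk F (Suc i) \<Longrightarrow> linear_ext (bdry F (Suc i)) (h (Suc i) k) = \<alpha> (Suc i) k - linear_ext (h i) (bdry F i k)"
proof -
  interpret F: residue_resolution X F by unfold_locales (rule F)
  define Q where "Q = (\<lambda>i f. graded_map X F F i (Suc i) f \<and>
     (\<forall>k<rnk F (Suc i). is_cycle F (Suc i) (\<alpha> (Suc i) k - linear_ext f (bdry F i k))) \<and>
     (i = 0 \<longrightarrow> (\<forall>k<rnk F 0. linear_ext (bdry F 0) (f k) = \<alpha> 0 k)))"
  define R where "R = (\<lambda>i f g. \<forall>k<rnk F (Suc i). linear_ext (bdry F (Suc i)) (g k) = \<alpha> (Suc i) k - linear_ext f (bdry F i k))"
  have \<alpha>_mem: "\<alpha> i k \<in> chains F (poly_ring X) i" "\<alpha> i k \<in> degree_part F i (bdeg F i k)" if "k < rnk F i" for i k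
    using \<alpha>(1)[of i] that by (auto simp: graded_map_def)
  have "\<exists>f. Q 0 f"
  proof -
    have "\<exists>w. w \<in> chains F (poly_ring X) (Suc 0) \<and> w \<in> degree_part F (Suc 0) (bdeg F 0 k) \<and> linear_ext (bdry F 0) w = \<alpha> 0 k"
      if k: "k < rnk F 0" for k
    proof -
      have "is_cycle F 0 (\<alpha> 0 k)" using \<alpha>(2)[OF k] by (simp add: is_cycle_def)
      from F.exact_graded[OF \<alpha>_mem[OF k] this] show ?thesis by blast
    qed
    then obtain f where f: "\<And>k. k < rnk F 0 \<Longrightarrow> f k \<in> chains F (poly_ring X) (Suc 0) \<and> f k \<in> degree_part F (Suc 0) (bdeg F 0 k) \<and> linear_ext (bdry F 0) (f k) = \<alpha> 0 k"
      by metis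
    have "is_cycle F (Suc 0) (\<alpha> (Suc 0) k - linear_ext f (bdry F 0 k))" if k: "k < rnk F (Suc 0)" for k
    proof -
      have "linear_ext (bdry F 0) (linear_ext f (bdry F 0 k)) = linear_ext (\<alpha> 0) (bdry F 0 k)"
        unfolding linear_ext_linear_ext using f F.chains_keys[OF F.bdry_chains[OF k]]
        by (intro linear_ext_cong) auto
      thus ?thesis using \<alpha>(3)[OF k] by (simp add: is_cycle_def linear_ext_diff)
    qed
    thus ?thesis using f by (intro exI[of _ f]) (simp add: Q_def graded_map_def)
  qed
  moreover have "\<exists>g. Q (Suc i) g \<and> R i f g" if Q: "Q i f" for i f
  proof -
    have gf: "graded_map X F F i (Suc i) f" using Q by (simp add: Q_def)
    have "\<exists>w. w \<in> chains F (poly_ring X) (Suc (Suc i)) \<and> w \<in> degree_part F (Suc (Suc i)) (bdeg F (Suc i) k) \<and>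
        linear_ext (bdry F (Suc i)) w = \<alpha> (Suc i) k - linear_ext f (bdry F i k)" if k: "k < rnk F (Suc i)" for k
    proof -
      let ?w = "\<alpha> (Suc i) k - linear_ext f (bdry F i k)"
      have "?w \<in> chains F (poly_ring X) (Suc i)"
        by (intro chains_diff[OF ring_ideal_ring] \<alpha>_mem k graded_mapD(1)[OF gf F.bdry_chains ring_ideal_ring])
      moreover have "?w \<in> degree_part F (Suc i) (bdeg F (Suc i) k)"
        by (intro degree_part_diff \<alpha>_mem k graded_mapD(2)[OF gf F.bdry_chains ring_ideal_ring] F.bdry_degree)
      moreover have "is_cycle F (Suc i) ?w" using Q k by (simp add: Q_def)
      ultimately show ?thesis using F.exact_graded by metis
    qed
    then obtain g where g: "\<And>k. k < rnk F (Suc i) \<Longrightarrow> g k \<in> chains F (poly_ring X) (Suc (Suc i)) \<and>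
        g k \<in> degree_part F (Suc (Suc i)) (bdeg F (Suc i) k) \<and> linear_ext (bdry F (Suc i)) (g k) = \<alpha> (Suc i) k - linear_ext f (bdry F i k)"
      by metis
    have "is_cycle F (Suc (Suc i)) (\<alpha> (Suc (Suc i)) k - linear_ext g (bdry F (Suc i) k))" if k: "k < rnk F (Suc (Suc i))" for k
    proof -
      have "linear_ext (bdry F (Suc i)) (linear_ext g (bdry F (Suc i) k))
          = linear_ext (\<lambda>l. \<alpha> (Suc i) l - linear_ext f (bdry F i l)) (bdry F (Suc i) k)"
        unfolding linear_ext_linear_ext
        using g F.chains_keys[OF F.bdry_chains[OF k]] by (intro linear_ext_cong) auto
      also have "\<dots> = linear_ext (\<alpha> (Suc i)) (bdry F (Suc i) k) - linear_ext f (linear_ext (bdry F i) (bdry F (Suc i) k))"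
        by (simp only: linear_ext_linear_ext linear_ext_fun_diff)
      also have "linear_ext (bdry F i) (bdry F (Suc i) k) = 0"
        using F.bdry_cycle[OF k] by (simp add: is_cycle_def)
      finally show ?thesis using \<alpha>(3)[OF k] by (simp add: is_cycle_def linear_ext_diff)
    qed
    thus ?thesis using g by (intro exI[of _ g]) (simp add: Q_def R_def graded_map_def)
  qed
  ultimately obtain h where "\<And>i. Q i (h i)" "\<And>i. R i (h i) (h (Suc i))"
    using dependent_nat_choice[of Q R] by metis
  thus ?thesis using that[of h] by (simp add: Q_def R_def)
qed

text \<open>For a cycle \<open>z\<close> the homotopy shows that \<open>z\<close> minus its round
  trip through \<open>\<phi>\<close> and \<open>\<psi>\<close> is a boundary, and its image under
  \<open>\<phi>\<close> is a boundary by hypothesis. All maps are linear over the polynomial ring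
  and so keep coefficients in \<open>I\<close>.\<close>

lemma tor_vanish_transfer:
  assumes F: "resolves_residue_field X (F :: ('x, 'k::field) free_complex)"
    and F': "resolves_residue_field X F'" and I: "ring_ideal X I"
    and vanish: "tor_cycles F' I i j \<subseteq> tor_boundaries F' I i j"
  shows "tor_cycles F I i j \<subseteq> tor_boundaries F I i j"
proof
  interpret F: residue_resolution X F by unfold_locales (rule F)
  interpret F': residue_resolution X F' by unfold_locales (rule F')
  obtain \<phi> where \<phi>: "\<And>i. graded_map X F F' i i (\<phi> i)" "\<And>k. k < rnk F 0 \<Longrightarrow> augmentation F' (\<phi> 0 k) = aug F k"
    "\<And>i k. k < rnk F (Suc i) \<Longrightarrow> linear_ext (bdry F' i) (\<phi> (Suc i) k) = linear_ext (\<phi> i) (bdry F i k)"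
    using chain_map_exists[OF F F'] by blast
  obtain \<psi> where \<psi>: "\<And>i. graded_map X F' F i i (\<psi> i)" "\<And>k. k < rnk F' 0 \<Longrightarrow> augmentation F (\<psi> 0 k) = aug F' k"
    "\<And>i k. k < rnk F' (Suc i) \<Longrightarrow> linear_ext (bdry F i) (\<psi> (Suc i) k) = linear_ext (\<psi> i) (bdry F' i k)"
    using chain_map_exists[OF F' F] by blast
  have com: "linear_ext (bdry F' i) (linear_ext (\<phi> (Suc i)) v) = linear_ext (\<phi> i) (linear_ext (bdry F i) v)"
    if "v \<in> chains F I' (Suc i)" for i v I'
    unfolding linear_ext_linear_ext using \<phi>(3) F.chains_keys[OF that] by (intro linear_ext_cong) auto
  have com': "linear_ext (bdry F i) (linear_ext (\<psi> (Suc i)) v) = linear_ext (\<psi> i) (linear_ext (bdry F' i) v)"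
    if "v \<in> chains F' I' (Suc i)" for i v I'
    unfolding linear_ext_linear_ext using \<psi>(3) F'.chains_keys[OF that] by (intro linear_ext_cong) auto
  define \<alpha> where "\<alpha> = (\<lambda>i k. single k 1 - linear_ext (\<psi> i) (\<phi> i k))"
  have \<phi>_mem: "\<phi> i k \<in> chains F' (poly_ring X) i" "\<phi> i k \<in> degree_part F' i (bdeg F i k)" if "k < rnk F i" for i k
    using \<phi>(1)[of i] that by (auto simp: graded_map_def)
  have 1: "graded_map X F F i i (\<alpha> i)" for i
    unfolding graded_map_def
  proof (intro allI impI conjI)
    fix k assume k: "k < rnk F i"
    show "\<alpha> i k \<in> chains F (poly_ring X) i" unfolding \<alpha>_def
      by (intro chains_diff[OF ring_ideal_ring] F.basis_chains k graded_mapD(1)[OF \<psi>(1) \<phi>_mem(1) ring_ideal_ring])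
    have "single k 1 \<in> degree_part F i (bdeg F i k)"
      by (auto simp: degree_part_homog lookup_single when_def homog_def)
    thus "\<alpha> i k \<in> degree_part F i (bdeg F i k)" unfolding \<alpha>_def
      by (intro degree_part_diff graded_mapD(2)[OF \<psi>(1) \<phi>_mem(1) ring_ideal_ring] \<phi>_mem k)
  qed
  have 2: "augmentation F (\<alpha> 0 k) = 0" if k: "k < rnk F 0" for k
  proof -
    have "augmentation F (linear_ext (\<psi> 0) (\<phi> 0 k)) = augmentation F' (\<phi> 0 k)"
      unfolding augmentation_linear_ext augmentation_def[of F']
      using \<psi>(2) F'.chains_keys[OF \<phi>_mem(1)[OF k]] by (intro sum.cong) auto
    thus ?thesis using \<phi>(2)[OF k] by (simp add: \<alpha>_def augmentation_diff augmentation_single)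
  qed
  have \<alpha>_ext: "linear_ext (\<alpha> i) v = v - linear_ext (\<psi> i) (linear_ext (\<phi> i) v)" for i v
    unfolding \<alpha>_def linear_ext_fun_diff linear_ext_id by (simp only: linear_ext_linear_ext)
  have 3: "linear_ext (bdry F i) (\<alpha> (Suc i) k) = linear_ext (\<alpha> i) (bdry F i k)" if k: "k < rnk F (Suc i)" for i k
  proof -
    have "linear_ext (bdry F i) (\<alpha> (Suc i) k) = bdry F i k - linear_ext (bdry F i) (linear_ext (\<psi> (Suc i)) (\<phi> (Suc i) k))"
      by (simp add: \<alpha>_def linear_ext_diff linear_ext_single)
    also have "\<dots> = bdry F i k - linear_ext (\<psi> i) (linear_ext (bdry F' i) (\<phi> (Suc i) k))"
      by (simp only: com'[OF \<phi>_mem(1)[OF k]])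
    finally show ?thesis by (simp only: \<phi>(3)[OF k] \<alpha>_ext)
  qed
  obtain h where h: "\<And>i. graded_map X F F i (Suc i) (h i)"
    "\<And>k. k < rnk F 0 \<Longrightarrow> linear_ext (bdry F 0) (h 0 k) = \<alpha> 0 k"
    "\<And>i k. k < rnk F (Suc i) \<Longrightarrow> linear_ext (bdry F (Suc i)) (h (Suc i) k) = \<alpha> (Suc i) k - linear_ext (h i) (bdry F i k)"
    using null_homotopy_exists[OF F 1 2 3] by blast
  fix z assume "z \<in> tor_cycles F I i j"
  hence z: "z \<in> chains F I i" "z \<in> degree_part F i j" "\<And>l. i = Suc l \<Longrightarrow> linear_ext (bdry F l) z = 0"
    by (auto simp: tor_cycles_def split: nat.splits)
  have "linear_ext (bdry F' l) (linear_ext (\<phi> i) z) = 0" if l: "i = Suc l" for l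
    using com[of z I l] z l by simp
  hence "linear_ext (\<phi> i) z \<in> tor_cycles F' I i j"
    using graded_mapD(1)[OF \<phi>(1) z(1) I] graded_mapD(2)[OF \<phi>(1) z(1) I z(2)]
    by (auto simp: tor_cycles_def split: nat.splits)
  then obtain w where w: "w \<in> chains F' I (Suc i)" "w \<in> degree_part F' (Suc i) j"
      "linear_ext (\<phi> i) z = linear_ext (bdry F' i) w"
    using vanish by (auto simp: tor_boundaries_def)
  have hz: "linear_ext (bdry F i) (linear_ext (h i) z) = linear_ext (\<alpha> i) z"
  proof (cases i)
    case 0
    show ?thesis unfolding linear_ext_linear_ext using h(2) F.chains_keys[OF z(1)] 0
      by (intro linear_ext_cong) auto
  next
    case (Suc l)
    have "linear_ext (bdry F (Suc l)) (linear_ext (h (Suc l)) z) =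
        linear_ext (\<lambda>k. \<alpha> (Suc l) k - linear_ext (h l) (bdry F l k)) z"
      unfolding linear_ext_linear_ext using h(3) F.chains_keys[OF z(1)] Suc by (intro linear_ext_cong) auto
    also have "\<dots> = linear_ext (\<alpha> (Suc l)) z - linear_ext (h l) (linear_ext (bdry F l) z)"
      by (simp only: linear_ext_fun_diff linear_ext_linear_ext)
    finally show ?thesis using z(3)[OF Suc] Suc by simp
  qed
  let ?u = "linear_ext (h i) z + linear_ext (\<psi> (Suc i)) w"
  have "linear_ext (bdry F i) ?u = linear_ext (\<alpha> i) z + linear_ext (\<psi> i) (linear_ext (\<phi> i) z)"
    by (simp only: linear_ext_add hz com'[OF w(1)] w(3))
  hence "z = linear_ext (bdry F i) ?u" by (simp add: \<alpha>_ext)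
  moreover have "?u \<in> chains F I (Suc i)"
    by (intro chains_add[OF I] graded_mapD(1)[OF h(1) z(1) I] graded_mapD(1)[OF \<psi>(1) w(1) I])
  moreover have "?u \<in> degree_part F (Suc i) j"
    by (intro degree_part_add graded_mapD(2)[OF h(1) z(1) I z(2)] graded_mapD(2)[OF \<psi>(1) w(1) I w(2)])
  ultimately show "z \<in> tor_boundaries F I i j" unfolding tor_boundaries_def by blast
qed

section \<open>The Koszul complex as a graded free resolution\<close>

context koszul
begin

definition ksubs :: "nat \<Rightarrow> 'x set set" where
  "ksubs i = {W. W \<subseteq> X \<and> card W = i}"

text \<open>Bases in \<open>free_complex\<close> are numbered, so the \<open>i\<close>-subsets are
  enumerated in an arbitrary order; \<open>of_fun\<close> and \<open>to_fun\<close> translate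
  between both descriptions.\<close>

definition kenum :: "nat \<Rightarrow> nat \<Rightarrow> 'x set" where
  "kenum i = (SOME e. bij_betw e {..<card (ksubs i)} (ksubs i))"

definition kidx :: "nat \<Rightarrow> 'x set \<Rightarrow> nat" where
  "kidx i = inv_into {..<card (ksubs i)} (kenum i)"

lemma finite_ksubs [simp]: "finite (ksubs i)"
  unfolding ksubs_def using finX by simp

lemma kenum_bij: "bij_betw (kenum i) {..<card (ksubs i)} (ksubs i)"
proof -
  have "\<exists>e. bij_betw e {..<card (ksubs i)} (ksubs i)"
    using ex_bij_betw_nat_finite[OF finite_ksubs, of i] by (simp add: atLeast0LessThan)
  thus ?thesis unfolding kenum_def by (rule someI_ex)
qed

lemma kenum_in: "k < card (ksubs i) \<Longrightarrow> kenum i k \<in> ksubs i"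
  using kenum_bij[of i] by (auto simp: bij_betw_def)

lemma kidx_less: "W \<in> ksubs i \<Longrightarrow> kidx i W < card (ksubs i)"
  using kenum_bij[of i] unfolding kidx_def by (metis bij_betw_imp_surj_on inv_into_into lessThan_iff)

lemma kenum_kidx: "W \<in> ksubs i \<Longrightarrow> kenum i (kidx i W) = W"
  using kenum_bij[of i] unfolding kidx_def by (metis bij_betw_imp_surj_on f_inv_into_f)

lemma kidx_kenum: "k < card (ksubs i) \<Longrightarrow> kidx i (kenum i k) = k"
  using kenum_bij[of i] unfolding kidx_def by (metis bij_betw_imp_inj_on inv_into_f_f lessThan_iff)

definition of_fun :: "nat \<Rightarrow> ('x set \<Rightarrow> ('x, 'k::field) pol) \<Rightarrow> (nat \<Rightarrow>\<^sub>0 ('x, 'k) pol)" where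
  "of_fun i v = (\<Sum>k<card (ksubs i). single k (v (kenum i k)))"

definition to_fun :: "nat \<Rightarrow> (nat \<Rightarrow>\<^sub>0 ('x, 'k::field) pol) \<Rightarrow> 'x set \<Rightarrow> ('x, 'k) pol" where
  "to_fun i c W = (if W \<in> ksubs i then lookup c (kidx i W) else 0)"

definition kbasis :: "'x set \<Rightarrow> 'x set \<Rightarrow> ('x, 'k::field) pol" where
  "kbasis U W = (if W = U then 1 else 0)"

definition kos :: "('x, 'k::field) free_complex" where
  "kos = \<lparr>rnk = (\<lambda>i. card (ksubs i)), bdeg = (\<lambda>i k. int i),
     bdry = (\<lambda>i k. of_fun i (kbd (kbasis (kenum (Suc i) k)))), aug = (\<lambda>k. 1)\<rparr>"

lemma kos_simps [simp]: "rnk kos i = card (ksubs i)" "bdeg kos i k = int i"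
  "bdry kos i k = of_fun i (kbd (kbasis (kenum (Suc i) k)))" "aug kos k = 1"
  by (simp_all add: kos_def)

lemma lookup_of_fun: "lookup (of_fun i v) k = (if k < card (ksubs i) then v (kenum i k) else 0)"
proof -
  have "lookup (of_fun i v) k = (\<Sum>l<card (ksubs i). if l = k then v (kenum i k) else 0)"
    unfolding of_fun_def lookup_sum by (intro sum.cong) (auto simp: lookup_single)
  thus ?thesis by simp
qed

lemma of_fun_eq_iff:
  assumes "v \<in> kchain i" "w \<in> kchain i" shows "of_fun i v = of_fun i w \<longleftrightarrow> v = w"
proof
  assume eq: "of_fun i v = of_fun i w"
  show "v = w"
  proof
    fix W show "v W = w W"
    proof (cases "W \<in> ksubs i")
      case True
      have "lookup (of_fun i v) (kidx i W) = lookup (of_fun i w) (kidx i W)" using eq by simp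
      thus ?thesis using True by (simp add: lookup_of_fun kidx_less kenum_kidx)
    next
      case False
      thus ?thesis using kchain_0[OF assms(1), of W] kchain_0[OF assms(2), of W] by (simp add: ksubs_def)
    qed
  qed
qed simp

lemma of_fun_chains: "(\<And>W. v W \<in> I) \<Longrightarrow> 0 \<in> I \<Longrightarrow> of_fun i v \<in> chains kos I i"
  by (rule chainsI) (simp_all add: lookup_of_fun)

lemma of_fun_to_fun:
  fixes c :: "nat \<Rightarrow>\<^sub>0 ('x, 'k::field) pol"
  assumes "c \<in> chains kos I i" shows "of_fun i (to_fun i c) = c"
proof (rule poly_mapping_eqI)
  fix k
  have "lookup c k = 0" if "\<not> k < card (ksubs i)" using chains_out[OF assms, of k] that by simp
  thus "lookup (of_fun i (to_fun i c)) k = lookup c k"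
    by (simp add: lookup_of_fun to_fun_def kenum_in kidx_kenum)
qed

lemma to_fun_chain:
  assumes "ring_ideal X I" "c \<in> chains kos I i"
  shows "to_fun i c \<in> kchain i" "to_fun i c W \<in> I"
proof -
  show 1: "to_fun i c W \<in> I" for W
    using chains_lookup[OF assms] ring_ideal_zero[OF assms(1)] by (simp add: to_fun_def)
  have "I \<subseteq> poly_ring X" using assms(1) by (simp add: ring_ideal_def)
  thus "to_fun i c \<in> kchain i"
  proof (intro kchainI)
    show "to_fun i c W \<in> poly_ring X" for W using 1 \<open>I \<subseteq> poly_ring X\<close> by blast
  qed (auto simp: to_fun_def ksubs_def)
qed

lemma chains_cases:
  assumes "ring_ideal X I" "c \<in> chains kos I i"
  obtains v where "c = of_fun i v" "v \<in> kchain i" "\<And>W. v W \<in> I"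
  using of_fun_to_fun[OF assms(2)] to_fun_chain[OF assms] that by metis

lemma of_fun_degree:
  assumes "v \<in> kchain i" shows "of_fun i v \<in> degree_part kos i j \<longleftrightarrow> khom (j - int i) v"
proof
  assume a: "of_fun i v \<in> degree_part kos i j"
  show "khom (j - int i) v" unfolding khom_def
  proof
    fix W show "homog (j - int i) (v W)"
    proof (cases "W \<in> ksubs i")
      case True
      have "homog (j - int i) (lookup (of_fun i v) (kidx i W))" using a by (simp add: degree_part_homog)
      thus ?thesis using True by (simp add: lookup_of_fun kidx_less kenum_kidx)
    next
      case False
      thus ?thesis using kchain_0[OF assms, of W] by (simp add: ksubs_def)
    qed
  qed
qed (simp add: degree_part_homog lookup_of_fun khom_def)

lemma kbd_kbasis:
  assumes v: "v \<in> kchain (Suc i)"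
  shows "kbd v W = (\<Sum>U\<in>ksubs (Suc i). v U * kbd (kbasis U) W)"
proof -
  have "(\<Sum>U\<in>ksubs (Suc i). v U * kbd (kbasis U) W)
      = (\<Sum>x\<in>X - W. \<Sum>U\<in>ksubs (Suc i). v U * (ksign x W * (indet x * kbasis U (insert x W))))"
    unfolding kbd_def sum_distrib_left by (rule sum.swap)
  also have "\<dots> = (\<Sum>x\<in>X - W. ksign x W * (indet x * v (insert x W)))"
  proof (rule sum.cong[OF refl])
    fix x
    have "(\<Sum>U\<in>ksubs (Suc i). v U * (ksign x W * (indet x * kbasis U (insert x W))))
       = (\<Sum>U\<in>ksubs (Suc i). if insert x W = U then ksign x W * (indet x * v (insert x W)) else 0)"
      by (intro sum.cong) (auto simp: kbasis_def algebra_simps)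
    also have "\<dots> = ksign x W * (indet x * v (insert x W))"
      using kchain_0[OF v, of "insert x W"] by (simp add: ksubs_def[of "Suc i"] finX)
    finally show "(\<Sum>U\<in>ksubs (Suc i). v U * (ksign x W * (indet x * kbasis U (insert x W))))
       = ksign x W * (indet x * v (insert x W))" .
  qed
  finally show ?thesis by (simp add: kbd_def)
qed

lemma kos_bdry:
  assumes v: "v \<in> kchain (Suc i)"
  shows "linear_ext (bdry kos i) (of_fun (Suc i) v) = of_fun i (kbd v)"
proof (rule poly_mapping_eqI)
  fix k
  have "keys (of_fun (Suc i) v) \<subseteq> {..<card (ksubs (Suc i))}"
    by (auto simp: in_keys_iff lookup_of_fun split: if_splits)
  hence "lookup (linear_ext (bdry kos i) (of_fun (Suc i) v)) k =
      (\<Sum>l<card (ksubs (Suc i)). v (kenum (Suc i) l) * lookup (of_fun i (kbd (kbasis (kenum (Suc i) l)))) k)"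
    by (subst linear_ext_superset[of "{..<card (ksubs (Suc i))}"])
      (simp_all add: lookup_sum lookup_vsmult lookup_of_fun[of "Suc i"])
  also have "\<dots> = (\<Sum>U\<in>ksubs (Suc i). v U * lookup (of_fun i (kbd (kbasis U))) k)"
    by (rule sum.reindex_bij_betw[OF kenum_bij])
  also have "\<dots> = lookup (of_fun i (kbd v)) k"
    by (simp add: lookup_of_fun kbd_kbasis[OF v])
  finally show "lookup (linear_ext (bdry kos i) (of_fun (Suc i) v)) k = lookup (of_fun i (kbd v)) k" .
qed

lemma ksubs_0: "ksubs 0 = {{}}"
  unfolding ksubs_def using finite_sub by auto

lemma kos_aug: "augmentation kos (of_fun 0 v) = lookup (v {}) 0"
proof -
  have c: "card (ksubs 0) = 1" by (simp add: ksubs_0)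
  have e: "kenum 0 0 = {}" using kenum_in[of 0 0] c by (simp add: ksubs_0)
  have "of_fun 0 v = single 0 (v {})" unfolding of_fun_def using c e by simp
  thus ?thesis by (simp add: augmentation_single)
qed

lemma kbasis_in: "U \<in> ksubs i \<Longrightarrow> kbasis U \<in> kchain i"
  by (rule kchainI) (auto simp: kbasis_def ksubs_def)

text \<open>Exactness is \<open>kbd_exact\<close>. The lemma also shows that a resolution exists, so
  that the choice in \<open>graded_betti\<close> picks an actual resolution.\<close>

lemma kos_resolves: "resolves_residue_field X (kos :: ('x, 'k::field) free_complex)"
  unfolding resolves_residue_field_def
proof (intro conjI allI impI)
  let ?S = "poly_ring X :: ('x, 'k) pol set"
  note ring = ring_ideal_ring[of X, where 'b = 'k]
  fix i k assume "k < rnk (kos :: ('x, 'k) free_complex) (Suc i)"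
  hence "kenum (Suc i) k \<in> ksubs (Suc i)" by (simp add: kenum_in)
  hence b: "(kbasis (kenum (Suc i) k) :: _ \<Rightarrow> ('x, 'k) pol) \<in> kchain (Suc i)" by (rule kbasis_in)
  have "khom 0 (kbasis (kenum (Suc i) k) :: _ \<Rightarrow> ('x, 'k) pol)"
    by (auto simp: khom_def kbasis_def homog_def)
  from khom_kbd[OF this] have "khom 1 (kbd (kbasis (kenum (Suc i) k)) :: _ \<Rightarrow> ('x, 'k) pol)" by simp
  thus "bdry kos i k \<in> chains kos ?S i \<inter> degree_part kos i (bdeg kos (Suc i) k)"
    using kbd_in[OF b] by (simp add: of_fun_degree of_fun_chains kchainD(1))
next
  let ?S = "poly_ring X :: ('x, 'k) pol set"
  show "augmentation kos ` chains kos ?S 0 = UNIV"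
  proof (intro set_eqI iffI)
    fix c :: 'k
    have "augmentation kos (of_fun 0 (\<lambda>_. const c)) = c" by (simp add: kos_aug const_def)
    moreover have "of_fun 0 (\<lambda>_. const c) \<in> chains kos ?S 0"
      by (rule of_fun_chains) (simp_all add: const_def poly_ring_single)
    ultimately show "c \<in> augmentation kos ` chains kos ?S 0" by (metis imageI)
  qed simp
next
  let ?S = "poly_ring X :: ('x, 'k) pol set"
  have ring: "ring_ideal X ?S" by (rule ring_ideal_ring)
  show "{v \<in> chains kos ?S 0. augmentation kos v = 0} = linear_ext (bdry kos 0) ` chains kos ?S 1"
  proof (intro equalityI subsetI)
    fix c assume "c \<in> {v \<in> chains kos ?S 0. augmentation kos v = 0}"
    hence c: "c \<in> chains kos ?S 0" "augmentation kos c = 0" by auto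
    obtain v where v: "c = of_fun 0 v" "v \<in> kchain 0" using chains_cases[OF ring c(1)] by blast
    have "lookup (v {}) 0 = 0" using c(2) v(1) by (simp add: kos_aug)
    hence "kbd (kcontract v) = v" using kbd_0[OF v(2)] by (intro kbd_exact[OF v(2)]) simp_all
    moreover have kc: "kcontract v \<in> kchain (Suc 0)" by (rule kcontract_in[OF v(2)])
    ultimately have "c = linear_ext (bdry kos 0) (of_fun (Suc 0) (kcontract v))"
      using kos_bdry[OF kc] v(1) by simp
    moreover have "of_fun (Suc 0) (kcontract v) \<in> chains kos ?S 1"
      unfolding One_nat_def by (rule of_fun_chains) (simp_all add: kchainD(1)[OF kc])
    ultimately show "c \<in> linear_ext (bdry kos 0) ` chains kos ?S 1" by blast
  next
    fix c assume "c \<in> linear_ext (bdry kos 0) ` chains kos ?S 1"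
    then obtain u where u: "u \<in> chains kos ?S (Suc 0)" "c = linear_ext (bdry kos 0) u" by auto
    obtain v where v: "u = of_fun (Suc 0) v" "v \<in> kchain (Suc 0)" using chains_cases[OF ring u(1)] by blast
    have c: "c = of_fun 0 (kbd v)" using u v kos_bdry by simp
    have "single x (Suc 0) = (0 :: 'x \<Rightarrow>\<^sub>0 nat) \<longleftrightarrow> False" for x
      using total_deg_eq_0_iff[of "single x (Suc 0)"] by simp
    hence "lookup (indet x :: ('x, 'k) pol) 0 = 0" for x by (simp add: indet_def lookup_single)
    hence "lookup (kbd v {}) 0 = 0" by (simp add: kbd_def lookup_sum lookup_mult_0)
    hence "augmentation kos c = 0" by (simp add: c kos_aug)
    moreover have "c \<in> chains kos ?S 0" unfolding c
      by (rule of_fun_chains) (simp_all add: kchainD(1)[OF kbd_in[OF v(2)]])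
    ultimately show "c \<in> {v \<in> chains kos ?S 0. augmentation kos v = 0}" by simp
  qed
  show "{v \<in> chains kos ?S (Suc i). linear_ext (bdry kos i) v = 0} = linear_ext (bdry kos (Suc i)) ` chains kos ?S (Suc (Suc i))" for i
  proof (intro equalityI subsetI)
    fix c assume "c \<in> {v \<in> chains kos ?S (Suc i). linear_ext (bdry kos i) v = 0}"
    hence c: "c \<in> chains kos ?S (Suc i)" "linear_ext (bdry kos i) c = 0" by auto
    obtain v where v: "c = of_fun (Suc i) v" "v \<in> kchain (Suc i)" using chains_cases[OF ring c(1)] by blast
    have z: "(\<lambda>_. 0) \<in> kchain i" by (rule kchainI) simp_all
    have "of_fun i (kbd v) = of_fun i (\<lambda>_. 0)"
      using c(2) v kos_bdry[OF v(2)] by (simp add: of_fun_def)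
    hence "kbd v = (\<lambda>_. 0)" using of_fun_eq_iff[OF kbd_in[OF v(2)] z] by blast
    hence "kbd (kcontract v) = v" by (intro kbd_exact[OF v(2)]) simp_all
    moreover have kc: "kcontract v \<in> kchain (Suc (Suc i))" by (rule kcontract_in[OF v(2)])
    ultimately have "c = linear_ext (bdry kos (Suc i)) (of_fun (Suc (Suc i)) (kcontract v))"
      using kos_bdry[OF kc] v(1) by simp
    moreover have "of_fun (Suc (Suc i)) (kcontract v) \<in> chains kos ?S (Suc (Suc i))"
      by (rule of_fun_chains) (simp_all add: kchainD(1)[OF kc])
    ultimately show "c \<in> linear_ext (bdry kos (Suc i)) ` chains kos ?S (Suc (Suc i))" by blast
  next
    fix c assume "c \<in> linear_ext (bdry kos (Suc i)) ` chains kos ?S (Suc (Suc i))"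
    then obtain u where u: "u \<in> chains kos ?S (Suc (Suc i))" "c = linear_ext (bdry kos (Suc i)) u" by auto
    obtain v where v: "u = of_fun (Suc (Suc i)) v" "v \<in> kchain (Suc (Suc i))" using chains_cases[OF ring u(1)] by blast
    have c: "c = of_fun (Suc i) (kbd v)" using u v kos_bdry by simp
    have "kbd (kbd v) = (\<lambda>_. 0)" using kbd_kbd[OF v(2)] by blast
    hence "linear_ext (bdry kos i) c = 0"
      unfolding c kos_bdry[OF kbd_in[OF v(2)]] by (simp add: of_fun_def)
    moreover have "c \<in> chains kos ?S (Suc i)" unfolding c
      by (rule of_fun_chains) (simp_all add: kchainD(1)[OF kbd_in[OF v(2)]])
    ultimately show "c \<in> {v \<in> chains kos ?S (Suc i). linear_ext (bdry kos i) v = 0}" by simp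
  qed
qed simp

text \<open>Vanishing of \<open>Tor\<^sub>i(\<K>, I)\<close> in degree \<open>i + j\<close>. In
  contrast to \<open>tor_vanish\<close>, which concerns the quotient, all coefficients lie in the
  ideal and the equalities are exact.\<close>

definition ktor_zero :: "('x, 'k::field) pol set \<Rightarrow> nat \<Rightarrow> int \<Rightarrow> bool" where
  "ktor_zero I i j \<longleftrightarrow> (\<forall>v\<in>kchain i. khom j v \<longrightarrow> (\<forall>W. v W \<in> I) \<longrightarrow> (\<forall>W. kbd v W = 0) \<longrightarrow>
     (\<exists>u\<in>kchain (Suc i). khom (j - 1) u \<and> (\<forall>W. u W \<in> I) \<and> kbd u = v))"

lemma ktor_zero_iff:
  assumes I: "ring_ideal X (I :: ('x, 'k::field) pol set)"
  shows "tor_cycles kos I i (int i + j) \<subseteq> tor_boundaries kos I i (int i + j) \<longleftrightarrow> ktor_zero I i j"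
proof -
  have sub: "I \<subseteq> poly_ring X" using I by (simp add: ring_ideal_def)
  have cyc: "of_fun i v \<in> tor_cycles kos I i (int i + j) \<longleftrightarrow> khom j v \<and> (\<forall>W. kbd v W = 0)"
    if v: "v \<in> kchain i" "\<And>W. v W \<in> I" for v
  proof -
    have "(case i of 0 \<Rightarrow> True | Suc l \<Rightarrow> linear_ext (bdry kos l) (of_fun i v) = 0) \<longleftrightarrow> (\<forall>W. kbd v W = 0)"
    proof (cases i)
      case 0 thus ?thesis using kbd_0[of v] v(1) by simp
    next
      case (Suc l)
      have z: "(\<lambda>_. 0) \<in> kchain l" by (rule kchainI) simp_all
      have vl: "v \<in> kchain (Suc l)" using v(1) Suc by simp
      have "linear_ext (bdry kos l) (of_fun i v) = 0 \<longleftrightarrow> of_fun l (kbd v) = of_fun l (\<lambda>_. 0)"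
        using kos_bdry[OF vl] Suc by (simp add: of_fun_def[of l "\<lambda>_. 0"])
      also have "\<dots> \<longleftrightarrow> kbd v = (\<lambda>_. 0)" by (rule of_fun_eq_iff[OF kbd_in[OF vl] z])
      finally show ?thesis using Suc by (simp add: fun_eq_iff)
    qed
    thus ?thesis using of_fun_chains[of v I i] v ring_ideal_zero[OF I]
      by (simp add: tor_cycles_def of_fun_degree)
  qed
  have bdy: "of_fun i v \<in> tor_boundaries kos I i (int i + j) \<longleftrightarrow>
      (\<exists>u\<in>kchain (Suc i). khom (j - 1) u \<and> (\<forall>W. u W \<in> I) \<and> kbd u = v)" if v: "v \<in> kchain i" for v
  proof
    assume "of_fun i v \<in> tor_boundaries kos I i (int i + j)"
    then obtain c where c: "c \<in> chains kos I (Suc i)" "c \<in> degree_part kos (Suc i) (int i + j)"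
        "of_fun i v = linear_ext (bdry kos i) c" by (auto simp: tor_boundaries_def)
    obtain u where u: "c = of_fun (Suc i) u" "u \<in> kchain (Suc i)" "\<And>W. u W \<in> I"
      using chains_cases[OF I c(1)] by blast
    have "of_fun i v = of_fun i (kbd u)" using c(3) u kos_bdry by simp
    hence "kbd u = v" using of_fun_eq_iff[OF v kbd_in[OF u(2)]] by simp
    moreover have "khom (j - 1) u" using c(2) u(1) of_fun_degree[OF u(2), of "int i + j"] by simp
    ultimately show "\<exists>u\<in>kchain (Suc i). khom (j - 1) u \<and> (\<forall>W. u W \<in> I) \<and> kbd u = v" using u by blast
  next
    assume "\<exists>u\<in>kchain (Suc i). khom (j - 1) u \<and> (\<forall>W. u W \<in> I) \<and> kbd u = v"
    then obtain u where u: "u \<in> kchain (Suc i)" "khom (j - 1) u" "\<And>W. u W \<in> I" "kbd u = v" by blast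
    have "of_fun (Suc i) u \<in> degree_part kos (Suc i) (int i + j)"
      using of_fun_degree[OF u(1), of "int i + j"] u(2) by simp
    moreover have "of_fun (Suc i) u \<in> chains kos I (Suc i)"
      by (rule of_fun_chains) (use u ring_ideal_zero[OF I] in auto)
    moreover have "of_fun i v = linear_ext (bdry kos i) (of_fun (Suc i) u)" using kos_bdry[OF u(1)] u(4) by simp
    ultimately show "of_fun i v \<in> tor_boundaries kos I i (int i + j)" unfolding tor_boundaries_def by blast
  qed
  show ?thesis
  proof
    assume a: "tor_cycles kos I i (int i + j) \<subseteq> tor_boundaries kos I i (int i + j)"
    show "ktor_zero I i j" unfolding ktor_zero_def
    proof (intro ballI impI)
      fix v assume "v \<in> kchain i" "khom j v" "\<forall>W. v W \<in> I" "\<forall>W. kbd v W = 0"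
      thus "\<exists>u\<in>kchain (Suc i). khom (j - 1) u \<and> (\<forall>W. u W \<in> I) \<and> kbd u = v"
        using a cyc[of v] bdy[of v] by blast
    qed
  next
    assume a: "ktor_zero I i j"
    show "tor_cycles kos I i (int i + j) \<subseteq> tor_boundaries kos I i (int i + j)"
    proof
      fix c assume c: "c \<in> tor_cycles kos I i (int i + j)"
      hence "c \<in> chains kos I i" by (simp add: tor_cycles_def)
      then obtain v where v: "c = of_fun i v" "v \<in> kchain i" "\<And>W. v W \<in> I" using chains_cases[OF I] by blast
      hence "khom j v \<and> (\<forall>W. kbd v W = 0)" using c cyc[OF v(2,3)] by blast
      thus "c \<in> tor_boundaries kos I i (int i + j)"
        using a v bdy[OF v(2)] unfolding ktor_zero_def by blast
    qed
  qed
qed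

end

section \<open>Vanishing of graded Betti numbers\<close>

lemma kscale_chains: "ring_ideal X I \<Longrightarrow> v \<in> chains F I i \<Longrightarrow> kscale c v \<in> chains F I i"
proof (rule chainsI)
  assume I: "ring_ideal X I" and v: "v \<in> chains F I i"
  show "lookup (kscale c v) k = 0" if "\<not> k < rnk F i" for k
    using chains_out[OF v that] by (simp add: lookup_kscale)
  have "const c \<in> poly_ring X" by (simp add: const_def poly_ring_single)
  thus "lookup (kscale c v) k \<in> I" for k
    unfolding lookup_kscale by (intro ring_ideal_mult[OF I] chains_lookup[OF I v])
qed

lemma kscale_degree:
  fixes v :: "nat \<Rightarrow>\<^sub>0 ('x, 'k::field) pol"
  assumes "v \<in> degree_part F i j" shows "kscale c v \<in> degree_part F i j"
proof -
  have "homog 0 (const c :: ('x, 'k) pol)" by (auto simp: homog_def const_def)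
  hence "homog (j - bdeg F i k) (const c * lookup v k)" for k
    using homog_mult[of 0 "const c" "j - bdeg F i k" "lookup v k"] assms by (simp add: degree_part_homog)
  thus ?thesis by (simp add: degree_part_homog lookup_kscale)
qed

lemma linear_ext_kscale: "linear_ext d (kscale c v) = kscale c (linear_ext d v)"
  by (simp add: kscale_def linear_ext_vsmult)

lemma subspace_tor_boundaries:
  assumes I: "ring_ideal X I" shows "kvec.subspace (tor_boundaries F I i j)"
  unfolding kvec.subspace_def tor_boundaries_def
proof (intro conjI ballI allI)
  let ?C = "chains F I (Suc i) \<inter> degree_part F (Suc i) j"
  have "0 \<in> ?C" using chains_zero[OF I] by (simp add: degree_part_homog)
  thus "0 \<in> linear_ext (bdry F i) ` ?C" by (metis imageI linear_ext_zero)
  fix x assume x: "x \<in> linear_ext (bdry F i) ` ?C"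
  then obtain a where a: "a \<in> ?C" "x = linear_ext (bdry F i) a" by blast
  show "kscale c x \<in> linear_ext (bdry F i) ` ?C" for c
  proof -
    have "kscale c a \<in> ?C" using a(1) kscale_chains[OF I, of a F "Suc i" c] kscale_degree[of a F "Suc i" j c] by blast
    thus ?thesis unfolding a(2) linear_ext_kscale[symmetric] by (rule imageI)
  qed
  fix y assume "y \<in> linear_ext (bdry F i) ` ?C"
  then obtain b where b: "b \<in> ?C" "y = linear_ext (bdry F i) b" by blast
  have "a + b \<in> ?C" using a b chains_add[OF I] degree_part_add by blast
  thus "x + y \<in> linear_ext (bdry F i) ` ?C" using a b by (metis imageI linear_ext_add)
qed

text \<open>A strand is spanned by the finitely many monomials of the right degree on each basis
  element. An infinite basis would have cardinality 0 and spoil the difference of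
  dimensions.\<close>

lemma finite_dim_strand:
  assumes X: "finite X" and I: "ring_ideal X (I :: ('x, 'k::field) pol set)"
  obtains T where "finite T" "chains F I i \<inter> degree_part F i j \<subseteq> kvec.span T"
proof -
  let ?M = "\<lambda>k. {m \<in> mons X. total_deg m = nat (j - bdeg F i k)}"
  let ?T = "(\<Union>k<rnk F i. (\<lambda>m. single k (single m (1::'k))) ` ?M k)"
  have "finite ?T" using finite_mons_deg[OF X] by blast
  moreover have "v \<in> kvec.span ?T" if v: "v \<in> chains F I i" "v \<in> degree_part F i j" for v
  proof -
    have "v = (\<Sum>k\<in>keys v. single k (lookup v k))" by (rule pol_expand)
    also have "\<dots> = (\<Sum>k\<in>keys v. \<Sum>m\<in>keys (lookup v k). single k (single m (lookup (lookup v k) m)))"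
    proof (rule sum.cong[OF refl])
      fix k :: nat
      have "single k (\<Sum>m\<in>A. f m) = (\<Sum>m\<in>A. single k (f m))" for A and f :: "('x \<Rightarrow>\<^sub>0 nat) \<Rightarrow> ('x, 'k) pol"
        by (induction A rule: infinite_finite_induct) (simp_all add: single_add)
      thus "single k (lookup v k) = (\<Sum>m\<in>keys (lookup v k). single k (single m (lookup (lookup v k) m)))"
        using pol_expand[of "lookup v k"] by metis
    qed
    also have "\<dots> = (\<Sum>k\<in>keys v. \<Sum>m\<in>keys (lookup v k). kscale (lookup (lookup v k) m) (single k (single m 1)))"
    proof (intro sum.cong refl)
      show "single k (single m c) = kscale c (single k (single m 1))" for k m and c :: 'k
        by (rule poly_mapping_eqI) (simp add: lookup_kscale lookup_single when_def const_def mult_single)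
    qed
    also have "\<dots> \<in> kvec.span ?T"
    proof (intro kvec.span_sum kvec.span_scale kvec.span_base)
      fix k m assume k: "k \<in> keys v" and m: "m \<in> keys (lookup v k)"
      have "k < rnk F i" using k v(1) by (auto simp: chains_def)
      moreover have "lookup v k \<in> poly_ring X"
        using chains_lookup[OF I v(1)] I by (auto simp: ring_ideal_def)
      hence "m \<in> mons X" using m by (auto simp: poly_ring_mons)
      moreover have "total_deg m = nat (j - bdeg F i k)"
        using v(2) m unfolding degree_part_homog homog_def by (metis (mono_tags, lifting) mem_Collect_eq nat_int)
      ultimately show "single k (single m 1) \<in> ?T" by blast
    qed
    finally show ?thesis .
  qed
  ultimately show ?thesis using that by blast
qed

text \<open>The truncated difference vanishes iff the dimension of \<open>C\<close> is at most that
  of \<open>B\<close>. A vector of \<open>C\<close> outside \<open>B\<close> would then extend a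
  basis of \<open>B\<close> to an independent set that is too large for the span of
  \<open>C\<close>.\<close>

lemma dim_diff_zero_iff:
  assumes BC: "B \<subseteq> C" and B: "kvec.subspace B" and T: "finite T" "C \<subseteq> kvec.span T"
  shows "kvec.dim C - kvec.dim B = 0 \<longleftrightarrow> C \<subseteq> B"
proof
  assume d: "kvec.dim C - kvec.dim B = 0"
  obtain P where P: "P \<subseteq> B" "kvec.independent P" "B \<subseteq> kvec.span P" "card P = kvec.dim B"
    using kvec.basis_exists[of B] by blast
  obtain Q where Q: "Q \<subseteq> C" "kvec.independent Q" "C \<subseteq> kvec.span Q" "card Q = kvec.dim C"
    using kvec.basis_exists[of C] by blast
  have finQ: "finite Q" using kvec.independent_span_bound[OF T(1) Q(2)] Q(1) T(2) by blast
  have finP: "finite P" using kvec.independent_span_bound[OF T(1) P(2)] P(1) BC T(2) by blast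
  show "C \<subseteq> B"
  proof
    fix z assume z: "z \<in> C"
    have "z \<in> kvec.span P"
    proof (rule ccontr)
      assume n: "z \<notin> kvec.span P"
      hence "kvec.independent (insert z P)" using P(2) by (simp add: kvec.independent_insert)
      moreover have "insert z P \<subseteq> kvec.span Q" using z P(1) BC Q(3) by blast
      ultimately have "card (insert z P) \<le> card Q" using kvec.independent_span_bound[OF finQ] by blast
      moreover have "z \<notin> P" using n kvec.span_base by blast
      ultimately show False using d P(4) Q(4) finP by simp
    qed
    moreover have "kvec.span P \<subseteq> B" using P(1) B by (rule kvec.span_minimal)
    ultimately show "z \<in> B" by blast
  qed
next
  assume "C \<subseteq> B" hence "C = B" using BC by blast
  thus "kvec.dim C - kvec.dim B = 0" by simp
qed

section \<open>Betti numbers of an ideal and Tor modules of its quotient\<close>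

context koszul
begin

text \<open>The chosen resolution is unknown; vanishing is transferred to the Koszul complex and
  back.\<close>

lemma graded_betti_zero_iff:
  assumes I: "ring_ideal X (I :: ('x, 'k::field) pol set)"
  shows "graded_betti X I i (int i + j) = 0 \<longleftrightarrow> ktor_zero I i j"
proof -
  define F :: "('x, 'k) free_complex" where "F = (SOME F. resolves_residue_field X F)"
  have F: "resolves_residue_field X F" unfolding F_def using kos_resolves by (rule someI)
  interpret F: residue_resolution X F by unfold_locales (rule F)
  have sub: "I \<subseteq> poly_ring X" using I by (simp add: ring_ideal_def)
  let ?j = "int i + j"
  obtain T where T: "finite T" "chains F I i \<inter> degree_part F i ?j \<subseteq> kvec.span T"
    using finite_dim_strand[OF finX I] by blast
  have "tor_boundaries F I i ?j \<subseteq> tor_cycles F I i ?j"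
  proof
    fix w assume "w \<in> tor_boundaries F I i ?j"
    then obtain u where u: "u \<in> chains F I (Suc i)" "u \<in> degree_part F (Suc i) ?j" "w = linear_ext (bdry F i) u"
      by (auto simp: tor_boundaries_def)
    have "is_cycle F i w" using F.bd_cycle chains_mono[OF sub] u by blast
    thus "w \<in> tor_cycles F I i ?j" using F.bd_chains[OF I u(1)] F.bd_degree[OF u(1,2)] u(3)
      by (auto simp: tor_cycles_def is_cycle_def split: nat.splits)
  qed
  hence "graded_betti X I i ?j = 0 \<longleftrightarrow> tor_cycles F I i ?j \<subseteq> tor_boundaries F I i ?j"
    unfolding graded_betti_def F_def[symmetric] Let_def
    by (rule dim_diff_zero_iff[OF _ subspace_tor_boundaries[OF I] T(1)]) (use T(2) in \<open>auto simp: tor_cycles_def\<close>)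
  also have "\<dots> \<longleftrightarrow> tor_cycles kos I i ?j \<subseteq> tor_boundaries kos I i ?j"
    using tor_vanish_transfer[OF F kos_resolves I] tor_vanish_transfer[OF kos_resolves F I] by blast
  finally show ?thesis using ktor_zero_iff[OF I] by simp
qed

text \<open>Below degree \<open>d\<close> the ideal has no homogeneous elements. Above it a
  dimension shift works: a cycle with coefficients in \<open>I\<close> is the boundary of a Koszul
  chain, which is a cycle modulo \<open>I\<close> one homological degree higher, and the regularity
  bound corrects it to a chain with coefficients in \<open>I\<close>.\<close>

lemma has_linear_resolutionI:
  assumes I: "ring_ideal X (I :: ('x, 'k::field) pol set)" and ne: "I \<noteq> {0}" and d: "1 \<le> d"
    and low: "\<And>c p. p \<in> I \<Longrightarrow> homog c p \<Longrightarrow> c < int d \<Longrightarrow> p = 0" and reg: "quot_reg (d - 1) I"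
  shows "has_linear_resolution X I d"
proof -
  have "ktor_zero I i j" if j: "j \<noteq> int d" for i j
    unfolding ktor_zero_def
  proof (intro ballI impI)
    fix v :: "'x set \<Rightarrow> ('x, 'k) pol"
    assume v: "v \<in> kchain i" "khom j v" "\<forall>W. v W \<in> I" "\<forall>W. kbd v W = 0"
    show "\<exists>u\<in>kchain (Suc i). khom (j - 1) u \<and> (\<forall>W. u W \<in> I) \<and> kbd u = v"
    proof (cases "j < int d")
      case True
      have "v W = 0" for W using low[of "v W" j] v True by (simp add: khom_def)
      hence "v = (\<lambda>_. 0)" by blast
      moreover have "(\<lambda>_. 0) \<in> kchain (Suc i)" by (rule kchainI) simp_all
      ultimately show ?thesis using ring_ideal_zero[OF I] by (intro bexI[of _ "\<lambda>_. 0"]) (simp_all add: khom_def)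
    next
      case False
      hence jd: "int d < j" using j by simp
      \<comment> \<open>For \<open>i = 0\<close> exactness requires a vanishing constant term; here
        the coefficients have positive degree \<open>j\<close>.\<close>
      have "lookup (v {}) 0 = 0"
      proof (rule ccontr)
        assume "lookup (v {}) 0 \<noteq> 0"
        hence "0 \<in> keys (v {})" by (simp add: in_keys_iff)
        hence "int (total_deg (0 :: 'x \<Rightarrow>\<^sub>0 nat)) = j" using v(2) unfolding khom_def homog_def by blast
        thus False using jd by simp
      qed
      hence k: "kbd (kcontract v) = v" using v by (intro kbd_exact[OF v(1)]) simp_all
      have kc: "kcontract v \<in> kchain (Suc i)" "khom (j - 1) (kcontract v)"
        using kcontract_in[OF v(1)] khom_kcontract[OF v(2)] .
      have "tor_vanish (Suc i) (j - 1) I" using reg jd d by (simp add: quot_reg_def of_nat_diff)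
      then obtain u where u: "u \<in> kchain (Suc (Suc i))" "khom (j - 1 - 1) u" "\<And>W. kcontract v W - kbd u W \<in> I"
        using kc v(3) k unfolding tor_vanish_def by metis
      let ?a = "\<lambda>W. kcontract v W - kbd u W"
      have "?a \<in> kchain (Suc i)" by (rule kchain_diff[OF kc(1) kbd_in[OF u(1)]])
      moreover have "khom (j - 1) (kbd u)" using khom_kbd[OF u(2)] by simp
      hence "khom (j - 1) ?a" by (rule khom_diff[OF kc(2)])
      moreover have "kbd ?a = v" by (rule ext) (simp add: kbd_diff k kbd_kbd[OF u(1)])
      ultimately show ?thesis using u(3) by blast
    qed
  qed
  thus ?thesis using ne graded_betti_zero_iff[OF I] by (simp add: has_linear_resolution_def)
qed

text \<open>The dimension shift backwards: \<open>Tor\<close> of the quotient in homological degree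
  \<open>i + 1\<close> is that of the ideal in homological degree \<open>i\<close>, with the
  coefficient degree raised by one. Hence a non-zero class of coefficient degree \<open>c\<close>
  forces \<open>d = c + 1\<close>.\<close>

lemma has_linear_resolutionD:
  assumes I: "ring_ideal X (I :: ('x, 'k::field) pol set)" and lin: "has_linear_resolution X I d"
    and c: "c + 1 \<noteq> int d"
  shows "tor_vanish (Suc i) c I"
  unfolding tor_vanish_def
proof (intro ballI impI)
  fix v :: "'x set \<Rightarrow> ('x, 'k) pol"
  assume v: "v \<in> kchain (Suc i)" "khom c v" "\<forall>W. kbd v W \<in> I"
  have "ktor_zero I i (c + 1)" using lin c graded_betti_zero_iff[OF I] by (simp add: has_linear_resolution_def)
  then obtain u where u: "u \<in> kchain (Suc i)" "khom (c + 1 - 1) u" "\<And>W. u W \<in> I" "kbd u = kbd v"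
    using kbd_in[OF v(1)] khom_kbd[OF v(2)] v(3) kbd_kbd[OF v(1)] unfolding ktor_zero_def by metis
  let ?a = "\<lambda>W. v W - u W"
  have a: "?a \<in> kchain (Suc i)" by (rule kchain_diff[OF v(1) u(1)])
  have "khom c ?a" using khom_diff[OF v(2), of u] u(2) by simp
  hence "khom (c - 1) (kcontract ?a)" by (rule khom_kcontract)
  moreover have "kbd (kcontract ?a) = ?a" by (rule kbd_exact[OF a]) (simp_all add: kbd_diff u(4))
  ultimately show "\<exists>w\<in>kchain (Suc (Suc i)). khom (c - 1) w \<and> (\<forall>W. v W - kbd w W \<in> I)"
    using kcontract_in[OF a] u(3) by (intro bexI[of _ "kcontract ?a"]) simp_all
qed

end

section \<open>Non-vanishing of graded Tor modules\<close>

context koszul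
begin

text \<open>The integer copy of \<open>ksign\<close>. Certificates are computed in
  \<open>int\<close> and mapped to the field only at the end, which makes them independent of the
  characteristic.\<close>

definition isign :: "'x \<Rightarrow> 'x set \<Rightarrow> int" where
  "isign x U = (-1) ^ card {u \<in> U. rk u < rk x}"

lemma ksign_single: "ksign x U * single m a = single m (of_int (isign x U) * a)"
proof -
  have "(-1) ^ n * single m a = single m ((-1) ^ n * a)" for n
    by (induction n) (simp_all add: single_uminus)
  thus ?thesis by (simp add: ksign_def isign_def)
qed

lemma fsum_ksign: "fsum \<mu> b (ksign x U * p) = of_int (isign x U) * fsum \<mu> b p"
  by (simp add: ksign_def isign_def fsum_sgn)

text \<open>Pairs of a set and a further element are regrouped by their union. This turns the
  pairing with a boundary into the pairing with a coboundary.\<close>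

lemma ksubs_sum_swap:
  "(\<Sum>W | W \<subseteq> X \<and> card W = i. \<Sum>x\<in>X - W. f W x) = (\<Sum>U | U \<subseteq> X \<and> card U = Suc i. \<Sum>x\<in>U. f (U - {x}) x)"
proof -
  have fin: "finite {W. W \<subseteq> X \<and> card W = j}" for j using finX by simp
  have "(\<Sum>W | W \<subseteq> X \<and> card W = i. \<Sum>x\<in>X - W. f W x) = (\<Sum>(W, x)\<in>(SIGMA W:{W. W \<subseteq> X \<and> card W = i}. X - W). f W x)"
    by (rule sum.Sigma) (use finX in auto)
  also have "\<dots> = (\<Sum>(U, x)\<in>(SIGMA U:{U. U \<subseteq> X \<and> card U = Suc i}. U). f (U - {x}) x)"
  proof (rule sum.reindex_bij_witness[of _ "\<lambda>(U, x). (U - {x}, x)" "\<lambda>(W, x). (insert x W, x)"], goal_cases)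
    case (1 a) thus ?case by auto
  next
    case (2 a) thus ?case using finite_sub by (auto simp: card_insert_if)
  next
    case (3 b) thus ?case by auto
  next
    case (4 b)
    obtain U x where b: "b = (U, x)" by (cases b)
    hence U: "U \<subseteq> X" "card U = Suc i" "x \<in> U" using 4 by auto
    have "card (U - {x}) = i" using U finite_sub[OF U(1)] by (simp add: card_Diff_singleton)
    thus ?case using U b by auto
  next
    case (5 a) thus ?case by auto
  qed
  also have "\<dots> = (\<Sum>U | U \<subseteq> X \<and> card U = Suc i. \<Sum>x\<in>U. f (U - {x}) x)"
    by (rule sum.Sigma[symmetric]) (use finX finite_sub in auto)
  finally show ?thesis .
qed

text \<open>In degree \<open>b\<close>, the complex \<open>K \<otimes> S/J\<close> is the chain complex of the simplicial complex of
  those \<open>U\<close> whose weight divides \<open>b\<close>. A cocycle \<open>\<kappa>\<close> pairing to 1 with a cycle \<open>z\<close> shows that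
  the homology is non-zero.\<close>

lemma not_tor_vanish_certificate:
  fixes ex :: "('x \<Rightarrow>\<^sub>0 nat) \<Rightarrow> 'b::cancel_comm_monoid_add" and z \<kappa> :: "'x set \<Rightarrow> int"
  assumes ex_add: "\<And>m n. ex (m + n) = ex m + ex n"
  defines "wt \<equiv> \<lambda>U. \<Sum>x\<in>U. ex (single x (Suc 0))"
  assumes z: "\<And>W. z W \<noteq> 0 \<Longrightarrow> W \<subseteq> X \<and> card W = i \<and> M W \<in> mons X \<and> ex (M W) + wt W = b \<and> total_deg (M W) = c"
    and cycle: "\<And>U. U \<subseteq> X \<Longrightarrow> Suc (card U) = i \<Longrightarrow> (\<Sum>x\<in>X - U. isign x U * z (insert x U)) = 0"
    and cocycle: "\<And>U m. U \<subseteq> X \<Longrightarrow> card U = Suc i \<Longrightarrow> m \<in> mons X \<Longrightarrow> ex m + wt U = b \<Longrightarrow>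
      (\<Sum>x\<in>U. \<kappa> (U - {x}) * isign x (U - {x})) = 0"
    and pairing: "(\<Sum>W | W \<subseteq> X \<and> card W = i. z W * \<kappa> W) = 1"
  shows "\<not> tor_vanish i (int c) (fibre_ideal X (\<lambda>m. Some (ex m)) :: ('x, 'k::field) pol set)"
proof
  let ?J = "fibre_ideal X (\<lambda>m. Some (ex m)) :: ('x, 'k) pol set"
  assume van: "tor_vanish i (int c) ?J"
  have wt_insert: "ex (m + single x (Suc 0)) + wt U = ex m + wt (insert x U)" if "finite U" "x \<notin> U" for m x U
    using that by (simp add: wt_def ex_add algebra_simps)
  \<comment> \<open>The monomial \<open>M W\<close> fills the index set \<open>W\<close> up to the
    multidegree \<open>b\<close>.\<close>
  define v :: "'x set \<Rightarrow> ('x, 'k) pol" where "v = (\<lambda>W. single (M W) (of_int (z W)))"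
  have v: "v \<in> kchain i"
  proof (rule kchainI)
    show "v W \<in> poly_ring X" for W using z[of W] by (cases "z W = 0") (auto simp: v_def poly_ring_single)
    show "v W = 0" if "\<not> (W \<subseteq> X \<and> card W = i)" for W using z[of W] that by (cases "z W = 0") (auto simp: v_def)
  qed
  have "khom (int c) v" unfolding khom_def homog_def v_def
  proof (intro allI ballI)
    fix W m assume "m \<in> keys (single (M W) (of_int (z W) :: 'k))"
    hence "m = M W" "z W \<noteq> 0" by (auto split: if_splits)
    thus "int (total_deg m) = int c" using z by blast
  qed
  moreover have "kbd v U \<in> ?J" for U
  proof -
    have "fsum (\<lambda>m. Some (ex m)) b' (kbd v U) = 0" for b'
    proof -
      have "kbd v U = (\<Sum>x\<in>X - U. single (M (insert x U) + single x (Suc 0)) (of_int (isign x U * z (insert x U))))"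
        unfolding kbd_def v_def
        by (intro sum.cong refl) (simp add: indet_def mult_single ksign_single add.commute)
      hence "fsum (\<lambda>m. Some (ex m)) b' (kbd v U)
        = (\<Sum>x\<in>X - U. if ex (M (insert x U) + single x (Suc 0)) = b' then of_int (isign x U * z (insert x U)) else 0)"
        by (simp only: fsum_sum fsum_single option.inject)
      \<comment> \<open>By cancellation all non-zero terms of the coefficient at \<open>U\<close>
        have the same label, so the fibre sum is either zero or the integer boundary of
        \<open>z\<close> at \<open>U\<close>.\<close>
      also have "\<dots> = (\<Sum>x\<in>X - U. if b' + wt U = b then of_int (isign x U * z (insert x U)) else 0)"
      proof (rule sum.cong[OF refl])
        fix x assume x: "x \<in> X - U"
        show "(if ex (M (insert x U) + single x (Suc 0)) = b' then of_int (isign x U * z (insert x U)) else (0 :: 'k))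
            = (if b' + wt U = b then of_int (isign x U * z (insert x U)) else 0)"
        proof (cases "z (insert x U) = 0")
          case False
          from z[OF this] have iu: "insert x U \<subseteq> X" "ex (M (insert x U)) + wt (insert x U) = b" by auto
          have "finite U" using finite_sub[OF iu(1)] by simp
          hence "ex (M (insert x U) + single x (Suc 0)) + wt U = b" using wt_insert x iu by simp
          hence "(ex (M (insert x U) + single x (Suc 0)) = b') = (b' + wt U = b)"
            by (metis add_right_cancel)
          thus ?thesis by simp
        qed simp
      qed
      also have "\<dots> = (if b' + wt U = b then of_int (\<Sum>x\<in>X - U. isign x U * z (insert x U)) else 0)" by simp
      also have "(\<Sum>x\<in>X - U. isign x U * z (insert x U)) = 0"
      proof (cases "U \<subseteq> X \<and> Suc (card U) = i")
        case False
        show ?thesis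
        proof (rule sum.neutral, rule ballI)
          fix x assume x: "x \<in> X - U"
          have "z (insert x U) = 0"
          proof (rule ccontr)
            assume "z (insert x U) \<noteq> 0"
            from z[OF this] have "insert x U \<subseteq> X" "card (insert x U) = i" by auto
            thus False using False x finite_sub[of "insert x U"] by auto
          qed
          thus "isign x U * z (insert x U) = 0" by simp
        qed
      qed (use cycle in blast)
      finally show ?thesis by simp
    qed
    thus ?thesis using kchainD(1)[OF kbd_pred_in[OF v]] by (simp add: fibre_ideal_def)
  qed
  ultimately obtain u where u: "u \<in> kchain (Suc i)" "\<And>W. v W - kbd u W \<in> ?J"
    using van v unfolding tor_vanish_def by blast
  \<comment> \<open>\<open>\<tau> W\<close> reads off the part of multidegree \<open>b\<close> of a
    coefficient at \<open>W\<close>. It vanishes on the ideal because it sees monomials only through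
    \<open>ex\<close>. \<open>L\<close> is the pairing with \<open>\<kappa>\<close>.\<close>
  define \<tau> where "\<tau> = (\<lambda>W. fsum (\<lambda>m. Some (ex m + wt W)) b :: ('x, 'k) pol \<Rightarrow> 'k)"
  define L where "L = (\<lambda>w. \<Sum>W | W \<subseteq> X \<and> card W = i. of_int (\<kappa> W) * \<tau> W (w W))"
  have \<tau>_J: "\<tau> W p = 0" if "p \<in> ?J" for W p
    unfolding \<tau>_def
  proof (rule fsum_coarsen[of p "\<lambda>m. Some (ex m)"])
    show "fsum (\<lambda>m. Some (ex m)) c p = 0" for c using that by (simp add: fibre_ideal_def)
  qed auto
  have "L v = of_int (\<Sum>W | W \<subseteq> X \<and> card W = i. z W * \<kappa> W)"
    unfolding L_def of_int_sum
  proof (rule sum.cong[OF refl])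
    fix W
    show "of_int (\<kappa> W) * \<tau> W (v W) = of_int (z W * \<kappa> W)"
      using z[of W] by (cases "z W = 0") (auto simp: \<tau>_def v_def fsum_single)
  qed
  hence "L v = 1" using pairing by simp
  moreover have "L v = L (kbd u)"
  proof -
    have "\<tau> W (v W) = \<tau> W (kbd u W)" for W
      using \<tau>_J[OF u(2), of W W] by (simp add: \<tau>_def fsum_diff)
    thus ?thesis by (simp add: L_def)
  qed
  moreover have "L (kbd u) = 0"
  proof -
    have "L (kbd u) = (\<Sum>W | W \<subseteq> X \<and> card W = i. \<Sum>x\<in>X - W. of_int (\<kappa> W * isign x W) * \<tau> (insert x W) (u (insert x W)))"
      unfolding L_def
    proof (rule sum.cong[OF refl])
      fix W assume "W \<in> {W. W \<subseteq> X \<and> card W = i}"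
      hence fW: "finite W" using finite_sub by blast
      have "\<tau> W (kbd u W) = (\<Sum>x\<in>X - W. of_int (isign x W) * \<tau> W (indet x * u (insert x W)))"
        by (simp add: \<tau>_def kbd_def fsum_sum fsum_ksign)
      also have "\<dots> = (\<Sum>x\<in>X - W. of_int (isign x W) * \<tau> (insert x W) (u (insert x W)))"
        using wt_insert[OF fW] by (intro sum.cong refl) (simp add: \<tau>_def fsum_indet)
      finally show "of_int (\<kappa> W) * \<tau> W (kbd u W) = (\<Sum>x\<in>X - W. of_int (\<kappa> W * isign x W) * \<tau> (insert x W) (u (insert x W)))"
        by (simp add: sum_distrib_left mult.assoc)
    qed
    also have "\<dots> = (\<Sum>U | U \<subseteq> X \<and> card U = Suc i. \<Sum>x\<in>U. of_int (\<kappa> (U - {x}) * isign x (U - {x})) * \<tau> (insert x (U - {x})) (u (insert x (U - {x}))))"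
      by (rule ksubs_sum_swap)
    also have "\<dots> = 0"
    proof (rule sum.neutral, rule ballI)
      fix U assume "U \<in> {U. U \<subseteq> X \<and> card U = Suc i}"
      hence U: "U \<subseteq> X" "card U = Suc i" by auto
      have "(\<Sum>x\<in>U. of_int (\<kappa> (U - {x}) * isign x (U - {x})) * \<tau> (insert x (U - {x})) (u (insert x (U - {x})))) =
          (\<Sum>x\<in>U. of_int (\<kappa> (U - {x}) * isign x (U - {x})) * \<tau> U (u U))"
        by (intro sum.cong refl) (simp add: insert_absorb)
      also have "\<dots> = of_int (\<Sum>x\<in>U. \<kappa> (U - {x}) * isign x (U - {x})) * \<tau> U (u U)"
        by (simp add: sum_distrib_right)
      also have "\<dots> = 0"
      \<comment> \<open>If some monomial of \<open>u U\<close> completes \<open>U\<close> to the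
        multidegree \<open>b\<close>, then \<open>U\<close> is a face and the cocycle condition
        applies; otherwise \<open>u U\<close> has no part in this multidegree.\<close>
      proof (cases "\<exists>m\<in>keys (u U). ex m + wt U = b")
        case True
        then obtain m where m: "m \<in> keys (u U)" "ex m + wt U = b" by blast
        hence "m \<in> mons X" using kchainD(1)[OF u(1), of U] by (auto simp: poly_ring_mons)
        thus ?thesis using cocycle[OF U _ m(2)] by simp
      next
        case False
        hence "\<tau> U (u U) = 0" unfolding \<tau>_def by (intro fsum_eq_0I) auto
        thus ?thesis by simp
      qed
      finally show "(\<Sum>x\<in>U. of_int (\<kappa> (U - {x}) * isign x (U - {x})) * \<tau> (insert x (U - {x})) (u (insert x (U - {x})))) = 0" .
    qed
    finally show ?thesis .
  qed
  ultimately show False by simp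
qed

text \<open>The same with finite sets encoded as increasing lists of the numbers \<open>rk x\<close>; the entry
  \<open>(us, a, ms)\<close> of \<open>Z\<close> is the chain \<open>a x\<^sup>m\<^sup>s e\<^sub>u\<^sub>s\<close>.\<close>

definition key :: "'x set \<Rightarrow> nat list" where
  "key U = sorted_list_of_set (rk ` U)"

end

section \<open>Chains and cochains as association lists\<close>

fun ksublists :: "nat \<Rightarrow> 'a list \<Rightarrow> 'a list list" where
  "ksublists 0 xs = [[]]"
| "ksublists (Suc k) [] = []"
| "ksublists (Suc k) (x # xs) = map ((#) x) (ksublists k xs) @ ksublists (Suc k) xs"

lemma filter_in_ksublists: "filter P xs \<in> set (ksublists (length (filter P xs)) xs)"
proof (induction xs)
  case (Cons x xs)
  show ?case
  proof (cases "P x")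
    case False
    thus ?thesis using Cons by (cases "length (filter P xs)") auto
  qed (use Cons in simp)
qed simp

definition look :: "(nat list \<times> int) list \<Rightarrow> nat list \<Rightarrow> int" where
  "look t us = (case map_of t us of None \<Rightarrow> 0 | Some a \<Rightarrow> a)"

text \<open>The comparison is strict, so the sign is the same whether or not \<open>u\<close> itself
  is on the list; boundary and coboundary share it.\<close>

definition lsign :: "nat \<Rightarrow> nat list \<Rightarrow> int" where
  "lsign u us = (-1) ^ length (filter (\<lambda>w. w < u) us)"

definition lcobound :: "(nat list \<times> int) list \<Rightarrow> nat list \<Rightarrow> int" where
  "lcobound t us = (\<Sum>u\<leftarrow>us. look t (remove1 u us) * lsign u us)"

text \<open>Only numbers below \<open>N\<close> are inserted, which is enough since the cycles use
  no others.\<close>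

definition lbound :: "nat \<Rightarrow> (nat list \<times> int) list \<Rightarrow> nat list \<Rightarrow> int" where
  "lbound N t us = (\<Sum>u\<leftarrow>[0..<N]. if u \<in> set us then 0 else lsign u us * look t (insort u us))"

context koszul
begin

lemma set_key: "U \<subseteq> X \<Longrightarrow> set (key U) = rk ` U"
  using finite_sub[of U] by (simp add: key_def)

lemma length_key: "U \<subseteq> X \<Longrightarrow> length (key U) = card U"
  using finite_sub[of U] rk_inj by (simp add: key_def card_image inj_on_subset)

lemma key_remove: "U \<subseteq> X \<Longrightarrow> x \<in> U \<Longrightarrow> key (U - {x}) = remove1 (rk x) (key U)"
proof -
  assume U: "U \<subseteq> X" "x \<in> U"
  have "rk ` (U - {x}) = rk ` U - {rk x}"
    using inj_on_image_set_diff[OF rk_inj, of U "{x}"] U by auto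
  thus ?thesis using finite_sub[OF U(1)] by (simp add: key_def sorted_list_of_set_remove)
qed

lemma key_insert: "U \<subseteq> X \<Longrightarrow> x \<in> X - U \<Longrightarrow> key (insert x U) = insort (rk x) (key U)"
proof -
  assume U: "U \<subseteq> X" "x \<in> X - U"
  have "rk x \<notin> rk ` U" using U rk_inj by (auto dest: inj_onD)
  thus ?thesis using finite_sub[OF U(1)] by (simp add: key_def sorted_list_of_set_insert)
qed

lemma isign_key: "U \<subseteq> X \<Longrightarrow> isign x U = lsign (rk x) (key U)"
proof -
  assume U: "U \<subseteq> X"
  have "length (filter (\<lambda>w. w < rk x) (key U)) = card {w \<in> rk ` U. w < rk x}"
    using set_key[OF U] by (subst distinct_length_filter) (auto simp: key_def intro!: arg_cong[of _ _ card])
  also have "{w \<in> rk ` U. w < rk x} = rk ` {u \<in> U. rk u < rk x}" by auto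
  also have "card \<dots> = card {u \<in> U. rk u < rk x}"
    using rk_inj U by (intro card_image) (auto intro: inj_on_subset)
  finally show ?thesis by (simp add: isign_def lsign_def)
qed

lemma isign_key_remove:
  assumes U: "U \<subseteq> X" "x \<in> U" shows "isign x (U - {x}) = lsign (rk x) (key U)"
proof -
  have "{u \<in> U - {x}. rk u < rk x} = {u \<in> U. rk u < rk x}" by auto
  hence "isign x (U - {x}) = isign x U" by (simp only: isign_def)
  thus ?thesis using isign_key[OF U(1)] by simp
qed

lemma sum_list_key: "U \<subseteq> X \<Longrightarrow> (\<Sum>u\<leftarrow>key U. f u) = (\<Sum>x\<in>U. f (rk x))"
proof -
  assume U: "U \<subseteq> X"
  have "distinct (key U)" by (simp add: key_def)
  hence "(\<Sum>u\<leftarrow>key U. f u) = (\<Sum>u\<in>rk ` U. f u)"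
    using set_key[OF U] by (simp add: sum_list_distinct_conv_sum_set)
  also have "\<dots> = (\<Sum>x\<in>U. f (rk x))"
    using inj_on_subset[OF rk_inj U] by (simp add: sum.reindex)
  finally show ?thesis .
qed

text \<open>The cycle condition and the pairing become computations with lists over the variables
  \<open>q 0, \<dots>, q (N - 1)\<close>. The cocycle condition keeps its semantic form, since it
  ranges over the faces, which are not computed exactly; it is checked later on a larger
  family.\<close>

lemma not_tor_vanish_lists:
  fixes ex :: "('x \<Rightarrow>\<^sub>0 nat) \<Rightarrow> 'b::cancel_comm_monoid_add" and q :: "nat \<Rightarrow> 'x"
    and Z :: "(nat list \<times> int \<times> nat list) list" and t :: "(nat list \<times> int) list"
  defines "mon \<equiv> \<lambda>ms. \<Sum>k\<leftarrow>ms. single (q k) (Suc 0)"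
  defines "tz \<equiv> map (\<lambda>(us, a, ms). (us, a)) Z"
  assumes ex_add: "\<And>m n. ex (m + n) = ex m + ex n" and ex_0: "ex 0 = 0"
    and q: "\<And>k. k < N \<Longrightarrow> q k \<in> X \<and> rk (q k) = k"
    and Z: "\<And>us a ms. (us, a, ms) \<in> set Z \<Longrightarrow> sorted us \<and> distinct us \<and> length us = i \<and> length ms = c \<and>
        set us \<union> set ms \<subseteq> {..<N} \<and> ex (mon (us @ ms)) = b"
    and dist: "distinct (map fst tz)"
    and cycle: "\<And>us. us \<in> set (ksublists (i - 1) [0..<N]) \<Longrightarrow> lbound N tz us = 0"
    and faces: "\<And>U m. U \<subseteq> X \<Longrightarrow> card U = Suc i \<Longrightarrow> m \<in> mons X \<Longrightarrow> ex m + (\<Sum>x\<in>U. ex (single x (Suc 0))) = b \<Longrightarrow>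
      lcobound t (key U) = 0"
    and pairing: "(\<Sum>(us, a)\<leftarrow>tz. a * look t us) = 1"
  shows "\<not> tor_vanish i (int c) (fibre_ideal X (\<lambda>m. Some (ex m)) :: ('x, 'k::field) pol set)"
proof -
  have q_inj: "inj_on q {..<N}" using q by (intro inj_on_inverseI[of _ rk]) auto
  have q_rk: "q (rk x) = x" if "x \<in> X" "rk x < N" for x
    using q[OF that(2)] that(1) inj_onD[OF rk_inj] by blast
  have tzD: "sorted us \<and> distinct us \<and> length us = i \<and> set us \<subseteq> {..<N}" if "(us, a) \<in> set tz" for us a
  proof -
    have "(us, a) \<in> (\<lambda>(us, a, ms). (us, a)) ` set Z" using that by (simp add: tz_def)
    then obtain e where e: "e \<in> set Z" "(us, a) = (\<lambda>(us, a, ms). (us, a)) e" by (rule imageE) blast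
    obtain us' a' ms where "e = (us', a', ms)" by (cases e)
    hence "(us, a, ms) \<in> set Z" using e by simp
    from Z[OF this] show ?thesis by simp
  qed
  have look0: "us \<in> fst ` set tz" if "look tz us \<noteq> 0" for us
  proof -
    have "map_of tz us \<noteq> None"
    proof
      assume "map_of tz us = None"
      thus False using that by (simp add: look_def)
    qed
    thus ?thesis by (simp add: map_of_eq_None_iff)
  qed
  have q_key: "q ` set (key W) = W" if "W \<subseteq> X" "set (key W) \<subseteq> {..<N}" for W
  proof -
    have "q (rk x) = x" if "x \<in> W" for x
      using that \<open>W \<subseteq> X\<close> \<open>set (key W) \<subseteq> {..<N}\<close> set_key[of W] by (intro q_rk) auto
    hence "(\<lambda>x. q (rk x)) ` W = (\<lambda>x. x) ` W" by (rule image_cong[OF refl])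
    thus ?thesis using set_key[OF that(1)] by (simp add: image_image)
  qed
  define zset where "zset = (\<lambda>W. if W \<subseteq> X then look tz (key W) else 0)"
  \<comment> \<open>The default 0 is met only outside the support of the cycle, where the
    coefficient vanishes.\<close>
  define M where "M = (\<lambda>W. case map_of (map (\<lambda>(us, a, ms). (us, ms)) Z) (key W) of None \<Rightarrow> 0 | Some ms \<Rightarrow> mon ms)"
  have ex_mon: "ex (mon ms) = (\<Sum>k\<leftarrow>ms. ex (single (q k) (Suc 0)))" for ms
    by (induction ms) (simp_all add: mon_def ex_0 ex_add)
  have mon_X: "mon ms \<in> mons X" if "set ms \<subseteq> {..<N}" for ms
    using that q by (induction ms) (auto simp: mon_def)
  have mon_deg: "total_deg (mon ms) = length ms" for ms
    by (induction ms) (simp_all add: mon_def)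
  have key_q: "key (q ` set us) = us" if "sorted us" "distinct us" "set us \<subseteq> {..<N}" for us
  proof -
    have "rk ` q ` set us = set us" using that(3) q by force
    thus ?thesis using that by (simp add: key_def sorted_list_of_set.idem_if_sorted_distinct)
  qed
  show ?thesis
  proof (rule not_tor_vanish_certificate[where ex = ex and z = zset and \<kappa> = "\<lambda>W. look t (key W)" and M = M and b = b])
    fix W assume nz: "zset W \<noteq> 0"
    hence W: "W \<subseteq> X" "look tz (key W) \<noteq> 0" by (auto simp: zset_def split: if_splits)
    then obtain a ms where e: "(key W, a, ms) \<in> set Z" using look0 by (force simp: tz_def)
    have mapeq: "map fst (map (\<lambda>(us, a, ms). (us, ms)) Z) = map fst tz" by (simp add: tz_def case_prod_beta comp_def)
    have "map_of (map (\<lambda>(us, a, ms). (us, ms)) Z) (key W) = Some ms"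
      using e dist mapeq by (intro map_of_is_SomeI) (simp only:, force)
    hence MW: "M W = mon ms" by (simp add: M_def)
    note d = Z[OF e]
    have "q ` set (key W) = W" using d by (intro q_key W(1)) simp
    moreover have "inj_on q (set (key W))" using q_inj d by (meson inj_on_subset le_sup_iff)
    ultimately have "(\<Sum>x\<in>W. ex (single x (Suc 0))) = (\<Sum>k\<in>set (key W). ex (single (q k) (Suc 0)))"
      by (intro sum.reindex_cong[of q]) simp_all
    also have "\<dots> = ex (mon (key W))"
      using d by (simp add: ex_mon sum_list_distinct_conv_sum_set)
    finally have "ex (M W) + (\<Sum>x\<in>W. ex (single x (Suc 0))) = b"
      using d by (simp add: MW ex_mon add.commute)
    thus "W \<subseteq> X \<and> card W = i \<and> M W \<in> mons X \<and> ex (M W) + (\<Sum>x\<in>W. ex (single x (Suc 0))) = b \<and> total_deg (M W) = c"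
      using W(1) d length_key[OF W(1)] MW mon_X mon_deg by simp
  next
    fix U assume U: "U \<subseteq> X" "Suc (card U) = i"
    show "(\<Sum>x\<in>X - U. isign x U * zset (insert x U)) = 0"
    proof (cases "rk ` U \<subseteq> {..<N}")
      case False
      show ?thesis
      proof (rule sum.neutral, rule ballI)
        fix x assume x: "x \<in> X - U"
        have "look tz (key (insert x U)) = 0"
        proof (rule ccontr)
          assume "look tz (key (insert x U)) \<noteq> 0"
          then obtain a where "(key (insert x U), a) \<in> set tz" using look0 by force
          hence "set (key (insert x U)) \<subseteq> {..<N}" using tzD by blast
          thus False using False set_key[of "insert x U"] U x by auto
        qed
        thus "isign x U * zset (insert x U) = 0" by (simp add: zset_def)
      qed
    next
      case True
      let ?g = "\<lambda>u. lsign u (key U) * look tz (insort u (key U))"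
      have eq: "isign x U * zset (insert x U) = ?g (rk x)" if "x \<in> X - U" for x
        using that U by (simp add: zset_def isign_key key_insert)
      have big: "?g u = 0" if "\<not> u < N" for u
      proof -
        have "insort u (key U) \<notin> fst ` set tz"
        proof
          assume "insort u (key U) \<in> fst ` set tz"
          then obtain a where "(insort u (key U), a) \<in> set tz" by force
          hence "set (insort u (key U)) \<subseteq> {..<N}" using tzD by blast
          thus False using that by (simp add: set_insort_key)
        qed
        hence "look tz (insort u (key U)) = 0" using look0 by blast
        thus ?thesis by simp
      qed
      have "(\<Sum>x\<in>X - U. isign x U * zset (insert x U)) = (\<Sum>x\<in>X - U. ?g (rk x))"
        using eq by (intro sum.cong) auto
      also have "\<dots> = (\<Sum>u\<in>rk ` (X - U). ?g u)"
        using rk_inj by (subst sum.reindex) (auto intro: inj_on_subset)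
      also have "\<dots> = (\<Sum>u\<in>{..<N} - rk ` U. ?g u)"
      proof (rule sum.mono_neutral_right)
        show "finite (rk ` (X - U))" using finX by simp
        show "{..<N} - rk ` U \<subseteq> rk ` (X - U)"
        proof
          fix u assume "u \<in> {..<N} - rk ` U"
          thus "u \<in> rk ` (X - U)" using q[of u] by (metis Diff_iff image_iff lessThan_iff)
        qed
        show "\<forall>u\<in>rk ` (X - U) - ({..<N} - rk ` U). ?g u = 0"
        proof
          fix u assume "u \<in> rk ` (X - U) - ({..<N} - rk ` U)"
          hence "u \<notin> rk ` U" "\<not> u < N" using rk_inj U(1) by (auto dest: inj_onD)
          thus "?g u = 0" using big by blast
        qed
      qed
      also have "\<dots> = lbound N tz (key U)"
      proof -
        have "lbound N tz (key U) = (\<Sum>u\<in>{..<N}. if u \<in> rk ` U then 0 else ?g u)"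
          unfolding lbound_def using set_key[OF U(1)]
          by (simp add: sum_list_distinct_conv_sum_set atLeast0LessThan)
        also have "\<dots> = (\<Sum>u\<in>{..<N} - rk ` U. if u \<in> rk ` U then 0 else ?g u)"
          by (rule sum.mono_neutral_right) auto
        also have "\<dots> = (\<Sum>u\<in>{..<N} - rk ` U. ?g u)" by (intro sum.cong) auto
        finally show ?thesis by simp
      qed
      also have "\<dots> = 0"
      proof (rule cycle)
        have "filter (\<lambda>u. u \<in> rk ` U) [0..<N] = key U"
          unfolding key_def
          by (rule sorted_distinct_set_unique) (use True finite_sub[OF U(1)] in \<open>auto simp: sorted_wrt_filter\<close>)
        moreover have "i - 1 = length (key U)" using length_key[OF U(1)] U(2) by simp
        ultimately show "key U \<in> set (ksublists (i - 1) [0..<N])"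
          using filter_in_ksublists[of "\<lambda>u. u \<in> rk ` U" "[0..<N]"] by simp
      qed
      finally show ?thesis .
    qed
  next
    fix U m assume U: "U \<subseteq> X" "card U = Suc i" "m \<in> mons X" "ex m + (\<Sum>x\<in>U. ex (single x (Suc 0))) = b"
    have "(\<Sum>x\<in>U. look t (key (U - {x})) * isign x (U - {x})) = (\<Sum>x\<in>U. look t (remove1 (rk x) (key U)) * lsign (rk x) (key U))"
      using U(1) by (intro sum.cong) (simp_all add: key_remove isign_key_remove)
    also have "\<dots> = lcobound t (key U)"
      unfolding lcobound_def by (rule sum_list_key[OF U(1), symmetric])
    finally show "(\<Sum>x\<in>U. look t (key (U - {x})) * isign x (U - {x})) = 0" using faces[OF U] by simp
  next
    have sub: "(\<lambda>us. q ` set us) ` fst ` set tz \<subseteq> {W. W \<subseteq> X \<and> card W = i}"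
    proof clarify
      fix us a assume "(us, a) \<in> set tz"
      hence d: "distinct us" "length us = i" "set us \<subseteq> {..<N}" using tzD by blast+
      have "card (q ` set us) = i" using d inj_on_subset[OF q_inj d(3)] by (simp add: card_image distinct_card)
      moreover have "q ` set us \<subseteq> X" using d(3) q by auto
      ultimately show "q ` set (fst (us, a)) \<subseteq> X \<and> card (q ` set (fst (us, a))) = i" by simp
    qed
    have inj: "inj_on (\<lambda>us. q ` set us) (fst ` set tz)"
    proof (rule inj_on_inverseI[of _ key])
      fix us assume "us \<in> fst ` set tz"
      then obtain a where "(us, a) \<in> set tz" by force
      thus "key (q ` set us) = us" using key_q tzD by blast
    qed
    have "(\<Sum>W | W \<subseteq> X \<and> card W = i. zset W * look t (key W)) = (\<Sum>W\<in>(\<lambda>us. q ` set us) ` fst ` set tz. zset W * look t (key W))"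
    proof (rule sum.mono_neutral_right[OF _ sub], use finX in simp, rule ballI)
      fix W assume W: "W \<in> {W. W \<subseteq> X \<and> card W = i} - (\<lambda>us. q ` set us) ` fst ` set tz"
      have "look tz (key W) = 0"
      proof (rule ccontr)
        assume "look tz (key W) \<noteq> 0"
        hence k: "key W \<in> fst ` set tz" using look0 by blast
        then obtain a where "(key W, a) \<in> set tz" by force
        hence "set (key W) \<subseteq> {..<N}" using tzD by blast
        hence "q ` set (key W) = W" using W by (intro q_key) auto
        thus False using W k by blast
      qed
      thus "zset W * look t (key W) = 0" by (simp add: zset_def)
    qed
    also have "\<dots> = (\<Sum>us\<in>fst ` set tz. zset (q ` set us) * look t (key (q ` set us)))"
      by (rule sum.reindex[OF inj, unfolded comp_def])
    also have "\<dots> = (\<Sum>us\<in>fst ` set tz. look tz us * look t us)"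
    proof (rule sum.cong[OF refl])
      fix us assume "us \<in> fst ` set tz"
      then obtain a where "(us, a) \<in> set tz" by force
      hence d: "sorted us" "distinct us" "set us \<subseteq> {..<N}" using tzD by blast+
      hence "q ` set us \<subseteq> X" using q by auto
      thus "zset (q ` set us) * look t (key (q ` set us)) = look tz us * look t us"
        using key_q[OF d] by (simp add: zset_def)
    qed
    also have "\<dots> = (\<Sum>e\<in>set tz. look tz (fst e) * look t (fst e))"
      using dist by (subst sum.reindex) (auto simp: distinct_map)
    also have "\<dots> = (\<Sum>e\<in>set tz. snd e * look t (fst e))"
      using dist by (intro sum.cong) (auto simp: look_def map_of_is_SomeI)
    also have "\<dots> = (\<Sum>(us, a)\<leftarrow>tz. a * look t us)"
    proof -
      have "distinct tz" using dist by (simp add: distinct_map)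
      hence "(\<Sum>e\<leftarrow>tz. snd e * look t (fst e)) = (\<Sum>e\<in>set tz. snd e * look t (fst e))"
        by (rule sum_list_distinct_conv_sum_set)
      moreover have "(\<lambda>(us, a). a * look t us) = (\<lambda>e. snd e * look t (fst e))" by (simp add: fun_eq_iff)
      ultimately show ?thesis by (simp only:)
    qed
    finally show "(\<Sum>W | W \<subseteq> X \<and> card W = i. zset W * look t (key W)) = 1" using pairing by simp
  qed (rule ex_add)
qed

end

section \<open>Certificates\<close>

text \<open>The graph under consideration has the vertices \<open>0, \<dots>, h - 1\<close> and the edges \<open>EL\<close>. A list of
  vertices encodes the partition one of whose parts is this list; the part that avoids \<open>0\<close> is
  used. A feature prescribes the restriction of a partition to an edge (if \<open>j = k\<close>) or to a triangle.
  The number of factors of a monomial that have a given feature depends only on the image of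
  the monomial under the cut map, so it bounds how many partitions with this feature can occur.
  In the definition of \<open>certificate\<close> below, \<open>vs\<close> lists partitions and \<open>ms0\<close> is a monomial in them,
  both by their indices; \<open>Z\<close> is a cycle and \<open>t\<close> a cocycle of the simplicial complex of those sets
  of partitions whose product divides some monomial with the same image as \<open>ms0\<close>.
  \<open>maybe_face\<close> is a necessary condition for membership in this complex.\<close>

definition msep :: "nat list \<Rightarrow> nat \<Rightarrow> nat \<Rightarrow> bool" where
  "msep A i j \<longleftrightarrow> (i \<in> set A) \<noteq> (j \<in> set A)"

type_synonym feature = "nat \<times> nat \<times> nat \<times> bool \<times> bool"

fun has_feature :: "feature \<Rightarrow> nat list \<Rightarrow> bool" where
  "has_feature (i, j, k, s, t) A \<longleftrightarrow> msep A i j = s \<and> msep A i k = t"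

fun valid_feature :: "(nat \<times> nat) list \<Rightarrow> feature \<Rightarrow> bool" where
  "valid_feature EL (i, j, k, s, t) \<longleftrightarrow> (i, j) \<in> set EL \<and> (i, k) \<in> set EL \<and> (j = k \<or> (j, k) \<in> set EL)"

text \<open>A budget has one entry per feature. A partition takes one unit for each feature that it
  has; \<open>None\<close> reports that a feature is used up.\<close>

fun spend :: "bool list \<Rightarrow> nat list \<Rightarrow> nat list option" where
  "spend (True # r) (b # bs) = (if b = 0 then None else map_option ((#) (b - 1)) (spend r bs))"
| "spend (False # r) (b # bs) = map_option ((#) b) (spend r bs)"
| "spend _ _ = Some []"

fun spend_all :: "bool list list \<Rightarrow> nat list \<Rightarrow> nat list option" where
  "spend_all [] b = Some b"
| "spend_all (r # rs) b = (case spend r b of None \<Rightarrow> None | Some b' \<Rightarrow> spend_all rs b')"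

text \<open>A lookahead: do \<open>n\<close> further partitions fit into the budget? A smaller
  \<open>n\<close> makes the test weaker and cheaper; it remains necessary as long as
  \<open>n\<close> is at most the number of factors left. In a certificate \<open>n\<close> is the
  lookahead after a set of \<open>i + 1\<close> partitions and \<open>n1\<close> the one after a
  single partition.\<close>

fun extendable :: "bool list list \<Rightarrow> nat \<Rightarrow> nat list \<Rightarrow> bool" where
  "extendable rs n b = (if n = 0 then True else
     list_ex (\<lambda>r. case spend r b of None \<Rightarrow> False | Some b' \<Rightarrow> extendable rs (n - 1) b') rs)"

declare extendable.simps [simp del]

definition maybe_face :: "bool list list \<Rightarrow> nat \<Rightarrow> nat list \<Rightarrow> bool list list \<Rightarrow> bool" where
  "maybe_face rs n b us = (case spend_all us b of None \<Rightarrow> False | Some b' \<Rightarrow> extendable rs n b')"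

definition feature_row :: "feature list \<Rightarrow> nat list \<Rightarrow> bool list" where
  "feature_row fs A = map (\<lambda>\<phi>. has_feature \<phi> A) fs"

definition certificate :: "nat \<Rightarrow> (nat \<times> nat) list \<Rightarrow> feature list \<Rightarrow> nat list list \<Rightarrow> nat list \<Rightarrow> nat \<Rightarrow> nat \<Rightarrow>
    (nat list \<times> int \<times> nat list) list \<Rightarrow> (nat list \<times> int) list \<Rightarrow> nat \<Rightarrow> nat \<Rightarrow> bool" where
  "certificate h EL fs vs ms0 i c Z t n n1 \<longleftrightarrow>
     (let N = length vs; masks = subseqs [1..<h]; rs = map (feature_row fs) masks;
          b = map (\<lambda>\<phi>. length (filter (\<lambda>k. has_feature \<phi> (vs ! k)) ms0)) fs
      in list_all (valid_feature EL) fs \<and> list_all (\<lambda>(i, j). i < j \<and> j < h) EL \<and>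
         distinct vs \<and> list_all (\<lambda>A. A \<in> set masks) vs \<and> list_all (\<lambda>k. k < N) ms0 \<and> length ms0 = i + c \<and>
         n + Suc i \<le> length ms0 \<and> Suc n1 \<le> length ms0 \<and>
         list_all (\<lambda>(us, a, ms). sorted us \<and> distinct us \<and> length us = i \<and> length ms = c \<and>
            list_all (\<lambda>k. k < N) (us @ ms) \<and>
            list_all (\<lambda>(i, j). length (filter (\<lambda>k. msep (vs ! k) i j) (us @ ms)) =
                length (filter (\<lambda>k. msep (vs ! k) i j) ms0)) EL) Z \<and>
         distinct (map fst Z) \<and>
         list_all (\<lambda>us. lbound N (map (\<lambda>(us, a, ms). (us, a)) Z) us = 0) (ksublists (i - 1) [0..<N]) \<and>
         list_all (\<lambda>A. A \<in> set vs \<or> \<not> maybe_face rs n1 b [feature_row fs A]) masks \<and>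
         list_all (\<lambda>us. lcobound t us = 0 \<or> \<not> maybe_face rs n b (map (\<lambda>k. feature_row fs (vs ! k)) us))
           (ksublists (Suc i) [0..<N]) \<and>
         (\<Sum>(us, a)\<leftarrow>map (\<lambda>(us, a, ms). (us, a)) Z. a * look t us) = 1)"

section \<open>The cut ideal as a fibre ideal\<close>

definition part :: "'v graph \<Rightarrow> 'v set \<Rightarrow> 'v set set" where
  "part G A = {A, fst G - A}"

text \<open>Described by the separation of vertices, a partition needs no choice of a side. With one
  vertex fixed the relation recovers the partition, see \<open>partition_eq_part\<close>.\<close>

definition sep :: "'v set set \<Rightarrow> 'v \<Rightarrow> 'v \<Rightarrow> bool" where
  "sep P u v \<longleftrightarrow> (\<exists>A\<in>P. u \<in> A \<and> v \<notin> A)"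

lemma partitions_part: "partitions G = part G ` Pow (fst G)"
proof (intro equalityI subsetI)
  fix P assume "P \<in> partitions G"
  then obtain A B where "P = {A, B}" "A \<union> B = fst G" "A \<inter> B = {}" by (auto simp: partitions_def)
  moreover from this have "B = fst G - A" by blast
  ultimately show "P \<in> part G ` Pow (fst G)" by (auto simp: part_def)
next
  fix P assume "P \<in> part G ` Pow (fst G)"
  then obtain A where "A \<subseteq> fst G" "P = {A, fst G - A}" by (auto simp: part_def)
  moreover from this have "A \<union> (fst G - A) = fst G" "A \<inter> (fst G - A) = {}" by auto
  ultimately show "P \<in> partitions G" unfolding partitions_def by blast
qed

lemma part_in: "A \<subseteq> fst G \<Longrightarrow> part G A \<in> partitions G"
  by (simp add: partitions_part)

lemma finite_partitions: "simple_graph G \<Longrightarrow> finite (partitions G)"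
  by (simp add: partitions_part simple_graph_def)

lemma sep_part: "A \<subseteq> fst G \<Longrightarrow> u \<in> fst G \<Longrightarrow> v \<in> fst G \<Longrightarrow> sep (part G A) u v \<longleftrightarrow> (u \<in> A) \<noteq> (v \<in> A)"
  by (auto simp: sep_def part_def)

text \<open>There are only two parts, so changing the part twice means returning. This parity is
  behind all the relations on triangles.\<close>

lemma sep_xor:
  assumes "P \<in> partitions G" "u \<in> fst G" "v \<in> fst G" "w \<in> fst G"
  shows "sep P u w \<longleftrightarrow> (sep P u v \<noteq> sep P v w)"
  using assms by (auto simp: partitions_part sep_part)

lemma sep_commute: "P \<in> partitions G \<Longrightarrow> u \<in> fst G \<Longrightarrow> v \<in> fst G \<Longrightarrow> sep P u v = sep P v u"
  by (auto simp: partitions_part sep_part)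

lemma sep_refl [simp]: "\<not> sep P u u"
  by (simp add: sep_def)

lemma partition_eq_part:
  assumes "P \<in> partitions G" "w \<in> fst G"
  shows "P = part G {v \<in> fst G. sep P w v}"
proof -
  obtain A where A: "A \<subseteq> fst G" "P = part G A" using assms by (auto simp: partitions_part)
  show ?thesis
  proof (cases "w \<in> A")
    case True
    hence "{v \<in> fst G. sep P w v} = fst G - A" using A True sep_part[OF A(1) assms(2)] by auto
    moreover have "fst G - (fst G - A) = A" using A by blast
    ultimately show ?thesis using A by (simp add: part_def insert_commute)
  next
    case False
    hence "{v \<in> fst G. sep P w v} = A" using A False sep_part[OF A(1) assms(2)] by auto
    thus ?thesis using A by simp
  qed
qed

lemma edge_vertices: "simple_graph G \<Longrightarrow> {u, v} \<in> snd G \<Longrightarrow> u \<in> fst G \<and> v \<in> fst G \<and> u \<noteq> v"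
  by (fastforce simp: simple_graph_def)

lemma edge_cases:
  assumes "simple_graph G" "e \<in> snd G"
  obtains u v where "e = {u, v}" "u \<in> fst G" "v \<in> fst G" "u \<noteq> v"
proof -
  have "card e = 2" using assms by (auto simp: simple_graph_def)
  then obtain u v where "e = {u, v}" by (auto simp: card_2_iff)
  thus ?thesis using that edge_vertices[of G u v] assms by blast
qed

lemma cut_iff:
  assumes "simple_graph G" "P \<in> partitions G" "{u, v} \<in> snd G"
  shows "{u, v} \<in> cut G P \<longleftrightarrow> sep P u v"
proof -
  obtain A where A: "A \<subseteq> fst G" "P = {A, fst G - A}" using assms(2) by (auto simp: partitions_part part_def)
  have uv: "u \<in> fst G" "v \<in> fst G" using edge_vertices[OF assms(1,3)] by auto
  have "{u, v} \<in> cut G P \<longleftrightarrow> (\<exists>B C. P = {B, C} \<and> (u \<in> B \<and> v \<in> C \<or> v \<in> B \<and> u \<in> C))"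
    using assms(3) by (auto simp: cut_def doubleton_eq_iff)
  also have "\<dots> \<longleftrightarrow> (u \<in> A \<and> v \<in> fst G - A) \<or> (v \<in> A \<and> u \<in> fst G - A)"
    unfolding A(2) doubleton_eq_iff by blast
  also have "\<dots> \<longleftrightarrow> sep P u v" using A uv by (auto simp: sep_def)
  finally show ?thesis .
qed

text \<open>The exponent vector of the image of the variable of \<open>P\<close>;
  \<open>expo\<close> extends it to monomials.\<close>

definition cut_vector :: "'v graph \<Rightarrow> 'v set set \<Rightarrow> ('v set st_var \<Rightarrow>\<^sub>0 nat)" where
  "cut_vector G P = (\<Sum>e\<in>cut G P. single (S_var e) 1) + (\<Sum>e\<in>snd G - cut G P. single (T_var e) 1)"

definition expo :: "'v graph \<Rightarrow> ('v set set \<Rightarrow>\<^sub>0 nat) \<Rightarrow> ('v set st_var \<Rightarrow>\<^sub>0 nat)" where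
  "expo G = lin (\<lambda>P n. \<Sum>_<n. cut_vector G P)"

lemma additive_expo:
  fixes G :: "'v graph"
  shows "additive_coeffs (\<lambda>P n. \<Sum>_<(n::nat). cut_vector G P)"
proof -
  have "(\<Sum>_<a + b. v) = (\<Sum>_<a. v) + (\<Sum>_<b. v)" for a b :: nat and v :: "'v set st_var \<Rightarrow>\<^sub>0 nat"
    by (induction b) (simp_all add: add.assoc)
  thus ?thesis by (simp add: additive_coeffs_def)
qed

lemma expo_add: "expo G (m + n) = expo G m + expo G n"
  unfolding expo_def by (rule lin_add[OF additive_expo])

lemma expo_zero [simp]: "expo G 0 = 0" by (simp add: expo_def)

lemma prod_single: "(\<Prod>i\<in>I. single (f i) 1) = single (\<Sum>i\<in>I. f i) (1 :: 'k::field)"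
  by (induction I rule: infinite_finite_induct) (simp_all add: mult_single)

lemma power_single: "single v 1 ^ n = single (\<Sum>_<n. v) (1 :: 'k::field)"
  for v :: "'b::comm_monoid_add"
  by (induction n) (simp_all add: mult_single add.commute)

text \<open>The cut map sends monomials to monomials, so a coefficient of the image collects the
  coefficients over one fibre of \<open>expo\<close>. This makes the cut ideal a fibre
  ideal.\<close>

lemma lookup_cut_map: "lookup (cut_map G p) b = fsum (\<lambda>m. Some (expo G m)) b p"
proof -
  have v: "(\<Prod>e\<in>cut G P. indet (S_var e)) * (\<Prod>e\<in>snd G - cut G P. indet (T_var e)) = (single (cut_vector G P) 1 :: (_, 'a) pol)" for P
    unfolding indet_def cut_vector_def by (simp add: prod_single mult_single)
  have "cut_map G p = (\<Sum>m\<in>keys p. single (expo G m) (lookup p m))"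
    unfolding cut_map_def subst_hom_def v power_single prod_single
    by (simp add: const_def mult_single expo_def lin_def)
  thus ?thesis
    by (simp add: lookup_sum lookup_single fsum_def lin_def when_def)
qed

lemma cut_ideal_fibre: "cut_ideal G = (fibre_ideal (partitions G) (\<lambda>m. Some (expo G m)) :: (_, 'k::field) pol set)"
proof -
  have "cut_map G p = 0 \<longleftrightarrow> (\<forall>b. fsum (\<lambda>m. Some (expo G m)) b p = 0)" for p :: "('a set set, 'k) pol"
    unfolding lookup_cut_map[symmetric] by (auto simp: poly_mapping_eq_iff fun_eq_iff)
  thus ?thesis by (simp add: cut_ideal_def fibre_ideal_def)
qed

text \<open>The number of factors of a monomial with the property \<open>\<phi>\<close>, counted
  with multiplicity. Fibres of the cut map are described by such counts.\<close>

definition cnt :: "('x \<Rightarrow> bool) \<Rightarrow> ('x \<Rightarrow>\<^sub>0 nat) \<Rightarrow> nat" where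
  "cnt \<phi> = lin (\<lambda>P n. if \<phi> P then n else 0)"

lemma cnt_add: "cnt \<phi> (m + n) = cnt \<phi> m + cnt \<phi> n"
  unfolding cnt_def by (rule lin_add) (simp add: additive_coeffs_def)

lemma cnt_zero [simp]: "cnt \<phi> 0 = 0" by (simp add: cnt_def)

lemma cnt_single: "cnt \<phi> (single P n) = (if \<phi> P then n else 0)"
  unfolding cnt_def by (rule lin_single) simp

lemma cnt_sum: "cnt \<phi> m = (\<Sum>P\<in>keys m. if \<phi> P then lookup m P else 0)"
  by (simp add: cnt_def lin_def)

lemma cnt_superset: "finite A \<Longrightarrow> m \<in> mons A \<Longrightarrow> cnt \<phi> m = (\<Sum>P\<in>A. if \<phi> P then lookup m P else 0)"
  unfolding cnt_def mons_def by (rule lin_superset) simp_all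

lemma cnt_cong: "(\<And>P. P \<in> keys m \<Longrightarrow> \<phi> P = \<psi> P) \<Longrightarrow> cnt \<phi> m = cnt \<psi> m"
  unfolding cnt_sum by (rule sum.cong) simp_all

lemma cnt_True: "cnt (\<lambda>_. True) m = total_deg m"
  by (simp add: cnt_sum total_deg_def)

lemma cnt_split: "cnt \<phi> m = cnt (\<lambda>P. \<phi> P \<and> \<psi> P) m + cnt (\<lambda>P. \<phi> P \<and> \<not> \<psi> P) m"
  unfolding cnt_sum sum.distrib[symmetric] by (rule sum.cong) simp_all

lemma cnt_not: "cnt (\<lambda>P. \<not> \<phi> P) m = total_deg m - cnt \<phi> m"
  using cnt_split[of "\<lambda>_. True" m \<phi>] by (simp add: cnt_True)

lemma cnt_le: "cnt \<phi> m \<le> total_deg m"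
  using cnt_split[of "\<lambda>_. True" m \<phi>] by (simp add: cnt_True)

lemma cnt_eq_0: "cnt \<phi> m = 0 \<Longrightarrow> P \<in> keys m \<Longrightarrow> \<not> \<phi> P"
  by (auto simp: cnt_sum in_keys_iff split: if_splits)

lemma cnt_xor:
  assumes "\<And>P. P \<in> keys m \<Longrightarrow> \<chi> P = (\<phi> P \<noteq> \<psi> P)"
  shows "2 * cnt (\<lambda>P. \<phi> P \<and> \<psi> P) m + cnt \<chi> m = cnt \<phi> m + cnt \<psi> m"
proof -
  have "cnt \<chi> m = cnt (\<lambda>P. \<phi> P \<noteq> \<psi> P) m" using assms by (rule cnt_cong)
  also have "\<dots> = cnt (\<lambda>P. \<phi> P \<and> \<not> \<psi> P) m + cnt (\<lambda>P. \<psi> P \<and> \<not> \<phi> P) m"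
    unfolding cnt_sum sum.distrib[symmetric] by (rule sum.cong) auto
  finally have "cnt \<chi> m = cnt (\<lambda>P. \<phi> P \<and> \<not> \<psi> P) m + cnt (\<lambda>P. \<psi> P \<and> \<not> \<phi> P) m" .
  moreover have "(\<lambda>P. \<psi> P \<and> \<phi> P) = (\<lambda>P. \<phi> P \<and> \<psi> P)" by auto
  ultimately show ?thesis
    using cnt_split[of \<phi> m \<psi>] cnt_split[of \<psi> m \<phi>] by simp
qed

lemma lookup_rep: "lookup (\<Sum>_<(n::nat). v) z = n * lookup v z"
  by (simp add: lookup_sum)

lemma lookup_expo:
  assumes G: "simple_graph G"
  shows "lookup (expo G m) (S_var e) = cnt (\<lambda>P. e \<in> cut G P) m"
    and "lookup (expo G m) (T_var e) = (if e \<in> snd G then total_deg m - cnt (\<lambda>P. e \<in> cut G P) m else 0)"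
proof -
  have "snd G \<subseteq> Pow (fst G)" "finite (fst G)" using G by (auto simp: simple_graph_def)
  hence fin: "finite (snd G)" using finite_subset by blast
  have sub: "cut G P \<subseteq> snd G" for P by (auto simp: cut_def)
  have S: "lookup (cut_vector G P) (S_var e) = (if e \<in> cut G P then 1 else 0)" for P
    using finite_subset[OF sub[of P] fin]
    by (simp add: cut_vector_def lookup_add lookup_sum lookup_single when_def)
  have T: "lookup (cut_vector G P) (T_var e) = (if e \<in> snd G - cut G P then 1 else 0)" for P
    using fin by (simp add: cut_vector_def lookup_add lookup_sum lookup_single when_def)
  show "lookup (expo G m) (S_var e) = cnt (\<lambda>P. e \<in> cut G P) m"
    by (simp add: expo_def cnt_sum lin_def lookup_sum[of _ "keys m"] lookup_rep S if_distrib cong: if_cong)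
  have "lookup (expo G m) (T_var e) = cnt (\<lambda>P. e \<in> snd G - cut G P) m"
    by (simp add: expo_def cnt_sum lin_def lookup_sum[of _ "keys m"] lookup_rep T if_distrib cong: if_cong)
  also have "\<dots> = (if e \<in> snd G then total_deg m - cnt (\<lambda>P. e \<in> cut G P) m else 0)"
    using cnt_not[of "\<lambda>P. e \<in> cut G P" m] by (simp add: cnt_sum[of "\<lambda>P. False"])
  finally show "lookup (expo G m) (T_var e) = (if e \<in> snd G then total_deg m - cnt (\<lambda>P. e \<in> cut G P) m else 0)" .
qed

lemma cnt_cut:
  assumes "simple_graph G" "m \<in> mons (partitions G)" "{u, v} \<in> snd G"
  shows "cnt (\<lambda>P. {u, v} \<in> cut G P) m = cnt (\<lambda>P. sep P u v) m"
  using assms by (intro cnt_cong cut_iff) (auto simp: mons_def)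

text \<open>For every edge the exponents of its two variables add up to the degree, so they amount
  to the degree and the number of factors that cut the edge. The degree is visible because there is
  an edge.\<close>

lemma expo_eq_iff:
  assumes G: "simple_graph G" "snd G \<noteq> {}" and m: "m \<in> mons (partitions G)" "m' \<in> mons (partitions G)"
  shows "expo G m = expo G m' \<longleftrightarrow> total_deg m = total_deg m' \<and>
    (\<forall>u v. {u, v} \<in> snd G \<longrightarrow> cnt (\<lambda>P. sep P u v) m = cnt (\<lambda>P. sep P u v) m')"
proof
  assume eq: "expo G m = expo G m'"
  have S: "cnt (\<lambda>P. e \<in> cut G P) m = cnt (\<lambda>P. e \<in> cut G P) m'" for e
    using lookup_expo(1)[OF G(1), of m e] lookup_expo(1)[OF G(1), of m' e] eq by simp
  obtain e where e: "e \<in> snd G" using G by blast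
  have "total_deg m - cnt (\<lambda>P. e \<in> cut G P) m = total_deg m' - cnt (\<lambda>P. e \<in> cut G P) m'"
    using lookup_expo(2)[OF G(1), of m e] lookup_expo(2)[OF G(1), of m' e] eq e by simp
  hence "total_deg m = total_deg m'"
    using S[of e] cnt_le[of "\<lambda>P. e \<in> cut G P" m] cnt_le[of "\<lambda>P. e \<in> cut G P" m'] by linarith
  moreover have "cnt (\<lambda>P. sep P u v) m = cnt (\<lambda>P. sep P u v) m'" if "{u, v} \<in> snd G" for u v
    using S[of "{u, v}"] cnt_cut[OF G(1) m(1) that] cnt_cut[OF G(1) m(2) that] by simp
  ultimately show "total_deg m = total_deg m' \<and>
    (\<forall>u v. {u, v} \<in> snd G \<longrightarrow> cnt (\<lambda>P. sep P u v) m = cnt (\<lambda>P. sep P u v) m')" by blast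
next
  assume a: "total_deg m = total_deg m' \<and>
    (\<forall>u v. {u, v} \<in> snd G \<longrightarrow> cnt (\<lambda>P. sep P u v) m = cnt (\<lambda>P. sep P u v) m')"
  have S: "cnt (\<lambda>P. e \<in> cut G P) m = cnt (\<lambda>P. e \<in> cut G P) m'" for e
  proof (cases "e \<in> snd G")
    case True
    then obtain u v where "e = {u, v}" using edge_cases[OF G(1)] by metis
    thus ?thesis using a True cnt_cut[OF G(1) m(1), of u v] cnt_cut[OF G(1) m(2), of u v] by simp
  next
    case False
    hence "e \<notin> cut G P" for P by (simp add: cut_def)
    thus ?thesis by (simp add: cnt_sum)
  qed
  show "expo G m = expo G m'"
  proof (rule poly_mapping_eqI)
    fix z show "lookup (expo G m) z = lookup (expo G m') z"
      using S a by (cases z) (simp_all add: lookup_expo[OF G(1)])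
  qed
qed

lemma graded_cut_ideal:
  assumes G: "simple_graph G" "snd G \<noteq> {}"
  shows "graded_fibres (partitions G) (\<lambda>m. Some (expo G m))"
  unfolding graded_fibres_def using expo_eq_iff[OF G] by (simp add: expo_add)

lemma ring_ideal_cut_ideal:
  "simple_graph G \<Longrightarrow> snd G \<noteq> {} \<Longrightarrow> ring_ideal (partitions G) (cut_ideal G)"
  unfolding cut_ideal_fibre by (intro ring_ideal_fibre graded_cut_ideal)

text \<open>The multiplicities of the restrictions of the partitions to a triangle, or to an edge, are
  linear functions of the exponent vector.\<close>

lemma cnt_triangle:
  assumes m: "m \<in> mons X" "m' \<in> mons X" and deg: "total_deg m = total_deg m'"
    and xor: "\<And>P. P \<in> X \<Longrightarrow> \<chi> P = (\<phi> P \<noteq> \<psi> P)"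
    and eq: "cnt \<phi> m = cnt \<phi> m'" "cnt \<psi> m = cnt \<psi> m'" "cnt \<chi> m = cnt \<chi> m'"
  shows "cnt (\<lambda>P. \<phi> P = s \<and> \<psi> P = t) m = cnt (\<lambda>P. \<phi> P = s \<and> \<psi> P = t) m'"
proof -
  have k: "P \<in> X" if "P \<in> keys m \<or> P \<in> keys m'" for P using that m by (auto simp: mons_def)
  \<comment> \<open>Inclusion-exclusion determines twice the number of factors with both properties,
    hence the number itself; the other three combinations follow.\<close>
  have 11: "cnt (\<lambda>P. \<phi> P \<and> \<psi> P) m = cnt (\<lambda>P. \<phi> P \<and> \<psi> P) m'"
    using cnt_xor[of m \<chi> \<phi> \<psi>] cnt_xor[of m' \<chi> \<phi> \<psi>] xor k eq by simp
  have 10: "cnt (\<lambda>P. \<phi> P \<and> \<not> \<psi> P) m = cnt (\<lambda>P. \<phi> P \<and> \<not> \<psi> P) m'"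
    using cnt_split[of \<phi> m \<psi>] cnt_split[of \<phi> m' \<psi>] 11 eq by simp
  have c: "(\<lambda>P. \<psi> P \<and> \<phi> P) = (\<lambda>P. \<phi> P \<and> \<psi> P)" "(\<lambda>P. \<psi> P \<and> \<not> \<phi> P) = (\<lambda>P. \<not> \<phi> P \<and> \<psi> P)" by auto
  have 01: "cnt (\<lambda>P. \<not> \<phi> P \<and> \<psi> P) m = cnt (\<lambda>P. \<not> \<phi> P \<and> \<psi> P) m'"
    using cnt_split[of \<psi> m \<phi>] cnt_split[of \<psi> m' \<phi>] 11 eq unfolding c by simp
  have 00: "cnt (\<lambda>P. \<not> \<phi> P \<and> \<not> \<psi> P) m = cnt (\<lambda>P. \<not> \<phi> P \<and> \<not> \<psi> P) m'"
    using cnt_split[of "\<lambda>P. \<not> \<phi> P" m \<psi>] cnt_split[of "\<lambda>P. \<not> \<phi> P" m' \<psi>] 01 eq deg cnt_not[of \<phi> m] cnt_not[of \<phi> m'] by simp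
  show ?thesis using 11 10 01 00 by (cases s; cases t) simp_all
qed

section \<open>Contractions\<close>

definition gconn :: "'v graph \<Rightarrow> 'v set \<Rightarrow> bool" where
  "gconn G A \<longleftrightarrow> (\<forall>u\<in>A. \<forall>v\<in>A. (u, v) \<in> {(x, y). x \<in> A \<and> y \<in> A \<and> {x, y} \<in> snd G}\<^sup>*)"

definition joined :: "'v graph \<Rightarrow> 'v set \<Rightarrow> 'v set \<Rightarrow> bool" where
  "joined G A B \<longleftrightarrow> (\<exists>u\<in>A. \<exists>v\<in>B. {u, v} \<in> snd G)"

definition budget :: "feature list \<Rightarrow> nat list list \<Rightarrow> nat list" where
  "budget fs L = map (\<lambda>\<phi>. length (filter (has_feature \<phi>) L)) fs"

section \<open>Soundness of the budget test\<close>

lemma spend_budget: "spend (feature_row fs A) (budget fs (A # L)) = Some (budget fs L)"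
  by (induction fs) (simp_all add: feature_row_def budget_def)

lemma spend_all_budget: "spend_all (map (feature_row fs) As) (budget fs (As @ L)) = Some (budget fs L)"
  by (induction As) (simp_all add: spend_budget)

lemma extendable_budget: "n \<le> length L \<Longrightarrow> set L \<subseteq> set Ms \<Longrightarrow> extendable (map (feature_row fs) Ms) n (budget fs L)"
proof (induction n arbitrary: L)
  case 0 thus ?case by (simp add: extendable.simps)
next
  case (Suc n)
  then obtain A L' where L: "L = A # L'" by (cases L) auto
  hence "A \<in> set Ms" "extendable (map (feature_row fs) Ms) n (budget fs L')" using Suc by auto
  thus ?case using spend_budget[of fs A L'] L by (subst extendable.simps) (force simp: list_ex_iff)
qed

text \<open>The rest \<open>L\<close> of an actual factorisation fits into what the partitions
  \<open>As\<close> leave of its budget. So a failed test shows that the set is not a face.\<close>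

lemma maybe_face_budget:
  "n \<le> length L \<Longrightarrow> set L \<subseteq> set Ms \<Longrightarrow> maybe_face (map (feature_row fs) Ms) n (budget fs (As @ L)) (map (feature_row fs) As)"
  by (simp add: maybe_face_def spend_all_budget extendable_budget)

lemma filter_in_subseqs: "filter P xs \<in> set (subseqs xs)"
  by (induction xs) (simp_all add: Let_def)

lemma subseqs_filter: "ys \<in> set (subseqs xs) \<Longrightarrow> distinct xs \<Longrightarrow> filter (\<lambda>x. x \<in> set ys) xs = ys"
proof (induction xs arbitrary: ys)
  case (Cons x xs)
  have sub: "set zs \<subseteq> set xs" if "zs \<in> set (subseqs xs)" for zs
    using that subseqs_powset[of xs] by blast
  from Cons(2) consider zs where "ys = x # zs" "zs \<in> set (subseqs xs)" | "ys \<in> set (subseqs xs)"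
    by (auto simp: Let_def)
  thus ?case
  proof cases
    case 1
    have "filter (\<lambda>y. y \<in> set ys) xs = filter (\<lambda>y. y \<in> set zs) xs"
      using Cons(3) 1 by (intro filter_cong) auto
    thus ?thesis using Cons(1)[OF 1(2)] Cons(3) 1(1) by simp
  next
    case 2
    have "x \<notin> set ys" using sub[OF 2] Cons(3) by auto
    thus ?thesis using Cons(1)[OF 2] Cons(3) by simp
  qed
qed simp

lemma mons_list:
  assumes "m \<in> mons X"
  obtains Ps where "set Ps \<subseteq> X" "m = (\<Sum>P\<leftarrow>Ps. single P (Suc 0))"
proof -
  have "\<exists>Ps. set Ps \<subseteq> X \<and> m = (\<Sum>P\<leftarrow>Ps. single P (Suc 0))" using assms
  proof (induction "total_deg m" arbitrary: m)
    case 0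
    hence "m = 0" by (simp add: total_deg_eq_0_iff)
    thus ?case by (intro exI[of _ "[]"]) simp
  next
    case (Suc n)
    hence "m \<noteq> 0" by (metis nat.simps(3) total_deg_zero)
    hence "keys m \<noteq> {}" by simp
    then obtain P where P: "P \<in> keys m" by blast
    define m' where "m' = m - single P (Suc 0)"
    have m: "m = m' + single P (Suc 0)" unfolding m'_def by (rule mon_minus_single[OF P, symmetric])
    have "m' \<in> mons X" "P \<in> X" "n = total_deg m'" using Suc(2,3) m by simp_all
    then obtain Ps where "set Ps \<subseteq> X" "m' = (\<Sum>P\<leftarrow>Ps. single P (Suc 0))" using Suc(1) by blast
    thus ?case using m \<open>P \<in> X\<close> by (intro exI[of _ "P # Ps"]) (simp add: add.commute)
  qed
  thus ?thesis using that by blast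
qed

lemma cnt_list: "cnt \<phi> (\<Sum>k\<leftarrow>ks. single (f k) (Suc 0)) = length (filter (\<lambda>k. \<phi> (f k)) ks)"
  by (induction ks) (simp_all add: cnt_add cnt_single)

lemma total_deg_list: "total_deg (\<Sum>k\<leftarrow>ks. single (f k) (Suc 0)) = length ks"
  by (induction ks) simp_all

lemma keys_list: "keys (\<Sum>k\<leftarrow>ks. single (f k) (Suc 0) :: _ \<Rightarrow>\<^sub>0 nat) = f ` set ks"
  by (induction ks) (simp_all add: keys_add_nat)

lemma expo_list: "expo G (\<Sum>k\<leftarrow>ks. single (f k) (Suc 0)) = (\<Sum>k\<leftarrow>ks. expo G (single (f k) (Suc 0)))"
  by (induction ks) (simp_all add: expo_add)

text \<open>The contracted graph never appears as a graph. Its edges are the list \<open>EL\<close>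
  of increasing pairs, and its partitions are those of \<open>G\<close> that cut no piece.\<close>

definition contraction :: "'v graph \<Rightarrow> nat \<Rightarrow> (nat \<times> nat) list \<Rightarrow> (nat \<Rightarrow> 'v set) \<Rightarrow> bool" where
  "contraction G h EL S \<longleftrightarrow> 0 < h \<and> (\<forall>i<h. S i \<noteq> {} \<and> gconn G (S i)) \<and> (\<Union>i<h. S i) = fst G \<and>
     (\<forall>i<h. \<forall>j<h. i \<noteq> j \<longrightarrow> S i \<inter> S j = {}) \<and>
     (\<forall>i j. i < j \<longrightarrow> j < h \<longrightarrow> joined G (S i) (S j) = ((i, j) \<in> set EL))"

locale contracted_graph =
  fixes G :: "'v graph" and h :: nat and EL :: "(nat \<times> nat) list" and S :: "nat \<Rightarrow> 'v set"
  assumes simple: "simple_graph G" and edges: "snd G \<noteq> {}" and contr: "contraction G h EL S"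
    and EL: "list_all (\<lambda>(i, j). i < j \<and> j < h) EL"
begin

abbreviation "X \<equiv> partitions G"

definition rep :: "nat \<Rightarrow> 'v" where "rep i = (SOME u. u \<in> S i)"

lemma h_pos: "0 < h" and S_union: "(\<Union>i<h. S i) = fst G"
  using contr by (simp_all add: contraction_def)

lemma S_conn: "i < h \<Longrightarrow> gconn G (S i)" and S_ne: "i < h \<Longrightarrow> S i \<noteq> {}"
  using contr by (simp_all add: contraction_def)

lemma S_disj: "i < h \<Longrightarrow> j < h \<Longrightarrow> u \<in> S i \<Longrightarrow> u \<in> S j \<Longrightarrow> i = j"
  using contr unfolding contraction_def by blast

lemma S_vertex: "i < h \<Longrightarrow> u \<in> S i \<Longrightarrow> u \<in> fst G"
  using S_union by blast

lemma rep_in: "i < h \<Longrightarrow> rep i \<in> S i"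
  unfolding rep_def using S_ne by (simp add: some_in_eq)

lemma vertex_S:
  assumes "u \<in> fst G" obtains i where "i < h" "u \<in> S i"
  using assms S_union by blast

lemma EL_joined:
  assumes "(i, j) \<in> set EL"
  obtains u v where "i < j" "j < h" "u \<in> S i" "v \<in> S j" "{u, v} \<in> snd G"
proof -
  have "i < j" "j < h" using EL assms by (auto simp: list_all_iff)
  moreover from this have "joined G (S i) (S j)" using contr assms by (simp add: contraction_def)
  ultimately show ?thesis using that by (auto simp: joined_def)
qed

definition blowup :: "nat list \<Rightarrow> 'v set set" where
  "blowup A = part G (\<Union>i\<in>set A. S i)"

definition pulled :: "'v set set \<Rightarrow> bool" where
  "pulled P \<longleftrightarrow> P \<in> X \<and> (\<forall>i<h. \<forall>u\<in>S i. \<forall>v\<in>S i. \<not> sep P u v)"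

text \<open>The pieces on the side away from piece 0; this normalisation agrees with the lists in
  certificates.\<close>

definition cls :: "'v set set \<Rightarrow> nat list" where
  "cls P = filter (\<lambda>i. sep P (rep 0) (rep i)) [1..<h]"

lemma sep_rep:
  assumes P: "pulled P" and i: "i < h" "u \<in> S i" and j: "j < h" "v \<in> S j"
  shows "sep P u v = msep (cls P) i j"
proof -
  have PX: "P \<in> X" using P by (simp add: pulled_def)
  note vert = S_vertex[OF i] S_vertex[OF j] S_vertex[OF i(1) rep_in[OF i(1)]] S_vertex[OF j(1) rep_in[OF j(1)]]
    S_vertex[OF h_pos rep_in[OF h_pos]]
  have "\<not> sep P u (rep i)" "\<not> sep P (rep j) v"
    using P i j rep_in[OF i(1)] rep_in[OF j(1)] unfolding pulled_def by blast+
  hence "sep P u v = sep P (rep i) (rep j)"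
    using sep_xor[OF PX, of u "rep i" v] sep_xor[OF PX, of "rep i" "rep j" v] vert by blast
  also have "\<dots> = (sep P (rep 0) (rep i) \<noteq> sep P (rep 0) (rep j))"
    using sep_xor[OF PX, of "rep i" "rep 0" "rep j"] sep_commute[OF PX, of "rep i" "rep 0"] vert by blast
  finally show ?thesis using i j
    by (cases "i = 0"; cases "j = 0") (auto simp: msep_def cls_def)
qed

lemma pulled_eq:
  assumes P: "pulled P" and Q: "pulled Q" and eq: "cls P = cls Q"
  shows "P = Q"
proof -
  have w: "rep 0 \<in> fst G" using S_vertex[OF h_pos rep_in[OF h_pos]] .
  have "sep P (rep 0) v = sep Q (rep 0) v" if v: "v \<in> fst G" for v
  proof -
    obtain i where "i < h" "v \<in> S i" using vertex_S[OF v] .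
    thus ?thesis using sep_rep[OF P h_pos rep_in[OF h_pos], of i v] sep_rep[OF Q h_pos rep_in[OF h_pos], of i v] eq by simp
  qed
  hence e: "{v \<in> fst G. sep P (rep 0) v} = {v \<in> fst G. sep Q (rep 0) v}" by blast
  have "P = part G {v \<in> fst G. sep P (rep 0) v}" "Q = part G {v \<in> fst G. sep Q (rep 0) v}"
    by (rule partition_eq_part; use P Q w in \<open>simp add: pulled_def\<close>)+
  thus ?thesis using e by simp
qed

lemma
  assumes A: "A \<in> set (subseqs [1..<h])"
  shows pulled_blowup: "pulled (blowup A)" and cls_blowup: "cls (blowup A) = A"
proof -
  have "set A \<in> set ` set (subseqs [1..<h])" using A by (rule imageI)
  hence Ah: "set A \<subseteq> {1..<h}" unfolding subseqs_powset by simp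
  have sub: "(\<Union>i\<in>set A. S i) \<subseteq> fst G" using Ah S_union by force
  have mem: "u \<in> (\<Union>i\<in>set A. S i) \<longleftrightarrow> i \<in> set A" if "i < h" "u \<in> S i" for i u
  proof
    assume "u \<in> (\<Union>i\<in>set A. S i)"
    then obtain l where l: "l \<in> set A" "u \<in> S l" by blast
    hence "l < h" using Ah by auto
    thus "i \<in> set A" using S_disj[OF that(1) _ that(2) l(2)] l(1) by simp
  qed (use that in blast)
  have sp: "sep (blowup A) u v \<longleftrightarrow> (i \<in> set A) \<noteq> (j \<in> set A)" if "i < h" "u \<in> S i" "j < h" "v \<in> S j" for i j u v
    using that mem[OF that(1,2)] mem[OF that(3,4)] sep_part[OF sub S_vertex[OF that(1,2)] S_vertex[OF that(3,4)]]
    by (simp add: blowup_def)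
  show "pulled (blowup A)"
    unfolding pulled_def using sp part_in[OF sub] by (simp add: blowup_def)
  have "0 \<notin> set A" using Ah by auto
  hence "cls (blowup A) = filter (\<lambda>i. i \<in> set A) [1..<h]"
    unfolding cls_def using sp[OF h_pos rep_in[OF h_pos]] rep_in by (intro filter_cong) auto
  thus "cls (blowup A) = A" using subseqs_filter[OF A] by simp
qed

lemma cls_in: "cls P \<in> set (subseqs [1..<h])"
  unfolding cls_def by (rule filter_in_subseqs)

text \<open>No factor of \<open>M0\<close> cuts an edge inside a piece. These zero counts are part
  of the exponent vector, so no factor of \<open>M\<close> cuts such an edge either, and
  connectedness spreads this over the whole piece.\<close>

lemma pulled_of_expo:
  assumes M: "M \<in> mons X" "M0 \<in> mons X" "expo G M = expo G M0" and M0: "\<And>P. P \<in> keys M0 \<Longrightarrow> pulled P"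
    and P: "P \<in> keys M"
  shows "pulled P"
proof -
  have PX: "P \<in> X" using M P by (auto simp: mons_def)
  have "\<not> sep P u v" if i: "i < h" and u: "u \<in> S i" and v: "v \<in> S i" for i u v
  proof -
    have "(u, v) \<in> {(x, y). x \<in> S i \<and> y \<in> S i \<and> {x, y} \<in> snd G}\<^sup>*"
      using S_conn[OF i] u v by (simp add: gconn_def)
    thus "\<not> sep P u v"
    proof (induction rule: rtrancl_induct)
      case (step y z)
      hence yz: "y \<in> S i" "z \<in> S i" "{y, z} \<in> snd G" by auto
      have "cnt (\<lambda>P. sep P y z) M0 = 0"
        using M0 yz i by (auto simp: cnt_sum pulled_def)
      hence "cnt (\<lambda>P. sep P y z) M = 0"
        using expo_eq_iff[OF simple edges M(1,2)] M(3) yz(3) by simp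
      hence "\<not> sep P y z" using cnt_eq_0[OF _ P, of "\<lambda>P. sep P y z"] by blast
      thus ?case using step.IH sep_xor[OF PX, of u y z] S_vertex[OF i] u yz by blast
    qed simp
  qed
  thus ?thesis using PX by (simp add: pulled_def)
qed

text \<open>An edge of the contraction is represented by one edge of \<open>G\<close>, whose cut
  count belongs to the exponent vector. Triangles follow from their three edges by
  \<open>cnt_triangle\<close>; an edge feature is the degenerate case \<open>j = k\<close>.\<close>

lemma feature_count:
  assumes M: "M \<in> mons X" "M0 \<in> mons X" "expo G M = expo G M0"
    and pM: "\<And>P. P \<in> keys M \<Longrightarrow> pulled P" and pM0: "\<And>P. P \<in> keys M0 \<Longrightarrow> pulled P"
    and \<phi>: "valid_feature EL \<phi>"
  shows "cnt (\<lambda>P. has_feature \<phi> (cls P)) M = cnt (\<lambda>P. has_feature \<phi> (cls P)) M0"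
proof -
  have deg: "total_deg M = total_deg M0" using expo_eq_iff[OF simple edges M(1,2)] M(3) by blast
  have edge: "cnt (\<lambda>P. msep (cls P) i j) M = cnt (\<lambda>P. msep (cls P) i j) M0" if ij: "(i, j) \<in> set EL" for i j
  proof -
    obtain u v where uv: "i < j" "j < h" "u \<in> S i" "v \<in> S j" "{u, v} \<in> snd G" using EL_joined[OF ij] .
    have e: "cnt (\<lambda>P. msep (cls P) i j) N = cnt (\<lambda>P. sep P u v) N" if "\<And>P. P \<in> keys N \<Longrightarrow> pulled P" for N
      using that uv sep_rep[of _ i u j v] by (intro cnt_cong) simp
    show ?thesis using e[OF pM] e[OF pM0] expo_eq_iff[OF simple edges M(1,2)] M(3) uv(5) by simp
  qed
  obtain i j k s t where f: "\<phi> = (i, j, k, s, t)" by (cases \<phi>)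
  have ij: "(i, j) \<in> set EL" "(i, k) \<in> set EL" using \<phi> f by simp_all
  have jk: "cnt (\<lambda>P. msep (cls P) j k) M = cnt (\<lambda>P. msep (cls P) j k) M0"
  proof (cases "j = k")
    case True thus ?thesis by (simp add: msep_def cnt_sum)
  next
    case False thus ?thesis using \<phi> f edge by simp
  qed
  have XM: "M \<in> mons UNIV" "M0 \<in> mons UNIV" by (simp_all add: mons_def)
  have "cnt (\<lambda>P. msep (cls P) i j = s \<and> msep (cls P) i k = t) M = cnt (\<lambda>P. msep (cls P) i j = s \<and> msep (cls P) i k = t) M0"
    by (rule cnt_triangle[OF XM deg, where \<chi> = "\<lambda>P. msep (cls P) j k"]) (use edge ij jk in \<open>auto simp: msep_def\<close>)
  thus ?thesis using f by simp
qed

text \<open>Edges of \<open>G\<close> inside a piece are never cut, and all other edges lie over a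
  pair in \<open>EL\<close>, so the counts over \<open>EL\<close> determine the exponent
  vector.\<close>

lemma expo_eqI_contracted:
  assumes "\<And>k. k \<in> set ks \<Longrightarrow> pulled (q k)" "\<And>k. k \<in> set ls \<Longrightarrow> pulled (q k)" "length ks = length ls"
    and cnt: "\<And>i j. (i, j) \<in> set EL \<Longrightarrow> length (filter (\<lambda>k. msep (cls (q k)) i j) ks) = length (filter (\<lambda>k. msep (cls (q k)) i j) ls)"
  shows "expo G (\<Sum>k\<leftarrow>ks. single (q k) (Suc 0)) = expo G (\<Sum>k\<leftarrow>ls. single (q k) (Suc 0))"
proof -
  have mons: "(\<Sum>k\<leftarrow>xs. single (q k) (Suc 0)) \<in> mons X" if "\<And>k. k \<in> set xs \<Longrightarrow> pulled (q k)" for xs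
    using that by (auto simp: mons_def keys_list pulled_def)
  have sepcnt: "cnt (\<lambda>P. sep P u v) (\<Sum>k\<leftarrow>xs. single (q k) (Suc 0)) = length (filter (\<lambda>k. msep (cls (q k)) i j) xs)"
    if "\<And>k. k \<in> set xs \<Longrightarrow> pulled (q k)" "i < h" "u \<in> S i" "j < h" "v \<in> S j" for xs u v i j
    unfolding cnt_list using that(1) sep_rep[OF _ that(2-5)] by (intro arg_cong[of _ _ length] filter_cong) auto
  have "cnt (\<lambda>P. sep P u v) (\<Sum>k\<leftarrow>ks. single (q k) (Suc 0)) = cnt (\<lambda>P. sep P u v) (\<Sum>k\<leftarrow>ls. single (q k) (Suc 0))"
    if e: "{u, v} \<in> snd G" for u v
  proof -
    have uv: "u \<in> fst G" "v \<in> fst G" using edge_vertices[OF simple e] by auto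
    obtain i where i: "i < h" "u \<in> S i" using vertex_S[OF uv(1)] .
    obtain j where j: "j < h" "v \<in> S j" using vertex_S[OF uv(2)] .
    have "length (filter (\<lambda>k. msep (cls (q k)) i j) ks) = length (filter (\<lambda>k. msep (cls (q k)) i j) ls)"
    proof -
      consider "i = j" | "i < j" | "j < i" by linarith
      thus ?thesis
      proof cases
        case 1 thus ?thesis by (simp add: msep_def)
      next
        case 2
        have "joined G (S i) (S j)" using i j e by (auto simp: joined_def)
        hence "(i, j) \<in> set EL" using contr 2 j(1) by (simp add: contraction_def)
        thus ?thesis by (rule cnt)
      next
        case 3
        have "{v, u} \<in> snd G" using e by (simp add: insert_commute)
        hence "joined G (S j) (S i)" using i j by (auto simp: joined_def)
        hence "(j, i) \<in> set EL" using contr 3 i(1) by (simp add: contraction_def)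
        moreover have "msep A i j = msep A j i" for A by (auto simp: msep_def)
        ultimately show ?thesis using cnt[of j i] by simp
      qed
    qed
    thus ?thesis using sepcnt[OF assms(1) i j] sepcnt[OF assms(2) i j] by simp
  qed
  moreover have "(\<Sum>k\<leftarrow>ks. single (q k) (Suc 0)) \<in> mons X" "(\<Sum>k\<leftarrow>ls. single (q k) (Suc 0)) \<in> mons X"
    using mons[of ks] mons[of ls] assms(1,2) by blast+
  ultimately show ?thesis using assms(3)
    by (subst expo_eq_iff[OF simple edges]) (simp_all only: total_deg_list, blast)
qed

text \<open>Two tests control the faces: the one on single partitions shows that only those in
  \<open>vs\<close> divide a monomial of the fibre, and the one on larger sets shows that the
  cocycle condition has been checked on every face.\<close>

lemma certificate_sound:
  assumes cert: "certificate h EL fs vs ms0 i c Z t n n1"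
  obtains rk where "koszul X rk"
    "\<not> koszul.tor_vanish X rk i (int c) (cut_ideal G :: ('v set set, 'k::field) pol set)"
proof -
  define N where "N = length vs"
  define masks where "masks = subseqs [1..<h]"
  define rs where "rs = map (feature_row fs) masks"
  define b where "b = budget fs (map ((!) vs) ms0)"
  define q where "q = (\<lambda>k. blowup (vs ! k))"
  have b_eq: "b = map (\<lambda>\<phi>. length (filter (\<lambda>k. has_feature \<phi> (vs ! k)) ms0)) fs"
    unfolding b_def budget_def by (simp add: filter_map comp_def)
  note C = cert[unfolded certificate_def Let_def, folded N_def masks_def, folded rs_def, folded b_eq]
  have fs: "\<And>\<phi>. \<phi> \<in> set fs \<Longrightarrow> valid_feature EL \<phi>"
    using C[THEN conjunct1] by (simp add: list_all_iff)
  have vs: "distinct vs" "\<And>A. A \<in> set vs \<Longrightarrow> A \<in> set masks"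
    using C[THEN conjunct2, THEN conjunct2, THEN conjunct1] C[THEN conjunct2, THEN conjunct2, THEN conjunct2, THEN conjunct1] by (simp_all add: list_all_iff)
  have ms0: "\<And>k. k \<in> set ms0 \<Longrightarrow> k < N" "length ms0 = i + c"
    using C[THEN conjunct2, THEN conjunct2, THEN conjunct2, THEN conjunct2, THEN conjunct1] C[THEN conjunct2, THEN conjunct2, THEN conjunct2, THEN conjunct2, THEN conjunct2, THEN conjunct1] by (simp_all add: list_all_iff)
  have n: "n + Suc i \<le> length ms0" "Suc n1 \<le> length ms0"
    using C[THEN conjunct2, THEN conjunct2, THEN conjunct2, THEN conjunct2, THEN conjunct2, THEN conjunct2, THEN conjunct1] C[THEN conjunct2, THEN conjunct2, THEN conjunct2, THEN conjunct2, THEN conjunct2, THEN conjunct2, THEN conjunct2, THEN conjunct1] .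
  have Z: "sorted us \<and> distinct us \<and> length us = i \<and> length ms = c \<and> set us \<union> set ms \<subseteq> {..<N} \<and>
      (\<forall>(i, j)\<in>set EL. length (filter (\<lambda>k. msep (vs ! k) i j) (us @ ms)) = length (filter (\<lambda>k. msep (vs ! k) i j) ms0))"
    if e: "(us, a, ms) \<in> set Z" for us a ms
    using bspec[OF C[THEN conjunct2, THEN conjunct2, THEN conjunct2, THEN conjunct2, THEN conjunct2, THEN conjunct2, THEN conjunct2, THEN conjunct2, THEN conjunct1, unfolded list_all_iff[of _ Z]] e]
    by (auto simp: list_all_iff)
  have dist: "distinct (map fst Z)" by (rule C[THEN conjunct2, THEN conjunct2, THEN conjunct2, THEN conjunct2, THEN conjunct2, THEN conjunct2, THEN conjunct2, THEN conjunct2, THEN conjunct2, THEN conjunct1])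
  have cyc: "lbound N (map (\<lambda>(us, a, ms). (us, a)) Z) us = 0" if "us \<in> set (ksublists (i - 1) [0..<N])" for us
    using bspec[OF C[THEN conjunct2, THEN conjunct2, THEN conjunct2, THEN conjunct2, THEN conjunct2, THEN conjunct2, THEN conjunct2, THEN conjunct2, THEN conjunct2, THEN conjunct2, THEN conjunct1, unfolded list_all_iff] that] .
  have sing: "A \<in> set vs \<or> \<not> maybe_face rs n1 b [feature_row fs A]" if "A \<in> set masks" for A
    using bspec[OF C[THEN conjunct2, THEN conjunct2, THEN conjunct2, THEN conjunct2, THEN conjunct2, THEN conjunct2, THEN conjunct2, THEN conjunct2, THEN conjunct2, THEN conjunct2, THEN conjunct2, THEN conjunct1, unfolded list_all_iff] that] .
  have cocyc: "lcobound t us = 0 \<or> \<not> maybe_face rs n b (map (\<lambda>k. feature_row fs (vs ! k)) us)"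
    if "us \<in> set (ksublists (Suc i) [0..<N])" for us
    using bspec[OF C[THEN conjunct2, THEN conjunct2, THEN conjunct2, THEN conjunct2, THEN conjunct2, THEN conjunct2, THEN conjunct2, THEN conjunct2, THEN conjunct2, THEN conjunct2, THEN conjunct2, THEN conjunct2, THEN conjunct1, unfolded list_all_iff] that] .
  have pair: "(\<Sum>(us, a)\<leftarrow>map (\<lambda>(us, a, ms). (us, a)) Z. a * look t us) = 1"
    by (rule C[THEN conjunct2, THEN conjunct2, THEN conjunct2, THEN conjunct2, THEN conjunct2, THEN conjunct2, THEN conjunct2, THEN conjunct2, THEN conjunct2, THEN conjunct2, THEN conjunct2, THEN conjunct2, THEN conjunct2])
  have vsk: "vs ! k \<in> set (subseqs [1..<h])" if "k < N" for k
    using vs(2)[of "vs ! k"] that by (simp add: N_def masks_def)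
  have q_pulled: "pulled (q k)" and q_cls: "cls (q k) = vs ! k" if "k < N" for k
    unfolding q_def using pulled_blowup[OF vsk[OF that]] cls_blowup[OF vsk[OF that]] by simp_all
  have q_inj: "inj_on q {..<N}"
  proof (rule inj_onI)
    fix k l assume "k \<in> {..<N}" "l \<in> {..<N}" "q k = q l"
    hence "vs ! k = vs ! l" using q_cls[of k] q_cls[of l] by simp
    thus "k = l" using vs(1) \<open>k \<in> _\<close> \<open>l \<in> _\<close> by (simp add: nth_eq_iff_index_eq N_def)
  qed
  have q_X: "q k \<in> X" if "k < N" for k using q_pulled[OF that] by (simp add: pulled_def)
  have finX: "finite X" by (rule finite_partitions[OF simple])
  obtain f :: "'v set set \<Rightarrow> nat" where f: "inj_on f X" using finite_imp_inj_to_nat_seg[OF finX] by metis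
  \<comment> \<open>The listed partitions receive the ranks \<open>0, \<dots>, N - 1\<close> in the
    order of \<open>vs\<close> and all others larger ones, so that ranks are list positions.\<close>
  define rk where "rk = (\<lambda>P. if P \<in> q ` {..<N} then inv_into {..<N} q P else N + f P)"
  have rk_q: "rk (q k) = k" if "k < N" for k using that q_inj by (simp add: rk_def inv_into_f_f)
  have rk_out: "rk P = N + f P" if "P \<notin> q ` {..<N}" for P using that by (simp add: rk_def)
  have "koszul X rk"
  proof
    show "finite X" by fact
    show "inj_on rk X"
    proof (rule inj_onI)
      fix P Q assume PQ: "P \<in> X" "Q \<in> X" "rk P = rk Q"
      consider k l where "k < N" "l < N" "P = q k" "Q = q l" | k where "k < N" "P = q k" "Q \<notin> q ` {..<N}"
        | k where "k < N" "Q = q k" "P \<notin> q ` {..<N}" | "P \<notin> q ` {..<N}" "Q \<notin> q ` {..<N}" by blast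
      thus "P = Q"
      proof cases
        case 4 thus ?thesis using PQ rk_out f by (simp add: inj_on_def)
      qed (use PQ rk_q rk_out in auto)
    qed
  qed
  interpret K: koszul X rk by fact
  define mon0 where "mon0 = (\<Sum>k\<leftarrow>ms0. single (q k) (Suc 0))"
  have mon0: "mon0 \<in> mons X" "\<And>P. P \<in> keys mon0 \<Longrightarrow> pulled P"
    using ms0(1) q_X q_pulled by (auto simp: mon0_def mons_def keys_list)
  \<comment> \<open>Every factorisation of a monomial with the image of \<open>mon0\<close> has
    pulled factors and the budget of \<open>ms0\<close>.\<close>
  have fibre: "budget fs (map cls Ps) = b \<and> length Ps = i + c \<and> (\<forall>P\<in>set Ps. pulled P)"
    if Ps: "set Ps \<subseteq> X" "expo G (\<Sum>P\<leftarrow>Ps. single P (Suc 0)) = expo G mon0" for Ps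
  proof -
    let ?M = "\<Sum>P\<leftarrow>Ps. single P (Suc 0)"
    have M: "?M \<in> mons X" using Ps(1) keys_list[of "\<lambda>P. P" Ps] by (simp add: mons_def)
    have pM: "pulled P" if "P \<in> keys ?M" for P by (rule pulled_of_expo[OF M mon0(1) Ps(2) mon0(2) that])
    have "length (filter (has_feature \<phi>) (map cls Ps)) = length (filter (has_feature \<phi>) (map ((!) vs) ms0))"
      if "\<phi> \<in> set fs" for \<phi>
    proof -
      have "cnt (\<lambda>P. has_feature \<phi> (cls P)) ?M = cnt (\<lambda>P. has_feature \<phi> (cls P)) mon0"
        by (rule feature_count[OF M mon0(1) Ps(2) pM mon0(2) fs[OF that]])
      moreover have "length (filter (\<lambda>k. has_feature \<phi> (cls (q k))) ms0) = length (filter (\<lambda>k. has_feature \<phi> (vs ! k)) ms0)"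
        using ms0(1) q_cls by (intro arg_cong[of _ _ length] filter_cong) auto
      ultimately show ?thesis unfolding mon0_def cnt_list by (simp add: filter_map comp_def)
    qed
    hence "budget fs (map cls Ps) = b" unfolding b_def budget_def by simp
    moreover have "length Ps = i + c"
      using expo_eq_iff[OF simple edges M mon0(1)] Ps(2) ms0(2) unfolding mon0_def total_deg_list by simp
    moreover have "\<forall>P\<in>set Ps. pulled P" using pM keys_list[of "\<lambda>P. P" Ps] by simp
    ultimately show ?thesis by blast
  qed
  have cls_masks: "cls P \<in> set masks" for P using cls_in by (simp add: masks_def)
  have in_q: "P \<in> q ` {..<N}" if Ps: "set Ps \<subseteq> X" "expo G (\<Sum>P\<leftarrow>Ps. single P (Suc 0)) = expo G mon0" and P: "P \<in> set Ps" for Ps P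
  proof -
    note fb = fibre[OF Ps]
    obtain ys zs where yz: "Ps = ys @ P # zs" using split_list[OF P] by blast
    have "budget fs ([cls P] @ map cls (ys @ zs)) = budget fs (map cls Ps)"
      unfolding budget_def yz by simp
    hence "budget fs ([cls P] @ map cls (ys @ zs)) = b" using fb by simp
    moreover have "n1 \<le> length (map cls (ys @ zs))" using fb yz n(2) ms0(2) by simp
    moreover have "set (map cls (ys @ zs)) \<subseteq> set masks" using cls_masks by auto
    ultimately have "maybe_face rs n1 b (map (feature_row fs) [cls P])"
      using maybe_face_budget[of n1 "map cls (ys @ zs)" masks fs "[cls P]"] unfolding rs_def by metis
    hence "cls P \<in> set vs" using sing[OF cls_masks[of P]] by simp
    then obtain k where k: "k < N" "cls P = vs ! k" by (auto simp: in_set_conv_nth N_def)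
    have "pulled P" using fb P by blast
    hence "P = q k" using pulled_eq[OF _ q_pulled[OF k(1)]] q_cls[OF k(1)] k(2) by simp
    thus ?thesis using k(1) by blast
  qed
  have "\<not> K.tor_vanish i (int c) (fibre_ideal X (\<lambda>m. Some (expo G m)) :: ('v set set, 'k) pol set)"
  proof (rule K.not_tor_vanish_lists[where N = N and q = q and Z = Z and t = t and b = "expo G mon0"])
    show "expo G (m + n) = expo G m + expo G n" for m n by (rule expo_add)
    show "q k \<in> X \<and> rk (q k) = k" if "k < N" for k using q_X rk_q that by blast
    show "sorted us \<and> distinct us \<and> length us = i \<and> length ms = c \<and> set us \<union> set ms \<subseteq> {..<N} \<and>
        expo G (\<Sum>k\<leftarrow>us @ ms. single (q k) (Suc 0)) = expo G mon0" if e: "(us, a, ms) \<in> set Z" for us a ms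
    proof -
      note z = Z[OF e]
      have "expo G (\<Sum>k\<leftarrow>us @ ms. single (q k) (Suc 0)) = expo G (\<Sum>k\<leftarrow>ms0. single (q k) (Suc 0))"
      proof (rule expo_eqI_contracted)
        show "pulled (q k)" if "k \<in> set (us @ ms)" for k using that z by (intro q_pulled) auto
        show "pulled (q k)" if "k \<in> set ms0" for k using that ms0(1) by (intro q_pulled)
        show "length (us @ ms) = length ms0" using z ms0(2) by simp
        fix i' j' assume ij: "(i', j') \<in> set EL"
        have "filter (\<lambda>k. msep (cls (q k)) i' j') (us @ ms) = filter (\<lambda>k. msep (vs ! k) i' j') (us @ ms)"
          using z q_cls by (intro filter_cong) auto
        moreover have "filter (\<lambda>k. msep (cls (q k)) i' j') ms0 = filter (\<lambda>k. msep (vs ! k) i' j') ms0"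
          using ms0(1) q_cls by (intro filter_cong) auto
        moreover have "length (filter (\<lambda>k. msep (vs ! k) i' j') (us @ ms)) = length (filter (\<lambda>k. msep (vs ! k) i' j') ms0)"
          using z ij by fast
        ultimately show "length (filter (\<lambda>k. msep (cls (q k)) i' j') (us @ ms)) = length (filter (\<lambda>k. msep (cls (q k)) i' j') ms0)"
          by simp
      qed
      thus ?thesis using z unfolding mon0_def by blast
    qed
    have e: "map fst (map (\<lambda>(us, a, ms). (us, a)) Z) = map fst Z" by (simp add: case_prod_beta)
    show "distinct (map fst (map (\<lambda>(us, a, ms). (us, a)) Z))" unfolding e by (rule dist)
    show "lbound N (map (\<lambda>(us, a, ms). (us, a)) Z) us = 0" if "us \<in> set (ksublists (i - 1) [0..<N])" for us
      using cyc[OF that] .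
    show "(\<Sum>(us, a)\<leftarrow>map (\<lambda>(us, a, ms). (us, a)) Z. a * look t us) = 1" by (rule pair)
    fix U m assume U: "U \<subseteq> X" "card U = Suc i" "m \<in> mons X" "expo G m + (\<Sum>x\<in>U. expo G (single x (Suc 0))) = expo G mon0"
    obtain Ps where Ps: "set Ps \<subseteq> X" "m = (\<Sum>P\<leftarrow>Ps. single P (Suc 0))" using mons_list[OF U(3)] .
    have finU: "finite U" using U(1) finX finite_subset by blast
    obtain ul where ul: "set ul = U" "distinct ul" using finite_distinct_list[OF finU] by blast
    have "expo G (\<Sum>P\<leftarrow>ul @ Ps. single P (Suc 0)) = (\<Sum>x\<in>U. expo G (single x (Suc 0))) + expo G m"
      using ul Ps(2) expo_list[of G "\<lambda>P. P" ul] by (simp add: expo_add sum_list_distinct_conv_sum_set)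
    hence e1: "expo G (\<Sum>P\<leftarrow>ul @ Ps. single P (Suc 0)) = expo G mon0" using U(4) by (simp add: add.commute)
    have s1: "set (ul @ Ps) \<subseteq> X" using ul Ps U(1) by simp
    have Uq: "U \<subseteq> q ` {..<N}" using in_q[OF s1 e1] ul by auto
    \<comment> \<open>The face is listed by increasing ranks, the order in which the sets were
      tested.\<close>
    define us where "us = K.key U"
    have set_us: "set us = rk ` U" unfolding us_def by (rule K.set_key[OF U(1)])
    have us_N: "set us \<subseteq> {..<N}" using Uq rk_q unfolding set_us by auto
    have q_rk: "q (rk P) = P" if "P \<in> U" for P using that Uq rk_q by auto
    have "(\<Sum>k\<leftarrow>us. expo G (single (q k) (Suc 0))) = (\<Sum>x\<in>U. expo G (single (q (rk x)) (Suc 0)))"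
      unfolding us_def by (rule K.sum_list_key[OF U(1)])
    also have "\<dots> = (\<Sum>x\<in>U. expo G (single x (Suc 0)))" using q_rk by simp
    finally have "expo G (\<Sum>P\<leftarrow>map q us @ Ps. single P (Suc 0)) = (\<Sum>x\<in>U. expo G (single x (Suc 0))) + expo G m"
      using Ps(2) expo_list[of G q us] by (simp add: expo_add comp_def)
    hence e2: "expo G (\<Sum>P\<leftarrow>map q us @ Ps. single P (Suc 0)) = expo G mon0" using U(4) by (simp add: add.commute)
    have s2: "set (map q us @ Ps) \<subseteq> X" using Ps q_X us_N by auto
    note fb = fibre[OF s2 e2]
    have lus: "length us = Suc i" unfolding us_def using K.length_key[OF U(1)] U(2) by simp
    have cq: "map cls (map q us) = map ((!) vs) us" using q_cls us_N by auto
    have "budget fs (map ((!) vs) us @ map cls Ps) = b" using fb unfolding map_append cq by blast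
    moreover have "n \<le> length (map cls Ps)" using fb lus n(1) ms0(2) by simp
    moreover have "set (map cls Ps) \<subseteq> set masks" using cls_masks by auto
    ultimately have "maybe_face rs n b (map (feature_row fs) (map ((!) vs) us))"
      using maybe_face_budget[of n "map cls Ps" masks fs "map ((!) vs) us"] unfolding rs_def by metis
    moreover have "us \<in> set (ksublists (Suc i) [0..<N])"
    proof -
      have "filter (\<lambda>u. u \<in> rk ` U) [0..<N] = us"
        unfolding us_def K.key_def
        by (rule sorted_distinct_set_unique) (use us_N set_us finU in \<open>auto simp: sorted_wrt_filter\<close>)
      thus ?thesis using filter_in_ksublists[of "\<lambda>u. u \<in> rk ` U" "[0..<N]"] lus by simp
    qed
    ultimately have "lcobound t us = 0" using cocyc[of us] by (simp add: comp_def)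
    thus "lcobound t (K.key U) = 0" by (simp add: us_def)
  qed simp
  thus ?thesis using that[OF \<open>koszul X rk\<close>] by (simp add: cut_ideal_fibre)
qed

text \<open>The homological degree is a successor because \<open>Tor\<close> of the quotient in
  positive homological degree is what the ideal controls.\<close>

lemma certificate_degree:
  assumes "certificate h EL fs vs ms0 (Suc i) c Z t n n1"
    and "has_linear_resolution (partitions G) (cut_ideal G :: ('v set set, 'k::field) pol set) d"
  shows "d = Suc c"
proof (rule ccontr)
  assume "d \<noteq> Suc c"
  obtain rk where rk: "koszul X rk" "\<not> koszul.tor_vanish X rk (Suc i) (int c) (cut_ideal G :: ('v set set, 'k) pol set)"
    using certificate_sound[OF assms(1)] .
  interpret K: koszul X rk by fact
  have "int c + 1 \<noteq> int d" using \<open>d \<noteq> Suc c\<close> by linarith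
  thus False using K.has_linear_resolutionD[OF ring_ideal_cut_ideal[OF simple edges] assms(2)] rk(2) by blast
qed

end

section \<open>The graphs with a linear resolution\<close>

lemma sum_Pow_insert:
  assumes "finite B" "x \<notin> B"
  shows "(\<Sum>A\<in>Pow (insert x B). g A) = (\<Sum>A\<in>Pow B. g A) + (\<Sum>A\<in>Pow B. g (insert x A) :: 'b::comm_monoid_add)"
proof -
  have "inj_on (insert x) (Pow B)" using assms(2) by (auto intro!: inj_onI)
  moreover have "Pow B \<inter> insert x ` Pow B = {}" using assms(2) by auto
  ultimately show ?thesis using assms(1) by (simp add: Pow_insert sum.union_disjoint sum.reindex)
qed

lemma part_inj:
  assumes "w \<in> fst G" shows "inj_on (part G) (Pow (fst G - {w}))"
proof (rule inj_onI)
  fix A B assume A: "A \<in> Pow (fst G - {w})" and B: "B \<in> Pow (fst G - {w})" and eq: "part G A = part G B"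
  have "v \<in> A \<longleftrightarrow> v \<in> B" if "v \<in> fst G" for v
    using sep_part[of A G w v] sep_part[of B G w v] A B assms that eq by auto
  thus "A = B" using A B by blast
qed

text \<open>Each partition is represented by its part that avoids \<open>w\<close>, so partitions
  correspond to subsets of the other vertices; with \<open>sum_Pow_insert\<close> a count becomes an
  explicit sum.\<close>

lemma partitions_base:
  assumes "w \<in> fst G" shows "partitions G = part G ` Pow (fst G - {w})"
proof
  show "partitions G \<subseteq> part G ` Pow (fst G - {w})"
  proof
    fix P assume "P \<in> partitions G"
    hence "P = part G {v \<in> fst G. sep P w v}" using assms by (rule partition_eq_part)
    moreover have "{v \<in> fst G. sep P w v} \<in> Pow (fst G - {w})" by auto
    ultimately show "P \<in> part G ` Pow (fst G - {w})" by (rule image_eqI)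
  qed
qed (auto intro: part_in)

lemma cnt_base:
  assumes "finite (fst G)" "w \<in> fst G" "m \<in> mons (partitions G)"
  shows "cnt \<phi> m = (\<Sum>A\<in>Pow (fst G - {w}). if \<phi> (part G A) then lookup m (part G A) else 0)"
proof -
  have "finite (partitions G)" using assms(1) by (simp add: partitions_part)
  hence "cnt \<phi> m = (\<Sum>P\<in>part G ` Pow (fst G - {w}). if \<phi> P then lookup m P else 0)"
    using assms(3) partitions_base[OF assms(2)] by (simp add: cnt_superset)
  thus ?thesis using part_inj[OF assms(2)] by (simp add: sum.reindex)
qed

lemma mons_eq_base:
  assumes "w \<in> fst G" "m \<in> mons (partitions G)" "m' \<in> mons (partitions G)"
    and "\<And>A. A \<subseteq> fst G - {w} \<Longrightarrow> lookup m (part G A) = lookup m' (part G A)"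
  shows "m = m'"
proof (rule poly_mapping_eqI)
  fix P show "lookup m P = lookup m' P"
  proof (cases "P \<in> partitions G")
    case True thus ?thesis using assms(4) partitions_base[OF assms(1)] by auto
  next
    case False
    hence "P \<notin> keys m" "P \<notin> keys m'" using assms(2,3) by (auto simp: mons_def)
    thus ?thesis by (simp add: in_keys_iff)
  qed
qed

text \<open>If \<open>m\<close> were alone in its fibre, the fibre sum would be its coefficient,
  which is not zero.\<close>

lemma fibre_ideal_collision:
  assumes p: "p \<in> fibre_ideal X (\<lambda>m. Some (ex m))" and m: "m \<in> keys p"
  obtains n where "n \<in> mons X" "ex n = ex m" "n \<noteq> m"
proof (rule ccontr)
  assume n: "\<not> thesis"
  have k: "keys p \<subseteq> mons X" using p by (simp add: fibre_ideal_def poly_ring_mons)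
  have "fsum (\<lambda>m. Some (ex m)) (ex m) p = (\<Sum>n\<in>keys p. if n = m then lookup p m else 0)"
    unfolding fsum_def lin_def
  proof (rule sum.cong[OF refl])
    fix l assume l: "l \<in> keys p"
    hence "ex l = ex m \<Longrightarrow> l = m" using n that[of l] k by blast
    thus "(if Some (ex l) = Some (ex m) then lookup p l else 0) = (if l = m then lookup p m else 0)" by auto
  qed
  hence "fsum (\<lambda>m. Some (ex m)) (ex m) p = lookup p m" using m by simp
  thus False using p m by (simp add: fibre_ideal_def in_keys_iff)
qed

lemma fibre_ideal_low_degree:
  assumes p: "p \<in> fibre_ideal X (\<lambda>m. Some (ex m))" and c: "homog c p" "c < int d"
    and inj: "\<And>m m'. m \<in> mons X \<Longrightarrow> m' \<in> mons X \<Longrightarrow> ex m = ex m' \<Longrightarrow> total_deg m < d \<Longrightarrow> m = m'"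
  shows "p = 0"
proof (rule ccontr)
  assume "p \<noteq> 0"
  then obtain m where m: "m \<in> keys p" by (metis ex_in_conv keys_eq_empty)
  have "m \<in> mons X" using p m by (auto simp: fibre_ideal_def poly_ring_mons)
  moreover have "int (total_deg m) = c" using c(1) m by (simp add: homog_def)
  hence "total_deg m < d" using c(2) by simp
  moreover obtain n where "n \<in> mons X" "ex n = ex m" "n \<noteq> m" using fibre_ideal_collision[OF p m] .
  ultimately show False using inj[of m n] by simp
qed

lemma fibre_ideal_zero_of_inj:
  assumes inj: "\<And>m m'. m \<in> mons X \<Longrightarrow> m' \<in> mons X \<Longrightarrow> ex m = ex m' \<Longrightarrow> m = m'"
  shows "fibre_ideal X (\<lambda>m. Some (ex m)) = {0 :: ('x, 'k::field) pol}"
proof -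
  have "p = 0" if p: "p \<in> fibre_ideal X (\<lambda>m. Some (ex m))" for p :: "('x, 'k) pol"
  proof (rule ccontr)
    assume "p \<noteq> 0"
    then obtain m where m: "m \<in> keys p" by (metis ex_in_conv keys_eq_empty)
    have "m \<in> mons X" using p m by (auto simp: fibre_ideal_def poly_ring_mons)
    moreover obtain n where "n \<in> mons X" "ex n = ex m" "n \<noteq> m" using fibre_ideal_collision[OF p m] .
    ultimately show False using inj[of m n] by simp
  qed
  moreover have "0 \<in> fibre_ideal X (\<lambda>m. Some (ex m))" by (rule fibre_ideal_zero)
  ultimately show ?thesis by blast
qed

lemma fibre_ideal_nonzero:
  assumes "m \<in> mons X" "m' \<in> mons X" "ex m = ex m'" "m \<noteq> m'"
  shows "fibre_ideal X (\<lambda>m. Some (ex m)) \<noteq> {0 :: ('x, 'k::field) pol}"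
proof -
  let ?p = "single m 1 - single m' 1 :: ('x, 'k) pol"
  have "?p \<in> fibre_ideal X (\<lambda>m. Some (ex m))"
    using assms by (simp add: fibre_ideal_def poly_ring_minus poly_ring_single fsum_diff fsum_single)
  moreover have "lookup ?p m \<noteq> 0" using assms(4) by (simp add: lookup_minus lookup_single)
  hence "?p \<noteq> 0" by (metis lookup_zero)
  ultimately show ?thesis by blast
qed

text \<open>Along a path the separations add up modulo 2, so in a connected graph the cut edges
  determine the partition.\<close>

lemma connected_partition_eq:
  assumes G: "simple_graph G" "connected_graph G" and P: "P \<in> partitions G" "Q \<in> partitions G"
    and eq: "\<And>u v. {u, v} \<in> snd G \<Longrightarrow> sep P u v = sep Q u v"
  shows "P = Q"
proof -
  obtain w where w: "w \<in> fst G" using G by (auto simp: simple_graph_def)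
  have "sep P w v = sep Q w v" if v: "v \<in> fst G" for v
  proof -
    have "(w, v) \<in> {(x, y). {x, y} \<in> snd G}\<^sup>*" using G(2) w v by (simp add: connected_graph_def)
    thus ?thesis
    proof (induction rule: rtrancl_induct)
      case (step y z)
      hence e: "{y, z} \<in> snd G" by simp
      have yz: "y \<in> fst G" "z \<in> fst G" using edge_vertices[OF G(1) e] by auto
      show ?case using step.IH eq[OF e] sep_xor[OF P(1) w yz] sep_xor[OF P(2) w yz] by simp
    qed simp
  qed
  hence "{v \<in> fst G. sep P w v} = {v \<in> fst G. sep Q w v}" by blast
  thus ?thesis using partition_eq_part[OF P(1) w] partition_eq_part[OF P(2) w] by simp
qed

text \<open>Distinct partitions of a connected graph have distinct cuts, so the ideal contains no
  linear forms.\<close>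

lemma expo_inj_degree_1:
  assumes G: "simple_graph G" "connected_graph G" "snd G \<noteq> {}"
    and m: "m \<in> mons (partitions G)" "m' \<in> mons (partitions G)" "expo G m = expo G m'" "total_deg m < 2"
  shows "m = m'"
proof -
  have e: "total_deg m = total_deg m'" "\<And>u v. {u, v} \<in> snd G \<Longrightarrow> cnt (\<lambda>P. sep P u v) m = cnt (\<lambda>P. sep P u v) m'"
    using expo_eq_iff[OF G(1,3) m(1,2)] m(3) by blast+
  have one: "\<exists>P\<in>partitions G. n = single P (Suc 0)" if n: "n \<in> mons (partitions G)" "total_deg n = 1" for n
  proof -
    obtain P where P: "P \<in> keys n"
    proof -
      have "n \<noteq> 0" using n(2) by auto
      thus ?thesis using that by (metis ex_in_conv keys_eq_empty)
    qed
    have eq: "(n - single P (Suc 0)) + single P (Suc 0) = n" by (rule mon_minus_single[OF P])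
    hence "total_deg (n - single P (Suc 0)) + 1 = total_deg n" by (metis One_nat_def total_deg_add total_deg_single)
    hence "n - single P (Suc 0) = 0" using n(2) by (simp add: total_deg_eq_0_iff)
    hence "n = single P (Suc 0)" using eq by simp
    moreover have "P \<in> partitions G" using P n(1) by (auto simp: mons_def)
    ultimately show ?thesis by blast
  qed
  consider "total_deg m = 0" | "total_deg m = 1" using m(4) by linarith
  thus ?thesis
  proof cases
    case 1 thus ?thesis using e(1) by (simp add: total_deg_eq_0_iff)
  next
    case 2
    obtain P where P: "P \<in> partitions G" "m = single P (Suc 0)" using one[OF m(1) 2] by blast
    obtain Q where Q: "Q \<in> partitions G" "m' = single Q (Suc 0)" using one[OF m(2)] 2 e(1) by auto
    have "sep P u v = sep Q u v" if "{u, v} \<in> snd G" for u v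
      using e(2)[OF that] P Q by (simp add: cnt_single split: if_splits)
    thus ?thesis using connected_partition_eq[OF G(1,2) P(1) Q(1)] P Q by simp
  qed
qed

lemma koszul_partitions:
  assumes "simple_graph G" obtains rk where "koszul (partitions G) rk"
proof -
  obtain f :: "_ \<Rightarrow> nat" where "inj_on f (partitions G)"
    using finite_imp_inj_to_nat_seg[OF finite_partitions[OF assms]] by metis
  thus ?thesis using that finite_partitions[OF assms] by (simp add: koszul_def)
qed

text \<open>\<open>quot_reg_segre\<close> bounds the regularity, connectedness excludes linear
  forms, and the minor of the first two columns shows that the ideal is not zero.\<close>

lemma segre_linear_resolution:
  fixes G :: "'v graph" and xv yv :: "nat \<Rightarrow> 'v set set"
  assumes G: "simple_graph G" "connected_graph G" "snd G \<noteq> {}"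
    and X: "partitions G = xv ` {..<n} \<union> yv ` {..<n}" "2 \<le> n"
    and inj: "inj_on xv {..<n}" "inj_on yv {..<n}" "xv ` {..<n} \<inter> yv ` {..<n} = {}"
    and fibre: "\<And>m m'. m \<in> mons (partitions G) \<Longrightarrow> m' \<in> mons (partitions G) \<Longrightarrow> expo G m = expo G m' \<longleftrightarrow>
      (\<forall>j<n. lookup m (xv j) + lookup m (yv j) = lookup m' (xv j) + lookup m' (yv j)) \<and>
      (\<Sum>j<n. lookup m (xv j)) = (\<Sum>j<n. lookup m' (xv j))"
  shows "has_linear_resolution (partitions G) (cut_ideal G :: ('v set set, 'k::field) pol set) 2"
proof -
  obtain rk where "koszul (partitions G) rk" using koszul_partitions[OF G(1)] .
  then interpret K: koszul "partitions G" rk .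
  have "K.quot_reg 1 (fibre_ideal (partitions G) (\<lambda>m. Some (expo G m)) :: ('v set set, 'k) pol set)"
    by (rule K.quot_reg_segre[OF X(1) inj]) (simp_all add: fibre)
  hence reg: "K.quot_reg (2 - 1) (cut_ideal G :: ('v set set, 'k) pol set)" by (simp add: cut_ideal_fibre)
  have ne: "cut_ideal G \<noteq> {0 :: ('v set set, 'k) pol}"
  proof -
    let ?m = "single (xv 0) (Suc 0) + single (yv 1) (Suc 0)" and ?m' = "single (xv 1) (Suc 0) + single (yv 0) (Suc 0)"
    have lt: "0 < n" "1 < n" using X(2) by simp_all
    have in_X: "xv 0 \<in> partitions G" "xv 1 \<in> partitions G" "yv 0 \<in> partitions G" "yv 1 \<in> partitions G"
      using X lt by auto
    have m: "?m \<in> mons (partitions G)" "?m' \<in> mons (partitions G)" using in_X by simp_all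
    have ne: "xv i \<noteq> yv j" if "i < n" "j < n" for i j using inj(3) that by blast
    have xx: "xv i = xv j \<longleftrightarrow> i = j" "yv i = yv j \<longleftrightarrow> i = j" if "i < n" "j < n" for i j
      using inj(1,2) that by (auto dest: inj_onD)
    have lx: "lookup ?m (xv j) = (if j = 0 then 1 else 0)" "lookup ?m' (xv j) = (if j = 1 then 1 else 0)"
      and ly: "lookup ?m (yv j) = (if j = 1 then 1 else 0)" "lookup ?m' (yv j) = (if j = 0 then 1 else 0)" if "j < n" for j
      using that lt xx[of 0 j] xx[of 1 j] ne[of 0 j] ne[of 1 j] ne[of j 0] ne[of j 1]
      by (auto simp: lookup_add lookup_single when_def)
    have "(\<Sum>j<n. lookup ?m (xv j)) = 1" "(\<Sum>j<n. lookup ?m' (xv j)) = 1" using lx lt by simp_all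
    hence "expo G ?m = expo G ?m'" using fibre[OF m] lx ly by simp
    moreover have "?m \<noteq> ?m'" using lx[of 0] lt by auto
    ultimately show ?thesis unfolding cut_ideal_fibre using fibre_ideal_nonzero[OF m] by blast
  qed
  show ?thesis
  proof (rule K.has_linear_resolutionI[OF ring_ideal_cut_ideal[OF G(1,3)] ne _ _ reg])
    fix c and p :: "('v set set, 'k) pol" assume "p \<in> cut_ideal G" "homog c p" "c < int 2"
    thus "p = 0" unfolding cut_ideal_fibre
      by (rule fibre_ideal_low_degree) (rule expo_inj_degree_1[OF G])
  qed simp
qed

lemma cnt_sep_commute:
  assumes "m \<in> mons (partitions G)" "u \<in> fst G" "v \<in> fst G"
  shows "cnt (\<lambda>P. sep P u v) m = cnt (\<lambda>P. sep P v u) m"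
proof (rule cnt_cong)
  fix P assume "P \<in> keys m"
  hence "P \<in> partitions G" using assms(1) by (auto simp: mons_def)
  thus "sep P u v = sep P v u" using assms(2,3) by (rule sep_commute)
qed

lemma Pow_triple: "Pow {a, b, c} = {{}, {a}, {b}, {a, b}, {c}, {a, c}, {b, c}, {a, b, c}}"
  by (simp add: Pow_insert insert_commute)

lemma part_eq_iff:
  assumes "w \<in> fst G" "A \<subseteq> fst G - {w}" "B \<subseteq> fst G - {w}"
  shows "part G A = part G B \<longleftrightarrow> (\<forall>x\<in>fst G - {w}. x \<in> A \<longleftrightarrow> x \<in> B)"
proof
  assume "part G A = part G B"
  hence "A = B" using inj_onD[OF part_inj[OF assms(1)]] assms(2,3) by (simp add: Pow_iff)
  thus "\<forall>x\<in>fst G - {w}. x \<in> A \<longleftrightarrow> x \<in> B" by simp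
next
  assume "\<forall>x\<in>fst G - {w}. x \<in> A \<longleftrightarrow> x \<in> B"
  hence "A = B" using assms(2,3) by auto
  thus "part G A = part G B" by simp
qed

text \<open>With the middle vertex \<open>b\<close> as base, a partition is given by the sides of
  \<open>a\<close> and \<open>c\<close>. The side of \<open>a\<close> is the column and that of
  \<open>c\<close> the row of a square matrix of size 2.\<close>

lemma linear_resolution_P3:
  fixes G :: "'v graph"
  assumes G: "simple_graph G" "connected_graph G" and V: "fst G = {a, b, c}" "distinct [a, b, c]"
    and E: "snd G = {{a, b}, {b, c}}"
  shows "has_linear_resolution (partitions G) (cut_ideal G :: ('v set set, 'k::field) pol set) 2"
proof -
  have ne: "a \<noteq> b" "a \<noteq> c" "b \<noteq> c" "b \<noteq> a" "c \<noteq> a" "c \<noteq> b" using V(2) by auto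
  have bV: "b \<in> fst G" and fin: "finite (fst G)" by (simp_all add: V(1))
  have Vb: "fst G - {b} = {a, c}" using V(1) ne by auto
  define xv where "xv = (\<lambda>j::nat. part G (insert c ([{}, {a}] ! j)))"
  define yv where "yv = (\<lambda>j::nat. part G ([{}, {a}] ! j))"
  have two: "{..<2::nat} = {0, Suc 0}" by auto
  have xy: "xv 0 = part G {c}" "xv (Suc 0) = part G {a, c}" "yv 0 = part G {}" "yv (Suc 0) = part G {a}"
    by (simp_all add: xv_def yv_def insert_commute)
  have pe: "part G A = part G B \<longleftrightarrow> A = B" if "A \<subseteq> {a, c}" "B \<subseteq> {a, c}" for A B
    using inj_onD[OF part_inj[OF bV], of A B] that Vb by auto
  have X: "partitions G = xv ` {..<2} \<union> yv ` {..<2}"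
  proof -
    have "Pow {a, c} = {{}, {a}, {c}, {a, c}}" by auto
    hence "partitions G = {part G {}, part G {a}, part G {c}, part G {a, c}}"
      unfolding partitions_base[OF bV] Vb by simp
    thus ?thesis unfolding two by (simp add: xy insert_commute)
  qed
  have d: "part G {c} \<noteq> part G {a, c}" "part G {} \<noteq> part G {a}" "part G {c} \<noteq> part G {}" "part G {c} \<noteq> part G {a}"
    "part G {a, c} \<noteq> part G {}" "part G {a, c} \<noteq> part G {a}"
    using ne by (auto simp: pe)
  have ex: "cnt \<phi> m = (if \<phi> (part G {}) then lookup m (part G {}) else 0) + (if \<phi> (part G {c}) then lookup m (part G {c}) else 0)
      + ((if \<phi> (part G {a}) then lookup m (part G {a}) else 0) + (if \<phi> (part G {a, c}) then lookup m (part G {a, c}) else 0))"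
    if "m \<in> mons (partitions G)" for \<phi> m
    using ne by (subst cnt_base[OF fin bV that]) (simp add: Vb sum_Pow_insert)
  have sp: "sep (part G A) u v = ((u \<in> A) \<noteq> (v \<in> A))" if "A \<subseteq> {a, b, c}" "u \<in> {a, b, c}" "v \<in> {a, b, c}" for A u v
    using that sep_part[of A G u v] V(1) by simp
  have sum2: "(\<Sum>j<2. f j) = f 0 + f (Suc 0)" for f :: "nat \<Rightarrow> nat" unfolding two by simp
  have all2: "(\<forall>j<2. Q j) \<longleftrightarrow> Q 0 \<and> Q (Suc 0)" for Q by (auto simp: less_2_cases_iff)
  have Ene: "snd G \<noteq> {}" using E by simp
  show ?thesis
  proof (rule segre_linear_resolution[where xv = xv and yv = yv and n = 2, OF G Ene X])
    show "inj_on xv {..<2}" "inj_on yv {..<2}" "xv ` {..<2} \<inter> yv ` {..<2} = {}"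
      unfolding two using d by (auto simp: xy)
    fix m m' assume m: "m \<in> mons (partitions G)" "m' \<in> mons (partitions G)"
    have Eiff: "(\<forall>u v. {u, v} \<in> snd G \<longrightarrow> cnt (\<lambda>P. sep P u v) m = cnt (\<lambda>P. sep P u v) m') \<longleftrightarrow>
        cnt (\<lambda>P. sep P a b) m = cnt (\<lambda>P. sep P a b) m' \<and> cnt (\<lambda>P. sep P b c) m = cnt (\<lambda>P. sep P b c) m'"
      using cnt_sep_commute[OF m(1), of b a] cnt_sep_commute[OF m(2), of b a]
        cnt_sep_commute[OF m(1), of c b] cnt_sep_commute[OF m(2), of c b] V(1) unfolding E
      by (auto simp: doubleton_eq_iff)
    have iff: "expo G m = expo G m' \<longleftrightarrow> cnt (\<lambda>_. True) m = cnt (\<lambda>_. True) m' \<and>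
        cnt (\<lambda>P. sep P a b) m = cnt (\<lambda>P. sep P a b) m' \<and> cnt (\<lambda>P. sep P b c) m = cnt (\<lambda>P. sep P b c) m'"
      using expo_eq_iff[OF G(1) Ene m] Eiff unfolding cnt_True by blast
    show "expo G m = expo G m' \<longleftrightarrow>
      (\<forall>j<2. lookup m (xv j) + lookup m (yv j) = lookup m' (xv j) + lookup m' (yv j)) \<and>
      (\<Sum>j<2. lookup m (xv j)) = (\<Sum>j<2. lookup m' (xv j))"
      unfolding iff ex[OF m(1)] ex[OF m(2)] sum2 all2 xy
      using ne by (simp add: sp) arith
  qed simp
qed

lemma all_edges_insert: "(\<forall>u v. {u, v} \<in> insert {a, b} E \<longrightarrow> f u v) \<longleftrightarrow> f a b \<and> f b a \<and> (\<forall>u v. {u, v} \<in> E \<longrightarrow> f u v)"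
  by (auto simp: doubleton_eq_iff)

lemma distinct_parts:
  assumes "w \<in> fst G" "fst G - {w} = {a, b, d}" and ne: "a \<noteq> b" "b \<noteq> a" "a \<noteq> d" "d \<noteq> a" "b \<noteq> d" "d \<noteq> b"
  shows "distinct (map (part G) [{}, {a}, {b}, {a, b}, {d}, {a, d}, {b, d}, {a, b, d}])"
proof -
  have pe: "part G A = part G B \<longleftrightarrow> (a \<in> A \<longleftrightarrow> a \<in> B) \<and> (b \<in> A \<longleftrightarrow> b \<in> B) \<and> (d \<in> A \<longleftrightarrow> d \<in> B)"
    if "A \<subseteq> {a, b, d}" "B \<subseteq> {a, b, d}" for A B
    using part_eq_iff[OF assms(1), of A B] that unfolding assms(2) by simp
  show ?thesis
    unfolding distinct.simps list.map set_simps insert_iff empty_iff de_Morgan_disj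
    by (intro conjI) (simp_all add: pe ne)
qed

text \<open>The cut vertex \<open>c\<close> is the base. The four columns are the restrictions to
  the triangle, and the row says whether \<open>d\<close> is separated from \<open>c\<close>. Column
  degrees are triangle counts; the degree of the first row counts the cuts of the pendant
  edge.\<close>

lemma linear_resolution_paw:
  fixes G :: "'v graph"
  assumes G: "simple_graph G" "connected_graph G" and V: "fst G = {a, b, c, d}" "distinct [a, b, c, d]"
    and E: "snd G = {{a, b}, {a, c}, {b, c}, {c, d}}"
  shows "has_linear_resolution (partitions G) (cut_ideal G :: ('v set set, 'k::field) pol set) 2"
proof -
  have ne: "a \<noteq> b" "a \<noteq> c" "b \<noteq> c" "b \<noteq> a" "c \<noteq> a" "c \<noteq> b" "a \<noteq> d" "b \<noteq> d" "c \<noteq> d" "d \<noteq> a" "d \<noteq> b" "d \<noteq> c"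
    using V(2) by auto
  have cV: "c \<in> fst G" and fin: "finite (fst G)" by (simp_all add: V(1))
  have Vc: "fst G - {c} = {a, b, d}" using V(1) ne by auto
  define xv where "xv = (\<lambda>j::nat. part G ([{d}, {a, d}, {b, d}, {a, b, d}] ! j))"
  define yv where "yv = (\<lambda>j::nat. part G ([{}, {a}, {b}, {a, b}] ! j))"
  have four: "{..<4::nat} = {0, Suc 0, 2, 3}" by auto
  have xy: "xv 0 = part G {d}" "xv (Suc 0) = part G {a, d}" "xv 2 = part G {b, d}" "xv 3 = part G {a, b, d}"
      "yv 0 = part G {}" "yv (Suc 0) = part G {a}" "yv 2 = part G {b}" "yv 3 = part G {a, b}"
    unfolding xv_def yv_def numeral_2_eq_2 numeral_3_eq_3 by simp_all
  have X: "partitions G = xv ` {..<4} \<union> yv ` {..<4}"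
  proof -
    show ?thesis unfolding partitions_base[OF cV] Vc Pow_triple four by (simp add: xy insert_commute)
  qed
  have ex: "cnt \<phi> m = (let f = (\<lambda>A. if \<phi> (part G A) then lookup m (part G A) else 0) in
      f {} + f {d} + (f {b} + f {b, d}) + (f {a} + f {a, d} + (f {a, b} + f {a, b, d})))"
    if "m \<in> mons (partitions G)" for \<phi> m
    using ne by (subst cnt_base[OF fin cV that]) (simp add: Vc sum_Pow_insert Let_def)
  have sp: "sep (part G A) u v = ((u \<in> A) \<noteq> (v \<in> A))" if "A \<subseteq> {a, b, c, d}" "u \<in> {a, b, c, d}" "v \<in> {a, b, c, d}" for A u v
    using that sep_part[of A G u v] V(1) by simp
  have sum4: "(\<Sum>j<4. f j) = f 0 + f (Suc 0) + f 2 + f 3" for f :: "nat \<Rightarrow> nat" unfolding four by simp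
  have all4: "(\<forall>j<4. Q j) \<longleftrightarrow> Q 0 \<and> Q (Suc 0) \<and> Q 2 \<and> Q 3" for Q :: "nat \<Rightarrow> bool"
    using four by (metis insert_iff lessThan_iff empty_iff)
  have Ene: "snd G \<noteq> {}" using E by simp
  have pe: "part G A = part G B \<longleftrightarrow> (a \<in> A \<longleftrightarrow> a \<in> B) \<and> (b \<in> A \<longleftrightarrow> b \<in> B) \<and> (d \<in> A \<longleftrightarrow> d \<in> B)"
    if "A \<subseteq> {a, b, d}" "B \<subseteq> {a, b, d}" for A B
    using part_eq_iff[OF cV, of A B] that unfolding Vc by simp
  show ?thesis
  proof (rule segre_linear_resolution[where xv = xv and yv = yv and n = 4, OF G Ene X])
    show "inj_on xv {..<4}" "inj_on yv {..<4}" "xv ` {..<4} \<inter> yv ` {..<4} = {}"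
      unfolding four using ne by (simp_all add: inj_on_def xy pe)
    fix m m' assume m: "m \<in> mons (partitions G)" "m' \<in> mons (partitions G)"
    have Eiff: "(\<forall>u v. {u, v} \<in> snd G \<longrightarrow> cnt (\<lambda>P. sep P u v) m = cnt (\<lambda>P. sep P u v) m') \<longleftrightarrow>
        cnt (\<lambda>P. sep P a b) m = cnt (\<lambda>P. sep P a b) m' \<and> cnt (\<lambda>P. sep P c a) m = cnt (\<lambda>P. sep P c a) m' \<and>
        cnt (\<lambda>P. sep P c b) m = cnt (\<lambda>P. sep P c b) m' \<and> cnt (\<lambda>P. sep P c d) m = cnt (\<lambda>P. sep P c d) m'"
      unfolding E all_edges_insert
      using cnt_sep_commute[OF m(1), of b a] cnt_sep_commute[OF m(2), of b a]
        cnt_sep_commute[OF m(1), of c a] cnt_sep_commute[OF m(2), of c a]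
        cnt_sep_commute[OF m(1), of c b] cnt_sep_commute[OF m(2), of c b]
        cnt_sep_commute[OF m(1), of c d] cnt_sep_commute[OF m(2), of c d] by (simp add: V(1))
    have tri: "cnt (\<lambda>P. sep P c a = s \<and> sep P c b = t) m = cnt (\<lambda>P. sep P c a = s \<and> sep P c b = t) m'"
      if "expo G m = expo G m'" for s t
    proof (rule cnt_triangle[OF m, where \<chi> = "\<lambda>P. sep P a b"])
      show "sep P a b = (sep P c a \<noteq> sep P c b)" if "P \<in> partitions G" for P
        using sep_xor[OF that, of a c b] sep_commute[OF that, of a c] V(1) by simp
    qed (use that expo_eq_iff[OF G(1) Ene m] Eiff in auto)
    have iff: "expo G m = expo G m' \<longleftrightarrow> cnt (\<lambda>_. True) m = cnt (\<lambda>_. True) m' \<and>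
        cnt (\<lambda>P. sep P a b) m = cnt (\<lambda>P. sep P a b) m' \<and> cnt (\<lambda>P. sep P c a) m = cnt (\<lambda>P. sep P c a) m' \<and>
        cnt (\<lambda>P. sep P c b) m = cnt (\<lambda>P. sep P c b) m' \<and> cnt (\<lambda>P. sep P c d) m = cnt (\<lambda>P. sep P c d) m'"
      using expo_eq_iff[OF G(1) Ene m] Eiff unfolding cnt_True by blast
    show "expo G m = expo G m' \<longleftrightarrow>
      (\<forall>j<4. lookup m (xv j) + lookup m (yv j) = lookup m' (xv j) + lookup m' (yv j)) \<and>
      (\<Sum>j<4. lookup m (xv j)) = (\<Sum>j<4. lookup m' (xv j))" (is "?L \<longleftrightarrow> ?R")
    proof
      assume L: ?L
      have "cnt (\<lambda>P. sep P c d) m = cnt (\<lambda>P. sep P c d) m'" using L expo_eq_iff[OF G(1) Ene m] Eiff by blast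
      thus ?R using tri[OF L, of False False] tri[OF L, of False True] tri[OF L, of True False] tri[OF L, of True True]
        unfolding ex[OF m(1)] ex[OF m(2)] sum4 all4 xy using ne by (simp add: sp Let_def)
    next
      assume ?R
      thus ?L unfolding iff ex[OF m(1)] ex[OF m(2)] sum4 all4 xy
        using ne by (simp add: sp Let_def)
    qed
  qed simp
qed

text \<open>The exponent vectors of the eight partitions satisfy one linear relation up to
  multiples: the sum over the subsets of \<open>{a, b, c}\<close> of even size equals the sum over
  those of odd size. Each side has four terms, hence the degree 4.\<close>

lemma linear_resolution_K4:
  fixes G :: "'v graph"
  assumes G: "simple_graph G" and V: "card (fst G) = 4"
    and E: "snd G = {e. e \<subseteq> fst G \<and> card e = 2}"
  shows "has_linear_resolution (partitions G) (cut_ideal G :: ('v set set, 'k::field) pol set) 4"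
proof -
  have "finite (fst G)" using V card_ge_0_finite[of "fst G"] by simp
  then obtain vs where vs: "set vs = fst G" "distinct vs" using finite_distinct_list by blast
  hence "length vs = 4" using V distinct_card by fastforce
  then obtain a b c d where "vs = [a, b, c, d]"
    by (auto simp: numeral_eq_Suc length_Suc_conv)
  hence V: "fst G = {a, b, c, d}" "distinct [a, b, c, d]" using vs by auto
  have ne: "a \<noteq> b" "a \<noteq> c" "b \<noteq> c" "b \<noteq> a" "c \<noteq> a" "c \<noteq> b" "a \<noteq> d" "b \<noteq> d" "c \<noteq> d" "d \<noteq> a" "d \<noteq> b" "d \<noteq> c"
    using V(2) by auto
  have dV: "d \<in> fst G" and fin: "finite (fst G)" by (simp_all add: V(1))
  have Vd: "fst G - {d} = {a, b, c}" using V(1) ne by auto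
  define Ev where "Ev = {part G {}, part G {a, b}, part G {a, c}, part G {b, c}}"
  define Od where "Od = {part G {a}, part G {b}, part G {c}, part G {a, b, c}}"
  have X: "partitions G = Ev \<union> Od"
    unfolding partitions_base[OF dV] Vd Ev_def Od_def Pow_triple by (simp add: insert_commute)
  have dist: "distinct (map (part G) [{}, {a}, {b}, {a, b}, {c}, {a, c}, {b, c}, {a, b, c}])"
    by (rule distinct_parts[OF dV Vd]) (fact ne)+
  have gen: "{p1, p4, p6, p7} \<inter> {p2, p3, p5, p8} = {} \<and> card {p1, p4, p6, p7} = 4 \<and> card {p2, p3, p5, p8} = 4"
    if "distinct [p1, p2, p3, p4, p5, p6, p7, p8]" for p1 p2 p3 p4 p5 p6 p7 p8 :: "'v set set"
    using that by simp
  have dis: "Ev \<inter> Od = {}" and card: "card Ev = 4" "card Od = 4"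
    unfolding Ev_def Od_def using gen[OF dist[unfolded list.map]] by blast+
  have edge: "{u, v} \<in> snd G" if "u \<in> fst G" "v \<in> fst G" "u \<noteq> v" for u v
    using that E by (simp add: card_2_iff) blast
  have Ene: "snd G \<noteq> {}" using edge[of a b] ne V(1) by auto
  have ex: "cnt \<phi> m = (let f = (\<lambda>A. if \<phi> (part G A) then lookup m (part G A) else 0) in
      f {} + f {c} + (f {b} + f {b, c}) + (f {a} + f {a, c} + (f {a, b} + f {a, b, c})))"
    if "m \<in> mons (partitions G)" for \<phi> m
    using ne by (subst cnt_base[OF fin dV that]) (simp add: Vd sum_Pow_insert Let_def)
  have sp: "sep (part G A) u v = ((u \<in> A) \<noteq> (v \<in> A))" if "A \<subseteq> {a, b, c, d}" "u \<in> {a, b, c, d}" "v \<in> {a, b, c, d}" for A u v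
    using that sep_part[of A G u v] V(1) by simp
  have fibre: "expo G m = expo G m' \<longleftrightarrow>
      (\<exists>k::int. (\<forall>e\<in>Ev. int (lookup m' e) = int (lookup m e) + k) \<and> (\<forall>f\<in>Od. int (lookup m' f) = int (lookup m f) - k))"
    if m: "m \<in> mons (partitions G)" "m' \<in> mons (partitions G)" for m m'
  proof
    assume L: "expo G m = expo G m'"
    have tri: "cnt (\<lambda>P. sep P d x = s \<and> sep P d y = t) m = cnt (\<lambda>P. sep P d x = s \<and> sep P d y = t) m'"
      if xy: "x \<in> {a, b, c}" "y \<in> {a, b, c}" "x \<noteq> y" for x y s t
    proof (rule cnt_triangle[OF m, where \<chi> = "\<lambda>P. sep P x y"])
      have xyV: "x \<in> fst G" "y \<in> fst G" "x \<noteq> d" "y \<noteq> d" using xy V(1) ne by auto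
      show "sep P x y = (sep P d x \<noteq> sep P d y)" if "P \<in> partitions G" for P
        using sep_xor[OF that xyV(1) dV xyV(2)] sep_commute[OF that xyV(1) dV] by simp
      show "total_deg m = total_deg m'" "cnt (\<lambda>P. sep P d x) m = cnt (\<lambda>P. sep P d x) m'"
        "cnt (\<lambda>P. sep P d y) m = cnt (\<lambda>P. sep P d y) m'" "cnt (\<lambda>P. sep P x y) m = cnt (\<lambda>P. sep P x y) m'"
        using L expo_eq_iff[OF G Ene m] edge[of d x] edge[of d y] edge[of x y] xyV dV xy(3) by auto
    qed
    \<comment> \<open>The shift is read off at the trivial partition; the triangle counts propagate
      it with alternating sign.\<close>
    define k where "k = int (lookup m' (part G {})) - int (lookup m (part G {}))"
    show "\<exists>k::int. (\<forall>e\<in>Ev. int (lookup m' e) = int (lookup m e) + k) \<and> (\<forall>f\<in>Od. int (lookup m' f) = int (lookup m f) - k)"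
      unfolding Ev_def Od_def
      apply (rule exI[of _ k])
      using tri[of b c False False] tri[of a c False False] tri[of a b False False]
        tri[of a c True False] tri[of a b True False] tri[of a b False True] tri[of a b True True]
      unfolding ex[OF m(1)] ex[OF m(2)] using ne by (simp add: sp Let_def k_def)
  next
    assume "\<exists>k::int. (\<forall>e\<in>Ev. int (lookup m' e) = int (lookup m e) + k) \<and> (\<forall>f\<in>Od. int (lookup m' f) = int (lookup m f) - k)"
    then obtain k where k: "\<forall>e\<in>Ev. int (lookup m' e) = int (lookup m e) + k" "\<forall>f\<in>Od. int (lookup m' f) = int (lookup m f) - k"
      by blast
    have "total_deg m = total_deg m'"
      using k unfolding cnt_True[symmetric] ex[OF m(1)] ex[OF m(2)] Ev_def Od_def by (simp add: Let_def)
    moreover have "cnt (\<lambda>P. sep P u v) m = cnt (\<lambda>P. sep P u v) m'" if e: "{u, v} \<in> snd G" for u v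
    proof -
      have "u \<in> {a, b, c, d}" "v \<in> {a, b, c, d}" "u \<noteq> v" using edge_vertices[OF G e] V(1) by auto
      thus ?thesis using k unfolding ex[OF m(1)] ex[OF m(2)] Ev_def Od_def
        by (elim insertE emptyE) (use ne in \<open>simp_all add: sp Let_def\<close>)
    qed
    ultimately show "expo G m = expo G m'" unfolding expo_eq_iff[OF G Ene m] by blast
  qed
  obtain rk where "koszul (partitions G) rk" using koszul_partitions[OF G] .
  then interpret K: koszul "partitions G" rk .
  have "K.quot_reg (card Od - 1) (fibre_ideal (partitions G) (\<lambda>m. Some (expo G m)) :: ('v set set, 'k) pol set)"
    by (rule K.quot_reg_binomial[OF X dis]) (use card fibre in \<open>auto simp: Ev_def\<close>)
  hence reg: "K.quot_reg (4 - 1) (cut_ideal G :: ('v set set, 'k) pol set)" by (simp add: cut_ideal_fibre card)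
  have finE: "finite Ev" "finite Od" by (simp_all add: Ev_def Od_def)
  have nz: "cut_ideal G \<noteq> {0 :: ('v set set, 'k) pol}"
  proof -
    let ?s = "\<lambda>A. \<Sum>P\<in>A. single P (Suc 0)"
    have ls: "lookup (?s A) P = (if P \<in> A then 1 else 0)" if "finite A" for A and P :: "'v set set"
      using that by (simp add: lookup_sum lookup_single when_def)
    have "keys (?s A) = A" if "finite A" for A :: "'v set set set" using ls[OF that] by (auto simp: in_keys_iff split: if_splits)
    hence m: "?s Ev \<in> mons (partitions G)" "?s Od \<in> mons (partitions G)" using finE X by (auto simp: mons_def)
    have "expo G (?s Ev) = expo G (?s Od)"
      unfolding fibre[OF m] by (rule exI[of _ "- 1"]) (use dis finE ls in auto)
    moreover have "?s Ev \<noteq> ?s Od"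
    proof
      assume "?s Ev = ?s Od"
      hence "lookup (?s Ev) (part G {}) = lookup (?s Od) (part G {})" by simp
      moreover have "part G {} \<in> Ev" by (simp add: Ev_def)
      moreover from this have "part G {} \<notin> Od" using dis by blast
      ultimately show False using ls[OF finE(1), of "part G {}"] ls[OF finE(2), of "part G {}"] by simp
    qed
    ultimately show ?thesis unfolding cut_ideal_fibre using fibre_ideal_nonzero[OF m] by blast
  qed
  show ?thesis
  proof (rule K.has_linear_resolutionI[OF ring_ideal_cut_ideal[OF G Ene] nz _ _ reg])
    fix j and p :: "('v set set, 'k) pol" assume "p \<in> cut_ideal G" "homog j p" "j < int 4"
    thus "p = 0" unfolding cut_ideal_fibre
    proof (rule fibre_ideal_low_degree)
      fix m m' assume m: "m \<in> mons (partitions G)" "m' \<in> mons (partitions G)" and eq: "expo G m = expo G m'" and deg: "total_deg m < 4"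
      obtain k where k: "\<forall>e\<in>Ev. int (lookup m' e) = int (lookup m e) + k" "\<forall>f\<in>Od. int (lookup m' f) = int (lookup m f) - k"
        using eq fibre[OF m] by blast
      have tot: "int (total_deg m) = (\<Sum>e\<in>Ev. int (lookup m e)) + (\<Sum>f\<in>Od. int (lookup m f))"
      proof -
        have "total_deg m = (\<Sum>x\<in>Ev \<union> Od. lookup m x)"
          using m(1) X finE by (intro total_deg_superset) (auto simp: mons_def)
        thus ?thesis using dis finE by (simp add: sum.union_disjoint)
      qed
      \<comment> \<open>A non-zero shift requires all four variables of one parity in
        \<open>m\<close>, hence degree at least 4.\<close>
      have "k = 0"
      proof (rule ccontr)
        assume "k \<noteq> 0"
        then consider "k \<ge> 1" | "k \<le> - 1" by linarith
        thus False
        proof cases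
          case 1
          have "int (lookup m f) \<ge> 1" if "f \<in> Od" for f using k(2) that 1 by (smt (verit) of_nat_0_le_iff)
          hence "(\<Sum>f\<in>Od. int (lookup m f)) \<ge> (\<Sum>f\<in>Od. 1)" by (intro sum_mono) auto
          moreover have "(\<Sum>e\<in>Ev. int (lookup m e)) \<ge> 0" by (intro sum_nonneg) simp
          ultimately show False using tot deg card by simp
        next
          case 2
          have "int (lookup m e) \<ge> 1" if "e \<in> Ev" for e using k(1) that 2 by (smt (verit) of_nat_0_le_iff)
          hence "(\<Sum>e\<in>Ev. int (lookup m e)) \<ge> (\<Sum>e\<in>Ev. 1)" by (intro sum_mono) auto
          moreover have "(\<Sum>f\<in>Od. int (lookup m f)) \<ge> 0" by (intro sum_nonneg) simp
          ultimately show False using tot deg card by simp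
        qed
      qed
      have "lookup m P = lookup m' P" if "P \<in> partitions G" for P using k that X \<open>k = 0\<close> by auto
      thus "m = m'" using m by (intro mons_eq_base[OF dV m]) (use V in \<open>auto intro: part_in\<close>)
    qed
  qed simp
qed

text \<open>A single edge passes the bound on complete graphs, but its cut map is injective on
  monomials. Its ideal is zero, which the definition of a linear resolution rules out.\<close>

lemma cut_ideal_K2:
  assumes G: "simple_graph G" and V: "fst G = {a, b}" "a \<noteq> b" and E: "{a, b} \<in> snd G"
  shows "cut_ideal G = {0 :: (_, 'k::field) pol}"
  unfolding cut_ideal_fibre
proof (rule fibre_ideal_zero_of_inj)
  fix m m' assume m: "m \<in> mons (partitions G)" "m' \<in> mons (partitions G)" and eq: "expo G m = expo G m'"
  have bV: "b \<in> fst G" and fin: "finite (fst G)" by (simp_all add: V)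
  have Vb: "fst G - {b} = {a}" using V by auto
  have Ene: "snd G \<noteq> {}" using E by blast
  have ex: "cnt \<phi> k = (if \<phi> (part G {}) then lookup k (part G {}) else 0) + (if \<phi> (part G {a}) then lookup k (part G {a}) else 0)"
    if "k \<in> mons (partitions G)" for \<phi> k
    by (subst cnt_base[OF fin bV that]) (simp add: Vb sum_Pow_insert)
  have sp: "sep (part G {}) a b = False" "sep (part G {a}) a b = True" using V sep_part[of _ G a b] by auto
  have "total_deg m = total_deg m'" "cnt (\<lambda>P. sep P a b) m = cnt (\<lambda>P. sep P a b) m'"
    using expo_eq_iff[OF G Ene m] eq E by blast+
  hence l: "lookup m (part G {}) = lookup m' (part G {})" "lookup m (part G {a}) = lookup m' (part G {a})"
    unfolding cnt_True[symmetric] ex[OF m(1)] ex[OF m(2)] by (simp_all add: sp)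
  show "m = m'"
  proof (rule mons_eq_base[OF bV m])
    fix A assume "A \<subseteq> fst G - {b}"
    hence "A = {} \<or> A = {a}" unfolding Vb by blast
    thus "lookup m (part G A) = lookup m' (part G A)" using l by blast
  qed
qed

text \<open>The four restrictions to the triangle are all the partitions, so their counts are the
  exponents of the monomial.\<close>

lemma cut_ideal_K3:
  assumes G: "simple_graph G" and V: "fst G = {a, b, c}" "distinct [a, b, c]"
    and E: "{a, b} \<in> snd G" "{c, a} \<in> snd G" "{c, b} \<in> snd G"
  shows "cut_ideal G = {0 :: (_, 'k::field) pol}"
  unfolding cut_ideal_fibre
proof (rule fibre_ideal_zero_of_inj)
  fix m m' assume m: "m \<in> mons (partitions G)" "m' \<in> mons (partitions G)" and eq: "expo G m = expo G m'"
  have ne: "a \<noteq> b" "a \<noteq> c" "b \<noteq> c" "b \<noteq> a" "c \<noteq> a" "c \<noteq> b" using V(2) by auto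
  have cV: "c \<in> fst G" and fin: "finite (fst G)" by (simp_all add: V)
  have Vc: "fst G - {c} = {a, b}" using V ne by auto
  have Ene: "snd G \<noteq> {}" using E by blast
  have ex: "cnt \<phi> k = (let f = (\<lambda>A. if \<phi> (part G A) then lookup k (part G A) else 0) in f {} + f {b} + (f {a} + f {a, b}))"
    if "k \<in> mons (partitions G)" for \<phi> k
    using ne by (subst cnt_base[OF fin cV that]) (simp add: Vc sum_Pow_insert Let_def)
  have sp: "sep (part G A) u v = ((u \<in> A) \<noteq> (v \<in> A))" if "A \<subseteq> {a, b, c}" "u \<in> {a, b, c}" "v \<in> {a, b, c}" for A u v
    using that sep_part[of A G u v] V(1) by simp
  have tri: "cnt (\<lambda>P. sep P c a = s \<and> sep P c b = t) m = cnt (\<lambda>P. sep P c a = s \<and> sep P c b = t) m'" for s t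
  proof (rule cnt_triangle[OF m, where \<chi> = "\<lambda>P. sep P a b"])
    show "sep P a b = (sep P c a \<noteq> sep P c b)" if "P \<in> partitions G" for P
      using sep_xor[OF that, of a c b] sep_commute[OF that, of a c] V(1) by simp
  qed (use expo_eq_iff[OF G Ene m] eq E in auto)
  have l: "lookup m (part G {}) = lookup m' (part G {})" "lookup m (part G {a}) = lookup m' (part G {a})"
      "lookup m (part G {b}) = lookup m' (part G {b})" "lookup m (part G {a, b}) = lookup m' (part G {a, b})"
    using tri[of False False] tri[of True False] tri[of False True] tri[of True True] ne
    unfolding ex[OF m(1)] ex[OF m(2)] by (simp_all add: sp Let_def)
  show "m = m'"
  proof (rule mons_eq_base[OF cV m])
    fix A assume "A \<subseteq> fst G - {c}"
    hence "A \<in> Pow {a, b}" unfolding Vc by blast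
    hence "A = {} \<or> A = {a} \<or> A = {b} \<or> A = {a, b}" by auto
    thus "lookup m (part G A) = lookup m' (part G A)" using l by blast
  qed
qed

section \<open>Certificates of the small graphs\<close>

text \<open>Homological degree 1 means a minimal generator. In all certificates of this kind
  \<open>Z\<close> comes from two monomials of one fibre, and \<open>t\<close> is, up to sign, the
  indicator of the variables on one side of a disconnection of the complex.\<close>

lemma generator_P3: "certificate 3 [(0, 1), (1, 2)] [(0, 1, 1, True, True), (0, 1, 1, False, False), (1, 2,
    2, True, True), (1, 2, 2, False, False)]
   [[], [1], [2], [1, 2]]
   [0, 1]
   (Suc 0) 1
   [([1], 1, [0]), ([3], -1, [2])]
   [([2], -1), ([3], -1)]
   0 0"
  by code_simp

text \<open>The quartic that compares the subsets of \<open>{1, 2, 3}\<close> of even size with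
  those of odd size.\<close>

lemma generator_K4: "certificate 4 [(0, 1), (0, 2), (0, 3), (1, 2), (1, 3), (2, 3)] [(0, 1, 2, False, False),
    (0, 1, 2, False, True), (0, 1, 2, True, False), (0, 1, 2, True, True), (0, 1, 3, False, False), (0, 1, 3,
    False, True), (0, 1, 3, True, False), (0, 1, 3, True, True), (0, 2, 3, False, False), (0, 2, 3, False,
    True), (0, 2, 3, True, False), (0, 2, 3, True, True), (1, 2, 3, False, False), (1, 2, 3, False, True),
    (1, 2, 3, True, False), (1, 2, 3, True, True)]
   [[], [1], [2], [1, 2], [3], [1, 3], [2, 3], [1, 2, 3]]
   [0, 3, 5, 6]
   (Suc 0) 3
   [([2], -1, [1, 4, 7]), ([6], 1, [0, 3, 5])]
   [([0], 1), ([3], 1), ([5], 1), ([6], 1)]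
   0 0"
  by code_simp

text \<open>Homological degree 2: the edges in \<open>Z\<close> bound the triangle on the positions
  0, 2, 3. The coefficient degree 2 forces \<open>d = 3\<close>, against the quadric of
  \<open>generator_C4\<close>.\<close>

lemma syzygy_C4: "certificate 4 [(0, 1), (0, 3), (1, 2), (2, 3)] [(0, 1, 1, True, True), (0, 1, 1, False,
    False), (0, 3, 3, True, True), (0, 3, 3, False, False), (1, 2, 2, True, True), (1, 2, 2, False, False),
    (2, 3, 3, True, True), (2, 3, 3, False, False)]
   [[], [1], [2], [1, 2], [3], [1, 3], [2, 3], [1, 2, 3]]
   [0, 5, 0, 5]
   (Suc 1) 2
   [([0, 2], 1, [5, 7]), ([0, 3], -1, [5, 6]), ([2, 3], 1, [6, 7])]
   [([2, 3], 1), ([2, 6], 1), ([3, 7], -1), ([6, 7], -1)]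
   0 0"
  by code_simp

text \<open>The cycle is the closed path of four edges through the positions 0, 2, 7, 6.\<close>

lemma syzygy_diamond: "certificate 4 [(0, 1), (0, 2), (1, 2), (1, 3), (2, 3)] [(0, 1, 1, True, True), (0, 1,
    1, False, False), (0, 2, 2, True, True), (0, 2, 2, False, False), (1, 3, 3, True, True), (1, 3, 3, False,
    False), (2, 3, 3, True, True), (2, 3, 3, False, False)]
   [[], [1], [2], [1, 2], [3], [1, 3], [2, 3], [1, 2, 3]]
   [0, 3, 1, 2]
   (Suc 1) 2
   [([0, 2], -1, [1, 3]), ([0, 6], 1, [3, 5]), ([2, 7], -1, [1, 4]), ([6, 7], 1, [4, 5])]
   [([0, 1], -1), ([0, 2], -1), ([1, 3], 1), ([2, 3], 1)]
   0 0"
  by code_simp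

text \<open>Homological degree 4: the cycle is a 3-sphere, the suspension with apexes 1 and 5 of the
  boundary of the tetrahedron 0, 3, 4, 7.\<close>

lemma syzygy_P4: "certificate 4 [(0, 1), (1, 2), (2, 3)] [(0, 1, 1, True, True), (0, 1, 1, False, False), (1,
    2, 2, True, True), (1, 2, 2, False, False), (2, 3, 3, True, True), (2, 3, 3, False, False)]
   [[], [1], [2], [1, 2], [3], [1, 3], [2, 3], [1, 2, 3]]
   [1, 2, 3, 4, 6, 7]
   (Suc 3) 2
   [([0, 1, 3, 4], -1, [1, 2]), ([0, 1, 3, 7], 1, [2, 2]), ([0, 1, 4, 7], -1, [2, 5]), ([0, 3, 4, 5], 1, [1,
    6]), ([0, 3, 5, 7], 1, [2, 6]), ([0, 4, 5, 7], -1, [1, 2]), ([1, 3, 4, 7], -1, [2, 6]), ([3, 4, 5, 7], 1, [6, 6])]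
   [([0, 1, 2, 3], -1), ([0, 1, 2, 6], -1), ([0, 1, 3, 7], 1), ([0, 2, 3, 4], -1), ([1, 2, 3, 5], 1)]
   0 0"
  by code_simp

text \<open>A 3-sphere again, the suspension with apexes 5 and 7 of the boundary of the tetrahedron
  0, 1, 2, 3.\<close>

lemma syzygy_K13: "certificate 4 [(0, 1), (0, 2), (0, 3)] [(0, 1, 1, True, True), (0, 1, 1, False, False),
    (0, 2, 2, True, True), (0, 2, 2, False, False), (0, 3, 3, True, True), (0, 3, 3, False, False)]
   [[], [1], [2], [1, 2], [3], [1, 3], [2, 3], [1, 2, 3]]
   [1, 2, 3, 4, 5, 6]
   (Suc 3) 2
   [([0, 1, 2, 5], 1, [6, 7]), ([0, 1, 2, 7], -1, [4, 7]), ([0, 1, 3, 5], -1, [6, 6]), ([0, 1, 3, 7], 1, [4,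
    6]), ([0, 2, 3, 5], 1, [4, 7]), ([0, 2, 3, 7], -1, [4, 5]), ([1, 2, 3, 5], -1, [4, 6]), ([1, 2, 3, 7], 1, [4, 4])]
   [([0, 1, 3, 5], -1), ([0, 2, 3, 6], 1), ([0, 3, 5, 6], -1), ([0, 4, 5, 6], -1), ([3, 5, 6, 7], 1)]
   0 0"
  by code_simp

text \<open>A 3-sphere with nine facets, the join of the boundaries of the triangles 1, 4, 7 and 2,
  5, 8.\<close>

lemma syzygy_butterfly: "certificate 5 [(0, 1), (0, 2), (0, 3), (0, 4), (1, 2), (3, 4)] [(0, 1, 1, True,
    True), (0, 2, 2, True, True), (0, 3, 3, True, True), (0, 4, 4, True, True), (1, 2, 2, False, False), (3,
    4, 4, False, False), (0, 1, 2, True, True), (0, 3, 4, True, True)]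
   [[], [1], [2], [3], [1, 3], [2, 3], [4], [1, 4], [2, 4]]
   [3, 6, 1, 7, 2, 5]
   (Suc 3) 2
   [([1, 2, 4, 5], 1, [6, 6]), ([1, 2, 4, 8], -1, [3, 6]), ([1, 2, 5, 7], 1, [3, 6]), ([1, 2, 7, 8], 1, [3,
    3]), ([1, 4, 5, 8], -1, [0, 6]), ([1, 5, 7, 8], -1, [0, 3]), ([2, 4, 5, 7], 1, [0, 6]), ([2, 4, 7, 8], 1,
    [0, 3]), ([4, 5, 7, 8], 1, [0, 0])]
   [([0, 1, 6, 7], 1), ([0, 2, 5, 6], 1), ([0, 5, 6, 7], 1), ([1, 2, 4, 5], 1), ([2, 4, 5, 6], -1), ([4, 5, 6, 7], 1)]
   0 0"
  by code_simp

text \<open>The binomial of degree 6 compares \<open>{}\<close> twice, \<open>{1, 2}\<close>,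
  \<open>{1, 3}\<close>, \<open>{1, 4}\<close>, \<open>{2, 3, 4}\<close> with \<open>{1}\<close>
  twice, \<open>{2}\<close>, \<open>{3}\<close>, \<open>{4}\<close>, \<open>{1, 2, 3, 4}\<close>.
  The lookaheads 2 and 3 help to discard sets that are not faces.\<close>

lemma generator_6_K5: "certificate 5 [(0, 1), (0, 2), (0, 3), (0, 4), (1, 2), (1, 3), (1, 4), (2, 3), (2, 4),
    (3, 4)] [(0, 1, 2, False, False), (0, 1, 2, False, True), (0, 1, 2, True, False), (0, 1, 2, True, True),
    (0, 1, 3, False, False), (0, 1, 3, False, True), (0, 1, 3, True, False), (0, 1, 3, True, True), (0, 1, 4,
    False, False), (0, 1, 4, False, True), (0, 1, 4, True, False), (0, 1, 4, True, True), (0, 2, 3, False,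
    False), (0, 2, 3, False, True), (0, 2, 3, True, False), (0, 2, 3, True, True), (0, 2, 4, False, False),
    (0, 2, 4, False, True), (0, 2, 4, True, False), (0, 2, 4, True, True), (0, 3, 4, False, False), (0, 3, 4,
    False, True), (0, 3, 4, True, False), (0, 3, 4, True, True), (1, 2, 3, False, False), (1, 2, 3, False,
    True), (1, 2, 3, True, False), (1, 2, 3, True, True), (1, 2, 4, False, False), (1, 2, 4, False, True),
    (1, 2, 4, True, False), (1, 2, 4, True, True), (1, 3, 4, False, False), (1, 3, 4, False, True), (1, 3, 4,
    True, False), (1, 3, 4, True, True), (2, 3, 4, False, False), (2, 3, 4, False, True), (2, 3, 4, True,
    False), (2, 3, 4, True, True)]
   [[], [1], [2], [1, 2], [3], [1, 3], [4], [1, 4], [2, 3, 4], [1, 2, 3, 4]]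
   [0, 0, 3, 5, 7, 8]
   (Suc 0) 5
   [([4], -1, [1, 1, 2, 6, 9]), ([8], 1, [0, 0, 3, 5, 7])]
   [([0], 1), ([3], 1), ([5], 1), ([7], 1), ([8], 1)]
   2 3"
  by code_simp

text \<open>The quadric compares two ways of cutting every edge of the square exactly once by two
  partitions.\<close>

lemma generator_C4: "certificate 4 [(0, 1), (0, 3), (1, 2), (2, 3)] [(0, 1, 1, True, True), (0, 1, 1, False,
    False), (0, 3, 3, True, True), (0, 3, 3, False, False), (1, 2, 2, True, True), (1, 2, 2, False, False)]
   [[], [1], [2], [1, 2], [3], [1, 3], [2, 3], [1, 2, 3]]
   [0, 5]
   (Suc 0) 1
   [([2], -1, [7]), ([6], 1, [3])]
   [([3], 1), ([6], 1)]
   0 0"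
  by code_simp

text \<open>As in the next three certificates, the graph is contracted further to a path with three
  vertices, here along the edge between 1 and 2, and the quadric of that path is used.\<close>

lemma generator_diamond: "certificate 4 [(0, 1), (0, 2), (1, 2), (1, 3), (2, 3)] [(0, 1, 1, True, True), (0,
    1, 1, False, False), (1, 2, 2, True, True), (1, 3, 3, True, True), (1, 3, 3, False, False)]
   [[], [1, 2], [3], [1, 2, 3]]
   [0, 1]
   (Suc 0) 1
   [([1], 1, [0]), ([3], -1, [2])]
   [([2], -1), ([3], -1)]
   0 0"
  by code_simp

lemma generator_P4: "certificate 4 [(0, 1), (1, 2), (2, 3)] [(0, 1, 1, True, True), (0, 1, 1, False, False),
    (1, 2, 2, True, True), (1, 2, 2, False, False), (2, 3, 3, True, True)]
   [[], [1], [2, 3], [1, 2, 3]]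
   [0, 1]
   (Suc 0) 1
   [([1], 1, [0]), ([3], -1, [2])]
   [([2], -1), ([3], -1)]
   0 0"
  by code_simp

lemma generator_K13: "certificate 4 [(0, 1), (0, 2), (0, 3)] [(0, 1, 1, True, True), (0, 1, 1, False, False),
    (0, 2, 2, True, True), (0, 2, 2, False, False), (0, 3, 3, True, True)]
   [[], [1], [2], [1, 2]]
   [1, 2]
   (Suc 0) 1
   [([1], 1, [2]), ([3], -1, [0])]
   [([0], -1), ([3], -1)]
   0 0"
  by code_simp

lemma generator_butterfly: "certificate 5 [(0, 1), (0, 2), (0, 3), (0, 4), (1, 2), (3, 4)] [(0, 1, 1, True,
    True), (0, 1, 1, False, False), (0, 2, 2, True, True), (0, 3, 3, True, True), (0, 3, 3, False, False),
    (0, 4, 4, True, True)]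
   [[], [1], [3], [1, 3]]
   [0, 3]
   (Suc 0) 1
   [([1], 1, [2]), ([3], -1, [0])]
   [([0], -1), ([3], -1)]
   0 0"
  by code_simp

text \<open>The vertices 0 and 4 are never separated; contracting their edge leaves
  \<open>K\<^sub>4\<close> with its quartic, against degree 6 in
  \<open>generator_6_K5\<close>.\<close>

lemma generator_4_K5: "certificate 5 [(0, 1), (0, 2), (0, 3), (0, 4), (1, 2), (1, 3), (1, 4), (2, 3), (2, 4),
    (3, 4)] [(0, 4, 4, True, True), (0, 1, 2, False, False), (0, 1, 2, False, True), (0, 1, 2, True, False),
    (0, 1, 2, True, True), (0, 1, 3, False, False), (0, 1, 3, False, True), (0, 1, 3, True, False), (0, 1, 3,
    True, True), (0, 2, 3, False, False), (0, 2, 3, False, True), (0, 2, 3, True, False), (0, 2, 3, True,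
    True), (1, 2, 3, False, False), (1, 2, 3, False, True), (1, 2, 3, True, False), (1, 2, 3, True, True)]
   [[], [1], [2], [1, 2], [3], [1, 3], [2, 3], [1, 2, 3]]
   [0, 3, 5, 6]
   (Suc 0) 3
   [([2], -1, [1, 4, 7]), ([6], 1, [0, 3, 5])]
   [([0], 1), ([3], 1), ([5], 1), ([6], 1)]
   0 0"
  by code_simp

section \<open>Connected vertex sets\<close>

lemma joined_commute: "joined G A B \<longleftrightarrow> joined G B A"
  unfolding joined_def by (metis insert_commute)

lemma joined_mono: "joined G A B \<Longrightarrow> A \<subseteq> A' \<Longrightarrow> B \<subseteq> B' \<Longrightarrow> joined G A' B'"
  unfolding joined_def by blast

lemma joined_Un: "joined G (A \<union> A') B \<longleftrightarrow> joined G A B \<or> joined G A' B"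
  "joined G B (A \<union> A') \<longleftrightarrow> joined G B A \<or> joined G B A'"
  unfolding joined_def by blast+

lemma joined_singletons: "joined G {u} {v} \<longleftrightarrow> {u, v} \<in> snd G"
  unfolding joined_def by simp

text \<open>Connectedness without paths: no proper non-empty subset is unjoined from its complement.
  The arguments with sets below use this form.\<close>

lemma gconn_iff: "gconn G A \<longleftrightarrow> (\<forall>T\<subseteq>A. T \<noteq> {} \<longrightarrow> T \<noteq> A \<longrightarrow> joined G T (A - T))"
proof
  assume g: "gconn G A"
  show "\<forall>T\<subseteq>A. T \<noteq> {} \<longrightarrow> T \<noteq> A \<longrightarrow> joined G T (A - T)"
  proof (intro allI impI)
    fix T assume T: "T \<subseteq> A" "T \<noteq> {}" "T \<noteq> A"
    obtain u v where uv: "u \<in> T" "v \<in> A" "v \<notin> T" using T by blast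
    have "(u, v) \<in> {(x, y). x \<in> A \<and> y \<in> A \<and> {x, y} \<in> snd G}\<^sup>*" using g uv T unfolding gconn_def by blast
    hence "v \<in> T \<or> joined G T (A - T)"
    proof (induction rule: rtrancl_induct)
      case (step y z) thus ?case unfolding joined_def by blast
    qed (use uv in simp)
    thus "joined G T (A - T)" using uv by blast
  qed
next
  assume j: "\<forall>T\<subseteq>A. T \<noteq> {} \<longrightarrow> T \<noteq> A \<longrightarrow> joined G T (A - T)"
  show "gconn G A"
    unfolding gconn_def
  proof (intro ballI)
    fix u v assume uv: "u \<in> A" "v \<in> A"
    let ?R = "{(x, y). x \<in> A \<and> y \<in> A \<and> {x, y} \<in> snd G}"
    define T where "T = {x \<in> A. (u, x) \<in> ?R\<^sup>*}"
    have T: "T \<subseteq> A" "u \<in> T" using uv by (auto simp: T_def)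
    have "\<not> joined G T (A - T)"
    proof
      assume "joined G T (A - T)"
      then obtain x y where xy: "x \<in> T" "y \<in> A" "y \<notin> T" "{x, y} \<in> snd G" unfolding joined_def by blast
      have "(u, x) \<in> ?R\<^sup>*" using xy(1) by (simp add: T_def)
      moreover have "(x, y) \<in> ?R" using xy T by blast
      ultimately have "(u, y) \<in> ?R\<^sup>*" by (rule rtrancl_into_rtrancl)
      thus False using xy by (simp add: T_def)
    qed
    hence "T = A" using j T by blast
    thus "(u, v) \<in> ?R\<^sup>*" using uv by (auto simp: T_def)
  qed
qed

lemma gconnD: "gconn G A \<Longrightarrow> T \<subseteq> A \<Longrightarrow> T \<noteq> {} \<Longrightarrow> \<not> joined G T (A - T) \<Longrightarrow> T = A"
  unfolding gconn_iff by blast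

lemma gconnI: "(\<And>T. T \<subseteq> A \<Longrightarrow> T \<noteq> {} \<Longrightarrow> \<not> joined G T (A - T) \<Longrightarrow> T = A) \<Longrightarrow> gconn G A"
  unfolding gconn_iff by blast

lemma gconn_singleton: "gconn G {u}"
  unfolding gconn_iff by auto

lemma gconn_meets:
  assumes "gconn G A" "A \<subseteq> B" "T \<subseteq> B" "\<not> joined G T (B - T)" "A \<inter> T \<noteq> {}"
  shows "A \<subseteq> T"
proof -
  have "\<not> joined G (A \<inter> T) (A - A \<inter> T)"
    using joined_mono[of G "A \<inter> T" "A - A \<inter> T" T "B - T"] assms(2,4) by blast
  hence "A \<inter> T = A" using gconnD[OF assms(1), of "A \<inter> T"] assms(5) by blast
  thus ?thesis by blast
qed

lemma gconn_Un:
  assumes "gconn G A" "gconn G B" "A \<inter> B \<noteq> {} \<or> joined G A B"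
  shows "gconn G (A \<union> B)"
proof (rule gconnI)
  fix T assume T: "T \<subseteq> A \<union> B" "T \<noteq> {}" "\<not> joined G T (A \<union> B - T)"
  have A: "A \<inter> T \<noteq> {} \<Longrightarrow> A \<subseteq> T" using gconn_meets[OF assms(1) _ T(1,3)] by simp
  have B: "B \<inter> T \<noteq> {} \<Longrightarrow> B \<subseteq> T" using gconn_meets[OF assms(2) _ T(1,3)] by simp
  show "T = A \<union> B"
  proof (rule ccontr)
    assume "T \<noteq> A \<union> B"
    hence "(A \<subseteq> T \<and> T \<inter> B = {}) \<or> (B \<subseteq> T \<and> T \<inter> A = {})" using A B T(1,2) by blast
    thus False
    proof
      assume a: "A \<subseteq> T \<and> T \<inter> B = {}"
      hence "joined G A B" using assms(3) by blast
      hence "joined G T (A \<union> B - T)" using a by (elim joined_mono) auto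
      thus False using T(3) by simp
    next
      assume a: "B \<subseteq> T \<and> T \<inter> A = {}"
      hence "joined G B A" using assms(3) joined_commute[of G A B] by blast
      hence "joined G T (A \<union> B - T)" using a by (elim joined_mono) auto
      thus False using T(3) by simp
    qed
  qed
qed

definition comp :: "'v graph \<Rightarrow> 'v set \<Rightarrow> 'v \<Rightarrow> 'v set" where
  "comp G U w = \<Union>{T. T \<subseteq> U \<and> w \<in> T \<and> gconn G T}"

lemma comp_subset: "comp G U w \<subseteq> U"
  unfolding comp_def by blast

lemma comp_upper: "K \<subseteq> U \<Longrightarrow> w \<in> K \<Longrightarrow> gconn G K \<Longrightarrow> K \<subseteq> comp G U w"
  unfolding comp_def by blast

lemma comp_self: "w \<in> U \<Longrightarrow> w \<in> comp G U w"
  unfolding comp_def using gconn_singleton[of G w] by (intro UnionI[of "{w}"]) auto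

lemma gconn_comp: "gconn G (comp G U w)"
proof (rule gconnI)
  fix T assume T: "T \<subseteq> comp G U w" "T \<noteq> {}" "\<not> joined G T (comp G U w - T)"
  have m: "K \<subseteq> T" if "K \<subseteq> U" "w \<in> K" "gconn G K" "K \<inter> T \<noteq> {}" for K
    using that T by (intro gconn_meets[of G K "comp G U w" T]) (auto simp: comp_def)
  obtain x where x: "x \<in> T" using T(2) by blast
  then obtain K where K: "K \<subseteq> U" "w \<in> K" "gconn G K" "x \<in> K" using T(1) unfolding comp_def by blast
  hence "w \<in> T" using m[OF K(1,2,3)] x by blast
  hence "comp G U w \<subseteq> T" using m unfolding comp_def by blast
  thus "T = comp G U w" using T(1) by blast
qed

lemma comp_closed:
  assumes "w \<in> U" shows "\<not> joined G (comp G U w) (U - comp G U w)"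
proof
  assume "joined G (comp G U w) (U - comp G U w)"
  then obtain x y where xy: "x \<in> comp G U w" "y \<in> U" "y \<notin> comp G U w" "{x, y} \<in> snd G" unfolding joined_def by blast
  have "joined G (comp G U w) {y}" using xy unfolding joined_def by blast
  hence "gconn G (comp G U w \<union> {y})" by (intro gconn_Un gconn_comp gconn_singleton disjI2)
  moreover have "comp G U w \<union> {y} \<subseteq> U" using comp_subset xy by fastforce
  moreover have "w \<in> comp G U w \<union> {y}" using comp_self[OF assms] by simp
  ultimately have "comp G U w \<union> {y} \<subseteq> comp G U w" by (intro comp_upper)
  thus False using xy by simp
qed

text \<open>\<open>Q\<close> is the component of \<open>b2\<close> after the removal of
  \<open>b1\<close>, and \<open>P\<close> is the rest. Any part of \<open>P\<close> not reached from
  \<open>b1\<close> inside \<open>P\<close> would be unjoined from \<open>Q\<close> too, as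
  \<open>Q\<close> is a full component, against the connectedness of \<open>S\<close>.\<close>

lemma gconn_split:
  assumes S: "gconn G S" and b: "b1 \<in> S" "b2 \<in> S" "b1 \<noteq> b2"
  obtains P Q where "P \<union> Q = S" "P \<inter> Q = {}" "gconn G P" "gconn G Q" "b1 \<in> P" "b2 \<in> Q" "joined G P Q"
proof -
  define Q where "Q = comp G (S - {b1}) b2"
  define P where "P = S - Q"
  have b2: "b2 \<in> S - {b1}" using b by blast
  have Q: "Q \<subseteq> S - {b1}" "b2 \<in> Q" "gconn G Q" "\<not> joined G Q (S - {b1} - Q)"
    unfolding Q_def by (rule comp_subset comp_self[OF b2] gconn_comp comp_closed[OF b2])+
  have bP: "b1 \<in> P" using b Q by (auto simp: P_def)
  define K where "K = comp G P b1"
  have K: "K \<subseteq> P" "b1 \<in> K" "gconn G K" "\<not> joined G K (P - K)"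
    unfolding K_def by (rule comp_subset comp_self[OF bP] gconn_comp comp_closed[OF bP])+
  have "S - (K \<union> Q) = P - K" by (auto simp: P_def)
  moreover have "\<not> joined G Q (P - K)" using Q(4) K(2) joined_mono[of G Q "P - K" Q "S - {b1} - Q"] by (auto simp: P_def)
  ultimately have "\<not> joined G (K \<union> Q) (S - (K \<union> Q))" using K(4) by (simp add: joined_Un)
  hence "K \<union> Q = S" using gconnD[OF S, of "K \<union> Q"] K Q by (auto simp: P_def)
  hence "P = K" using K(1) by (auto simp: P_def)
  hence "gconn G P" using K(3) by simp
  moreover have "joined G P (S - P)"
  proof -
    have "P \<noteq> S" "P \<noteq> {}" "P \<subseteq> S" using Q(1,2) bP b by (auto simp: P_def)
    thus ?thesis using S unfolding gconn_iff by blast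
  qed
  moreover have "S - P = Q" using Q(1) by (auto simp: P_def)
  ultimately show ?thesis using that[of P Q] Q bP by (auto simp: P_def)
qed

lemma gconn_vertices: "simple_graph G \<Longrightarrow> connected_graph G \<Longrightarrow> gconn G (fst G)"
proof -
  assume G: "simple_graph G" "connected_graph G"
  have "{(x, y). {x, y} \<in> snd G} = {(x, y). x \<in> fst G \<and> y \<in> fst G \<and> {x, y} \<in> snd G}"
    using edge_vertices[OF G(1)] by blast
  thus ?thesis using G(2) unfolding gconn_def connected_graph_def by simp
qed

section \<open>Classification\<close>

definition pieces :: "'v graph \<Rightarrow> 'v set list \<Rightarrow> bool" where
  "pieces G Ss \<longleftrightarrow> (\<forall>A\<in>set Ss. A \<noteq> {} \<and> gconn G A) \<and> \<Union>(set Ss) = fst G \<and> sorted_wrt (\<lambda>A B. A \<inter> B = {}) Ss"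

lemma contraction_pieces:
  assumes "pieces G Ss" "length Ss = h" "0 < h"
    and "list_all (\<lambda>(i, j). joined G (Ss ! i) (Ss ! j) = ((i, j) \<in> set EL)) [(i, j). i \<leftarrow> [0..<h], j \<leftarrow> [Suc i..<h]]"
  shows "contraction G h EL ((!) Ss)"
  unfolding contraction_def
proof (intro conjI allI impI)
  show "0 < h" by fact
  show "(\<Union>i<h. Ss ! i) = fst G"
  proof -
    have "(!) Ss ` {..<h} = set Ss" using nth_image[of h Ss] assms(2) by (simp add: atLeast0LessThan[symmetric])
    thus ?thesis using assms(1) by (simp add: pieces_def)
  qed
  show "Ss ! i \<noteq> {}" "gconn G (Ss ! i)" if "i < h" for i using that assms(1,2) by (simp_all add: pieces_def)
  show "Ss ! i \<inter> Ss ! j = {}" if "i < h" "j < h" "i \<noteq> j" for i j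
  proof -
    have s: "sorted_wrt (\<lambda>A B. A \<inter> B = {}) Ss" using assms(1) by (simp add: pieces_def)
    show ?thesis
      using sorted_wrt_nth_less[OF s, of i j] sorted_wrt_nth_less[OF s, of j i] that assms(2) by (metis inf_commute nat_neq_iff)
  qed
  show "joined G (Ss ! i) (Ss ! j) = ((i, j) \<in> set EL)" if "i < j" "j < h" for i j
    using assms(4) that by (auto simp: list_all_iff)
qed

text \<open>Every nonvanishing Betti number that can be read off a contraction of \<open>G\<close> lies on the
  strand of degree \<open>d\<close>.\<close>

definition forced_degree :: "'v graph \<Rightarrow> nat \<Rightarrow> bool" where
  "forced_degree G d \<longleftrightarrow> (\<forall>h EL S fs vs ms0 i c Z t n n1.
     contraction G h EL S \<longrightarrow> list_all (\<lambda>(i, j). i < j \<and> j < h) EL \<longrightarrow>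
     certificate h EL fs vs ms0 (Suc i) c Z t n n1 \<longrightarrow> d = Suc c)"

text \<open>The classification knows the ideal and the field only through the number
  \<open>d\<close> in this conclusion.\<close>

lemma forced_degree_linear_resolution:
  assumes "simple_graph G" "snd G \<noteq> {}"
    and "has_linear_resolution (partitions G) (cut_ideal G :: ('v set set, 'k::field) pol set) d"
  shows "forced_degree G d"
  unfolding forced_degree_def
proof (intro allI impI)
  fix h EL and S :: "nat \<Rightarrow> 'v set" and fs vs ms0 i c Z t n n1
  assume a: "contraction G h EL S" "list_all (\<lambda>(i, j). i < j \<and> j < h) EL" "certificate h EL fs vs ms0 (Suc i) c Z t n n1"
  interpret contracted_graph G h EL S by unfold_locales (use assms a in auto)
  show "d = Suc c" by (rule certificate_degree[OF a(3) assms(3)])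
qed

locale linear_type =
  fixes G :: "'v graph" and d :: nat
  assumes simple: "simple_graph G" and conn: "connected_graph G" and edges: "snd G \<noteq> {}"
    and forced: "forced_degree G d"
begin

abbreviation V where "V \<equiv> fst G"

abbreviation join (infix "\<leftrightarrow>" 50) where "A \<leftrightarrow> B \<equiv> joined G A B"

lemma degree:
  assumes "contraction G h EL S" "list_all (\<lambda>(i, j). i < j \<and> j < h) EL"
    and "certificate h EL fs vs ms0 (Suc i) c Z t n n1"
  shows "d = Suc c"
  using forced assms unfolding forced_degree_def by blast

text \<open>The syzygy gives \<open>d = 3\<close> and the generator \<open>d = 2\<close>. The next
  four exclusions follow the same pattern; for \<open>K\<^sub>5\<close> the two values are 6 and
  4.\<close>

lemma no_C4: "pieces G [A, B, C, D] \<Longrightarrow> A \<leftrightarrow> B \<Longrightarrow> B \<leftrightarrow> C \<Longrightarrow> C \<leftrightarrow> D \<Longrightarrow> A \<leftrightarrow> D \<Longrightarrow> \<not> A \<leftrightarrow> C \<Longrightarrow> \<not> B \<leftrightarrow> D \<Longrightarrow> False"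
  using degree[OF _ _ syzygy_C4, of "(!) [A, B, C, D]"] degree[OF _ _ generator_C4, of "(!) [A, B, C, D]"]
    contraction_pieces[of G "[A, B, C, D]" 4 "[(0, 1), (0, 3), (1, 2), (2, 3)]"]
  by (simp add: upt_rec)

lemma no_diamond: "pieces G [A, B, C, D] \<Longrightarrow> A \<leftrightarrow> B \<Longrightarrow> A \<leftrightarrow> C \<Longrightarrow> B \<leftrightarrow> C \<Longrightarrow> B \<leftrightarrow> D \<Longrightarrow> C \<leftrightarrow> D \<Longrightarrow> \<not> A \<leftrightarrow> D \<Longrightarrow> False"
  using degree[OF _ _ syzygy_diamond, of "(!) [A, B, C, D]"] degree[OF _ _ generator_diamond, of "(!) [A, B, C, D]"]
    contraction_pieces[of G "[A, B, C, D]" 4 "[(0, 1), (0, 2), (1, 2), (1, 3), (2, 3)]"]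
  by (simp add: upt_rec)

lemma no_P4: "pieces G [A, B, C, D] \<Longrightarrow> A \<leftrightarrow> B \<Longrightarrow> B \<leftrightarrow> C \<Longrightarrow> C \<leftrightarrow> D \<Longrightarrow> \<not> A \<leftrightarrow> C \<Longrightarrow> \<not> A \<leftrightarrow> D \<Longrightarrow> \<not> B \<leftrightarrow> D \<Longrightarrow> False"
  using degree[OF _ _ syzygy_P4, of "(!) [A, B, C, D]"] degree[OF _ _ generator_P4, of "(!) [A, B, C, D]"]
    contraction_pieces[of G "[A, B, C, D]" 4 "[(0, 1), (1, 2), (2, 3)]"]
  by (simp add: upt_rec)

lemma no_K13: "pieces G [A, B, C, D] \<Longrightarrow> A \<leftrightarrow> B \<Longrightarrow> A \<leftrightarrow> C \<Longrightarrow> A \<leftrightarrow> D \<Longrightarrow> \<not> B \<leftrightarrow> C \<Longrightarrow> \<not> B \<leftrightarrow> D \<Longrightarrow> \<not> C \<leftrightarrow> D \<Longrightarrow> False"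
  using degree[OF _ _ syzygy_K13, of "(!) [A, B, C, D]"] degree[OF _ _ generator_K13, of "(!) [A, B, C, D]"]
    contraction_pieces[of G "[A, B, C, D]" 4 "[(0, 1), (0, 2), (0, 3)]"]
  by (simp add: upt_rec)

lemma no_butterfly: "pieces G [A, B, C, D, F] \<Longrightarrow> A \<leftrightarrow> B \<Longrightarrow> A \<leftrightarrow> C \<Longrightarrow> A \<leftrightarrow> D \<Longrightarrow> A \<leftrightarrow> F \<Longrightarrow> B \<leftrightarrow> C \<Longrightarrow> D \<leftrightarrow> F \<Longrightarrow>
    \<not> B \<leftrightarrow> D \<Longrightarrow> \<not> B \<leftrightarrow> F \<Longrightarrow> \<not> C \<leftrightarrow> D \<Longrightarrow> \<not> C \<leftrightarrow> F \<Longrightarrow> False"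
  using degree[OF _ _ syzygy_butterfly, of "(!) [A, B, C, D, F]"] degree[OF _ _ generator_butterfly, of "(!) [A, B, C, D, F]"]
    contraction_pieces[of G "[A, B, C, D, F]" 5 "[(0, 1), (0, 2), (0, 3), (0, 4), (1, 2), (3, 4)]"]
  by (simp add: upt_rec)

lemma no_K5: "pieces G [A, B, C, D, F] \<Longrightarrow> A \<leftrightarrow> B \<Longrightarrow> A \<leftrightarrow> C \<Longrightarrow> A \<leftrightarrow> D \<Longrightarrow> A \<leftrightarrow> F \<Longrightarrow> B \<leftrightarrow> C \<Longrightarrow> B \<leftrightarrow> D \<Longrightarrow> B \<leftrightarrow> F \<Longrightarrow>
    C \<leftrightarrow> D \<Longrightarrow> C \<leftrightarrow> F \<Longrightarrow> D \<leftrightarrow> F \<Longrightarrow> False"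
  using degree[OF _ _ generator_6_K5, of "(!) [A, B, C, D, F]"] degree[OF _ _ generator_4_K5, of "(!) [A, B, C, D, F]"]
    contraction_pieces[of G "[A, B, C, D, F]" 5 "[(0, 1), (0, 2), (0, 3), (0, 4), (1, 2), (1, 3), (1, 4), (2, 3), (2, 4), (3, 4)]"]
  by (simp add: upt_rec)

lemma degree_P3: "pieces G [A, B, C] \<Longrightarrow> A \<leftrightarrow> B \<Longrightarrow> B \<leftrightarrow> C \<Longrightarrow> \<not> A \<leftrightarrow> C \<Longrightarrow> d = 2"
  using degree[OF _ _ generator_P3, of "(!) [A, B, C]"] contraction_pieces[of G "[A, B, C]" 3 "[(0, 1), (1, 2)]"]
  by (simp add: upt_rec)

lemma degree_K4: "pieces G [A, B, C, D] \<Longrightarrow> A \<leftrightarrow> B \<Longrightarrow> A \<leftrightarrow> C \<Longrightarrow> A \<leftrightarrow> D \<Longrightarrow> B \<leftrightarrow> C \<Longrightarrow> B \<leftrightarrow> D \<Longrightarrow> C \<leftrightarrow> D \<Longrightarrow> d = 4"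
  using degree[OF _ _ generator_K4, of "(!) [A, B, C, D]"]
    contraction_pieces[of G "[A, B, C, D]" 4 "[(0, 1), (0, 2), (0, 3), (1, 2), (1, 3), (2, 3)]"]
  by (simp add: upt_rec)

text \<open>The sets \<open>A\<close> and \<open>C\<close> are the two full sides of the minimal separator \<open>B\<close>.\<close>

lemma obtain_separation:
  assumes u: "u \<in> V" and w: "w \<in> V" and uw: "u \<noteq> w" "{u, w} \<notin> snd G"
  obtains A M C B where "A \<union> M \<union> C = V" "A \<inter> M = {}" "A \<inter> C = {}" "M \<inter> C = {}"
    "gconn G A" "gconn G C" "A \<noteq> {}" "C \<noteq> {}" "M \<noteq> {}" "\<not> A \<leftrightarrow> C"
    "B \<subseteq> M" "\<And>x. x \<in> B \<Longrightarrow> {x} \<leftrightarrow> A \<and> {x} \<leftrightarrow> C" "\<not> (M - B) \<leftrightarrow> A" "\<not> (M - B) \<leftrightarrow> C"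
    "\<And>T. T \<subseteq> M \<Longrightarrow> T \<noteq> {} \<Longrightarrow> \<not> T \<leftrightarrow> (M - T) \<Longrightarrow> T \<inter> B \<noteq> {}"
proof -
  \<comment> \<open>\<open>C\<close> is the component of \<open>w\<close> away from \<open>u\<close>
    and its neighbours, and \<open>B\<close> consists of the vertices attached to it. All of
    \<open>B\<close> is adjacent to \<open>u\<close>; with \<open>A\<close> the component of
    \<open>u\<close> off \<open>B\<close>, each vertex of \<open>B\<close> sees both sides.\<close>
  define U where "U = V - insert u {x. {u, x} \<in> snd G}"
  have wU: "w \<in> U" using w uw by (simp add: U_def)
  define C where "C = comp G U w"
  have C: "C \<subseteq> U" "w \<in> C" "gconn G C" "\<not> C \<leftrightarrow> (U - C)"
    unfolding C_def by (rule comp_subset comp_self[OF wU] gconn_comp comp_closed[OF wU])+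
  define B where "B = {x \<in> V - C. {x} \<leftrightarrow> C}"
  have uC: "u \<notin> C" "\<not> {u} \<leftrightarrow> C" using C(1) by (auto simp: U_def joined_def)
  have Bu: "{u, x} \<in> snd G" if "x \<in> B" for x
  proof (rule ccontr)
    assume n: "{u, x} \<notin> snd G"
    have "x \<noteq> u" using that uC by (auto simp: B_def)
    hence "x \<in> U - C" using that n by (simp add: U_def B_def)
    moreover have "{x} \<leftrightarrow> C" using that by (simp add: B_def)
    ultimately have "(U - C) \<leftrightarrow> C" by (elim joined_mono) simp_all
    thus False using C(4) by (simp add: joined_commute)
  qed
  have uB: "u \<in> V - B" using u uC by (simp add: B_def)
  define A where "A = comp G (V - B) u"
  have A: "A \<subseteq> V - B" "u \<in> A" "gconn G A" "\<not> A \<leftrightarrow> (V - B - A)"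
    unfolding A_def by (rule comp_subset comp_self[OF uB] gconn_comp comp_closed[OF uB])+
  have out: "\<not> X \<leftrightarrow> C" if "X \<subseteq> V - C - B" for X
  proof
    assume "X \<leftrightarrow> C"
    then obtain x y where "x \<in> X" "y \<in> C" "{x, y} \<in> snd G" unfolding joined_def by blast
    moreover from this have "{x} \<leftrightarrow> C" unfolding joined_def by blast
    ultimately have "x \<in> B" using that unfolding B_def by blast
    thus False using that \<open>x \<in> X\<close> by blast
  qed
  have AC: "A \<inter> C = {}"
  proof (rule ccontr)
    assume "A \<inter> C \<noteq> {}"
    moreover have "\<not> (A \<inter> C) \<leftrightarrow> (A - A \<inter> C)"
    proof
      assume "(A \<inter> C) \<leftrightarrow> (A - A \<inter> C)"
      hence "(A - A \<inter> C) \<leftrightarrow> (A \<inter> C)" by (simp add: joined_commute)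
      hence "(A - C) \<leftrightarrow> C" by (elim joined_mono) auto
      moreover have "A - C \<subseteq> V - C - B" using A(1) by blast
      ultimately show False using out by blast
    qed
    ultimately have "A \<inter> C = A" using gconnD[OF A(3), of "A \<inter> C"] by blast
    thus False using A(2) uC by blast
  qed
  define M where "M = V - A - C"
  have CV: "C \<subseteq> V" using C(1) by (auto simp: U_def)
  have AV: "A \<subseteq> V" using A(1) by blast
  have BM: "B \<subseteq> M" using A(1) by (auto simp: B_def M_def)
  have jAC: "\<not> A \<leftrightarrow> C" using out[of A] A(1) AC by blast
  have MA: "\<not> (M - B) \<leftrightarrow> A"
  proof
    assume "(M - B) \<leftrightarrow> A"
    hence "A \<leftrightarrow> (M - B)" by (simp add: joined_commute)
    hence "A \<leftrightarrow> (V - B - A)" by (elim joined_mono) (auto simp: M_def)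
    thus False using A(4) by simp
  qed
  have MC: "\<not> (M - B) \<leftrightarrow> C" by (rule out) (auto simp: M_def)
  \<comment> \<open>A component of \<open>M\<close> is attached to the rest of the connected graph,
    and inside \<open>M\<close> only vertices of \<open>B\<close> have neighbours in
    \<open>A\<close> or \<open>C\<close>.\<close>
  have T: "T \<inter> B \<noteq> {}" if T: "T \<subseteq> M" "T \<noteq> {}" "\<not> T \<leftrightarrow> (M - T)" for T
  proof
    assume TB: "T \<inter> B = {}"
    have "T \<subseteq> V" "T \<noteq> V" using T(1) A(2) u by (auto simp: M_def)
    hence "T \<leftrightarrow> (V - T)" using gconnD[OF gconn_vertices[OF simple conn], of T] T(2) by blast
    moreover have "V - T \<subseteq> A \<union> C \<union> (M - T)" by (auto simp: M_def)
    ultimately have "T \<leftrightarrow> (A \<union> C \<union> (M - T))" using joined_mono by blast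
    hence "T \<leftrightarrow> A \<or> T \<leftrightarrow> C" using T(3) by (simp add: joined_Un)
    moreover have "T \<subseteq> M - B" using T(1) TB by blast
    ultimately show False using MA MC joined_mono by blast
  qed
  have Mne: "M \<noteq> {}"
  proof
    assume "M = {}"
    hence "V = A \<union> C" using AV CV by (auto simp: M_def)
    hence "V - A = C" using AC by blast
    thus False using gconnD[OF gconn_vertices[OF simple conn], of A] AV A(2) jAC C(2) AC CV by blast
  qed
  show ?thesis
  proof (rule that[of A M C B])
    show "A \<union> M \<union> C = V" "A \<inter> M = {}" "M \<inter> C = {}" using AV CV by (auto simp: M_def)
    show "{x} \<leftrightarrow> A \<and> {x} \<leftrightarrow> C" if "x \<in> B" for x
      using Bu[OF that] A(2) that joined_commute[of G "{x}" A] by (auto simp: B_def joined_def)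
  qed (use A C AC jAC BM MA MC T Mne in auto)
qed

end

section \<open>Existence of a cut vertex\<close>

context linear_type
begin

lemma pieces_4:
  assumes "A \<noteq> {}" "B \<noteq> {}" "C \<noteq> {}" "D \<noteq> {}" "gconn G A" "gconn G B" "gconn G C" "gconn G D"
    and "A \<inter> B = {}" "A \<inter> C = {}" "A \<inter> D = {}" "B \<inter> C = {}" "B \<inter> D = {}" "C \<inter> D = {}" "A \<union> B \<union> C \<union> D = V"
  shows "pieces G [A, B, C, D]"
  using assms by (simp add: pieces_def Un_assoc)

text \<open>Both ways for the middle set \<open>M\<close> to have more than one vertex are excluded:
  several components give a diamond or a 4-cycle, and a connected \<open>M\<close> splits into two
  halves that give a claw or a diamond.\<close>

lemma obtain_cut_vertex:
  assumes "u \<in> V" "w \<in> V" "u \<noteq> w" "{u, w} \<notin> snd G"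
  obtains A v C where "A \<union> {v} \<union> C = V" "v \<notin> A" "v \<notin> C" "A \<inter> C = {}"
    "gconn G A" "gconn G C" "A \<noteq> {}" "C \<noteq> {}" "\<not> A \<leftrightarrow> C" "{v} \<leftrightarrow> A" "{v} \<leftrightarrow> C"
proof -
  obtain A M C B where un: "A \<union> M \<union> C = V" and dis: "A \<inter> M = {}" "A \<inter> C = {}" "M \<inter> C = {}"
    and g: "gconn G A" "gconn G C" and ne: "A \<noteq> {}" "C \<noteq> {}" "M \<noteq> {}" and AC: "\<not> A \<leftrightarrow> C" and BM: "B \<subseteq> M"
    and B: "\<And>x. x \<in> B \<Longrightarrow> {x} \<leftrightarrow> A \<and> {x} \<leftrightarrow> C" and MA: "\<not> (M - B) \<leftrightarrow> A" and MC: "\<not> (M - B) \<leftrightarrow> C"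
    and T: "\<And>T. T \<subseteq> M \<Longrightarrow> T \<noteq> {} \<Longrightarrow> \<not> T \<leftrightarrow> (M - T) \<Longrightarrow> T \<inter> B \<noteq> {}"
    by (rule obtain_separation[OF assms]) (rule that)
  have meet: "T \<leftrightarrow> A" "T \<leftrightarrow> C" if "T \<inter> B \<noteq> {}" for T
  proof -
    obtain x where "x \<in> T" "x \<in> B" using \<open>T \<inter> B \<noteq> {}\<close> by blast
    thus "T \<leftrightarrow> A" "T \<leftrightarrow> C" using B[of x] joined_mono[of G "{x}" _ T] by auto
  qed
  have M_conn: "gconn G M"
  proof (rule ccontr)
    assume n: "\<not> gconn G M"
    obtain b where b: "b \<in> M" using ne by blast
    define M1 where "M1 = comp G M b"
    have M1: "M1 \<subseteq> M" "b \<in> M1" "gconn G M1" "\<not> M1 \<leftrightarrow> (M - M1)"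
      unfolding M1_def by (rule comp_subset comp_self[OF b] gconn_comp comp_closed[OF b])+
    have "M1 \<noteq> M" using n M1(3) by blast
    then obtain b' where b': "b' \<in> M" "b' \<notin> M1" using M1(1) by blast
    define M2 where "M2 = comp G M b'"
    have M2: "M2 \<subseteq> M" "b' \<in> M2" "gconn G M2" "\<not> M2 \<leftrightarrow> (M - M2)"
      unfolding M2_def by (rule comp_subset comp_self[OF b'(1)] gconn_comp comp_closed[OF b'(1)])+
    have M12: "M1 \<inter> M2 = {}"
      using gconn_meets[OF M2(3) M2(1) M1(1) M1(4)] M2(2) b'(2) by blast
    define R where "R = M - M1 - M2"
    have nj: "\<not> M1 \<leftrightarrow> M2" "\<not> M1 \<leftrightarrow> R" "\<not> M2 \<leftrightarrow> R"
    proof -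
      have "M2 \<subseteq> M - M1" "R \<subseteq> M - M1" "R \<subseteq> M - M2" using M12 M2(1) by (auto simp: R_def)
      thus "\<not> M1 \<leftrightarrow> M2" "\<not> M1 \<leftrightarrow> R" "\<not> M2 \<leftrightarrow> R" using M1(4) M2(4) joined_mono by blast+
    qed
    have R_closed: "\<not> X \<leftrightarrow> (M - X)" if X: "X \<subseteq> R" "\<not> X \<leftrightarrow> (R - X)" for X
    proof
      assume "X \<leftrightarrow> (M - X)"
      moreover have "M - X \<subseteq> (R - X) \<union> M1 \<union> M2" by (auto simp: R_def)
      ultimately have "X \<leftrightarrow> ((R - X) \<union> M1 \<union> M2)" using joined_mono by blast
      hence "X \<leftrightarrow> M1 \<or> X \<leftrightarrow> M2" using X(2) by (simp add: joined_Un)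
      hence "M1 \<leftrightarrow> R \<or> M2 \<leftrightarrow> R" using X(1) joined_commute[of G X] joined_mono[of G _ X _ R] by blast
      thus False using nj by blast
    qed
    have hitA: "X \<leftrightarrow> A" if X: "X \<subseteq> R" "X \<noteq> {}" "\<not> X \<leftrightarrow> (R - X)" for X
      using T[of X] X R_closed[of X] meet(1)[of X] by (auto simp: R_def)
    \<comment> \<open>The remaining components of \<open>M\<close> are absorbed into
      \<open>A\<close>; each of them meets \<open>B\<close> and hence is joined to
      \<open>A\<close>.\<close>
    define A' where "A' = A \<union> R"
    have "gconn G A'"
    proof (rule gconnI)
      fix X assume X: "X \<subseteq> A'" "X \<noteq> {}" "\<not> X \<leftrightarrow> (A' - X)"
      have AX: "A \<inter> X \<noteq> {} \<Longrightarrow> A \<subseteq> X" using gconn_meets[OF g(1) _ X(1,3)] by (simp add: A'_def)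
      have XA: "A' - X \<subseteq> R \<Longrightarrow> A' - X = R - X" by (auto simp: A'_def)
      show "X = A'"
      proof (rule ccontr)
        assume XA': "X \<noteq> A'"
        consider "A \<subseteq> X" | "A \<inter> X = {}" using AX by blast
        thus False
        proof cases
          case 1
          let ?Y = "A' - X"
          have Y: "?Y \<subseteq> R" "?Y \<noteq> {}" using 1 X(1) XA' by (auto simp: A'_def)
          have "\<not> ?Y \<leftrightarrow> X" using X(3) by (simp add: joined_commute)
          moreover have "R - ?Y \<subseteq> X" by (auto simp: A'_def)
          ultimately have "\<not> ?Y \<leftrightarrow> (R - ?Y)" "\<not> ?Y \<leftrightarrow> A" using joined_mono 1 by blast+
          thus False using hitA[OF Y] by blast
        next
          case 2
          have XR: "X \<subseteq> R" using 2 X(1) by (auto simp: A'_def)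
          have "R - X \<subseteq> A' - X" "A \<subseteq> A' - X" using 2 by (auto simp: A'_def)
          hence "\<not> X \<leftrightarrow> (R - X)" "\<not> X \<leftrightarrow> A" using X(3) joined_mono by blast+
          thus False using hitA[OF XR X(2)] by blast
        qed
      qed
    qed
    have hit: "M1 \<inter> B \<noteq> {}" "M2 \<inter> B \<noteq> {}" using T[OF M1(1) _ M1(4)] T[OF M2(1) _ M2(4)] M1(2) M2(2) by blast+
    have j: "M1 \<leftrightarrow> A'" "M2 \<leftrightarrow> A'" "M1 \<leftrightarrow> C" "M2 \<leftrightarrow> C"
      using meet[OF hit(1)] meet[OF hit(2)] by (simp_all add: A'_def joined_Un)
    have un': "A' \<union> M1 \<union> M2 \<union> C = V" using un M1(1) M2(1) by (auto simp: A'_def R_def)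
    have dis': "A' \<inter> M1 = {}" "A' \<inter> M2 = {}" "A' \<inter> C = {}" "M1 \<inter> C = {}" "M2 \<inter> C = {}"
      using dis M1(1) M2(1) by (auto simp: A'_def R_def)
    have ne': "A' \<noteq> {}" "M1 \<noteq> {}" "M2 \<noteq> {}" using ne M1(2) M2(2) by (auto simp: A'_def)
    show False
    \<comment> \<open>Two unjoined components of \<open>M\<close>, each joined to both sides: a
      diamond if the sides have become joined, a 4-cycle otherwise.\<close>
    proof (cases "A' \<leftrightarrow> C")
      case True
      have "pieces G [M1, A', C, M2]"
        by (rule pieces_4) (use un' dis' M12 M1(3) M2(3) g ne ne' \<open>gconn G A'\<close> in \<open>simp_all add: Int_commute Un_ac\<close>)
      thus False using no_diamond[of M1 A' C M2] True j nj joined_commute by metis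
    next
      case False
      have "pieces G [A', M1, C, M2]"
        by (rule pieces_4) (use un' dis' M12 M1(3) M2(3) g ne ne' \<open>gconn G A'\<close> in \<open>simp_all add: Int_commute Un_ac\<close>)
      thus False using no_C4[of A' M1 C M2] False j nj joined_commute by metis
    qed
  qed
  obtain v where v: "v \<in> B" using T[of M] ne by (auto simp: joined_def)
  have vM: "v \<in> M" using v BM by blast
  have M_sub: "b = v" if b: "b \<in> M" for b
  proof (rule ccontr)
    assume bv: "b \<noteq> v"
    obtain P Q where PQ: "P \<union> Q = M" "P \<inter> Q = {}" "gconn G P" "gconn G Q" "v \<in> P" "b \<in> Q" "P \<leftrightarrow> Q"
      using gconn_split[OF M_conn vM b] bv by metis
    have P: "P \<leftrightarrow> A" "P \<leftrightarrow> C" using meet[of P] v PQ by blast+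
    have dis': "P \<inter> A = {}" "P \<inter> C = {}" "Q \<inter> A = {}" "Q \<inter> C = {}" using dis PQ(1) by blast+
    have un': "A \<union> P \<union> Q \<union> C = V" using un PQ(1) by blast
    have ne': "P \<noteq> {}" "Q \<noteq> {}" using PQ by blast+
    have AP: "A \<leftrightarrow> P" using P joined_commute by blast
    show False
    \<comment> \<open>\<open>P\<close> contains \<open>v\<close> and touches both sides. If
      \<open>Q\<close> touches neither, \<open>P\<close> is the centre of a claw; if it touches
      both, there is a diamond whose unjoined ends are \<open>A\<close> and
      \<open>C\<close>.\<close>
    proof (cases "Q \<inter> B = {}")
      case True
      have "Q \<subseteq> M - B" using True PQ(1) by blast
      hence Q: "\<not> Q \<leftrightarrow> A" "\<not> Q \<leftrightarrow> C" using MA MC joined_mono by blast+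
      have "pieces G [P, Q, A, C]"
        by (rule pieces_4) (use un' dis' dis(2) PQ(2-4) g ne ne' in \<open>simp_all add: Int_commute Un_ac\<close>)
      thus False using no_K13[of P Q A C] P Q AC PQ(7) by blast
    next
      case False
      have Q: "A \<leftrightarrow> Q" "Q \<leftrightarrow> C" using meet[OF False] joined_commute by blast+
      have "pieces G [A, P, Q, C]"
        by (rule pieces_4) (use un' dis' dis(2) PQ(2-4) g ne ne' in \<open>simp_all add: Int_commute Un_ac\<close>)
      thus False using no_diamond[of A P Q C] AP P Q AC PQ(7) by blast
    qed
  qed
  hence M: "M = {v}" using vM by blast
  show ?thesis
    by (rule that[of A v C]) (use un dis g ne AC B[OF v] in \<open>auto simp: M\<close>)
qed

end

section \<open>The two sides of a cut vertex\<close>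

context linear_type
begin

definition cut_vertex :: "'v set \<Rightarrow> 'v \<Rightarrow> 'v set \<Rightarrow> bool" where
  "cut_vertex A v C \<longleftrightarrow> A \<union> {v} \<union> C = V \<and> v \<notin> A \<and> v \<notin> C \<and> A \<inter> C = {} \<and> gconn G A \<and> gconn G C \<and>
     A \<noteq> {} \<and> C \<noteq> {} \<and> \<not> A \<leftrightarrow> C \<and> {v} \<leftrightarrow> A \<and> {v} \<leftrightarrow> C"

lemma cut_vertex_commute: "cut_vertex A v C \<Longrightarrow> cut_vertex C v A"
  unfolding cut_vertex_def using joined_commute[of G A C] by (simp add: Un_ac Int_commute)

text \<open>If \<open>v\<close> did not reach \<open>Q\<close>, then \<open>C\<close>,
  \<open>v\<close>, \<open>P\<close>, \<open>Q\<close> would form a path of four pieces.\<close>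

lemma cut_vertex_split:
  assumes cv: "cut_vertex A v C" and PQ: "P \<union> Q = A" "P \<inter> Q = {}" "gconn G P" "gconn G Q" "P \<noteq> {}" "Q \<noteq> {}"
  shows "{v} \<leftrightarrow> Q" "P \<leftrightarrow> Q"
proof -
  have A: "A \<union> {v} \<union> C = V" "v \<notin> A" "v \<notin> C" "A \<inter> C = {}" "gconn G A" "gconn G C" "C \<noteq> {}" "\<not> A \<leftrightarrow> C" "{v} \<leftrightarrow> A" "{v} \<leftrightarrow> C"
    using cv by (simp_all add: cut_vertex_def)
  have "A - P = Q" "P \<noteq> A" "P \<subseteq> A" using PQ by auto
  thus pq: "P \<leftrightarrow> Q" using gconnD[OF A(5), of P] PQ(5) by auto
  show "{v} \<leftrightarrow> Q"
  proof (rule ccontr)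
    assume n: "\<not> {v} \<leftrightarrow> Q"
    have "{v} \<leftrightarrow> P" using A(9) n unfolding PQ(1)[symmetric] by (simp add: joined_Un)
    moreover have "\<not> C \<leftrightarrow> P" "\<not> C \<leftrightarrow> Q" using A(8) unfolding PQ(1)[symmetric] by (simp_all add: joined_Un joined_commute)
    moreover have "C \<leftrightarrow> {v}" using A(10) by (simp add: joined_commute)
    moreover have "C \<inter> P = {}" "C \<inter> Q = {}" "v \<notin> P" "v \<notin> Q" "C \<union> {v} \<union> P \<union> Q = V" using A(1,2,4) PQ(1) by auto
    hence "pieces G [C, {v}, P, Q]"
      by (intro pieces_4) (use A PQ gconn_singleton[of G v] in auto)
    ultimately show False using no_P4[of C "{v}" P Q] pq n by blast
  qed
qed

lemma cut_vertex_degree: "cut_vertex A v C \<Longrightarrow> d = 2"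
proof -
  assume cv: "cut_vertex A v C"
  hence "pieces G [A, {v}, C]" unfolding cut_vertex_def pieces_def using gconn_singleton[of G v] by (simp add: Un_ac)
  moreover have "A \<leftrightarrow> {v}" "{v} \<leftrightarrow> C" "\<not> A \<leftrightarrow> C" using cv by (simp_all add: cut_vertex_def joined_commute)
  ultimately show ?thesis using degree_P3 by blast
qed

text \<open>Merge \<open>v\<close> and \<open>C\<close> into one piece \<open>W\<close>, which is
  joined to \<open>Q\<close> and to \<open>R\<close> by \<open>cut_vertex_split\<close>. If
  \<open>Q\<close> and \<open>R\<close> are unjoined, the four pieces form a diamond or a 4-cycle.
  Otherwise they form \<open>K\<^sub>4\<close>, whose degree 4 contradicts the degree 2 forced by a
  cut vertex.\<close>

lemma cut_vertex_three:
  assumes cv: "cut_vertex A v C" and O: "K \<union> Q \<union> R = A" "K \<inter> Q = {}" "K \<inter> R = {}" "Q \<inter> R = {}"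
    "gconn G K" "gconn G Q" "gconn G R" "K \<noteq> {}" "Q \<noteq> {}" "R \<noteq> {}" "K \<leftrightarrow> Q" "K \<leftrightarrow> R"
  shows False
proof -
  have A: "A \<union> {v} \<union> C = V" "v \<notin> A" "v \<notin> C" "A \<inter> C = {}" "gconn G A" "gconn G C" "C \<noteq> {}" "\<not> A \<leftrightarrow> C" "{v} \<leftrightarrow> A" "{v} \<leftrightarrow> C"
    using cv by (simp_all add: cut_vertex_def)
  define W where "W = insert v C"
  have W: "gconn G W" using gconn_Un[OF gconn_singleton A(6), of v] A(10) by (simp add: W_def)
  have vW: "W \<leftrightarrow> X" if "{v} \<leftrightarrow> X" for X using joined_mono[OF that, of W X] by (simp add: W_def)
  have KQ: "gconn G (K \<union> Q)" "gconn G (K \<union> R)" using gconn_Un O by blast+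
  have R: "W \<leftrightarrow> R" by (rule vW, rule cut_vertex_split(1)[OF cv, of "K \<union> Q"]) (use O KQ in auto)
  have Q: "W \<leftrightarrow> Q" by (rule vW, rule cut_vertex_split(1)[OF cv, of "K \<union> R"]) (use O KQ in auto)
  have dis: "W \<inter> K = {}" "W \<inter> Q = {}" "W \<inter> R = {}" "W \<noteq> {}" using A(2,4) O(1) by (auto simp: W_def)
  have un: "W \<union> K \<union> Q \<union> R = V" using A(1) O(1) by (auto simp: W_def)
  have comm: "Q \<leftrightarrow> W" "K \<leftrightarrow> W \<longleftrightarrow> W \<leftrightarrow> K" "R \<leftrightarrow> Q \<longleftrightarrow> Q \<leftrightarrow> R" "Q \<leftrightarrow> K" "R \<leftrightarrow> K" using Q O(11,12) joined_commute by blast+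
  show False
  proof (cases "Q \<leftrightarrow> R")
    case True
    have "gconn G (Q \<union> R)" using gconn_Un O(6,7) True by blast
    hence "W \<leftrightarrow> K" by (intro vW, intro cut_vertex_split(1)[OF cv, of "Q \<union> R"]) (use O in auto)
    moreover have "pieces G [W, K, Q, R]" by (rule pieces_4) (use dis un O W in simp_all)
    ultimately have "d = 4" using degree_K4[of W K Q R] Q R O(11,12) True by blast
    thus False using cut_vertex_degree[OF cv] by simp
  next
    case QR: False
    show False
    proof (cases "W \<leftrightarrow> K")
      case True
      have "pieces G [Q, W, K, R]" by (rule pieces_4) (use dis un O W in \<open>simp_all add: Int_commute Un_ac\<close>)
      thus False using no_diamond[of Q W K R] comm Q R O(12) True QR by blast
    next
      case False
      have "pieces G [W, Q, K, R]" by (rule pieces_4) (use dis un O W in \<open>simp_all add: Int_commute Un_ac\<close>)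
      thus False using no_C4[of W Q K R] comm Q R O(12) False QR by blast
    qed
  qed
qed

text \<open>A further split of \<open>P\<close> would leave three pieces one of which is joined to
  the other two, against \<open>cut_vertex_three\<close>.\<close>

lemma cut_vertex_split_singleton:
  assumes cv: "cut_vertex A v C" and PQ: "P \<union> Q = A" "P \<inter> Q = {}" "gconn G P" "gconn G Q" "P \<noteq> {}" "Q \<noteq> {}" "P \<leftrightarrow> Q"
    and p: "p \<in> P" "p' \<in> P"
  shows "p = p'"
proof (rule ccontr)
  assume "p \<noteq> p'"
  then obtain K R where KR: "K \<union> R = P" "K \<inter> R = {}" "gconn G K" "gconn G R" "p \<in> K" "p' \<in> R" "K \<leftrightarrow> R"
    using gconn_split[OF PQ(3) p] by metis
  have "K \<leftrightarrow> Q \<or> R \<leftrightarrow> Q" using PQ(7) KR(1) by (metis joined_Un(1))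
  thus False
  proof
    assume "K \<leftrightarrow> Q"
    thus False by (intro cut_vertex_three[OF cv, of K Q R]) (use KR PQ in auto)
  next
    assume "R \<leftrightarrow> Q"
    moreover have "R \<leftrightarrow> K" using KR(7) by (simp add: joined_commute)
    ultimately show False by (intro cut_vertex_three[OF cv, of R Q K]) (use KR PQ in auto)
  qed
qed

lemma cut_vertex_side:
  assumes cv: "cut_vertex A v C"
  obtains a where "A = {a}" "{v, a} \<in> snd G"
    | a b where "A = {a, b}" "a \<noteq> b" "{a, b} \<in> snd G" "{v, a} \<in> snd G" "{v, b} \<in> snd G"
proof -
  have A: "gconn G A" "A \<noteq> {}" "{v} \<leftrightarrow> A" using cv by (simp_all add: cut_vertex_def)
  obtain a where a: "a \<in> A" using A by blast
  show ?thesis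
  proof (cases "A = {a}")
    case True thus ?thesis using that(1) A(3) by (simp add: joined_singletons)
  next
    case False
    then obtain b where b: "b \<in> A" "a \<noteq> b" using a by blast
    obtain P Q where PQ: "P \<union> Q = A" "P \<inter> Q = {}" "gconn G P" "gconn G Q" "a \<in> P" "b \<in> Q" "P \<leftrightarrow> Q"
      using gconn_split[OF A(1) a b] by metis
    have ne: "P \<noteq> {}" "Q \<noteq> {}" using PQ by blast+
    have QP: "Q \<union> P = A" "Q \<inter> P = {}" "Q \<leftrightarrow> P" using PQ by (simp_all add: Un_commute Int_commute joined_commute)
    have P: "P = {a}" using cut_vertex_split_singleton[OF cv PQ(1-4) ne PQ(7)] PQ(5) by blast
    have Q: "Q = {b}" using cut_vertex_split_singleton[OF cv QP(1,2) PQ(4,3) ne(2,1) QP(3)] PQ(6) by blast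
    have "{v} \<leftrightarrow> Q" "{v} \<leftrightarrow> P"
      using cut_vertex_split(1)[OF cv PQ(1-4) ne] cut_vertex_split(1)[OF cv QP(1,2) PQ(4,3) ne(2,1)] .
    thus ?thesis using that(2)[of a b] PQ(1,7) b(2) unfolding P Q by (simp add: joined_singletons insert_commute)
  qed
qed

definition is_P3 :: "'v \<Rightarrow> 'v \<Rightarrow> 'v \<Rightarrow> bool" where
  "is_P3 a b c \<longleftrightarrow> V = {a, b, c} \<and> distinct [a, b, c] \<and> snd G = {{a, b}, {b, c}}"

definition is_paw :: "'v \<Rightarrow> 'v \<Rightarrow> 'v \<Rightarrow> 'v \<Rightarrow> bool" where
  "is_paw a b c e \<longleftrightarrow> V = {a, b, c, e} \<and> distinct [a, b, c, e] \<and> snd G = {{a, b}, {a, c}, {b, c}, {c, e}}"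

lemma edges_eqI:
  assumes "F \<subseteq> snd G" "\<And>x y. x \<in> V \<Longrightarrow> y \<in> V \<Longrightarrow> x \<noteq> y \<Longrightarrow> {x, y} \<in> snd G \<Longrightarrow> {x, y} \<in> F"
  shows "snd G = F"
  using assms edge_cases[OF simple] by (metis subsetI subset_antisym)

lemma paw_of_cut_vertex:
  assumes cv: "cut_vertex {a, b} v {c}" and ab: "a \<noteq> b" "{a, b} \<in> snd G" "{v, a} \<in> snd G" "{v, b} \<in> snd G" and c: "{v, c} \<in> snd G"
  shows "is_paw a b v c"
proof -
  have A: "{a, b} \<union> {v} \<union> {c} = V" "v \<noteq> a" "v \<noteq> b" "v \<noteq> c" "c \<noteq> a" "c \<noteq> b" "\<not> {a, b} \<leftrightarrow> {c}"
    using cv by (auto simp: cut_vertex_def)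
  have n: "{a, c} \<notin> snd G" "{b, c} \<notin> snd G" "{c, a} \<notin> snd G" "{c, b} \<notin> snd G"
    using A(7) joined_singletons[of G] by (auto simp: joined_def insert_commute)
  have "snd G = {{a, b}, {a, v}, {b, v}, {v, c}}"
  proof (rule edges_eqI)
    show "{{a, b}, {a, v}, {b, v}, {v, c}} \<subseteq> snd G" using ab c by (simp add: insert_commute)
    fix x y assume xy: "x \<in> V" "y \<in> V" "x \<noteq> y" "{x, y} \<in> snd G"
    have "x = a \<or> x = b \<or> x = v \<or> x = c" "y = a \<or> y = b \<or> y = v \<or> y = c" using xy(1,2) A(1) by blast+
    thus "{x, y} \<in> {{a, b}, {a, v}, {b, v}, {v, c}}"
      using xy(3,4) n by (elim disjE) (simp_all add: insert_commute)
  qed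
  thus ?thesis using A ab(1) unfolding is_paw_def by auto
qed

text \<open>A side of the cut vertex \<open>v\<close> is one vertex, or two adjacent ones, all
  adjacent to \<open>v\<close>. The combinations are the path, twice the triangle with a pendant
  edge, and two triangles with a common vertex, of which the last is excluded.\<close>

lemma noncomplete_classification:
  assumes "u \<in> V" "w \<in> V" "u \<noteq> w" "{u, w} \<notin> snd G"
  shows "(\<exists>a b c. is_P3 a b c) \<or> (\<exists>a b c e. is_paw a b c e)"
proof -
  obtain A v C where cv: "cut_vertex A v C"
    using obtain_cut_vertex[OF assms] unfolding cut_vertex_def by metis
  note vc = cut_vertex_commute[OF cv]
  have A: "A \<union> {v} \<union> C = V" "v \<notin> A" "v \<notin> C" "A \<inter> C = {}" "\<not> A \<leftrightarrow> C" using cv by (simp_all add: cut_vertex_def)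
  consider a where "A = {a}" "{v, a} \<in> snd G"
    | a b where "A = {a, b}" "a \<noteq> b" "{a, b} \<in> snd G" "{v, a} \<in> snd G" "{v, b} \<in> snd G"
    by (rule cut_vertex_side[OF cv])
  thus ?thesis
  proof cases
    case a: 1
    consider c where "C = {c}" "{v, c} \<in> snd G"
      | c e where "C = {c, e}" "c \<noteq> e" "{c, e} \<in> snd G" "{v, c} \<in> snd G" "{v, e} \<in> snd G"
      by (rule cut_vertex_side[OF vc])
    thus ?thesis
    proof cases
      case c: 1
      have ne: "a \<noteq> v" "v \<noteq> c" "a \<noteq> c" "{a, c} \<notin> snd G" "{c, a} \<notin> snd G"
        using A a c by (auto simp: joined_singletons insert_commute)
      have "snd G = {{a, v}, {v, c}}"
      proof (rule edges_eqI)
        show "{{a, v}, {v, c}} \<subseteq> snd G" using a c by (simp add: insert_commute)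
        fix x y assume xy: "x \<in> V" "y \<in> V" "x \<noteq> y" "{x, y} \<in> snd G"
        have "x = a \<or> x = v \<or> x = c" "y = a \<or> y = v \<or> y = c" using xy(1,2) A(1) a c by blast+
        thus "{x, y} \<in> {{a, v}, {v, c}}" using xy(3,4) ne by (elim disjE) (simp_all add: insert_commute)
      qed
      hence "is_P3 a v c" using A(1) a c ne unfolding is_P3_def by auto
      thus ?thesis by blast
    next
      case c: 2
      show ?thesis using paw_of_cut_vertex[of c e v a] vc a c by blast
    qed
  next
    case a: 2
    consider c where "C = {c}" "{v, c} \<in> snd G"
      | c e where "C = {c, e}" "c \<noteq> e" "{c, e} \<in> snd G" "{v, c} \<in> snd G" "{v, e} \<in> snd G"
      by (rule cut_vertex_side[OF vc])
    thus ?thesis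
    proof cases
      case c: 1
      show ?thesis using paw_of_cut_vertex[of a b v c] cv a c by blast
    next
      case c: 2
      have n: "\<not> {a} \<leftrightarrow> {c}" "\<not> {a} \<leftrightarrow> {e}" "\<not> {b} \<leftrightarrow> {c}" "\<not> {b} \<leftrightarrow> {e}"
        using A(5) joined_mono[of G _ _ A C] a(1) c(1) by blast+
      have "pieces G [{v}, {a}, {b}, {c}, {e}]"
        using A(1-4) a(1,2) c(1,2) gconn_singleton[of G v] gconn_singleton[of G a] gconn_singleton[of G b] gconn_singleton[of G c] gconn_singleton[of G e]
        unfolding pieces_def by auto
      thus ?thesis using no_butterfly[of "{v}" "{a}" "{b}" "{c}" "{e}"] n a c by (simp add: joined_singletons)
    qed
  qed
qed

text \<open>Four single vertices and the set of all others would form a contraction to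
  \<open>K\<^sub>5\<close>.\<close>

lemma complete_card:
  assumes complete: "\<And>u w. u \<in> V \<Longrightarrow> w \<in> V \<Longrightarrow> u \<noteq> w \<Longrightarrow> {u, w} \<in> snd G"
  shows "card V \<le> 4"
proof (rule ccontr)
  assume "\<not> card V \<le> 4"
  then obtain W where W: "W \<subseteq> V" "card W = 4" "finite W" using obtain_subset_with_card_n[of 4 V] by auto
  obtain vs where vs: "set vs = W" "distinct vs" using finite_distinct_list[OF W(3)] by blast
  hence "length vs = 4" using W distinct_card by fastforce
  then obtain a b c e where "vs = [a, b, c, e]" by (auto simp: numeral_eq_Suc length_Suc_conv)
  hence We: "W = {a, b, c, e}" "distinct [a, b, c, e]" using vs by auto
  define R where "R = V - W"
  have "R \<noteq> {}" using W \<open>\<not> card V \<le> 4\<close> by (auto simp: R_def)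
  have R: "R \<subseteq> V" "a \<notin> R" "b \<notin> R" "c \<notin> R" "e \<notin> R" by (auto simp: R_def We)
  have j: "T \<leftrightarrow> T'" if T: "T \<subseteq> V" "T' \<subseteq> V" "T \<inter> T' = {}" "T \<noteq> {}" "T' \<noteq> {}" for T T'
  proof -
    obtain x y where "x \<in> T" "y \<in> T'" using T by blast
    moreover from this have "{x, y} \<in> snd G" using complete[of x y] T by blast
    ultimately show ?thesis unfolding joined_def by blast
  qed
  have "gconn G R"
  proof (rule gconnI)
    fix T assume T: "T \<subseteq> R" "T \<noteq> {}" "\<not> T \<leftrightarrow> (R - T)"
    show "T = R" using j[of T "R - T"] T R(1) by blast
  qed
  have inV: "a \<in> V" "b \<in> V" "c \<in> V" "e \<in> V" using W(1) We by auto
  have un: "{a} \<union> ({b} \<union> ({c} \<union> ({e} \<union> R))) = V" using W(1) We by (auto simp: R_def)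
  have "pieces G [{a}, {b}, {c}, {e}, R]"
    using un \<open>R \<noteq> {}\<close> \<open>gconn G R\<close> We(2) R gconn_singleton[of G a] gconn_singleton[of G b] gconn_singleton[of G c] gconn_singleton[of G e]
    unfolding pieces_def by simp
  thus False
    by (rule no_K5) (rule j; use inV We(2) R \<open>R \<noteq> {}\<close> in simp)+
qed

end

section \<open>Isomorphisms with the three graphs\<close>

lemma isomorphic_graphsE:
  assumes "simple_graph G" "isomorphic_graphs G H"
  obtains g where "bij_betw g (fst H) (fst G)" "snd G = (\<lambda>e. g ` e) ` snd H"
proof -
  obtain f where f: "bij_betw f (fst G) (fst H)" "(\<lambda>e. f ` e) ` snd G = snd H"
    using assms(2) unfolding isomorphic_graphs_def by blast
  have inj: "inj_on f (fst G)" using f(1) by (rule bij_betw_imp_inj_on)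
  have "inv_into (fst G) f ` f ` e = e" if "e \<in> snd G" for e
    using inv_into_image_cancel[OF inj, of e] assms(1) that by (auto simp: simple_graph_def)
  hence "(\<lambda>e. inv_into (fst G) f ` e) ` snd H = snd G" unfolding f(2)[symmetric] by (simp add: image_image)
  thus ?thesis using that[OF bij_betw_inv_into[OF f(1)]] by simp
qed

lemma path_graph_3: "path_graph 3 = ({0, 1, 2}, {{0, 1}, {1, 2}})"
proof -
  have "{{i, Suc i} | i. Suc i < 3} = {{0, 1}, {1, 2}}"
  proof -
    have "Suc i < 3 \<longleftrightarrow> i = 0 \<or> i = 1" for i by auto
    thus ?thesis by (auto simp: numeral_2_eq_2)
  qed
  moreover have "{..<3} = {0, 1, 2 :: nat}" by auto
  ultimately show ?thesis by (simp add: path_graph_def)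
qed

lemma isomorphic_path_graph_3:
  fixes G :: "'v graph"
  assumes "simple_graph G"
  shows "isomorphic_graphs G (path_graph 3) \<longleftrightarrow>
    (\<exists>a b c. fst G = {a, b, c} \<and> distinct [a, b, c] \<and> snd G = {{a, b}, {b, c}})"
proof
  assume "isomorphic_graphs G (path_graph 3)"
  then obtain g where g: "bij_betw g {0, 1, 2 :: nat} (fst G)" "snd G = (\<lambda>e. g ` e) ` {{0, 1}, {1, 2}}"
    using isomorphic_graphsE[OF assms, of "path_graph 3"] unfolding path_graph_3 by auto
  have "fst G = {g 0, g 1, g 2}" using bij_betw_imp_surj_on[OF g(1)] by auto
  moreover have "distinct [g 0, g 1, g 2]" using bij_betw_imp_inj_on[OF g(1)] by (simp add: inj_on_def)
  moreover have "snd G = {{g 0, g 1}, {g 1, g 2}}" using g(2) by simp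
  ultimately show "\<exists>a b c. fst G = {a, b, c} \<and> distinct [a, b, c] \<and> snd G = {{a, b}, {b, c}}" by blast
next
  assume "\<exists>a b c. fst G = {a, b, c} \<and> distinct [a, b, c] \<and> snd G = {{a, b}, {b, c}}"
  then obtain a b c where G: "fst G = {a, b, c}" "distinct [a, b, c]" "snd G = {{a, b}, {b, c}}" by blast
  let ?f = "\<lambda>x. if x = a then 0 else if x = b then 1 else 2 :: nat"
  have "bij_betw ?f (fst G) {0, 1, 2}" using G(2) unfolding G(1) bij_betw_def inj_on_def by auto
  moreover have "b \<noteq> a" "c \<noteq> a" "c \<noteq> b" using G(2) by auto
  hence "(\<lambda>e. ?f ` e) ` snd G = {{0, 1}, {1, 2}}" unfolding G(3) by (simp add: insert_commute)
  ultimately show "isomorphic_graphs G (path_graph 3)"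
    unfolding isomorphic_graphs_def path_graph_3 fst_conv snd_conv by blast
qed

lemma isomorphic_K2_glued_K3:
  fixes G :: "'v graph"
  assumes "simple_graph G"
  shows "isomorphic_graphs G K2_glued_K3 \<longleftrightarrow>
    (\<exists>a b c d. fst G = {a, b, c, d} \<and> distinct [a, b, c, d] \<and> snd G = {{a, b}, {a, c}, {b, c}, {c, d}})"
proof
  assume "isomorphic_graphs G K2_glued_K3"
  then obtain g where g: "bij_betw g {0, 1, 2, 3 :: nat} (fst G)" "snd G = (\<lambda>e. g ` e) ` ({{0, 1}, {0, 2}, {1, 2}} \<union> {{2, 3}})"
    using isomorphic_graphsE[OF assms, of K2_glued_K3] unfolding K2_glued_K3_def by auto
  have "fst G = {g 0, g 1, g 2, g 3}" using bij_betw_imp_surj_on[OF g(1)] by auto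
  moreover have "distinct [g 0, g 1, g 2, g 3]" using bij_betw_imp_inj_on[OF g(1)] by (simp add: inj_on_def)
  moreover have "snd G = {{g 0, g 1}, {g 0, g 2}, {g 1, g 2}, {g 2, g 3}}" using g(2) by (simp add: insert_commute)
  ultimately show "\<exists>a b c d. fst G = {a, b, c, d} \<and> distinct [a, b, c, d] \<and> snd G = {{a, b}, {a, c}, {b, c}, {c, d}}" by blast
next
  assume "\<exists>a b c d. fst G = {a, b, c, d} \<and> distinct [a, b, c, d] \<and> snd G = {{a, b}, {a, c}, {b, c}, {c, d}}"
  then obtain a b c d where "fst G = {a, b, c, d} \<and> distinct [a, b, c, d] \<and> snd G = {{a, b}, {a, c}, {b, c}, {c, d}}"
    by (elim exE)
  hence G: "fst G = {a, b, c, d}" "distinct [a, b, c, d]" "snd G = {{a, b}, {a, c}, {b, c}, {c, d}}" by simp_all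
  let ?f = "\<lambda>x. if x = a then 0 else if x = b then 1 else if x = c then 2 else 3 :: nat"
  have ne: "b \<noteq> a" "c \<noteq> a" "c \<noteq> b" "d \<noteq> a" "d \<noteq> b" "d \<noteq> c" using G(2) by auto
  have im: "?f ` fst G = {0, 1, 2, 3}" unfolding G(1) using ne by (simp add: insert_commute)
  have "card (fst G) = 4" unfolding G(1) using G(2) by simp
  hence "inj_on ?f (fst G)" using im G(1) by (intro eq_card_imp_inj_on) simp_all
  hence "bij_betw ?f (fst G) {0, 1, 2, 3}" unfolding bij_betw_def using im by blast
  moreover from ne have "(\<lambda>e. ?f ` e) ` snd G = {{0, 1}, {0, 2}, {1, 2}} \<union> {{2, 3}}" unfolding G(3) by (simp add: insert_commute)
  ultimately show "isomorphic_graphs G K2_glued_K3"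
    unfolding isomorphic_graphs_def K2_glued_K3_def fst_conv snd_conv by blast
qed

lemma image_two_subsets:
  assumes "inj_on f A"
  shows "(\<lambda>e. f ` e) ` {e. e \<subseteq> A \<and> card e = 2} = {e. e \<subseteq> f ` A \<and> card e = 2}"
proof (intro equalityI subsetI)
  fix e assume "e \<in> {e. e \<subseteq> f ` A \<and> card e = 2}"
  then obtain K where K: "K \<subseteq> A" "e = f ` K" "card e = 2" by (auto elim: subset_imageE)
  hence "card K = 2" using card_image[OF inj_on_subset[OF assms K(1)]] by simp
  thus "e \<in> (\<lambda>e. f ` e) ` {e. e \<subseteq> A \<and> card e = 2}" using K by blast
qed (use card_image[OF inj_on_subset[OF assms]] in auto)

lemma isomorphic_complete_graph:
  fixes G :: "'v graph"
  assumes "simple_graph G"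
  shows "isomorphic_graphs G (complete_graph n) \<longleftrightarrow> card (fst G) = n \<and> snd G = {e. e \<subseteq> fst G \<and> card e = 2}"
proof
  assume "isomorphic_graphs G (complete_graph n)"
  then obtain g where g: "bij_betw g {..<n} (fst G)" "snd G = (\<lambda>e. g ` e) ` {e. e \<subseteq> {..<n} \<and> card e = 2}"
    using isomorphic_graphsE[OF assms, of "complete_graph n"] unfolding complete_graph_def by auto
  thus "card (fst G) = n \<and> snd G = {e. e \<subseteq> fst G \<and> card e = 2}"
    using bij_betw_same_card[OF g(1)] image_two_subsets[OF bij_betw_imp_inj_on[OF g(1)]] bij_betw_imp_surj_on[OF g(1)] by simp
next
  assume G: "card (fst G) = n \<and> snd G = {e. e \<subseteq> fst G \<and> card e = 2}"
  have "finite (fst G)" using assms by (simp add: simple_graph_def)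
  then obtain f where f: "bij_betw f (fst G) {..<n}"
    using ex_bij_betw_finite_nat[of "fst G"] G by (auto simp: atLeast0LessThan)
  have "(\<lambda>e. f ` e) ` snd G = {e. e \<subseteq> {..<n} \<and> card e = 2}"
    using G image_two_subsets[OF bij_betw_imp_inj_on[OF f]] bij_betw_imp_surj_on[OF f] by simp
  thus "isomorphic_graphs G (complete_graph n)"
    unfolding isomorphic_graphs_def complete_graph_def fst_conv snd_conv using f by blast
qed

theorem theorem6p10:
  fixes G :: "'v graph"
  assumes "simple_graph G" and "connected_graph G" and "card (snd G) \<ge> 1"
  shows "(\<exists>d\<ge>2. has_linear_resolution (partitions G) (cut_ideal G :: ('v set set, 'k::field) pol set) d)
    \<longleftrightarrow> isomorphic_graphs G (path_graph 3)
      \<or> isomorphic_graphs G K2_glued_K3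
      \<or> isomorphic_graphs G (complete_graph 4)"
proof
  let ?I = "cut_ideal G :: ('v set set, 'k) pol set"
  assume "\<exists>d\<ge>2. has_linear_resolution (partitions G) ?I d"
  then obtain d where d: "has_linear_resolution (partitions G) ?I d" by blast
  hence I: "?I \<noteq> {0}" by (simp add: has_linear_resolution_def)
  have edges: "snd G \<noteq> {}" using assms(3) by auto
  interpret linear_type G d
    by unfold_locales (use assms(1,2) edges forced_degree_linear_resolution[OF assms(1) edges d] in auto)
  show "isomorphic_graphs G (path_graph 3) \<or> isomorphic_graphs G K2_glued_K3 \<or> isomorphic_graphs G (complete_graph 4)"
  proof (cases "\<exists>u\<in>V. \<exists>w\<in>V. u \<noteq> w \<and> {u, w} \<notin> snd G")
    case True
    then obtain u w where "u \<in> V" "w \<in> V" "u \<noteq> w" "{u, w} \<notin> snd G" by blast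
    hence "(\<exists>a b c. is_P3 a b c) \<or> (\<exists>a b c e. is_paw a b c e)" by (rule noncomplete_classification)
    thus ?thesis
      unfolding isomorphic_path_graph_3[OF assms(1)] isomorphic_K2_glued_K3[OF assms(1)] is_P3_def is_paw_def by argo
  next
    case False
    hence complete: "{u, w} \<in> snd G" if "u \<in> V" "w \<in> V" "u \<noteq> w" for u w using that by blast
    have le: "card V \<le> 4" by (rule complete_card[OF complete])
    have finV: "finite V" using assms(1) by (simp add: simple_graph_def)
    obtain e where e: "e \<in> snd G" using edges by blast
    hence "e \<subseteq> V" "card e = 2" using assms(1) by (auto simp: simple_graph_def)
    hence "card V \<ge> 2" using card_mono[OF finV, of e] by simp
    \<comment> \<open>With two or three vertices the ideal of the complete graph is zero, which a
      linear resolution excludes by definition; four vertices remain.\<close>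
    then consider "card V = 2" | "card V = 3" | "card V = 4" using le by linarith
    thus ?thesis
    proof cases
      case 1
      then obtain a b where ab: "V = {a, b}" "a \<noteq> b" by (auto simp: card_2_iff)
      have "?I = {0}" by (rule cut_ideal_K2[OF assms(1) ab]) (use complete ab in simp)
      thus ?thesis using I by blast
    next
      case 2
      then obtain a b c where abc: "V = {a, b, c}" "distinct [a, b, c]" by (auto simp: card_3_iff)
      have "?I = {0}" by (rule cut_ideal_K3[OF assms(1) abc]) (rule complete; use abc in auto)+
      thus ?thesis using I by blast
    next
      case 3
      have "snd G = {e. e \<subseteq> V \<and> card e = 2}"
      proof
        show "snd G \<subseteq> {e. e \<subseteq> V \<and> card e = 2}" using assms(1) by (auto simp: simple_graph_def)
        show "{e. e \<subseteq> V \<and> card e = 2} \<subseteq> snd G" using complete by (auto simp: card_2_iff)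
      qed
      thus ?thesis using 3 isomorphic_complete_graph[OF assms(1)] by blast
    qed
  qed
next
  assume "isomorphic_graphs G (path_graph 3) \<or> isomorphic_graphs G K2_glued_K3 \<or> isomorphic_graphs G (complete_graph 4)"
  then consider "isomorphic_graphs G (path_graph 3)" | "isomorphic_graphs G K2_glued_K3" | "isomorphic_graphs G (complete_graph 4)"
    by blast
  thus "\<exists>d\<ge>2. has_linear_resolution (partitions G) (cut_ideal G :: ('v set set, 'k) pol set) d"
  proof cases
    case 1
    hence "\<exists>a b c. fst G = {a, b, c} \<and> distinct [a, b, c] \<and> snd G = {{a, b}, {b, c}}"
      unfolding isomorphic_path_graph_3[OF assms(1)] .
    hence "has_linear_resolution (partitions G) (cut_ideal G :: ('v set set, 'k) pol set) 2"
      by (elim exE conjE) (rule linear_resolution_P3[OF assms(1,2)])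
    thus ?thesis by blast
  next
    case 2
    hence "\<exists>a b c d. fst G = {a, b, c, d} \<and> distinct [a, b, c, d] \<and> snd G = {{a, b}, {a, c}, {b, c}, {c, d}}"
      unfolding isomorphic_K2_glued_K3[OF assms(1)] .
    hence "has_linear_resolution (partitions G) (cut_ideal G :: ('v set set, 'k) pol set) 2"
      by (elim exE conjE) (rule linear_resolution_paw[OF assms(1,2)])
    thus ?thesis by blast
  next
    case 3
    hence "has_linear_resolution (partitions G) (cut_ideal G :: ('v set set, 'k) pol set) 4"
      unfolding isomorphic_complete_graph[OF assms(1)] by (intro linear_resolution_K4[OF assms(1)]) blast+
    moreover have "(2::nat) \<le> 4" by simp
    ultimately show ?thesis by blast
  qed
qed

end
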